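(* Let $p$ be a prime, $n\ge 1$ an integer, $V$ a vector space of dimension $d$ over $\mathbf{F}_p$, and $K(n)^*$ the $n$th Morava K-theory at $p$. The $K(n)^*[GL(V)]$-modules $K(n)^*(BV)$ and $K(n)^*[\mathrm{Hom}(V,(\mathbf{F}_p)^n)]$ are isomorphic as ungraded modules in the following cases: (a) $n=1$, for any $p$ and $d$; (b) $d=2$, $p=2$, and any $n$. Moreover, they are isomorphic as (ungraded) $K(n)^*[SL(V)]$-modules in the case: (c) $d=2$, $p=3$, and $n=1$, $2$ or $3$.
   Context: The module $K(n)^*(BV)$. The coefficient ring is $K(n)^*=\mathbf{F}_p[v_n,v_n^{-1}]$ with $v_n$ in degree $-2(p^n-1)$. $GL(V)$ acts on the right of $V$, hence on the left of $K(n)^*(BV)$. Explicitly, identifying $V$ with the row vectors $(\mathbf{F}_p)^d$, $$K(n)^*(BV)=K(n)^*[x_1,\ldots,x_d]/(x_1^{p^n},\ldots,x_d^{p^n}),\qquad \deg x_i=2,$$ where $x_j$ is the Chern class of the 1-dimensional representation given by the $j$th coordinate. $GL(V)$ acts by graded $K(n)^*$-algebra automorphisms, and the matrix $(a_{ij})\in GL_d(\mathbf{F}_p)$ sends $x_j$ to the reduction modulo $p$ of $e\bigl(\sum_i a_{ij}\,l(x_i)\bigr)$ (with the $a_{ij}$ lifted to integers), where $l(x)=\sum_{i\ge 0} v_n^{(p^{ni}-1)/(p^n-1)}x^{p^{ni}}/p^i$ and $e$ is the compositional inverse of $l$; the resulting power series in $x_1,\dots,x_d$ has coefficients in $\mathbf{Z}_{(p)}[v_n]$,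 so reduction mod $p$ makes sense. For a $G$-set $S$ and a ring $R$, $R[S]$ denotes the permutation module with $R$-basis $S$. The set $\mathrm{Hom}(V,(\mathbf{F}_p)^n)$ of $\mathbf{F}_p$-linear maps is a left $GL(V)$-set via $(g\phi)(v)=\phi(vg)$. $SL(V)\le GL(V)$ is the subgroup of elements of determinant $1$. *)

theory Defs
  imports
    "HOL-Algebra.QuotRing"
    "HOL-Algebra.Module"
    "HOL-Library.FuncSet"
    "HOL-Library.Poly_Mapping"
    "HOL-Computational_Algebra.Formal_Power_Series"
    "Jordan_Normal_Form.Determinant"
    "Berlekamp_Zassenhaus.Finite_Field"
begin

section \<open>Coefficients and the groups acting\<close>

text \<open>The prime field is \<open>'p mod_ring\<close> with \<open>'p :: prime_card\<close>; its characteristic is \<open>CARD('p)\<close>.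
  The coefficient ring \<open>K(n)\<^sup>*\<close> is the ring of Laurent polynomials in \<open>v\<^sub>n\<close> over it (the product on
  \<open>\<Rightarrow>\<^sub>0\<close> is convolution); \<open>v\<^sub>n\<close> is \<open>Poly_Mapping.single 1 1\<close>. Only the ungraded ring matters here, so
  that \<open>n\<close> does not occur in the type.\<close>

type_synonym 'p morava = "int \<Rightarrow>\<^sub>0 'p mod_ring"

text \<open>\<open>V\<close> is the space of row vectors of length \<open>d\<close>, with \<open>GL(V)\<close> acting on the right.\<close>

definition GL :: "nat \<Rightarrow> 'a::field mat set" where
  "GL d = {A \<in> carrier_mat d d. invertible_mat A}"

definition SL :: "nat \<Rightarrow> 'a::field mat set" where
  "SL d = {A \<in> GL d. det A = 1}"

definition row_mult :: "'a::semiring_0 vec \<Rightarrow> 'a mat \<Rightarrow> 'a vec" where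
  "row_mult v A = transpose_mat A *\<^sub>v v"


section \<open>Power series in several variables\<close>

text \<open>Monomials in \<open>x\<^sub>0, x\<^sub>1, \<dots>\<close> are exponent vectors \<open>nat \<Rightarrow>\<^sub>0 nat\<close>. A power series is an arbitrary
  function on monomials, a polynomial a finitely supported one.\<close>

type_synonym monomial = "nat \<Rightarrow>\<^sub>0 nat"
type_synonym 'a mpoly = "monomial \<Rightarrow>\<^sub>0 'a"
type_synonym 'a mps = "monomial \<Rightarrow> 'a"

definition mps_var :: "nat \<Rightarrow> 'a::comm_ring_1 mps" where
  "mps_var i m = (if m = Poly_Mapping.single i 1 then 1 else 0)"

definition mps_mult :: "'a::comm_ring_1 mps \<Rightarrow> 'a mps \<Rightarrow> 'a mps" where
  "mps_mult f g m = (\<Sum>(a, b) | a + b = m. f a * g b)"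

primrec mps_power :: "'a::comm_ring_1 mps \<Rightarrow> nat \<Rightarrow> 'a mps" where
  "mps_power f 0 = (\<lambda>m. if m = 0 then 1 else 0)"
| "mps_power f (Suc k) = mps_mult f (mps_power f k)"

definition total_degree :: "monomial \<Rightarrow> nat" where
  "total_degree m = (\<Sum>i\<in>Poly_Mapping.keys m. Poly_Mapping.lookup m i)"

text \<open>The substitution \<open>f(g)\<close>, for \<open>g\<close> without constant term: then \<open>g^k\<close> has no terms of total
  degree below \<open>k\<close>, so the coefficient of \<open>m\<close> in \<open>\<Sum>k. f\<^sub>k g^k\<close> is the following finite sum.\<close>

definition mps_compose :: "'a::comm_ring_1 fps \<Rightarrow> 'a mps \<Rightarrow> 'a mps" where
  "mps_compose f g m = (\<Sum>k\<le>total_degree m. fps_nth f k * mps_power g k m)"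


section \<open>The formal group law of Morava K-theory\<close>

text \<open>Coefficients lie in \<open>\<rat>[v\<^sub>n]\<close>. For \<open>n \<ge> 1\<close> and \<open>p \<ge> 2\<close> the index set below has at most one
  element, and the natural number division is exact.\<close>

definition fgl_log :: "nat \<Rightarrow> nat \<Rightarrow> rat poly fps" where
  "fgl_log p n = Abs_fps (\<lambda>k. \<Sum>i | p ^ (n * i) = k.
     Polynomial.monom (1 / of_nat p ^ i) ((p ^ (n * i) - 1) div (p ^ n - 1)))"

definition fgl_exp :: "nat \<Rightarrow> nat \<Rightarrow> rat poly fps" where
  "fgl_exp p n = (THE e. e oo fgl_log p n = fps_X \<and> fgl_log p n oo e = fps_X)"

lemma fps_left_compose_inverse_exists:
  fixes a :: "'a::idom fps"
  assumes a0: "fps_nth a 0 = 0" and a1: "fps_nth a 1 = 1"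
  obtains b where "b oo a = fps_X" "fps_nth b 0 = 0" "fps_nth b 1 = 1"
proof -
  define F where "F c k = fps_nth fps_X k - (\<Sum>i<k. c i * fps_nth (a ^ i) k)"
    for c :: "nat \<Rightarrow> 'a" and k
  define c where "c = wfrec less_than F"
  have rec: "c k = fps_nth fps_X k - (\<Sum>i<k. c i * fps_nth (a ^ i) k)" for k
  proof -
    have "c k = F (cut c less_than k) k"
      unfolding c_def by (rule wfrec) simp
    also have "\<dots> = F c k"
      by (simp add: F_def cut_def)
    finally show ?thesis by (simp add: F_def)
  qed
  have diag: "fps_nth (a ^ k) k = 1" for k
    using startsby_zero_power_nth_same[OF a0, of k] a1 by simp
  have comp: "Abs_fps c oo a = fps_X"
  proof (rule fps_ext)
    fix k
    have "fps_nth (Abs_fps c oo a) k = (\<Sum>i<k. c i * fps_nth (a ^ i) k) + c k * fps_nth (a ^ k) k"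
      by (simp add: fps_compose_nth atLeast0AtMost flip: lessThan_Suc_atMost)
    then show "fps_nth (Abs_fps c oo a) k = fps_nth fps_X k"
      using rec[of k] diag[of k] by simp
  qed
  have "c 0 = 0" "c 1 = 1"
    using rec[of 0] rec[of 1] by (simp_all)
  with comp show ?thesis by (intro that[of "Abs_fps c"]) simp_all
qed

lemma fps_compose_inverse_ex1:
  fixes a :: "'a::idom fps"
  assumes a0: "fps_nth a 0 = 0" and a1: "fps_nth a 1 = 1"
  shows "\<exists>!e. e oo a = fps_X \<and> a oo e = fps_X"
proof -
  obtain b where b: "b oo a = fps_X" "fps_nth b 0 = 0" "fps_nth b 1 = 1"
    using fps_left_compose_inverse_exists[OF a0 a1] .
  obtain c where c: "c oo b = fps_X"
    using fps_left_compose_inverse_exists[OF b(2,3)] by blast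
  have "c = c oo (b oo a)"
    by (simp add: b)
  also have "\<dots> = a"
    by (simp add: fps_compose_assoc a0 b(2) c)
  finally have ab: "a oo b = fps_X"
    using c by simp
  show ?thesis
  proof (rule ex1I[of _ b])
    fix e assume e: "e oo a = fps_X \<and> a oo e = fps_X"
    have "e = e oo (a oo b)" by (simp add: ab)
    also have "\<dots> = b"
      using e b(2) by (simp add: fps_compose_assoc a0)
    finally show "e = b" .
  qed (simp add: b ab)
qed

lemma fgl_exp_inverse:
  assumes "p \<ge> 2" and "n \<ge> 1"
  shows "fgl_exp p n oo fgl_log p n = fps_X" "fgl_log p n oo fgl_exp p n = fps_X"
proof -
  have "{i. p ^ (n * i) = 0} = {}" "{i. p ^ (n * i) = Suc 0} = {0}"
    using assms by auto
  then have "fps_nth (fgl_log p n) 0 = 0" "fps_nth (fgl_log p n) (Suc 0) = 1"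
    by (simp_all only: fgl_log_def fps_nth_Abs_fps) simp_all
  then have "fps_nth (fgl_log p n) 0 = 0" "fps_nth (fgl_log p n) 1 = 1"
    by simp_all
  then show "fgl_exp p n oo fgl_log p n = fps_X" "fgl_log p n oo fgl_exp p n = fps_X"
    using theI'[OF fps_compose_inverse_ex1[of "fgl_log p n"]]
    unfolding fgl_exp_def by blast+
qed

text \<open>Reduction modulo \<open>p\<close> of an element of \<open>\<int>\<^sub>(\<^sub>p\<^sub>)[v\<^sub>n]\<close>, as an element of \<open>K(n)\<^sup>*\<close>. The value on
  rationals whose denominator is divisible by \<open>p\<close> is irrelevant.\<close>

definition reduce_rat :: "rat \<Rightarrow> 'p::prime_card mod_ring" where
  "reduce_rat r = (case quotient_of r of (a, b) \<Rightarrow> of_int a / of_int b)"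

definition reduce_poly :: "rat poly \<Rightarrow> 'p::prime_card morava" where
  "reduce_poly q = (\<Sum>k\<le>Polynomial.degree q. Poly_Mapping.single (int k) (reduce_rat (Polynomial.coeff q k)))"

text \<open>The reduction of \<open>e(\<Sum>\<^sub>i a\<^sub>i\<^sub>j l(x\<^sub>i))\<close>. The integral lifts of the \<open>a\<^sub>i\<^sub>j\<close> are taken in
  \<open>{0..<p}\<close>; since \<open>[p](x) = v\<^sub>n x^(p^n)\<close> modulo \<open>p\<close>, another choice of lifts changes the series only by
  elements of the ideal \<open>(x\<^sub>i^(p^n))\<close>.\<close>

definition fgl_sum_series :: "nat \<Rightarrow> nat \<Rightarrow> 'p::prime_card mod_ring mat \<Rightarrow> nat \<Rightarrow> 'p morava mps" where
  "fgl_sum_series n d A j m = reduce_poly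
     (mps_compose (fgl_exp CARD('p) n)
       (\<lambda>m. \<Sum>i<d. of_int (to_int_mod_ring (A $$ (i, j))) *
                   mps_compose (fgl_log CARD('p) n) (mps_var i) m) m)"


section \<open>Modules with a group action\<close>

text \<open>A module over a group ring \<open>R[G]\<close> is an \<open>R\<close>-module with an \<open>R\<close>-linear action of \<open>G\<close>; the
  \<open>R[G]\<close>-linear maps are the \<open>G\<close>-equivariant \<open>R\<close>-linear ones. Here \<open>R\<close> is (all of) the type \<open>'r\<close>.\<close>

definition isomorphic_modules ::
  "'g set \<Rightarrow> ('r::comm_ring_1, 'a) module \<Rightarrow> ('g \<Rightarrow> 'a \<Rightarrow> 'a) \<Rightarrow>
   ('r, 'b) module \<Rightarrow> ('g \<Rightarrow> 'b \<Rightarrow> 'b) \<Rightarrow> bool" where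
  "isomorphic_modules G M actM N actN \<longleftrightarrow>
    (\<exists>f. bij_betw f (carrier M) (carrier N) \<and>
      (\<forall>x\<in>carrier M. \<forall>y\<in>carrier M. f (x \<oplus>\<^bsub>M\<^esub> y) = f x \<oplus>\<^bsub>N\<^esub> f y) \<and>
      (\<forall>c. \<forall>x\<in>carrier M. f (c \<odot>\<^bsub>M\<^esub> x) = c \<odot>\<^bsub>N\<^esub> f x) \<and>
      (\<forall>g\<in>G. \<forall>x\<in>carrier M. f (actM g x) = actN g (f x)))"


section \<open>The module \<open>K(n)\<^sup>*(BV)\<close>\<close>

definition mpoly_ring :: "nat \<Rightarrow> 'a::comm_ring_1 mpoly ring" where
  "mpoly_ring d = \<lparr>carrier = {P. \<forall>m\<in>Poly_Mapping.keys P. Poly_Mapping.keys m \<subseteq> {..<d}},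
     monoid.mult = (*), one = 1, zero = 0, add = (+)\<rparr>"

definition mpoly_const :: "'a::comm_ring_1 \<Rightarrow> 'a mpoly" where
  "mpoly_const c = Poly_Mapping.single 0 c"

definition mpoly_subst :: "(nat \<Rightarrow> 'a::comm_ring_1 mpoly) \<Rightarrow> 'a mpoly \<Rightarrow> 'a mpoly" where
  "mpoly_subst F P = (\<Sum>m\<in>Poly_Mapping.keys P. mpoly_const (Poly_Mapping.lookup P m) *
     (\<Prod>j\<in>Poly_Mapping.keys m. F j ^ Poly_Mapping.lookup m j))"

definition KBV_ideal :: "nat \<Rightarrow> nat \<Rightarrow> 'p::prime_card morava mpoly set" where
  "KBV_ideal n d = genideal (mpoly_ring d)
     ((\<lambda>i. Poly_Mapping.single (Poly_Mapping.single i (CARD('p) ^ n)) 1) ` {..<d})"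

definition KBV_ring :: "nat \<Rightarrow> nat \<Rightarrow> 'p::prime_card morava mpoly set ring" where
  "KBV_ring n d = mpoly_ring d Quot KBV_ideal n d"

text \<open>The scalars act through the structure map \<open>K(n)\<^sup>* \<rightarrow> K(n)\<^sup>*(BV)\<close>.\<close>

definition KBV :: "nat \<Rightarrow> nat \<Rightarrow> ('p::prime_card morava, 'p morava mpoly set) module" where
  "KBV n d = ring.extend (KBV_ring n d)
     \<lparr>module.smult = \<lambda>c X. (KBV_ideal n d +>\<^bsub>mpoly_ring d\<^esub> mpoly_const c) \<otimes>\<^bsub>KBV_ring n d\<^esub> X\<rparr>"

text \<open>\<open>K[x]/(x\<^sub>i^q)\<close> is also the quotient of \<open>K[[x]]\<close> by \<open>(x\<^sub>i^q)\<close>; the class of a power series is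
  represented by its terms with all exponents below \<open>q\<close>.\<close>

definition truncate_mps :: "nat \<Rightarrow> nat \<Rightarrow> 'a::comm_ring_1 mps \<Rightarrow> 'a mpoly" where
  "truncate_mps q d f = (\<Sum>m | Poly_Mapping.keys m \<subseteq> {..<d} \<and> (\<forall>i<d. Poly_Mapping.lookup m i < q).
     Poly_Mapping.single m (f m))"

text \<open>The algebra endomorphism of the quotient with \<open>x\<^sub>j \<mapsto> e(\<Sum>\<^sub>i a\<^sub>i\<^sub>j l(x\<^sub>i))\<close>: the coset of \<open>P\<close> is
  sent to the coset of the polynomial obtained from \<open>P\<close> by substitution, for any representative \<open>P\<close>.\<close>

definition KBV_act ::
  "nat \<Rightarrow> nat \<Rightarrow> 'p::prime_card mod_ring mat \<Rightarrow> 'p morava mpoly set \<Rightarrow> 'p morava mpoly set" where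
  "KBV_act n d A X = (\<Union>P\<in>X. KBV_ideal n d +>\<^bsub>mpoly_ring d\<^esub>
     mpoly_subst (\<lambda>j. truncate_mps (CARD('p) ^ n) d (fgl_sum_series n d A j)) P)"


section \<open>Permutation modules\<close>

text \<open>As in the library's \<open>module_vec\<close>, the ring multiplication of the module record is unused.\<close>

definition perm_module :: "'s set \<Rightarrow> ('r::comm_ring_1, 's \<Rightarrow>\<^sub>0 'r) module" where
  "perm_module S = \<lparr>carrier = {f. Poly_Mapping.keys f \<subseteq> S}, monoid.mult = undefined, one = undefined,
     zero = 0, add = (+), module.smult = (\<lambda>c f. Poly_Mapping.map ((*) c) f)\<rparr>"

definition perm_act :: "('g \<Rightarrow> 's \<Rightarrow> 's) \<Rightarrow> 'g \<Rightarrow> ('s \<Rightarrow>\<^sub>0 'r::comm_ring_1) \<Rightarrow> ('s \<Rightarrow>\<^sub>0 'r)" where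
  "perm_act act g f = (\<Sum>s\<in>Poly_Mapping.keys f. Poly_Mapping.single (act g s) (Poly_Mapping.lookup f s))"

definition lin_maps :: "nat \<Rightarrow> nat \<Rightarrow> ('a::field vec \<Rightarrow> 'a vec) set" where
  "lin_maps d n = {\<phi> \<in> carrier_vec d \<rightarrow>\<^sub>E carrier_vec n.
     (\<forall>u\<in>carrier_vec d. \<forall>v\<in>carrier_vec d. \<phi> (u + v) = \<phi> u + \<phi> v) \<and>
     (\<forall>c. \<forall>v\<in>carrier_vec d. \<phi> (c \<cdot>\<^sub>v v) = c \<cdot>\<^sub>v \<phi> v)}"

definition lin_maps_act :: "nat \<Rightarrow> 'a::field mat \<Rightarrow> ('a vec \<Rightarrow> 'a vec) \<Rightarrow> ('a vec \<Rightarrow> 'a vec)" where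
  "lin_maps_act d A \<phi> = (\<lambda>v\<in>carrier_vec d. \<phi> (row_mult v A))"

definition KHom ::
  "nat \<Rightarrow> nat \<Rightarrow> ('p::prime_card morava, ('p mod_ring vec \<Rightarrow> 'p mod_ring vec) \<Rightarrow>\<^sub>0 'p morava) module" where
  "KHom n d = perm_module (lin_maps d n)"

definition KHom_act ::
  "nat \<Rightarrow> 'p::prime_card mod_ring mat \<Rightarrow>
   (('p mod_ring vec \<Rightarrow> 'p mod_ring vec) \<Rightarrow>\<^sub>0 'p morava) \<Rightarrow>
   (('p mod_ring vec \<Rightarrow> 'p mod_ring vec) \<Rightarrow>\<^sub>0 'p morava)" where
  "KHom_act d = perm_act (lin_maps_act d)"

end

theory Submission
 imports Defs
begin

text \<open>Grading \<open>v\<^sub>n\<close> away, both modules descend to the prime field, where it suffices to give an equivariant map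
  from \<open>d\<close> by \<open>n\<close> matrices to truncated polynomials whose image spans; a count of dimensions does the rest. For
  \<open>n = 1\<close> the Artin--Hasse exponential identifies the formal group law with the multiplicative one modulo
  \<open>x\<^sub>i\<^sup>p\<close>, and the characters of the group ring map to group elements. For \<open>d = p = 2\<close> the span of four
  polynomials permuted by the group generates everything under tensor products of Frobenius twists. For \<open>d = 2\<close>,
  \<open>p = 3\<close> the group \<open>SL\<close> is \<open>Q\<^sub>8 \<rtimes> C\<^sub>3\<close>; the dimensions of the fixed space and of the trace image of the
  unipotent generator determine the module up to generators matching the orbits on the permutation side.\<close>

text \<open>What separates the cases is how much of the group law survives modulo the powers
  \<open>x_i^q\<close>, \<open>q = p^n\<close>. There the logarithm of a variable is the variable
  itself, so a coefficient of the action is a coefficient of the exponential times a multinomial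
  coefficient. In two variables the total degrees stay below \<open>2q - 1\<close>, where the
  exponential (at \<open>v = 1\<close>) has only the terms \<open>x\<close> and
  \<open>-x^q/p\<close>; the binomial coefficients of \<open>q\<close> are therefore needed modulo
  \<open>p^2\<close>. For \<open>n = 1\<close> the number of variables is arbitrary and all
  coefficients of the exponential matter, whence the detour through an integral change of
  coordinate. For \<open>p = 3\<close> and \<open>n = 2, 3\<close> no permuted family is written
  down. \<open>SL(2,3)\<close> has on 2 by \<open>n\<close> matrices the fixed point 0,
  \<open>a = (3^n - 1)/2\<close> orbits with stabilizer of order three and \<open>N\<close> free
  orbits, with \<open>(a, N)\<close> equal to \<open>(4, 2)\<close> or \<open>(13, 26)\<close>.
  Generators with these stabilizers exist as soon as certain subspaces are large enough. Explicit
  fixed vectors and traces thus serve only as lower bounds, and the total dimension forces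
  equality.\<close>

abbreviation (input) mcoeff :: "('a \<Rightarrow>\<^sub>0 'b::zero) => 'a => 'b" where "mcoeff \<equiv> Poly_Mapping.lookup"
abbreviation (input) msingle :: "'a => 'b::zero => 'a \<Rightarrow>\<^sub>0 'b" where "msingle \<equiv> Poly_Mapping.single"
abbreviation (input) mkeys :: "('a \<Rightarrow>\<^sub>0 'b::zero) => 'a set" where "mkeys \<equiv> Poly_Mapping.keys"

section \<open>Truncated polynomials\<close>

definition box :: "nat => nat => monomial set" where
 "box q d = {m. mkeys m \<subseteq> {..<d} & (\<forall>i<d. mcoeff m i < q)}"

text \<open>On polynomials in the first \<open>d\<close> variables this is congruence modulo the
  ideal of the powers \<open>x_i^q\<close>, stated through coefficients so that no quotient ring has
  to be carried along; monomials in further variables are ignored as well.\<close>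

definition mcong :: "nat => nat => 'a::comm_ring_1 mpoly => 'a mpoly => bool" where
 "mcong q d P Q \<longleftrightarrow> (\<forall>m\<in>box q d. mcoeff P m = mcoeff Q m)"

abbreviation trunc :: "nat => nat => 'a::comm_ring_1 mpoly => 'a mpoly" where
 "trunc q d P \<equiv> truncate_mps q d (mcoeff P)"

definition pvar :: "nat => 'a::comm_ring_1 mpoly" where
 "pvar i = msingle (msingle i 1) 1"

definition mpolys :: "nat => 'a::comm_ring_1 mpoly set" where
 "mpolys d = {P. \<forall>m\<in>mkeys P. mkeys m \<subseteq> {..<d}}"

definition box_polys :: "nat => nat => 'a::comm_ring_1 mpoly set" where
 "box_polys q d = {P. mkeys P \<subseteq> box q d}"

lemma finite_bounded_monomials: "finite {m :: monomial. mkeys m \<subseteq> {..<d} & (\<forall>i<d. mcoeff m i < q)}"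
proof -
 have "finite {f. (\<forall>i\<in>{..<d}. f i \<in> {..<q}) & (\<forall>i. i \<notin> {..<d} --> f i = (0::nat))}"
 proof -
  have "{f. (\<forall>i\<in>{..<d}. f i \<in> {..<q}) & (\<forall>i. i \<notin> {..<d} --> f i = (0::nat))} =
   {f. \<forall>x. (x \<in> {..<d} --> f x \<in> {..<q}) & (x \<notin> {..<d} --> f x = 0)}"
   by (rule Collect_cong) blast
  then show ?thesis
   using finite_set_of_finite_funs[of "{..<d}" "{..<q}" "0::nat"] by simp
 qed
 then have "finite ((%f. Abs_poly_mapping f) ` {f. (\<forall>i\<in>{..<d}. f i \<in> {..<q}) & (\<forall>i. i \<notin> {..<d} --> f i = (0::nat))})"
  by (rule finite_imageI)
 moreover have "{m :: monomial. mkeys m \<subseteq> {..<d} & (\<forall>i<d. mcoeff m i < q)} \<subseteq>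
   ((%f. Abs_poly_mapping f) ` {f. (\<forall>i\<in>{..<d}. f i \<in> {..<q}) & (\<forall>i. i \<notin> {..<d} --> f i = (0::nat))})"
 proof
  fix m :: monomial
  assume "m \<in> {m. mkeys m \<subseteq> {..<d} & (\<forall>i<d. mcoeff m i < q)}"
  then show "m \<in> ((%f. Abs_poly_mapping f) ` {f. (\<forall>i\<in>{..<d}. f i \<in> {..<q}) & (\<forall>i. i \<notin> {..<d} --> f i = (0::nat))})"
   by (intro image_eqI[of _ _ "mcoeff m"]) (auto simp: in_keys_iff)
 qed
 ultimately show ?thesis by (rule finite_subset[rotated])
qed

lemma finite_box [simp]: "finite (box q d)"
 using finite_bounded_monomials by (simp add: box_def)

definition monomial_of :: "nat => (nat => nat) => monomial" where
 "monomial_of d f = (\<Sum>i<d. msingle i (f i))"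

lemma lookup_monomial_of: "mcoeff (monomial_of d f) j = (if j < d then f j else 0)"
 by (simp add: monomial_of_def lookup_sum lookup_single when_def)

lemma monomial_of_mem_box: "monomial_of d f \<in> box q d \<longleftrightarrow> (\<forall>i<d. f i < q)"
 by (auto simp: box_def in_keys_iff lookup_monomial_of split: if_splits)

lemma monomial_of_lookup: "m \<in> box q d ==> monomial_of d (mcoeff m) = m"
 by (intro poly_mapping_eqI) (auto simp: lookup_monomial_of box_def in_keys_iff)

lemma card_box: "card (box q d) = q ^ d"
proof -
 have "bij_betw (%m. \<lambda>i\<in>{..<d}. mcoeff m i) (box q d) (PiE {..<d} (%_. {..<q}))"
 proof (rule bij_betwI[where g = "monomial_of d"])
  show "(%m. \<lambda>i\<in>{..<d}. mcoeff m i) \<in> box q d \<rightarrow> (PiE {..<d} (%_. {..<q}))"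
   by (rule funcsetI) (simp add: box_def)
  show "monomial_of d \<in> (PiE {..<d} (%_. {..<q})) \<rightarrow> box q d"
   by (rule funcsetI) (simp add: monomial_of_mem_box PiE_iff)
 next
  fix m assume m: "m \<in> box q d"
  have "monomial_of d (\<lambda>i\<in>{..<d}. mcoeff m i) = monomial_of d (mcoeff m)"
   by (intro poly_mapping_eqI) (simp add: lookup_monomial_of)
  with monomial_of_lookup[OF m] show "monomial_of d (\<lambda>i\<in>{..<d}. mcoeff m i) = m" by simp
 next
  fix f :: "nat => nat" assume "f \<in> PiE {..<d} (%_. {..<q})"
  then show "(\<lambda>i\<in>{..<d}. mcoeff (monomial_of d f) i) = f"
   by (intro ext) (simp add: lookup_monomial_of PiE_iff extensional_def)
 qed
 then show ?thesis
  by (simp add: bij_betw_same_card card_PiE)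
qed

lemma lookup_truncate:
 "mcoeff (truncate_mps q d f) m = (if m \<in> box q d then f m else 0)"
 unfolding truncate_mps_def lookup_sum box_def[symmetric] lookup_single when_def
 by (simp add: sum.delta)

lemma truncate_mem_box_polys: "truncate_mps q d f \<in> box_polys q d"
 by (auto simp: box_polys_def in_keys_iff lookup_truncate split: if_splits)

lemma box_polys_subset_mpolys: "box_polys q d \<subseteq> mpolys d"
 by (auto simp: box_polys_def mpolys_def box_def)

lemma trunc_box_polys: "P \<in> box_polys q d ==> trunc q d P = P"
 by (intro poly_mapping_eqI) (auto simp: lookup_truncate box_polys_def in_keys_iff)

lemma mcong_iff_trunc: "mcong q d P Q \<longleftrightarrow> trunc q d P = trunc q d Q"
 by (auto simp: mcong_def poly_mapping_eq_iff fun_eq_iff lookup_truncate)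

lemma mcong_refl [simp]: "mcong q d P P"
 by (simp add: mcong_def)

lemma mcong_sym: "mcong q d P Q ==> mcong q d Q P"
 by (simp add: mcong_def)

lemma mcong_trans [trans]: "mcong q d P Q ==> mcong q d Q R ==> mcong q d P R"
 by (simp add: mcong_def)

lemma mcong_eq_trans [trans]: "mcong q d P Q ==> Q = R ==> mcong q d P R"
 "P = Q ==> mcong q d Q R ==> mcong q d P R"
 by simp_all

lemma mcong_trunc: "mcong q d (trunc q d P) P"
 by (simp add: mcong_def lookup_truncate)

lemma mcong_box_polys: "P \<in> box_polys q d ==> Q \<in> box_polys q d ==> mcong q d P Q ==> P = Q"
 by (metis mcong_iff_trunc trunc_box_polys)

lemma mcong_add: "mcong q d P P' ==> mcong q d Q Q' ==> mcong q d (P + Q) (P' + Q')"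
 by (simp add: mcong_def lookup_add)

lemma mcong_diff: "mcong q d P P' ==> mcong q d Q Q' ==> mcong q d (P - Q) (P' - Q')"
 by (simp add: mcong_def lookup_minus)

lemma mcong_uminus: "mcong q d P P' ==> mcong q d (- P) (- P')"
 by (simp add: mcong_def)

lemma mcong_sum: "(!!i. i \<in> A ==> mcong q d (f i) (g i)) ==> mcong q d (sum f A) (sum g A)"
 by (simp add: mcong_def lookup_sum)

text \<open>Exponents of a divisor are no larger than those of the multiple. Consequently the
  monomials outside the box span an ideal, and \<open>mcong\<close> is compatible with
  products.\<close>

lemma box_add_left: "a + b \<in> box q d ==> a \<in> box q d"
proof -
 assume *: "a + b \<in> box q d"
 have "mkeys a \<subseteq> mkeys (a + b)"
  by (auto simp: in_keys_iff lookup_add)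
 moreover have "mcoeff a i \<le> mcoeff (a + b) i" for i
  by (simp add: lookup_add)
 ultimately show ?thesis using * unfolding box_def
  by (auto intro: le_less_trans[of "mcoeff a i" "mcoeff (a + b) i" for i])
qed

lemma box_add_right: "a + b \<in> box q d ==> b \<in> box q d"
 using box_add_left[of b a] by (simp add: add.commute)

lemma mcong_mult:
 assumes "mcong q d P P'" "mcong q d Q Q'"
 shows "mcong q d (P * Q) (P' * Q')"
 unfolding mcong_def
proof
 fix m assume m: "m \<in> box q d"
 have "mcoeff P l * (\<Sum>k. mcoeff Q k when m = l + k) =
   mcoeff P' l * (\<Sum>k. mcoeff Q' k when m = l + k)" for l
 proof -
  have *: "(mcoeff Q k when m = l + k) = (mcoeff Q' k when m = l + k)" for k
   using assms(2) m box_add_right[of l k] by (auto simp: when_def mcong_def)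
  show ?thesis
  proof (cases "\<exists>k. m = l + k")
   case True
   with m box_add_left have "l \<in> box q d" by blast
   with assms(1) * show ?thesis by (simp add: mcong_def)
  qed (simp add: when_def)
 qed
 then show "mcoeff (P * Q) m = mcoeff (P' * Q') m"
  unfolding lookup_mult by simp
qed

lemma mcong_power: "mcong q d P Q ==> mcong q d (P ^ k) (Q ^ k)"
 by (induction k) (auto intro: mcong_mult)

lemma mcong_prod: "(!!i. i \<in> A ==> mcong q d (f i) (g i)) ==> mcong q d (prod f A) (prod g A)"
 by (induction A rule: infinite_finite_induct) (auto intro: mcong_mult)

lemma poly_mapping_eq_sum_single:
 assumes "finite A" "mkeys P \<subseteq> A"
 shows "P = (\<Sum>m\<in>A. msingle m (mcoeff P m))"
proof (rule poly_mapping_eqI)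
 fix k
 have "(\<Sum>m\<in>A. mcoeff P m when m = k) = (if k \<in> A then mcoeff P k else 0)"
  using assms(1) by (simp add: when_def sum.delta)
 then show "mcoeff P k = mcoeff (\<Sum>m\<in>A. msingle m (mcoeff P m)) k"
  using assms(2) by (auto simp: lookup_sum lookup_single in_keys_iff)
qed

text \<open>The case of single terms concerns only monomials that occur in \<open>P\<close>, so
  facts about the support of \<open>P\<close> remain usable during the induction.\<close>

lemma poly_mapping_sum_induct [case_names single add zero]:
 fixes P :: "'b \<Rightarrow>\<^sub>0 'c::comm_monoid_add"
 assumes single: "!!m c. m \<in> mkeys P ==> S (msingle m c)"
  and add: "!!P Q. S P ==> S Q ==> S (P + Q)" and "S 0"
 shows "S P"
proof -
 have "S (\<Sum>m\<in>A. msingle m (mcoeff P m))" if "finite A" "A \<subseteq> mkeys P" for A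
  using that by (induction A rule: finite_induct) (auto intro: assms)
 from this[of "mkeys P"] show ?thesis
  using poly_mapping_eq_sum_single[of "mkeys P" P] by simp
qed

subsection \<open>Substitution\<close>

definition mon_eval :: "(nat => 'b::comm_monoid_mult) => monomial => 'b" where
 "mon_eval F m = (\<Prod>j\<in>mkeys m. F j ^ mcoeff m j)"

lemma mon_eval_superset:
 "finite A ==> mkeys m \<subseteq> A ==> mon_eval F m = (\<Prod>j\<in>A. F j ^ mcoeff m j)"
 unfolding mon_eval_def by (rule prod.mono_neutral_left) (auto simp: in_keys_iff)

lemma mon_eval_0 [simp]: "mon_eval F 0 = 1"
 by (simp add: mon_eval_def)

lemma mon_eval_add: "mon_eval F (a + b) = mon_eval F a * mon_eval F b"
proof -
 let ?A = "mkeys a \<union> mkeys b"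
 have "mon_eval F (a + b) = (\<Prod>j\<in>?A. F j ^ mcoeff (a + b) j)"
  by (rule mon_eval_superset) (use keys_add[of a b] in auto)
 also have "\<dots> = (\<Prod>j\<in>?A. F j ^ mcoeff a j) * (\<Prod>j\<in>?A. F j ^ mcoeff b j)"
  by (simp add: lookup_add power_add prod.distrib)
 also have "\<dots> = mon_eval F a * mon_eval F b"
  by (simp add: mon_eval_superset[of ?A])
 finally show ?thesis .
qed

lemma mon_eval_single [simp]: "mon_eval F (msingle j k) = F j ^ k"
 by (cases "k = 0") (simp_all add: mon_eval_def)

lemma mpoly_subst_superset:
 "finite A ==> mkeys P \<subseteq> A ==>
  mpoly_subst F P = (\<Sum>m\<in>A. mpoly_const (mcoeff P m) * mon_eval F m)"
 unfolding mpoly_subst_def mon_eval_def[symmetric]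
 by (rule sum.mono_neutral_left) (auto simp: in_keys_iff mpoly_const_def)

lemma mpoly_const_mult: "mpoly_const (a * b) = mpoly_const a * mpoly_const b"
 by (simp add: mpoly_const_def mult_single)

lemma mpoly_const_add: "mpoly_const (a + b) = mpoly_const a + mpoly_const b"
 by (simp add: mpoly_const_def single_add)

lemma mpoly_const_0 [simp]: "mpoly_const 0 = 0"
 by (simp add: mpoly_const_def)

lemma mpoly_const_1 [simp]: "mpoly_const 1 = 1"
 by (simp add: mpoly_const_def)

lemma mpoly_subst_add: "mpoly_subst F (P + Q) = mpoly_subst F P + mpoly_subst F Q"
proof -
 let ?A = "mkeys P \<union> mkeys Q"
 have "mpoly_subst F (P + Q) = (\<Sum>m\<in>?A. mpoly_const (mcoeff (P + Q) m) * mon_eval F m)"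
  by (rule mpoly_subst_superset) (use keys_add[of P Q] in auto)
 also have "\<dots> = mpoly_subst F P + mpoly_subst F Q"
  by (simp add: mpoly_subst_superset[of ?A] lookup_add mpoly_const_add algebra_simps sum.distrib)
 finally show ?thesis .
qed

lemma mpoly_subst_0 [simp]: "mpoly_subst F 0 = 0"
 by (simp add: mpoly_subst_def)

lemma mpoly_subst_single: "mpoly_subst F (msingle m c) = mpoly_const c * mon_eval F m"
 by (subst mpoly_subst_superset[of "{m}"]) auto

lemma mpoly_subst_1 [simp]: "mpoly_subst F 1 = 1"
 using mpoly_subst_single[of F 0 1] by simp

lemma mpoly_subst_const [simp]: "mpoly_subst F (mpoly_const c) = mpoly_const c"
 using mpoly_subst_single[of F 0 c] by (simp add: mpoly_const_def)

lemma mpoly_subst_pvar [simp]: "mpoly_subst F (pvar j) = F j"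
 by (simp add: pvar_def mpoly_subst_single)

lemma mpoly_subst_uminus: "mpoly_subst F (- P) = - mpoly_subst F P"
 using mpoly_subst_add[of F P "- P"] by (simp add: add_eq_0_iff)

lemma mpoly_subst_diff: "mpoly_subst F (P - Q) = mpoly_subst F P - mpoly_subst F Q"
 using mpoly_subst_add[of F P "- Q"] by (simp add: mpoly_subst_uminus)

lemma mpoly_subst_sum: "mpoly_subst F (sum f A) = (\<Sum>i\<in>A. mpoly_subst F (f i))"
 by (induction A rule: infinite_finite_induct) (auto simp: mpoly_subst_add)

lemma mpoly_subst_mult: "mpoly_subst F (P * Q) = mpoly_subst F P * mpoly_subst F Q"
proof (induction P rule: poly_mapping_sum_induct)
 case (single m c)
 show ?case
 proof (induction Q rule: poly_mapping_sum_induct)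
  case (single m' c')
  then show ?case
   by (simp add: mult_single mpoly_subst_single mpoly_const_mult mon_eval_add ac_simps)
 qed (simp_all add: ring_distribs mpoly_subst_add)
qed (simp_all add: ring_distribs mpoly_subst_add)

lemma mpoly_subst_power: "mpoly_subst F (P ^ k) = mpoly_subst F P ^ k"
 by (induction k) (auto simp: mpoly_subst_mult)

lemma mpoly_subst_prod: "mpoly_subst F (prod f A) = (\<Prod>i\<in>A. mpoly_subst F (f i))"
 by (induction A rule: infinite_finite_induct) (auto simp: mpoly_subst_mult)

lemma mpoly_subst_mon_eval: "mpoly_subst F (mon_eval G m) = mon_eval (%j. mpoly_subst F (G j)) m"
 by (simp add: mon_eval_def mpoly_subst_prod mpoly_subst_power)

lemma mpoly_subst_subst:
 "mpoly_subst F (mpoly_subst G P) = mpoly_subst (%j. mpoly_subst F (G j)) P"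
 by (induction P rule: poly_mapping_sum_induct)
  (simp_all add: mpoly_subst_add mpoly_subst_single mpoly_subst_mult mpoly_subst_mon_eval)

lemma pvar_power: "pvar j ^ k = msingle (msingle j k) 1"
 by (induction k) (simp_all add: pvar_def mult_single flip: single_add)

lemma mon_eval_pvar: "mon_eval pvar m = (msingle m 1 :: 'a::comm_ring_1 mpoly)"
proof -
 have "mon_eval pvar (\<Sum>i\<in>A. msingle i (f i)) =
   (msingle (\<Sum>i\<in>A. msingle i (f i)) 1 :: 'a mpoly)" if "finite A" for A f
  using that
  by (induction A rule: finite_induct) (simp_all add: mon_eval_add pvar_power mult_single)
 from this[of "mkeys m" "mcoeff m"] show ?thesis
  by (simp flip: poly_mapping_eq_sum_single)
qed

lemma single_eq_const_mult: "msingle m c = mpoly_const c * msingle m 1"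
 by (simp add: mpoly_const_def mult_single)

lemma mpoly_subst_id [simp]: "mpoly_subst pvar P = P"
 by (induction P rule: poly_mapping_sum_induct)
  (simp_all add: mpoly_subst_add mpoly_subst_single mon_eval_pvar mpoly_const_def mult_single)

lemma mcong_mon_eval:
 assumes "mkeys m \<subseteq> {..<d}" "!!j. j < d ==> mcong q e (F j) (G j)"
 shows "mcong q e (mon_eval F m) (mon_eval G m)"
 unfolding mon_eval_def using assms by (intro mcong_prod mcong_power) auto

lemma mcong_subst_fun:
 assumes "P \<in> mpolys d" "!!j. j < d ==> mcong q e (F j) (G j)"
 shows "mcong q e (mpoly_subst F P) (mpoly_subst G P)"
 unfolding mpoly_subst_def mon_eval_def[symmetric] using assms
 by (intro mcong_sum mcong_mult mcong_refl mcong_mon_eval) (auto simp: mpolys_def)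

lemma mpolys_0 [simp]: "0 \<in> mpolys d" and mpolys_1 [simp]: "1 \<in> mpolys d"
 and mpolys_const [simp]: "mpoly_const c \<in> mpolys d"
 by (auto simp: mpolys_def mpoly_const_def)

lemma mpolys_add: "P \<in> mpolys d ==> Q \<in> mpolys d ==> P + Q \<in> mpolys d"
 unfolding mpolys_def using keys_add[of P Q] by blast

lemma mpolys_uminus: "P \<in> mpolys d ==> - P \<in> mpolys d"
 unfolding mpolys_def by (simp add: in_keys_iff)

lemma mpolys_diff: "P \<in> mpolys d ==> Q \<in> mpolys d ==> P - Q \<in> mpolys d"
 using mpolys_add[of P d "- Q"] by (simp add: mpolys_uminus)

lemma mpolys_mult: "P \<in> mpolys d ==> Q \<in> mpolys d ==> P * Q \<in> mpolys d"
 unfolding mpolys_def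
proof safe
 fix m i
 assume *: "\<forall>m\<in>mkeys P. mkeys m \<subseteq> {..<d}"
  "\<forall>m\<in>mkeys Q. mkeys m \<subseteq> {..<d}"
  "m \<in> mkeys (P * Q)" "i \<in> mkeys m"
 then obtain a b where "a \<in> mkeys P" "b \<in> mkeys Q" "m = a + b"
  using keys_mult[of P Q] by auto
 with * keys_add[of a b] show "i < d" by blast
qed

lemma mpolys_power: "P \<in> mpolys d ==> P ^ k \<in> mpolys d"
 by (induction k) (auto intro: mpolys_mult)

lemma mpolys_sum: "(!!i. i \<in> A ==> f i \<in> mpolys d) ==> sum f A \<in> mpolys d"
 by (induction A rule: infinite_finite_induct) (auto intro: mpolys_add)

lemma mpolys_prod: "(!!i. i \<in> A ==> f i \<in> mpolys d) ==> prod f A \<in> mpolys d"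
 by (induction A rule: infinite_finite_induct) (auto intro: mpolys_mult)

lemma mpolys_pvar: "j < d ==> pvar j \<in> mpolys d"
 by (auto simp: mpolys_def pvar_def split: if_splits)

lemma mpolys_truncate [simp]: "truncate_mps q d f \<in> mpolys d"
 using truncate_mem_box_polys box_polys_subset_mpolys by blast

lemma mpolys_subst:
 assumes "P \<in> mpolys d" "!!j. j < d ==> F j \<in> mpolys e"
 shows "mpoly_subst F P \<in> mpolys e"
 unfolding mpoly_subst_def using assms(1)
 by (intro mpolys_sum mpolys_mult mpolys_prod mpolys_power mpolys_const assms(2)) (auto simp: mpolys_def)

text \<open>A monomial outside the box contains some \<open>x_i^q\<close>, whose image
  \<open>F i ^ q\<close> vanishes; so the substitution passes to the quotient by the ideal of these
  powers.\<close>

lemma mcong_subst_arg: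
 assumes F: "!!j. j < d ==> mcong q d (F j ^ q) 0"
  and PQ: "P \<in> mpolys d" "Q \<in> mpolys d" "mcong q d P Q"
 shows "mcong q d (mpoly_subst F P) (mpoly_subst F Q)"
proof -
 have "mcong q d (mpoly_subst F (P - Q)) (\<Sum>m\<in>mkeys (P - Q). 0)"
  unfolding mpoly_subst_def mon_eval_def[symmetric]
 proof (rule mcong_sum)
  fix m assume m: "m \<in> mkeys (P - Q)"
  with mpolys_diff[OF PQ(1,2)] have sub: "mkeys m \<subseteq> {..<d}"
   by (simp add: mpolys_def)
  have "m \<notin> box q d"
   using m PQ(3) by (auto simp: in_keys_iff lookup_minus mcong_def)
  with sub obtain i where i: "i < d" "q \<le> mcoeff m i"
   by (auto simp: box_def not_less)
  have "mcong q d (F i ^ mcoeff m i) 0"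
  proof -
   have "F i ^ mcoeff m i = F i ^ q * F i ^ (mcoeff m i - q)"
    using i by (simp flip: power_add)
   then show ?thesis
    using mcong_mult[OF F[OF i(1)] mcong_refl[of q d "F i ^ (mcoeff m i - q)"]] by simp
  qed
  then have "mcong q d (F i ^ mcoeff m i * prod (%j. F j ^ mcoeff m j) ({..<d} - {i}))
    (0 * prod (%j. F j ^ mcoeff m j) ({..<d} - {i}))"
   by (intro mcong_mult mcong_refl)
  moreover have "mon_eval F m = F i ^ mcoeff m i * prod (%j. F j ^ mcoeff m j) ({..<d} - {i})"
   using mon_eval_superset[OF _ sub, of F] i by (simp add: prod.remove)
  ultimately have "mcong q d (mon_eval F m) 0" by simp
  from mcong_mult[OF mcong_refl this]
  show "mcong q d (mpoly_const (mcoeff (P - Q) m) * mon_eval F m) 0"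
   by simp
 qed
 then have "mcong q d (mpoly_subst F P - mpoly_subst F Q) 0"
  by (simp add: mpoly_subst_diff)
 then show ?thesis
  by (simp add: mcong_def lookup_minus)
qed

lemma CHAR_poly_mapping: "CHAR('b::monoid_add \<Rightarrow>\<^sub>0 'c::comm_ring_1) = CHAR('c)"
proof (rule CHAR_eqI)
 show "of_nat CHAR('c) = (0 :: 'b \<Rightarrow>\<^sub>0 'c)"
  by (simp flip: single_of_nat)
 fix x :: nat assume "of_nat x = (0 :: 'b \<Rightarrow>\<^sub>0 'c)"
 then have "mcoeff (of_nat x :: 'b \<Rightarrow>\<^sub>0 'c) 0 = 0" by simp
 then have "of_nat x = (0 :: 'c)" by (simp add: lookup_of_nat)
 then show "CHAR('c) dvd x" by (simp add: of_nat_eq_0_iff_char_dvd)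
qed

lemma power_single: "msingle m c ^ k = msingle (\<Sum>i<k. m) (c ^ k)"
 by (induction k) (simp_all add: mult_single add.commute)

lemma lookup_sum_const: "mcoeff (\<Sum>i<(k::nat). m :: monomial) j = k * mcoeff m j"
 by (simp only: lookup_sum) simp

text \<open>In characteristic \<open>p\<close> the \<open>q\<close>-th power is taken term by term,
  and the \<open>q\<close>-th power of a nonconstant monomial leaves the box.\<close>

lemma mcong_power_0:
 fixes P :: "'a::comm_ring_1 mpoly"
 assumes "prime CHAR('a)" "mcoeff P 0 = 0"
 shows "mcong (CHAR('a) ^ n) d (P ^ (CHAR('a) ^ n)) 0"
proof -
 let ?q = "CHAR('a) ^ n"
 have "P ^ ?q = (\<Sum>m\<in>mkeys P. msingle m (mcoeff P m)) ^ ?q"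
  by (simp flip: poly_mapping_eq_sum_single)
 also have "\<dots> = (\<Sum>m\<in>mkeys P. msingle m (mcoeff P m) ^ ?q)"
  by (rule freshmans_dream_sum') (simp_all add: CHAR_poly_mapping assms)
 also have "mcong ?q d \<dots> (\<Sum>m\<in>mkeys P. 0)"
 proof (rule mcong_sum)
  fix m assume m: "m \<in> mkeys P"
  with assms have "m \<noteq> 0" by (auto simp: in_keys_iff)
  then obtain i where i: "mcoeff m i \<noteq> 0"
   by (metis lookup_zero poly_mapping_eqI)
  have "(\<Sum>i<?q. m) \<notin> box ?q d"
  proof
   assume *: "(\<Sum>i<?q. m) \<in> box ?q d"
   have pos: "?q > 0" using assms(1) prime_gt_0_nat by simp
   have "i \<in> mkeys (\<Sum>i<?q. m)"
    using i pos by (simp only: in_keys_iff lookup_sum_const) simp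
   with * have "?q * mcoeff m i < ?q"
    by (auto simp only: box_def mem_Collect_eq lookup_sum_const)
   with i show False by simp
  qed
  then show "mcong ?q d (msingle m (mcoeff P m) ^ ?q) 0"
   by (auto simp: mcong_def power_single lookup_single when_def)
 qed
 finally show ?thesis by simp
qed

section \<open>The formal group law\<close>

text \<open>The logarithm at \<open>v = 1\<close>, that is
  \<open>x + x^q/p + x^(q^2)/p^2 + ...\<close> with \<open>q = p^n\<close>.\<close>

definition log_series :: "nat => nat => rat fps" where
 "log_series p n = Abs_fps (%k. \<Sum>i | p ^ (n * i) = k. 1 / of_nat p ^ i)"

definition exp_series :: "nat => nat => rat fps" where
 "exp_series p n = fps_inv (log_series p n)"

text \<open>With \<open>v\<^sub>n\<close> in degree \<open>-(p^n - 1)\<close> and the variables in degree 1, the series are homogeneous, so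
  that the power of \<open>v\<^sub>n\<close> in a coefficient is determined by the exponent.\<close>

definition hom_fps :: "nat => nat => rat poly fps => rat fps => bool" where
 "hom_fps w r f g \<longleftrightarrow> (\<forall>k. fps_nth f k = Polynomial.monom (fps_nth g k) ((k - r) div w) &
   (fps_nth g k \<noteq> 0 --> r \<le> k & w dvd k - r))"

definition hom_mps :: "nat => nat => rat poly mps => rat mps => bool" where
 "hom_mps w r f g \<longleftrightarrow> (\<forall>m. f m = Polynomial.monom (g m) ((total_degree m - r) div w) &
   (g m \<noteq> 0 --> r \<le> total_degree m & w dvd total_degree m - r))"

lemma total_degree_superset:
 "finite A ==> mkeys m \<subseteq> A ==> total_degree m = (\<Sum>i\<in>A. mcoeff m i)"
 unfolding total_degree_def by (rule sum.mono_neutral_left) (auto simp: in_keys_iff)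

lemma total_degree_0 [simp]: "total_degree 0 = 0"
 by (simp add: total_degree_def)

lemma total_degree_add [simp]: "total_degree (a + b) = total_degree a + total_degree b"
 using keys_add[of a b]
 by (simp add: total_degree_superset[of "mkeys a \<union> mkeys b"] lookup_add sum.distrib)

lemma total_degree_single [simp]: "total_degree (msingle i k) = k"
 by (cases "k = 0") (simp_all add: total_degree_def)

lemma sum_monom: "(\<Sum>i\<in>A. Polynomial.monom (f i) k) = Polynomial.monom (\<Sum>i\<in>A. f i) k"
 by (induction A rule: infinite_finite_induct) (simp_all add: add_monom)

text \<open>Subtraction and division of natural numbers are truncated; the four hypotheses make both
  exact, so that the exponents of \<open>v\<close> add under multiplication.\<close>

lemma homogeneous_product_exponent:
 fixes a b r s w :: nat
 assumes "r \<le> a" "w dvd a - r" "s \<le> b" "w dvd b - s"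
 shows "(a - r) div w + (b - s) div w = (a + b - (r + s)) div w" "w dvd a + b - (r + s)"
proof -
 have eq: "a + b - (r + s) = (a - r) + (b - s)" using assms by simp
 show "(a - r) div w + (b - s) div w = (a + b - (r + s)) div w"
  unfolding eq using div_plus_div_distrib_dvd_left[OF assms(2), of "b - s"] by simp
 show "w dvd a + b - (r + s)"
  unfolding eq using assms by (intro dvd_add)
qed

lemma hom_fps_mult:
 assumes "hom_fps w r f f'" "hom_fps w s g g'"
 shows "hom_fps w (r + s) (f * g) (f' * g')"
 unfolding hom_fps_def
proof (intro allI conjI impI)
 fix k
 \<comment> \<open>A vanishing factor carries no information about its exponent, but then both sides
   are zero.\<close>
 have trm: "fps_nth f i * fps_nth g (k - i) = Polynomial.monom (fps_nth f' i * fps_nth g' (k - i)) ((k - (r + s)) div w)"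
  if "i \<in> {0..k}" for i
 proof (cases "fps_nth f' i = 0 \<or> fps_nth g' (k - i) = 0")
  case True
  then show ?thesis using assms by (auto simp: hom_fps_def)
 next
  case False
  then have "(i - r) div w + (k - i - s) div w = (i + (k - i) - (r + s)) div w"
   using assms by (intro homogeneous_product_exponent) (auto simp: hom_fps_def)
  moreover have "i + (k - i) = k" using that by simp
  ultimately have "(i - r) div w + (k - i - s) div w = (k - (r + s)) div w" by (simp only:)
  then show ?thesis using assms by (simp add: hom_fps_def mult_monom)
 qed
 then have "fps_nth (f * g) k = (\<Sum>i=0..k. Polynomial.monom (fps_nth f' i * fps_nth g' (k - i)) ((k - (r + s)) div w))"
  unfolding fps_mult_nth by (rule sum.cong[OF refl])
 then show "fps_nth (f * g) k = Polynomial.monom (fps_nth (f' * g') k) ((k - (r + s)) div w)"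
  by (simp add: fps_mult_nth sum_monom)
next
 fix k assume "fps_nth (f' * g') k \<noteq> 0"
 then obtain i where "i \<in> {0..k}" "fps_nth f' i * fps_nth g' (k - i) \<noteq> 0"
  unfolding fps_mult_nth by (rule sum.not_neutral_contains_not_neutral)
 then have i: "i \<le> k" "fps_nth f' i \<noteq> 0" "fps_nth g' (k - i) \<noteq> 0"
  by auto
 then have *: "r \<le> i" "w dvd i - r" "s \<le> k - i" "w dvd k - i - s"
  using assms by (auto simp: hom_fps_def)
 show "r + s \<le> k" using *(1,3) i(1) by linarith
 show "w dvd k - (r + s)" using homogeneous_product_exponent(2)[OF *] unfolding le_add_diff_inverse[OF i(1)] .
qed

lemma hom_fps_power: "hom_fps w r f f' ==> hom_fps w (k * r) (f ^ k) (f' ^ k)"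
proof (induction k)
 case 0
 then show ?case by (auto simp: hom_fps_def)
next
 case (Suc k)
 then show ?case unfolding mult_Suc power_Suc by (intro hom_fps_mult)
qed

lemma mps_mult_nonzero:
 fixes f g :: "'a::comm_ring_1 mps"
 assumes "mps_mult f g m \<noteq> 0"
 obtains a b where "m = a + b" "f a \<noteq> 0" "g b \<noteq> 0"
proof -
 from assms obtain x where x: "x \<in> {(a, b). a + b = m}" "(%(a, b). f a * g b) x \<noteq> 0"
  unfolding mps_mult_def by (rule sum.not_neutral_contains_not_neutral)
 show ?thesis
  by (rule that[of "fst x" "snd x"]) (use x in \<open>auto split: prod.splits\<close>)
qed

lemma hom_mps_mult:
 assumes "hom_mps w r f f'" "hom_mps w s g g'"
 shows "hom_mps w (r + s) (mps_mult f g) (mps_mult f' g')"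
 unfolding hom_mps_def
proof (intro allI conjI impI)
 fix m
 have trm: "f a * g b = Polynomial.monom (f' a * g' b) ((total_degree m - (r + s)) div w)"
  if "a + b = m" for a b
 proof (cases "f' a = 0 \<or> g' b = 0")
  case True
  then show ?thesis using assms by (auto simp: hom_mps_def)
 next
  case False
  then have "(total_degree a - r) div w + (total_degree b - s) div w =
    (total_degree a + total_degree b - (r + s)) div w"
   using assms by (intro homogeneous_product_exponent) (auto simp: hom_mps_def)
  then have "(total_degree a - r) div w + (total_degree b - s) div w = (total_degree m - (r + s)) div w"
   unfolding that[symmetric] total_degree_add .
  then show ?thesis using assms by (simp add: hom_mps_def mult_monom)
 qed
 have "mps_mult f g m = (\<Sum>x | fst x + snd x = m. Polynomial.monom (f' (fst x) * g' (snd x)) ((total_degree m - (r + s)) div w))"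
  unfolding mps_mult_def case_prod_unfold by (rule sum.cong[OF refl]) (simp add: trm)
 then show "mps_mult f g m = Polynomial.monom (mps_mult f' g' m) ((total_degree m - (r + s)) div w)"
  by (simp add: mps_mult_def case_prod_unfold sum_monom)
next
 fix m assume "mps_mult f' g' m \<noteq> 0"
 then obtain a b where ab: "m = a + b" "f' a \<noteq> 0" "g' b \<noteq> 0" by (rule mps_mult_nonzero)
 then have *: "r \<le> total_degree a" "w dvd total_degree a - r" "s \<le> total_degree b" "w dvd total_degree b - s"
  using assms by (auto simp: hom_mps_def)
 show "r + s \<le> total_degree m" unfolding ab(1) total_degree_add using *(1,3) by (rule add_mono)
 show "w dvd total_degree m - (r + s)" using homogeneous_product_exponent(2)[OF *] unfolding ab(1) total_degree_add .
qed

lemma hom_mps_power: "hom_mps w r f f' ==> hom_mps w (k * r) (mps_power f k) (mps_power f' k)"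
proof (induction k)
 case 0
 then show ?case by (auto simp: hom_mps_def)
next
 case (Suc k)
 then show ?case unfolding mult_Suc mps_power.simps by (intro hom_mps_mult)
qed

lemma hom_mps_compose:
 assumes "hom_fps w 1 f f'" "hom_mps w 1 g g'"
 shows "hom_mps w 1 (mps_compose f g) (mps_compose f' g')"
 unfolding hom_mps_def
proof (intro allI conjI impI)
 fix m
 have pw: "hom_mps w k (mps_power g k) (mps_power g' k)" for k
  using hom_mps_power[OF assms(2), of k] by simp
 have trm: "fps_nth f k * mps_power g k m = Polynomial.monom (fps_nth f' k * mps_power g' k m) ((total_degree m - 1) div w)" for k
 proof (cases "fps_nth f' k = 0 \<or> mps_power g' k m = 0")
  case True
  then show ?thesis using assms pw[of k] by (auto simp: hom_mps_def hom_fps_def)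
 next
  case False
  \<comment> \<open>The outer series has weight 1 and the inner power has weight \<open>k\<close>,
    so \<open>k\<close> drops out of the total exponent.\<close>
  then have "(k - 1) div w + (total_degree m - k) div w = (k + total_degree m - (1 + k)) div w"
   using assms pw[of k] by (intro homogeneous_product_exponent) (auto simp: hom_mps_def hom_fps_def)
  then show ?thesis using assms pw[of k] by (simp add: hom_mps_def hom_fps_def mult_monom)
 qed
 show "mps_compose f g m = Polynomial.monom (mps_compose f' g' m) ((total_degree m - 1) div w)"
  unfolding mps_compose_def trm sum_monom ..
next
 fix m assume "mps_compose f' g' m \<noteq> 0"
 then obtain k where "fps_nth f' k * mps_power g' k m \<noteq> 0"
  unfolding mps_compose_def by (rule sum.not_neutral_contains_not_neutral)
 then have k: "fps_nth f' k \<noteq> 0" "mps_power g' k m \<noteq> 0"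
  by auto
 have "hom_mps w k (mps_power g k) (mps_power g' k)"
  using hom_mps_power[OF assms(2), of k] by simp
 with k assms have *: "1 \<le> k" "w dvd k - 1" "k \<le> total_degree m" "w dvd total_degree m - k"
  by (auto simp: hom_mps_def hom_fps_def)
 show "1 \<le> total_degree m" using *(1,3) by linarith
 have "w dvd k + total_degree m - (1 + k)" using * by (rule homogeneous_product_exponent(2))
 moreover have "k + total_degree m - (1 + k) = total_degree m - 1" by linarith
 ultimately show "w dvd total_degree m - 1" by (rule back_subst[of "(dvd) w"])
qed

lemma fps_compose_inverse_unique:
 fixes a :: "'a::idom fps"
 assumes "fps_nth a 0 = 0" "b oo a = fps_X" "a oo c = fps_X" "fps_nth c 0 = 0"
 shows "b = c"
proof -
 have "b = b oo (a oo c)" by (simp add: assms)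
 also have "\<dots> = (b oo a) oo c" by (rule fps_compose_assoc) (simp_all add: assms)
 also have "\<dots> = c" by (simp add: assms)
 finally show ?thesis .
qed

context
 fixes p n q :: nat
 assumes p: "prime p" and n: "n \<ge> 1" and q: "q = p ^ n"
begin

lemma q_ge_2: "q \<ge> 2"
 using prime_ge_2_nat[OF p] n self_le_power[of p n] q by simp

lemma dvd_power_minus_one: "(q - 1) dvd q ^ i - (1::nat)"
proof (induction i)
 case (Suc i)
 have "q ^ i \<ge> 1" "q \<ge> 1" using q_ge_2 by simp_all
 then have "q ^ Suc i - 1 = q * (q ^ i - 1) + (q - 1)"
  by (simp add: diff_mult_distrib2)
 with Suc show ?case by (metis dvd_add dvd_mult dvd_refl)
qed simp

lemma log_series_power: "fps_nth (log_series p n) (q ^ i) = 1 / of_nat p ^ i"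
proof -
 have "{j. p ^ (n * j) = q ^ i} = {i}"
  using q_ge_2 by (auto simp: q power_mult power_inject_exp)
 then show ?thesis by (simp add: log_series_def)
qed

lemma log_series_other: "(!!i. k \<noteq> q ^ i) ==> fps_nth (log_series p n) k = 0"
proof -
 assume "!!i. k \<noteq> q ^ i"
 then have "{j. p ^ (n * j) = k} = {}" by (auto simp: q power_mult)
 then show ?thesis by (simp add: log_series_def)
qed

lemma log_series_0 [simp]: "fps_nth (log_series p n) 0 = 0"
 using q_ge_2 by (intro log_series_other) auto

lemma log_series_1 [simp]: "fps_nth (log_series p n) (Suc 0) = 1"
 using log_series_power[of 0] by simp

lemma hom_fps_log: "hom_fps (q - 1) 1 (fgl_log p n) (log_series p n)"
 unfolding hom_fps_def
proof (intro allI)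
 fix k
 show "fps_nth (fgl_log p n) k = Polynomial.monom (fps_nth (log_series p n) k) ((k - 1) div (q - 1)) &
  (fps_nth (log_series p n) k \<noteq> 0 --> 1 \<le> k & q - 1 dvd k - 1)"
 proof (cases "\<exists>i. k = q ^ i")
  case True
  then obtain i where k: "k = q ^ i" by blast
  have "{j. p ^ (n * j) = q ^ i} = {i}"
   using q_ge_2 by (auto simp: q power_mult power_inject_exp)
  then have "fps_nth (fgl_log p n) k = Polynomial.monom (1 / of_nat p ^ i) ((q ^ i - 1) div (q - 1))"
   by (simp add: fgl_log_def k q power_mult)
  then show ?thesis using q_ge_2 dvd_power_minus_one[of i] by (simp add: k log_series_power)
 next
  case False
  then have "{j. p ^ (n * j) = k} = {}" by (auto simp: q power_mult)
  then show ?thesis using False by (simp add: fgl_log_def log_series_other)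
 qed
qed

lemma exp_series_left: "exp_series p n oo log_series p n = fps_X"
 unfolding exp_series_def by (rule fps_inv) simp_all

lemma exp_series_right: "log_series p n oo exp_series p n = fps_X"
 unfolding exp_series_def by (rule fps_inv_right) simp_all

lemma exp_series_0 [simp]: "fps_nth (exp_series p n) 0 = 0"
 by (simp add: exp_series_def fps_inv_def)

lemma log_series_power_support:
 "fps_nth (log_series p n ^ i) k \<noteq> 0 ==> i \<le> k & q - 1 dvd k - i"
 using hom_fps_power[OF hom_fps_log, of i] by (simp add: hom_fps_def)

text \<open>Comparison of the coefficients of \<open>x^k\<close> in \<open>e(l(x)) = x\<close>; the
  power \<open>l^k\<close> has coefficient 1 at \<open>k\<close> because \<open>l\<close> starts
  with \<open>x\<close>.\<close>

lemma exp_series_rec: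
 "fps_nth (exp_series p n) k = (if k = 1 then 1 else 0) -
   (\<Sum>i<k. fps_nth (exp_series p n) i * fps_nth (log_series p n ^ i) k)"
proof -
 have "(\<Sum>i=0..k. fps_nth (exp_series p n) i * fps_nth (log_series p n ^ i) k) = (if k = 1 then 1 else 0)"
  using arg_cong[OF exp_series_left, of "%f. fps_nth f k"] by (simp add: fps_compose_nth)
 moreover have "fps_nth (log_series p n ^ k) k = 1"
  using startsby_zero_power_nth_same[of "log_series p n" k] by simp
 ultimately show ?thesis
  by (simp add: atLeast0AtMost flip: lessThan_Suc_atMost)
qed

text \<open>Induction along \<open>exp_series_rec\<close>: \<open>q - 1\<close> divides
  \<open>i - 1\<close> where \<open>e\<close> has a coefficient and \<open>k - i\<close> where
  \<open>l^i\<close> has one, hence also their sum \<open>k - 1\<close>.\<close>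

lemma exp_series_support: "fps_nth (exp_series p n) k \<noteq> 0 ==> 1 \<le> k & q - 1 dvd k - 1"
proof (induction k rule: less_induct)
 case (less k)
 show ?case
 proof (cases "k = 1")
  case False
  with less.prems have "(\<Sum>i<k. fps_nth (exp_series p n) i * fps_nth (log_series p n ^ i) k) \<noteq> 0"
   using exp_series_rec[of k] by auto
  then obtain i where "i \<in> {..<k}" "fps_nth (exp_series p n) i * fps_nth (log_series p n ^ i) k \<noteq> 0"
   by (rule sum.not_neutral_contains_not_neutral)
  then have i: "i < k" "fps_nth (exp_series p n) i \<noteq> 0" "fps_nth (log_series p n ^ i) k \<noteq> 0"
   by auto
  with less.IH log_series_power_support have *: "1 \<le> i" "q - 1 dvd i - 1" "q - 1 dvd k - i" by auto
  have "k - 1 = (k - i) + (i - 1)" using * i by simp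
  with * have "q - 1 dvd k - 1" by (metis dvd_add)
  with * i show ?thesis by simp
 qed simp
qed

lemma hom_fps_exp: "hom_fps (q - 1) 1 (fgl_exp p n) (exp_series p n)"
proof -
 \<comment> \<open>The powers of \<open>v\<close> are put back into the inverse at
   \<open>v = 1\<close>. The result inverts \<open>fgl_log\<close>, and uniqueness of inverses
   identifies it with \<open>fgl_exp\<close>.\<close>
 define e' where "e' = Abs_fps (%k. Polynomial.monom (fps_nth (exp_series p n) k) ((k - 1) div (q - 1)))"
 have e': "hom_fps (q - 1) 1 e' (exp_series p n)"
  using exp_series_support by (simp add: hom_fps_def e'_def)
 have "e' oo fgl_log p n = fps_X"
 proof (rule fps_ext)
  fix k
  have pw: "hom_fps (q - 1) i (fgl_log p n ^ i) (log_series p n ^ i)" for i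
   using hom_fps_power[OF hom_fps_log, of i] by simp
  have trm: "fps_nth e' i * fps_nth (fgl_log p n ^ i) k =
   Polynomial.monom (fps_nth (exp_series p n) i * fps_nth (log_series p n ^ i) k) ((k - 1) div (q - 1))" for i
  proof (cases "fps_nth (exp_series p n) i = 0 \<or> fps_nth (log_series p n ^ i) k = 0")
   case True
   then show ?thesis using e' pw[of i] by (auto simp: hom_fps_def)
  next
   case False
   then have "(i - 1) div (q - 1) + (k - i) div (q - 1) = (i + k - (1 + i)) div (q - 1)"
    using e' pw[of i] by (intro homogeneous_product_exponent) (auto simp: hom_fps_def)
   then show ?thesis using e' pw[of i] by (simp add: hom_fps_def mult_monom)
  qed
  have "fps_nth (e' oo fgl_log p n) k = Polynomial.monom (fps_nth (exp_series p n oo log_series p n) k) ((k - 1) div (q - 1))"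
   unfolding fps_compose_nth trm sum_monom ..
  then show "fps_nth (e' oo fgl_log p n) k = fps_nth fps_X k"
   by (simp add: exp_series_left)
 qed
 moreover have "fps_nth (fgl_log p n) 0 = 0"
  using hom_fps_log by (simp add: hom_fps_def)
 moreover have inv: "fgl_exp p n oo fgl_log p n = fps_X" "fgl_log p n oo fgl_exp p n = fps_X"
  using fgl_exp_inverse[of p n] prime_ge_2_nat[OF p] n by auto
 moreover have "fps_nth (fgl_exp p n) 0 = 0"
  using arg_cong[OF inv(1), of "%f. fps_nth f 0"] by (simp add: fps_compose_nth)
 ultimately have "e' = fgl_exp p n"
  using fps_compose_inverse_unique by blast
 with e' show ?thesis by simp
qed

end

lemma reduce_rat_0 [simp]: "reduce_rat 0 = 0"
 by (simp add: reduce_rat_def)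

lemma reduce_poly_monom:
 "reduce_poly (Polynomial.monom c k) = (msingle (int k) (reduce_rat c) :: 'p::prime_card morava)"
proof (cases "c = 0")
 case True
 then show ?thesis by (simp add: reduce_poly_def)
next
 case False
 then have "reduce_poly (Polynomial.monom c k) =
  (\<Sum>i\<le>k. msingle (int i) (reduce_rat (if k = i then c else 0)) :: 'p morava)"
  by (simp add: reduce_poly_def degree_monom_eq)
 also have "\<dots> = (\<Sum>i\<in>{k}. msingle (int i) (reduce_rat (if k = i then c else 0)))"
  by (rule sum.mono_neutral_right) auto
 finally show ?thesis by simp
qed

lemma total_degree_box: "m \<in> box q d ==> total_degree m = (\<Sum>i<d. mcoeff m i)"
 by (rule total_degree_superset) (auto simp: box_def)

text \<open>A sum over an infinite set would be zero by convention, so this finiteness is what gives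
  \<open>mps_mult\<close> its meaning. Both summands lie in a box of side
  \<open>total_degree m + 1\<close>.\<close>

lemma finite_monomial_splits: "finite {(a, b). a + b = (m :: monomial)}"
proof -
 obtain d where d: "mkeys m \<subseteq> {..<d}"
  using finite_nat_iff_bounded[of "mkeys m"] by auto
 have "mcoeff m i \<le> total_degree m" for i
 proof (cases "i \<in> mkeys m")
  case True
  then show ?thesis unfolding total_degree_def by (intro member_le_sum) auto
 next
  case False
  then show ?thesis by (simp add: in_keys_iff)
 qed
 with d have "m \<in> box (Suc (total_degree m)) d"
  by (simp add: box_def less_Suc_eq_le)
 then have "{(a, b). a + b = m} \<subseteq> box (Suc (total_degree m)) d \<times> box (Suc (total_degree m)) d"
  using box_add_left box_add_right by blast
 then show ?thesis by (rule finite_subset) simp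
qed

lemma hom_mps_var: "hom_mps w 1 (mps_var i) (mps_var i)"
 by (auto simp: hom_mps_def mps_var_def)

lemma hom_mps_of_int:
 assumes "hom_mps w r f g"
 shows "hom_mps w r (%m. of_int c * f m) (%m. of_int c * g m)"
proof -
 have "of_int c * Polynomial.monom a k = Polynomial.monom (of_int c * a) k" for a :: rat and k
  by (simp add: of_int_poly smult_monom)
 with assms show ?thesis by (simp add: hom_mps_def)
qed

lemma hom_mps_sum:
 assumes "!!i. i \<in> A ==> hom_mps w r (f i) (g i)"
 shows "hom_mps w r (%m. \<Sum>i\<in>A. f i m) (%m. \<Sum>i\<in>A. g i m)"
 unfolding hom_mps_def
proof (intro allI conjI impI)
 fix m
 have "(\<Sum>i\<in>A. f i m) = (\<Sum>i\<in>A. Polynomial.monom (g i m) ((total_degree m - r) div w))"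
  using assms by (intro sum.cong) (auto simp: hom_mps_def)
 then show "(\<Sum>i\<in>A. f i m) = Polynomial.monom (\<Sum>i\<in>A. g i m) ((total_degree m - r) div w)"
  by (simp add: sum_monom)
next
 fix m assume "(\<Sum>i\<in>A. g i m) \<noteq> 0"
 then obtain i where "i \<in> A" "g i m \<noteq> 0" by (rule sum.not_neutral_contains_not_neutral)
 with assms show "r \<le> total_degree m" "w dvd total_degree m - r" by (auto simp: hom_mps_def)
qed

definition fgl_coeff :: "nat => nat => nat => (nat => int) => rat mps" where
 "fgl_coeff p n d a = mps_compose (exp_series p n)
   (%m. \<Sum>i<d. of_int (a i) * mps_compose (log_series p n) (mps_var i) m)"

text \<open>By homogeneity each coefficient over the polynomials in \<open>v\<close> is a single
  monomial, on which \<open>reduce_poly\<close> is just the reduction of one rational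
  number.\<close>

lemma fgl_sum_series_eq:
 fixes A :: "'p::prime_card mod_ring mat" and n d j :: nat
 assumes n: "n \<ge> 1"
 defines "c \<equiv> fgl_coeff CARD('p) n d (%i. to_int_mod_ring (A $$ (i, j)))"
 shows "fgl_sum_series n d A j m =
   msingle (int ((total_degree m - 1) div (CARD('p) ^ n - 1))) (reduce_rat (c m))"
  and "c m \<noteq> 0 ==> 1 \<le> total_degree m & CARD('p) ^ n - 1 dvd total_degree m - 1"
proof -
 note h = prime_card[where 'a='p] n refl
 have hom: "hom_mps (CARD('p) ^ n - 1) 1
   (mps_compose (fgl_exp CARD('p) n)
    (%m. \<Sum>i<d. of_int (to_int_mod_ring (A $$ (i, j))) *
          mps_compose (fgl_log CARD('p) n) (mps_var i) m)) c"
  unfolding c_def fgl_coeff_def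
  by (intro hom_mps_compose hom_fps_exp[OF h] hom_mps_sum hom_mps_of_int hom_fps_log[OF h] hom_mps_var)
 then show "fgl_sum_series n d A j m =
   msingle (int ((total_degree m - 1) div (CARD('p) ^ n - 1))) (reduce_rat (c m))"
  by (simp add: fgl_sum_series_def hom_mps_def reduce_poly_monom)
 from hom show "c m \<noteq> 0 ==> 1 \<le> total_degree m & CARD('p) ^ n - 1 dvd total_degree m - 1"
  by (simp add: hom_mps_def)
qed

subsection \<open>Coefficients in the box\<close>

lemma mps_mult_box_cong:
 fixes f g f' g' :: "'a::comm_ring_1 mps"
 assumes "!!m. m \<in> box q d ==> f m = f' m" "!!m. m \<in> box q d ==> g m = g' m" "m \<in> box q d"
 shows "mps_mult f g m = mps_mult f' g' m"
 unfolding mps_mult_def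
proof (rule sum.cong[OF refl])
 fix x assume "x \<in> {(a, b). a + b = m}"
 then have "fst x + snd x \<in> box q d" using assms(3) by (simp add: case_prod_unfold)
 then have "fst x \<in> box q d" "snd x \<in> box q d" by (rule box_add_left, rule box_add_right)
 with assms(1,2) show "(case x of (a, b) => f a * g b) = (case x of (a, b) => f' a * g' b)"
  by (simp add: case_prod_unfold)
qed

lemma mps_power_box_cong:
 fixes f f' :: "'a::comm_ring_1 mps"
 assumes "!!m. m \<in> box q d ==> f m = f' m" "m \<in> box q d"
 shows "mps_power f k m = mps_power f' k m"
 using assms(2) by (induction k arbitrary: m) (simp_all add: mps_mult_box_cong[OF assms(1)])

lemma mps_mult_var:
 "mps_mult (mps_var i) g m = (if mcoeff m i = 0 then 0 else g (m - msingle i 1))"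
proof (cases "mcoeff m i = 0")
 case True
 then have "m \<noteq> msingle i 1 + b" for b :: monomial
  by (auto simp: lookup_add)
 then have "mps_mult (mps_var i) g m = 0"
  unfolding mps_mult_def by (intro sum.neutral) (auto simp: mps_var_def)
 then show ?thesis using True by simp
next
 case False
 let ?e = "msingle i (1::nat)"
 have split: "?e + (m - ?e) = m"
  using False by (intro poly_mapping_eqI) (auto simp: lookup_add lookup_minus lookup_single when_def)
 have "mps_mult (mps_var i) g m = (\<Sum>(a, b)\<in>{(?e, m - ?e)}. mps_var i a * g b)"
  unfolding mps_mult_def
 proof (rule sum.mono_neutral_right[OF finite_monomial_splits])
  show "{(?e, m - ?e)} \<subseteq> {(a, b). a + b = m}" using split by simp
  show "\<forall>x\<in>{(a, b). a + b = m} - {(?e, m - ?e)}. (case x of (a, b) => mps_var i a * g b) = 0"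
   by (auto simp: mps_var_def split: if_splits)
 qed
 then show ?thesis using False by (simp add: mps_var_def)
qed

lemma mps_power_var:
 "mps_power (mps_var i) k m = (if m = msingle i k then 1 else (0 :: 'a::comm_ring_1))"
proof (induction k arbitrary: m)
 case (Suc k)
 have "m - msingle i 1 = msingle i k \<longleftrightarrow> m = msingle i (Suc k)"
  if "mcoeff m i \<noteq> 0"
  using that by (auto simp: poly_mapping_eq_iff fun_eq_iff lookup_minus lookup_single when_def split: if_splits)
 moreover have "mcoeff m i \<noteq> 0" if "m = msingle i (Suc k)"
  using that by simp
 ultimately show ?case by (auto simp: mps_mult_var Suc.IH)
qed simp

text \<open>The further terms \<open>x_i^(q^k)\<close>, \<open>k \<ge> 1\<close>, of the logarithm
  lie outside the box. This is what makes the action computable there.\<close>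

lemma mps_compose_log_var:
 assumes "prime p" "n \<ge> 1" "m \<in> box (p ^ n) d"
 shows "mps_compose (log_series p n) (mps_var i) m = mps_var i m"
proof -
 have "mps_compose (log_series p n) (mps_var i) m =
   (\<Sum>k\<le>total_degree m. if k = total_degree m then
    (if m = msingle i (total_degree m) then fps_nth (log_series p n) k else 0) else 0)"
  unfolding mps_compose_def mps_power_var by (intro sum.cong) auto
 then have eq: "mps_compose (log_series p n) (mps_var i) m =
   (if m = msingle i (total_degree m) then fps_nth (log_series p n) (total_degree m) else 0)"
  by simp
 show ?thesis
 proof (cases "m = msingle i (total_degree m)")
  case True
  have "total_degree m < p ^ n"
  proof (cases "total_degree m = 0")
   case False
   then have "i < d" using assms(3) True
    by (metis (no_types, lifting) box_def keys_single insert_subset lessThan_iff mem_Collect_eq)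
   then show ?thesis using assms(3) True by (metis (no_types, lifting) box_def lookup_single_eq mem_Collect_eq)
  qed (use assms in \<open>simp add: prime_gt_0_nat\<close>)
  note lt = this
  show ?thesis
  proof (cases "total_degree m = 1")
   case True2: True
   then show ?thesis using eq True log_series_1[OF assms(1,2) refl] by (simp add: mps_var_def)
  next
   case False
   have "total_degree m \<noteq> (p ^ n) ^ k" for k
   proof (cases "k = 0")
    case False
    then have "p ^ n \<le> (p ^ n) ^ k"
     using prime_gt_0_nat[OF assms(1)] by (intro self_le_power) auto
    with lt show ?thesis by simp
   qed (use \<open>total_degree m \<noteq> 1\<close> in simp)
   then have "fps_nth (log_series p n) (total_degree m) = 0"
    by (rule log_series_other[OF assms(1,2) refl])
   moreover have "m \<noteq> msingle i 1" using False by (metis total_degree_single)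
   ultimately show ?thesis using eq by (simp add: mps_var_def)
  qed
 next
  case False
  then have "m \<noteq> msingle i 1" by (metis total_degree_single)
  with False eq show ?thesis by (simp add: mps_var_def)
 qed
qed

text \<open>The coefficient of \<open>m\<close> in the power of exponent
  \<open>total_degree m\<close> of the linear form with coefficients \<open>a\<close>.\<close>

definition multinomial_term :: "nat => (nat => int) => monomial => rat" where
 "multinomial_term d a m = fact (total_degree m) *
   (\<Prod>i<d. of_int (a i) ^ mcoeff m i / fact (mcoeff m i))"

lemma mps_mult_linear:
 "mps_mult (%m. \<Sum>i<d. c i * mps_var i m) g m =
  (\<Sum>i<d. c i * (if mcoeff m i = 0 then 0 else g (m - msingle i 1)))"
proof -
 have "mps_mult (%m. \<Sum>i<d. c i * mps_var i m) g m = (\<Sum>x | fst x + snd x = m. \<Sum>i<d. c i * (mps_var i (fst x) * g (snd x)))"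
  by (simp add: mps_mult_def case_prod_unfold sum_distrib_right mult.assoc)
 also have "\<dots> = (\<Sum>i<d. c i * mps_mult (mps_var i) g m)"
  unfolding mps_mult_def case_prod_unfold sum_distrib_left by (rule sum.swap)
 finally show ?thesis by (simp only: mps_mult_var)
qed

text \<open>Splitting off one factor \<open>x_i\<close> multiplies the normalized coefficient by the
  exponent of \<open>x_i\<close>; these exponents sum to the total degree, which turns
  \<open>fact k\<close> into \<open>fact (Suc k)\<close>.\<close>

lemma mps_power_linear:
 assumes "mkeys m \<subseteq> {..<d}"
 shows "mps_power (%m. \<Sum>i<d. of_int (a i) * mps_var i m) k m =
  (if total_degree m = k then multinomial_term d a m else 0)"
 using assms
proof (induction k arbitrary: m)
 case 0
 have "m = 0 \<longleftrightarrow> total_degree m = 0"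
  by (simp add: total_degree_def in_keys_iff poly_mapping_eq_iff fun_eq_iff)
 then show ?case by (auto simp: multinomial_term_def)
next
 case (Suc k)
 let ?e = "%i. msingle i (1::nat)"
 let ?w = "%m i. of_int (a i) ^ mcoeff m i / fact (mcoeff m i) :: rat"
 have deg: "total_degree m = (\<Sum>i<d. mcoeff m i)"
  using Suc.prems by (intro total_degree_superset) auto
 have step: "of_int (a i) * (if mcoeff m i = 0 then 0 else
    mps_power (%m. \<Sum>i<d. of_int (a i) * mps_var i m) k (m - ?e i)) =
   (if total_degree m = Suc k then fact k * of_nat (mcoeff m i) * (\<Prod>i<d. ?w m i) else 0)"
  if i: "i < d" for i
 proof (cases "mcoeff m i = 0")
  case False
  have eq: "?e i + (m - ?e i) = m"
   using False by (intro poly_mapping_eqI) (auto simp: lookup_add lookup_minus lookup_single when_def)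
  have "total_degree (?e i + (m - ?e i)) = total_degree m" by (simp only: eq)
  then have td: "Suc (total_degree (m - ?e i)) = total_degree m" by simp
  have sub: "mkeys (m - ?e i) \<subseteq> {..<d}"
  proof
   fix x assume "x \<in> mkeys (m - ?e i)"
   then have "x \<in> mkeys m" by (simp add: in_keys_iff lookup_minus)
   with Suc.prems show "x \<in> {..<d}" by blast
  qed
  have "of_int (a i) * (\<Prod>j<d. ?w (m - ?e i) j) =
    of_nat (mcoeff m i) * (\<Prod>j<d. ?w m j)"
  proof -
   have "?w (m - ?e i) j = ?w m j" if "j \<noteq> i" for j
    using that by (simp add: lookup_minus lookup_single when_def)
   then have rest: "(\<Prod>j\<in>{..<d} - {i}. ?w (m - ?e i) j) = (\<Prod>j\<in>{..<d} - {i}. ?w m j)"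
    by (intro prod.cong) auto
   obtain l where l: "mcoeff m i = Suc l"
    using False not0_implies_Suc by blast
   then have "of_int (a i) * ?w (m - ?e i) i = of_nat (mcoeff m i) * ?w m i"
    by (simp add: lookup_minus lookup_single fact_Suc del: of_nat_Suc)
   then have "of_int (a i) * (?w (m - ?e i) i * (\<Prod>j\<in>{..<d} - {i}. ?w (m - ?e i) j)) =
     of_nat (mcoeff m i) * (?w m i * (\<Prod>j\<in>{..<d} - {i}. ?w m j))"
    unfolding rest mult.assoc[symmetric] by (rule arg_cong)
   moreover have "(\<Prod>j<d. ?w m' j) = ?w m' i * (\<Prod>j\<in>{..<d} - {i}. ?w m' j)" for m'
    using i by (intro prod.remove) auto
   ultimately show ?thesis by (simp only:)
  qed
  then have "of_int (a i) * multinomial_term d a (m - ?e i) =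
    fact (total_degree (m - ?e i)) * of_nat (mcoeff m i) * (\<Prod>i<d. ?w m i)"
   by (simp add: multinomial_term_def ac_simps)
  then show ?thesis using False td Suc.IH[OF sub] by auto
 qed simp
 have "mps_power (%m. \<Sum>i<d. of_int (a i) * mps_var i m) (Suc k) m =
   (\<Sum>i<d. if total_degree m = Suc k then fact k * of_nat (mcoeff m i) * (\<Prod>i<d. ?w m i) else 0)"
  unfolding mps_power.simps mps_mult_linear using step by (intro sum.cong) auto
 also have "\<dots> = (if total_degree m = Suc k then multinomial_term d a m else 0)"
 proof (cases "total_degree m = Suc k")
  case True
  have "(\<Sum>i<d. fact k * of_nat (mcoeff m i) * (\<Prod>i<d. ?w m i)) =
    fact k * of_nat (\<Sum>i<d. mcoeff m i) * (\<Prod>i<d. ?w m i)"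
   by (simp add: sum_distrib_left sum_distrib_right)
  also have "\<dots> = multinomial_term d a m"
   using True unfolding deg[symmetric] by (simp add: multinomial_term_def ac_simps)
  finally show ?thesis using True by simp
 qed simp
 finally show ?case .
qed

text \<open>With the logarithms invisible in the box, \<open>m\<close> occurs only in that power of
  the linear form whose exponent is the total degree of \<open>m\<close>.\<close>

lemma fgl_coeff_box:
 assumes "prime p" "n \<ge> 1" "m \<in> box (p ^ n) d"
 shows "fgl_coeff p n d a m = fps_nth (exp_series p n) (total_degree m) * multinomial_term d a m"
proof -
 have "mps_power (%m. \<Sum>i<d. of_int (a i) * mps_compose (log_series p n) (mps_var i) m) k m =
   mps_power (%m. \<Sum>i<d. of_int (a i) * mps_var i m) k m" for k
  by (rule mps_power_box_cong[OF _ assms(3)]) (simp add: mps_compose_log_var[OF assms(1,2)])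
 moreover have "mkeys m \<subseteq> {..<d}" using assms(3) by (simp add: box_def)
 ultimately have "fgl_coeff p n d a m = (\<Sum>k\<le>total_degree m. if k = total_degree m then
   fps_nth (exp_series p n) k * multinomial_term d a m else 0)"
  unfolding fgl_coeff_def mps_compose_def by (intro sum.cong) (auto simp: mps_power_linear)
 then show ?thesis by simp
qed

text \<open>The product is reduced as a whole, because the coefficient of the exponential alone can
  have \<open>p\<close> in its denominator.\<close>

definition fgl_poly :: "nat => nat => 'p::prime_card mod_ring mat => nat => 'p mod_ring mpoly" where
 "fgl_poly n d A j = truncate_mps (CARD('p) ^ n) d
   (%m. reduce_rat (fps_nth (exp_series CARD('p) n) (total_degree m) *
    multinomial_term d (%i. to_int_mod_ring (A $$ (i, j))) m))"

lemma fgl_poly_mpolys [simp]: "fgl_poly n d A j \<in> mpolys d"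
 by (simp add: fgl_poly_def)

lemma lookup_fgl_sum_series:
 fixes A :: "'p::prime_card mod_ring mat"
 assumes n: "n \<ge> 1"
 shows "mcoeff (truncate_mps (CARD('p) ^ n) d (fgl_sum_series n d A j)) m =
   msingle (int ((total_degree m - 1) div (CARD('p) ^ n - 1))) (mcoeff (fgl_poly n d A j) m)"
  and "mcoeff (fgl_poly n d A j) m \<noteq> 0 ==>
   1 \<le> total_degree m & CARD('p) ^ n - 1 dvd total_degree m - 1"
proof -
 let ?c = "fgl_coeff CARD('p) n d (%i. to_int_mod_ring (A $$ (i, j)))"
 have eq: "mcoeff (fgl_poly n d A j) m = reduce_rat (?c m)" if "m \<in> box (CARD('p) ^ n) d"
  using that fgl_coeff_box[OF prime_card[where 'a='p] n that] by (simp add: fgl_poly_def lookup_truncate)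
 have eq': "mcoeff (fgl_poly n d A j) m = 0" if "m \<notin> box (CARD('p) ^ n) d"
  using that by (simp add: fgl_poly_def lookup_truncate)
 show "mcoeff (truncate_mps (CARD('p) ^ n) d (fgl_sum_series n d A j)) m =
   msingle (int ((total_degree m - 1) div (CARD('p) ^ n - 1))) (mcoeff (fgl_poly n d A j) m)"
  using eq eq' by (cases "m \<in> box (CARD('p) ^ n) d") (simp_all add: fgl_sum_series_eq(1)[OF n] lookup_truncate)
 assume "mcoeff (fgl_poly n d A j) m \<noteq> 0"
 then have "?c m \<noteq> 0" using eq eq' by (metis reduce_rat_0)
 then show "1 \<le> total_degree m & CARD('p) ^ n - 1 dvd total_degree m - 1"
  by (rule fgl_sum_series_eq(2)[OF n])
qed

section \<open>Descent to the prime field\<close>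

text \<open>A polynomial over \<open>K(n)\<^sup>*\<close> that is homogeneous of degree \<open>r\<close>, where \<open>v\<^sub>n\<close> has degree \<open>-w\<close>, is determined
  by its reduction at \<open>v\<^sub>n = 1\<close>.\<close>

definition homogenize :: "nat => nat => 'a::comm_ring_1 mpoly => (int \<Rightarrow>\<^sub>0 'a) mpoly" where
 "homogenize w r P = (\<Sum>m\<in>mkeys P.
   msingle m (msingle ((int (total_degree m) - int r) div int w) (mcoeff P m)))"

definition homogenizable :: "nat => nat => 'a::comm_ring_1 mpoly => bool" where
 "homogenizable w r P \<longleftrightarrow> (\<forall>m\<in>mkeys P. int w dvd int (total_degree m) - int r)"

lemma lookup_homogenize:
 "mcoeff (homogenize w r P) m =
  msingle ((int (total_degree m) - int r) div int w) (mcoeff P m)"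
proof (cases "m \<in> mkeys P")
 case True
 then show ?thesis by (simp add: homogenize_def lookup_sum lookup_single when_def sum.delta)
next
 case False
 then have "mcoeff (homogenize w r P) m = 0"
  unfolding homogenize_def lookup_sum by (intro sum.neutral) (auto simp: lookup_single when_def)
 with False show ?thesis by (simp add: in_keys_iff)
qed

lemma homogenize_single:
 "homogenize w r (msingle m c) =
  msingle m (msingle ((int (total_degree m) - int r) div int w) c)"
 by (rule poly_mapping_eqI) (simp add: lookup_homogenize lookup_single when_def)

lemma homogenize_add: "homogenize w r (P + Q) = homogenize w r P + homogenize w r Q"
 by (rule poly_mapping_eqI) (simp add: lookup_homogenize lookup_add single_add)

lemma homogenize_0 [simp]: "homogenize w r 0 = 0"
 by (rule poly_mapping_eqI) (simp add: lookup_homogenize)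

lemma mcong_homogenize: "mcong q d P Q ==> mcong q d (homogenize w r P) (homogenize w r Q)"
 by (simp add: mcong_def lookup_homogenize)

lemma mpolys_homogenize: "P \<in> mpolys d ==> homogenize w r P \<in> mpolys d"
 by (auto simp: mpolys_def in_keys_iff lookup_homogenize)

lemma homogenize_mult:
 assumes "homogenizable w r P" "homogenizable w s Q"
 shows "homogenize w r P * homogenize w s Q = homogenize w (r + s) (P * Q)"
proof (induction P rule: poly_mapping_sum_induct)
 case m: (single m c)
 show ?case
 proof (induction Q rule: poly_mapping_sum_induct)
  case m': (single m' c')
  have dvd: "int w dvd int (total_degree m) - int r" "int w dvd int (total_degree m') - int s"
   using assms m m' by (auto simp: homogenizable_def)
  have "int (total_degree (m + m')) - int (r + s) = (int (total_degree m) - int r) + (int (total_degree m') - int s)"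
   by simp
  then have "(int (total_degree (m + m')) - int (r + s)) div int w =
    (int (total_degree m) - int r) div int w + (int (total_degree m') - int s) div int w"
   using div_plus_div_distrib_dvd_left[OF dvd(1)] by metis
  then show ?case by (simp only: homogenize_single mult_single)
 qed (simp_all add: ring_distribs homogenize_add)
qed (simp_all add: ring_distribs homogenize_add)

lemma homogenizable_mult:
 assumes "homogenizable w r P" "homogenizable w s Q"
 shows "homogenizable w (r + s) (P * Q)"
 unfolding homogenizable_def
proof
 fix k assume "k \<in> mkeys (P * Q)"
 then obtain a b where "a \<in> mkeys P" "b \<in> mkeys Q" "k = a + b"
  using keys_mult[of P Q] by auto
 then have "int w dvd (int (total_degree a) - int r) + (int (total_degree b) - int s)"
  using assms by (auto simp: homogenizable_def)
 then show "int w dvd int (total_degree k) - int (r + s)"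
  unfolding \<open>k = a + b\<close> by (simp add: algebra_simps)
qed

lemma homogenize_1: "homogenize w 0 1 = 1" "homogenizable w 0 1"
 using homogenize_single[of w 0 0 1] by (simp_all add: homogenizable_def)

lemma homogenize_power:
 assumes "homogenizable w r P"
 shows "homogenize w r P ^ k = homogenize w (k * r) (P ^ k) & homogenizable w (k * r) (P ^ k)"
proof (induction k)
 case 0
 then show ?case by (simp add: homogenize_1)
next
 case (Suc k)
 then show ?case using assms
  unfolding mult_Suc power_Suc by (simp only: homogenize_mult homogenizable_mult)
qed

lemma homogenize_prod:
 assumes "!!i. i \<in> A ==> homogenizable w (r i) (P i)"
 shows "(\<Prod>i\<in>A. homogenize w (r i) (P i)) = homogenize w (sum r A) (prod P A) &
  homogenizable w (sum r A) (prod P A)"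
 using assms
proof (induction A rule: infinite_finite_induct)
 case (insert x A)
 then have "homogenizable w (r x) (P x)" "homogenizable w (sum r A) (prod P A)"
  "(\<Prod>i\<in>A. homogenize w (r i) (P i)) = homogenize w (sum r A) (prod P A)" by simp_all
 with insert.hyps show ?case by (simp add: homogenize_mult homogenizable_mult)
qed (simp_all add: homogenize_1)

lemma homogenize_mon_eval:
 assumes "!!j. homogenizable w 1 (F j)"
 shows "mon_eval (%j. homogenize w 1 (F j)) m = homogenize w (total_degree m) (mon_eval F m)"
  and "homogenizable w (total_degree m) (mon_eval F m)"
proof -
 have *: "homogenize w 1 (F j) ^ k = homogenize w k (F j ^ k) & homogenizable w k (F j ^ k)" for j k
  using homogenize_power[OF assms[of j], of k] by simp
 show "mon_eval (%j. homogenize w 1 (F j)) m = homogenize w (total_degree m) (mon_eval F m)"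
  "homogenizable w (total_degree m) (mon_eval F m)"
  using homogenize_prod[of "mkeys m" w "mcoeff m" "%j. F j ^ mcoeff m j"] *
  by (simp_all add: mon_eval_def total_degree_def)
qed

lemma lookup_const_mult: "mcoeff (mpoly_const c * P) m = c * mcoeff P m"
proof (induction P rule: poly_mapping_sum_induct)
 case (single m' c')
 then show ?case by (simp add: mpoly_const_def mult_single lookup_single when_def)
qed (simp_all add: lookup_add ring_distribs)

text \<open>The degrees of the monomials being arbitrary, the exponent is now rounded.\<close>

lemma mpoly_subst_homogenize:
 assumes "!!j. homogenizable w 1 (F j)"
 shows "mpoly_subst (%j. homogenize w 1 (F j)) (homogenize w 0 P) = homogenize w 0 (mpoly_subst F P)"
proof (induction P rule: poly_mapping_sum_induct)
 case (single m c)
 show ?case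
 proof (rule poly_mapping_eqI)
  fix k
  let ?x = "mcoeff (mon_eval F m) k"
  \<comment> \<open>The quotient of the first summand is rounded, but the second division is exact
    whenever the coefficient \<open>?x\<close> is nonzero, and this suffices for additivity.\<close>
  have "msingle (int (total_degree m) div int w + (int (total_degree k) - int (total_degree m)) div int w) (c * ?x) =
   msingle (int (total_degree k) div int w) (c * ?x)"
  proof (cases "?x = 0")
   case False
   then have "int w dvd int (total_degree k) - int (total_degree m)"
    using homogenize_mon_eval(2)[OF assms, of m] by (simp add: homogenizable_def in_keys_iff)
   from div_plus_div_distrib_dvd_right[OF this, of "int (total_degree m)"] show ?thesis by simp
  qed simp
  then show "mcoeff (mpoly_subst (%j. homogenize w 1 (F j)) (homogenize w 0 (msingle m c))) k =
    mcoeff (homogenize w 0 (mpoly_subst F (msingle m c))) k"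
   unfolding homogenize_single mpoly_subst_single lookup_const_mult lookup_homogenize
    homogenize_mon_eval(1)[OF assms] mult_single by simp
 qed
qed (simp_all add: homogenize_add mpoly_subst_add)

text \<open>The truncated series of the definition is recovered from its value at
  \<open>v = 1\<close>, so that from here on only \<open>fgl_poly\<close> over the prime field has
  to be studied.\<close>

lemma fgl_sum_series_homogenize:
 fixes A :: "'p::prime_card mod_ring mat"
 assumes n: "n \<ge> 1"
 shows "truncate_mps (CARD('p) ^ n) d (fgl_sum_series n d A j) = homogenize (CARD('p) ^ n - 1) 1 (fgl_poly n d A j)"
  and "homogenizable (CARD('p) ^ n - 1) 1 (fgl_poly n d A j)"
proof -
 let ?w = "CARD('p) ^ n - 1"
 show "truncate_mps (CARD('p) ^ n) d (fgl_sum_series n d A j) = homogenize ?w 1 (fgl_poly n d A j)"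
 proof (rule poly_mapping_eqI)
  fix m
  have "int ((total_degree m - 1) div ?w) = (int (total_degree m) - int 1) div int ?w"
   if "mcoeff (fgl_poly n d A j) m \<noteq> 0"
   using lookup_fgl_sum_series(2)[OF n that] by (simp add: zdiv_int of_nat_diff)
  then show "mcoeff (truncate_mps (CARD('p) ^ n) d (fgl_sum_series n d A j)) m =
   mcoeff (homogenize ?w 1 (fgl_poly n d A j)) m"
   unfolding lookup_fgl_sum_series(1)[OF n] lookup_homogenize by (metis single_zero)
 qed
 show "homogenizable ?w 1 (fgl_poly n d A j)"
  unfolding homogenizable_def
 proof
  fix m assume "m \<in> mkeys (fgl_poly n d A j)"
  then have "1 \<le> total_degree m" "?w dvd total_degree m - 1"
   using lookup_fgl_sum_series(2)[OF n, of d A j m] by (auto simp: in_keys_iff)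
  then show "int ?w dvd int (total_degree m) - int 1"
   by (metis of_nat_diff of_nat_dvd_iff)
 qed
qed

text \<open>The weight condition excludes a constant term, so \<open>mcong_power_0\<close> applies
  both over the prime field and over the Laurent polynomials, which have the same
  characteristic.\<close>

lemma fgl_poly_power_0:
 fixes A :: "'p::prime_card mod_ring mat"
 assumes n: "n \<ge> 1"
 shows "mcong (CARD('p) ^ n) d (fgl_poly n d A j ^ (CARD('p) ^ n)) 0"
  and "mcong (CARD('p) ^ n) d (truncate_mps (CARD('p) ^ n) d (fgl_sum_series n d A j) ^ (CARD('p) ^ n)) 0"
proof -
 have *: "mcoeff (fgl_poly n d A j) 0 = 0"
  using lookup_fgl_sum_series(2)[OF n, of d A j 0] by auto
 with prime_card[where 'a='p] show "mcong (CARD('p) ^ n) d (fgl_poly n d A j ^ (CARD('p) ^ n)) 0"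
  using mcong_power_0[of "fgl_poly n d A j" n d] by simp
 have "mcoeff (truncate_mps (CARD('p) ^ n) d (fgl_sum_series n d A j)) 0 = 0"
  unfolding fgl_sum_series_homogenize(1)[OF n] using * by (simp add: lookup_homogenize)
 with prime_card[where 'a='p]
 show "mcong (CARD('p) ^ n) d (truncate_mps (CARD('p) ^ n) d (fgl_sum_series n d A j) ^ (CARD('p) ^ n)) 0"
  using mcong_power_0[of "truncate_mps (CARD('p) ^ n) d (fgl_sum_series n d A j)" n d]
  by (simp add: CHAR_poly_mapping)
qed

subsection \<open>Bases\<close>

lemma card_box_polys: "card (box_polys q d :: 'a::{finite,comm_ring_1} mpoly set) = CARD('a) ^ card (box q d)"
proof -
 have "bij_betw (%P. \<lambda>m\<in>box q d. mcoeff P m) (box_polys q d) (PiE (box q d) (%_. UNIV :: 'a set))"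
 proof (rule bij_betwI[where g = "truncate_mps q d"])
  show "truncate_mps q d \<in> PiE (box q d) (%_. UNIV) \<rightarrow> (box_polys q d :: 'a mpoly set)"
   by (rule funcsetI) (rule truncate_mem_box_polys)
 next
  fix P :: "'a mpoly" assume "P \<in> box_polys q d"
  then show "truncate_mps q d (\<lambda>m\<in>box q d. mcoeff P m) = P"
   by (intro poly_mapping_eqI) (auto simp: lookup_truncate box_polys_def in_keys_iff)
 next
  fix f assume "f \<in> PiE (box q d) (%_. UNIV :: 'a set)"
  then show "(\<lambda>m\<in>box q d. mcoeff (truncate_mps q d f) m) = f"
   by (intro ext) (simp add: lookup_truncate PiE_iff extensional_def)
 qed (rule funcsetI, simp)
 then show ?thesis by (simp add: bij_betw_same_card card_PiE)
qed

text \<open>Spanning gives the coefficient matrix a one-sided inverse. Over a finite ring,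
  multiplication by the matrix is then a surjection between sets of equal size, hence injective, and
  the inverse is two-sided.\<close>

lemma dual_matrix_exists:
 fixes f :: "'s => 'a::{finite,comm_ring_1} mpoly"
 assumes S: "finite S" "card S = card (box q d)"
  and f: "!!s. s \<in> S ==> f s \<in> box_polys q d"
  and span: "!!m. m \<in> box q d ==> \<exists>c. mcong q d (msingle m 1) (\<Sum>s\<in>S. mpoly_const (c s) * f s)"
 obtains C where
  "!!m k. m \<in> box q d ==> k \<in> box q d ==> (\<Sum>s\<in>S. C m s * mcoeff (f s) k) = (if m = k then 1 else 0)"
  "!!s t. s \<in> S ==> t \<in> S ==> (\<Sum>m\<in>box q d. mcoeff (f s) m * C m t) = (if s = t then 1 else 0)"
proof -
 from span obtain C where C: "mcong q d (msingle m 1) (\<Sum>s\<in>S. mpoly_const (C m s) * f s)"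
  if "m \<in> box q d" for m by metis
 have CD: "(\<Sum>s\<in>S. C m s * mcoeff (f s) k) = (if m = k then 1 else 0)"
  if "m \<in> box q d" "k \<in> box q d" for m k
  using C[OF that(1)] that(2) by (simp add: mcong_def lookup_sum lookup_const_mult lookup_single when_def)
 define L where "L c = (\<lambda>k\<in>box q d. \<Sum>s\<in>S. c s * mcoeff (f s) k)" for c
 have "L ` (S \<rightarrow>\<^sub>E UNIV) = (box q d \<rightarrow>\<^sub>E UNIV)"
 proof
  show "L ` (S \<rightarrow>\<^sub>E UNIV) \<subseteq> (box q d \<rightarrow>\<^sub>E UNIV)" by (rule image_subsetI) (simp add: L_def)
  show "(box q d \<rightarrow>\<^sub>E UNIV) \<subseteq> L ` (S \<rightarrow>\<^sub>E UNIV)"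
  proof
   fix g assume g: "g \<in> (box q d \<rightarrow>\<^sub>E (UNIV :: 'a set))"
   have "(\<Sum>s\<in>S. (\<Sum>m\<in>box q d. g m * C m s) * mcoeff (f s) k) = g k" if k: "k \<in> box q d" for k
   proof -
    have "(\<Sum>s\<in>S. (\<Sum>m\<in>box q d. g m * C m s) * mcoeff (f s) k) =
     (\<Sum>m\<in>box q d. g m * (\<Sum>s\<in>S. C m s * mcoeff (f s) k))"
     unfolding sum_distrib_right sum_distrib_left by (subst sum.swap) (simp add: mult.assoc)
    also have "\<dots> = (\<Sum>m\<in>box q d. if m = k then g m else 0)"
     using CD[OF _ k] by (intro sum.cong) auto
    finally show ?thesis using k by simp
   qed
   then have eq: "L (\<lambda>s\<in>S. \<Sum>m\<in>box q d. g m * C m s) = g"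
    using g by (intro ext) (simp add: L_def PiE_iff extensional_def)
   show "g \<in> L ` (S \<rightarrow>\<^sub>E UNIV)"
    by (rule image_eqI, rule eq[symmetric]) (simp add: restrict_PiE_iff)
  qed
 qed
 moreover have "card (S \<rightarrow>\<^sub>E (UNIV :: 'a set)) = card (box q d \<rightarrow>\<^sub>E (UNIV :: 'a set))"
  using S by (simp add: card_PiE)
 moreover have "finite (S \<rightarrow>\<^sub>E (UNIV :: 'a set))" using S by (simp add: finite_PiE)
 ultimately have inj: "inj_on L (S \<rightarrow>\<^sub>E UNIV)" by (intro eq_card_imp_inj_on) simp_all
 have DC: "(\<Sum>m\<in>box q d. mcoeff (f s) m * C m t) = (if s = t then 1 else 0)"
  if s: "s \<in> S" "t \<in> S" for s t
 proof -
  \<comment> \<open>Row \<open>s\<close> of the product in question and row \<open>s\<close> of the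
    identity matrix have the same image under the injective map \<open>L\<close>.\<close>
  have "L (\<lambda>t\<in>S. \<Sum>m\<in>box q d. mcoeff (f s) m * C m t) = L (\<lambda>t\<in>S. if s = t then 1 else 0)"
  proof -
   have "(\<Sum>t\<in>S. (\<Sum>m\<in>box q d. mcoeff (f s) m * C m t) * mcoeff (f t) k) =
     (\<Sum>t\<in>S. (if s = t then 1 else 0) * mcoeff (f t) k)" if k: "k \<in> box q d" for k
   proof -
    have "(\<Sum>t\<in>S. (\<Sum>m\<in>box q d. mcoeff (f s) m * C m t) * mcoeff (f t) k) =
     (\<Sum>m\<in>box q d. mcoeff (f s) m * (\<Sum>t\<in>S. C m t * mcoeff (f t) k))"
     unfolding sum_distrib_right sum_distrib_left by (subst sum.swap) (simp add: mult.assoc)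
    also have "\<dots> = (\<Sum>m\<in>box q d. if m = k then mcoeff (f s) m else 0)"
     using CD[OF _ k] by (intro sum.cong) auto
    also have "\<dots> = mcoeff (f s) k" using k by simp
    also have "\<dots> = (\<Sum>t\<in>S. if t = s then mcoeff (f t) k else 0)"
     using s S by simp
    also have "\<dots> = (\<Sum>t\<in>S. (if s = t then 1 else 0) * mcoeff (f t) k)"
     by (intro sum.cong) auto
    finally show ?thesis .
   qed
   then show ?thesis by (intro ext) (simp add: L_def)
  qed
  then have "(\<lambda>t\<in>S. \<Sum>m\<in>box q d. mcoeff (f s) m * C m t) = (\<lambda>t\<in>S. if s = t then 1 else 0)"
   by (rule inj_onD[OF inj]) (simp_all add: PiE_iff)
  from fun_cong[OF this, of t] s show ?thesis by simp
 qed
 show ?thesis using CD DC by (rule that)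
qed

text \<open>Rescaling the two mutually inverse matrices by powers of \<open>v\<^sub>n\<close> gives mutually inverse matrices over
  the Laurent polynomials.\<close>

lemma homogenized_basis:
 fixes f :: "'s => 'a::{finite,comm_ring_1} mpoly"
 assumes S: "finite S" "card S = card (box q d)"
  and f: "!!s. s \<in> S ==> f s \<in> box_polys q d"
  and span: "!!m. m \<in> box q d ==> \<exists>c. mcong q d (msingle m 1) (\<Sum>s\<in>S. mpoly_const (c s) * f s)"
 shows "\<exists>c. mcong q d P (\<Sum>s\<in>S. mpoly_const (c s) * homogenize w 0 (f s))"
  and "mcong q d (\<Sum>s\<in>S. mpoly_const (b s) * homogenize w 0 (f s))
      (\<Sum>s\<in>S. mpoly_const (c s) * homogenize w 0 (f s)) ==> s \<in> S ==> b s = c s"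
proof -
 obtain C where
  CD: "!!m k. m \<in> box q d ==> k \<in> box q d ==> (\<Sum>s\<in>S. C m s * mcoeff (f s) k) = (if m = k then 1 else 0)"
  and DC: "!!s t. s \<in> S ==> t \<in> S ==> (\<Sum>m\<in>box q d. mcoeff (f s) m * C m t) = (if s = t then 1 else 0)"
  using dual_matrix_exists[OF assms] by blast
 define e where "e m = int (total_degree m) div int w" for m
 define D' where "D' s m = msingle (e m) (mcoeff (f s) m)" for s m
 define C' where "C' m s = msingle (- e m) (C m s)" for s m
 have single_sum: "msingle k (\<Sum>i\<in>A. g i) = (\<Sum>i\<in>A. msingle k (g i))"
  for k :: int and g :: "'x => 'a" and A by (induction A rule: infinite_finite_induct) (simp_all add: single_add)
 have CD': "(\<Sum>s\<in>S. C' m s * D' s k) = (if m = k then 1 else 0)" if "m \<in> box q d" "k \<in> box q d" for m k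
 proof -
  have "(\<Sum>s\<in>S. C' m s * D' s k) = msingle (- e m + e k) (\<Sum>s\<in>S. C m s * mcoeff (f s) k)"
   unfolding single_sum by (simp add: C'_def D'_def mult_single)
  with CD[OF that] show ?thesis by auto
 qed
 have DC': "(\<Sum>m\<in>box q d. D' s m * C' m t) = (if s = t then 1 else 0)" if "s \<in> S" "t \<in> S" for s t
 proof -
  have "(\<Sum>m\<in>box q d. D' s m * C' m t) = msingle 0 (\<Sum>m\<in>box q d. mcoeff (f s) m * C m t)"
   unfolding single_sum by (simp add: C'_def D'_def mult_single)
  with DC[OF that] show ?thesis by auto
 qed
 have lk: "mcoeff (\<Sum>s\<in>S. mpoly_const (c s) * homogenize w 0 (f s)) k = (\<Sum>s\<in>S. c s * D' s k)" for c k
  by (simp add: lookup_sum lookup_const_mult lookup_homogenize D'_def e_def)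
 show "\<exists>c. mcong q d P (\<Sum>s\<in>S. mpoly_const (c s) * homogenize w 0 (f s))"
 proof (intro exI[of _ "%s. \<Sum>m\<in>box q d. mcoeff P m * C' m s"])
  have "(\<Sum>s\<in>S. (\<Sum>m\<in>box q d. mcoeff P m * C' m s) * D' s k) = mcoeff P k"
   if k: "k \<in> box q d" for k
  proof -
   have "(\<Sum>s\<in>S. (\<Sum>m\<in>box q d. mcoeff P m * C' m s) * D' s k) =
    (\<Sum>m\<in>box q d. mcoeff P m * (\<Sum>s\<in>S. C' m s * D' s k))"
    unfolding sum_distrib_right sum_distrib_left by (subst sum.swap) (simp add: mult.assoc)
   also have "\<dots> = (\<Sum>m\<in>box q d. if m = k then mcoeff P m else 0)"
    using CD'[OF _ k] by (intro sum.cong) auto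
   finally show ?thesis using k by simp
  qed
  then show "mcong q d P (\<Sum>s\<in>S. mpoly_const (\<Sum>m\<in>box q d. mcoeff P m * C' m s) * homogenize w 0 (f s))"
   by (simp add: mcong_def lk)
 qed
 assume eq: "mcong q d (\<Sum>s\<in>S. mpoly_const (b s) * homogenize w 0 (f s))
      (\<Sum>s\<in>S. mpoly_const (c s) * homogenize w 0 (f s))" and s: "s \<in> S"
 have recover: "(\<Sum>k\<in>box q d. (\<Sum>t\<in>S. c t * D' t k) * C' k s) = c s" for c
 proof -
  have "(\<Sum>k\<in>box q d. (\<Sum>t\<in>S. c t * D' t k) * C' k s) = (\<Sum>t\<in>S. c t * (\<Sum>k\<in>box q d. D' t k * C' k s))"
   unfolding sum_distrib_right sum_distrib_left by (subst sum.swap) (simp add: mult.assoc)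
  also have "\<dots> = (\<Sum>t\<in>S. if t = s then c t else 0)"
   using DC'[OF _ s] by (intro sum.cong) auto
  finally show ?thesis using s S by simp
 qed
 have "(\<Sum>t\<in>S. b t * D' t k) = (\<Sum>t\<in>S. c t * D' t k)" if "k \<in> box q d" for k
  using eq that by (simp add: mcong_def lk)
 then have "(\<Sum>k\<in>box q d. (\<Sum>t\<in>S. b t * D' t k) * C' k s) = (\<Sum>k\<in>box q d. (\<Sum>t\<in>S. c t * D' t k) * C' k s)"
  by (intro sum.cong) auto
 then show "b s = c s" by (simp only: recover)
qed

section \<open>The modules as explicit sets\<close>

lemma mpoly_ring_simps [simp]:
 "carrier (mpoly_ring d) = mpolys d"
 "x \<oplus>\<^bsub>mpoly_ring d\<^esub> y = x + y" "x \<otimes>\<^bsub>mpoly_ring d\<^esub> y = x * y"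
 "\<zero>\<^bsub>mpoly_ring d\<^esub> = 0" "\<one>\<^bsub>mpoly_ring d\<^esub> = 1"
 by (simp_all add: mpoly_ring_def mpolys_def)

lemma cring_mpoly_ring: "cring (mpoly_ring d :: 'a::comm_ring_1 mpoly ring)"
proof (rule cringI)
 show "abelian_group (mpoly_ring d :: 'a mpoly ring)"
 proof (rule abelian_groupI)
  fix x :: "'a mpoly" assume "x \<in> carrier (mpoly_ring d)"
  then show "\<exists>y\<in>carrier (mpoly_ring d). y \<oplus>\<^bsub>mpoly_ring d\<^esub> x = \<zero>\<^bsub>mpoly_ring d\<^esub>"
   by (intro bexI[of _ "- x"]) (simp_all add: mpolys_uminus)
 qed (simp_all add: mpolys_add add_ac)
 show "Group.comm_monoid (mpoly_ring d :: 'a mpoly ring)"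
  by (rule comm_monoidI) (simp_all add: mpolys_mult mult_ac)
qed (simp add: ring_distribs)

lemma a_inv_mpoly_ring:
 assumes "x \<in> mpolys d"
 shows "\<ominus>\<^bsub>mpoly_ring d\<^esub> x = - x"
proof -
 interpret cring "mpoly_ring d :: 'a mpoly ring" by (rule cring_mpoly_ring)
 show ?thesis
  by (rule minus_equality) (simp_all add: assms mpolys_uminus)
qed

definition null_polys :: "nat => nat => 'a::comm_ring_1 mpoly set" where
 "null_polys q d = {P \<in> mpolys d. mcong q d P 0}"

lemma ideal_null_polys: "ideal (null_polys q d :: 'a::comm_ring_1 mpoly set) (mpoly_ring d)"
proof (rule idealI)
 show "ring (mpoly_ring d :: 'a mpoly ring)" using cring_mpoly_ring cring.axioms(1) by blast
 show "subgroup (null_polys q d :: 'a mpoly set) (add_monoid (mpoly_ring d))"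
 proof (rule subgroup.intro)
  fix x :: "'a mpoly" assume x: "x \<in> null_polys q d"
  then have "inv\<^bsub>add_monoid (mpoly_ring d)\<^esub> x = - x"
   using a_inv_mpoly_ring[of x d] by (simp add: a_inv_def null_polys_def)
  then show "inv\<^bsub>add_monoid (mpoly_ring d)\<^esub> x \<in> null_polys q d"
   using x mcong_uminus[of q d x 0] by (simp add: null_polys_def mpolys_uminus)
 next
  fix x y :: "'a mpoly" assume "x \<in> null_polys q d" "y \<in> null_polys q d"
  then show "x \<otimes>\<^bsub>add_monoid (mpoly_ring d)\<^esub> y \<in> null_polys q d"
   using mcong_add[of q d x 0 y 0] by (simp add: null_polys_def mpolys_add)
 qed (auto simp: null_polys_def)
next
 fix a x :: "'a mpoly" assume *: "a \<in> null_polys q d" "x \<in> carrier (mpoly_ring d)"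
 then have "mcong q d (x * a) (x * 0)"
  by (intro mcong_mult mcong_refl) (simp add: null_polys_def)
 with * show "x \<otimes>\<^bsub>mpoly_ring d\<^esub> a \<in> null_polys q d" "a \<otimes>\<^bsub>mpoly_ring d\<^esub> x \<in> null_polys q d"
  by (simp_all add: null_polys_def mpolys_mult mult.commute)
qed

text \<open>A monomial outside the box is a multiple of some \<open>x_i^q\<close>, hence lies in
  every ideal containing these powers.\<close>

lemma null_polys_subset_ideal:
 assumes I: "ideal I (mpoly_ring d :: 'a::comm_ring_1 mpoly ring)"
  and gen: "!!i. i < d ==> msingle (msingle i q) 1 \<in> I"
 shows "null_polys q d \<subseteq> I"
proof
 interpret ideal I "mpoly_ring d" by (rule I)
 fix P :: "'a mpoly" assume P: "P \<in> null_polys q d"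
 have trm: "msingle m (mcoeff P m) \<in> I" if m: "m \<in> mkeys P" for m
 proof -
  from m P have sub: "mkeys m \<subseteq> {..<d}" and "m \<notin> box q d"
   by (auto simp: null_polys_def mpolys_def mcong_def in_keys_iff)
  then obtain i where i: "i < d" "q \<le> mcoeff m i"
   by (auto simp: box_def not_less)
  let ?e = "msingle i q"
  have eq: "(m - ?e) + ?e = m"
   using i by (intro poly_mapping_eqI) (auto simp: lookup_add lookup_minus lookup_single when_def)
  have "mkeys (m - ?e) \<subseteq> {..<d}"
  proof
   fix x assume "x \<in> mkeys (m - ?e)"
   then have "x \<in> mkeys m" by (simp add: in_keys_iff lookup_minus)
   with sub show "x \<in> {..<d}" by blast
  qed
  then have "msingle (m - ?e) (mcoeff P m) \<in> carrier (mpoly_ring d)"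
   by (auto simp: mpolys_def split: if_splits)
  from I_l_closed[OF gen[OF i(1)] this] show ?thesis by (simp add: mult_single eq)
 qed
 have "(\<Sum>m\<in>A. msingle m (mcoeff P m)) \<in> I"
  if "finite A" "A \<subseteq> mkeys P" for A
  using that
 proof (induction A rule: finite_induct)
  case empty
  then show ?case using additive_subgroup.zero_closed[OF ideal.axioms(1)[OF I]] by simp
 next
  case (insert x A)
  then have "msingle x (mcoeff P x) \<oplus>\<^bsub>mpoly_ring d\<^esub>
    (\<Sum>m\<in>A. msingle m (mcoeff P m)) \<in> I"
   by (intro additive_subgroup.a_closed[OF ideal.axioms(1)[OF I]] trm) auto
  with insert show ?case by simp
 qed
 from this[of "mkeys P"] show "P \<in> I"
  using poly_mapping_eq_sum_single[of "mkeys P" P] by simp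
qed

lemma KBV_ideal_eq: "(KBV_ideal n d :: 'p::prime_card morava mpoly set) = null_polys (CARD('p) ^ n) d"
proof
 let ?R = "mpoly_ring d :: 'p morava mpoly ring"
 let ?gens = "(%i. msingle (msingle i (CARD('p) ^ n)) 1) ` {..<d} :: 'p morava mpoly set"
 interpret cring ?R by (rule cring_mpoly_ring)
 have sub: "?gens \<subseteq> carrier ?R"
  using prime_card[where 'a='p] prime_gt_0_nat by (auto simp: mpolys_def split: if_splits)
 have "?gens \<subseteq> null_polys (CARD('p) ^ n) d"
 proof
  fix x assume "x \<in> ?gens"
  then obtain i where i: "i < d" "x = msingle (msingle i (CARD('p) ^ n)) 1" by blast
  then have "msingle i (CARD('p) ^ n) \<notin> box (CARD('p) ^ n) d"
   by (auto simp: box_def)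
  then have "mcong (CARD('p) ^ n) d x 0"
   by (auto simp: mcong_def i lookup_single when_def)
  with sub \<open>x \<in> ?gens\<close> show "x \<in> null_polys (CARD('p) ^ n) d" by (auto simp: null_polys_def)
 qed
 then show "(KBV_ideal n d :: 'p morava mpoly set) \<subseteq> null_polys (CARD('p) ^ n) d"
  unfolding KBV_ideal_def by (rule genideal_minimal[OF ideal_null_polys])
 show "null_polys (CARD('p) ^ n) d \<subseteq> (KBV_ideal n d :: 'p morava mpoly set)"
  unfolding KBV_ideal_def
  by (rule null_polys_subset_ideal[OF genideal_ideal[OF sub]]) (use genideal_self[OF sub] in blast)
qed

definition coset :: "nat => nat => 'a::comm_ring_1 mpoly => 'a mpoly set" where
 "coset q d P = {Q \<in> mpolys d. mcong q d Q P}"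

lemma coset_eq_iff: "P \<in> mpolys d ==> Q \<in> mpolys d ==> coset q d P = coset q d Q \<longleftrightarrow> mcong q d P Q"
 by (auto simp: coset_def mcong_def)

lemma a_r_coset_null_polys:
 fixes P :: "'a::comm_ring_1 mpoly"
 assumes "P \<in> mpolys d"
 shows "null_polys q d +>\<^bsub>mpoly_ring d\<^esub> P = coset q d P"
 unfolding a_r_coset_def'
proof safe
 fix h :: "'a mpoly" assume "h \<in> null_polys q d"
 then show "h \<oplus>\<^bsub>mpoly_ring d\<^esub> P \<in> coset q d P"
  using assms mcong_add[of q d h 0 P P] by (simp add: null_polys_def coset_def mpolys_add)
next
 fix Q assume Q: "Q \<in> coset q d P"
 then have "Q - P \<in> null_polys q d"
  using assms by (auto simp: coset_def null_polys_def mpolys_diff mcong_def lookup_minus)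
 then show "Q \<in> (\<Union>h\<in>null_polys q d. {h \<oplus>\<^bsub>mpoly_ring d\<^esub> P})"
  by (intro UN_I[of "Q - P"]) simp_all
qed

context
 fixes n d q :: nat and K :: "('p::prime_card morava, 'p morava mpoly set) module"
 assumes q: "q = CARD('p) ^ n" and K: "K = KBV n d"
begin

lemma carrier_KBV: "carrier K = coset q d ` mpolys d"
 unfolding K KBV_def KBV_ring_def FactRing_def A_RCOSETS_def' KBV_ideal_eq q[symmetric]
 by (auto simp: ring.defs a_r_coset_null_polys)

lemma add_KBV:
 assumes "P \<in> mpolys d" "Q \<in> mpolys d"
 shows "coset q d P \<oplus>\<^bsub>K\<^esub> coset q d Q = coset q d (P + Q)"
proof -
 interpret ideal "null_polys q d :: 'p morava mpoly set" "mpoly_ring d" by (rule ideal_null_polys)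
 have "coset q d P \<oplus>\<^bsub>K\<^esub> coset q d Q = coset q d P <+>\<^bsub>mpoly_ring d\<^esub> coset q d Q"
  by (simp add: K KBV_def KBV_ring_def FactRing_def ring.defs)
 then show ?thesis
  using a_rcos_sum[of P Q] assms by (simp add: a_r_coset_null_polys mpolys_add)
qed

lemma smult_KBV:
 assumes "P \<in> mpolys d"
 shows "c \<odot>\<^bsub>K\<^esub> coset q d P = coset q d (mpoly_const c * P)"
proof -
 interpret ideal "null_polys q d :: 'p morava mpoly set" "mpoly_ring d" by (rule ideal_null_polys)
 have "c \<odot>\<^bsub>K\<^esub> coset q d P = rcoset_mult (mpoly_ring d) (null_polys q d) (coset q d (mpoly_const c)) (coset q d P)"
  by (simp add: K KBV_def KBV_ring_def FactRing_def ring.defs KBV_ideal_eq q a_r_coset_null_polys)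
 then show ?thesis
  using rcoset_mult_add[of "mpoly_const c" P] assms by (simp add: a_r_coset_null_polys mpolys_mult)
qed

text \<open>The definition unites the cosets obtained from all representatives; they coincide
  because the substituted series have vanishing \<open>q\<close>-th powers.\<close>

lemma KBV_act_coset:
 fixes A :: "'p mod_ring mat"
 assumes n: "n \<ge> 1" and P: "P \<in> mpolys d"
 shows "KBV_act n d A (coset q d P) =
  coset q d (mpoly_subst (%j. truncate_mps q d (fgl_sum_series n d A j)) P)"
proof -
 let ?F = "%j. truncate_mps q d (fgl_sum_series n d A j)"
 have "null_polys q d +>\<^bsub>mpoly_ring d\<^esub> mpoly_subst ?F Q = coset q d (mpoly_subst ?F P)"
  if Q: "Q \<in> coset q d P" for Q
 proof -
  have "mcong q d (mpoly_subst ?F Q) (mpoly_subst ?F P)"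
   using Q P fgl_poly_power_0(2)[OF n, of d A] unfolding q coset_def
   by (intro mcong_subst_arg) auto
  moreover have "Q \<in> mpolys d" using Q by (simp add: coset_def)
  ultimately show ?thesis
   using P by (simp add: a_r_coset_null_polys coset_eq_iff mpolys_subst)
 qed
 moreover have "P \<in> coset q d P" using P by (simp add: coset_def)
 ultimately show ?thesis
  unfolding KBV_act_def KBV_ideal_eq q[symmetric] by blast
qed

end

subsection \<open>Linear maps and matrices\<close>

definition mat_map :: "nat => 'a::field mat => 'a vec => 'a vec" where
 "mat_map d \<Phi> = (\<lambda>v\<in>carrier_vec d. row_mult v \<Phi>)"

lemma mat_map_mem_lin_maps: "\<Phi> \<in> carrier_mat d n ==> mat_map d \<Phi> \<in> lin_maps d n"
 by (auto simp: lin_maps_def mat_map_def row_mult_def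
   mult_add_distrib_mat_vec[of _ n d] mult_mat_vec[of _ n d])

lemma mat_map_unit_vec:
 "\<Phi> \<in> carrier_mat d n ==> i < d ==> j < n ==> mat_map d \<Phi> (unit_vec d i) $ j = \<Phi> $$ (i, j)"
 by (simp add: mat_map_def row_mult_def)

lemma inj_on_mat_map: "inj_on (mat_map d) (carrier_mat d n)"
proof (rule inj_onI)
 fix \<Phi> \<Psi> :: "'a mat"
 assume *: "\<Phi> \<in> carrier_mat d n" "\<Psi> \<in> carrier_mat d n" "mat_map d \<Phi> = mat_map d \<Psi>"
 show "\<Phi> = \<Psi>"
 proof (rule eq_matI)
  fix i j assume "i < dim_row \<Psi>" "j < dim_col \<Psi>"
  then show "\<Phi> $$ (i, j) = \<Psi> $$ (i, j)"
   using * mat_map_unit_vec[of \<Phi> d n i j] mat_map_unit_vec[of \<Psi> d n i j] by simp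
 qed (use * in auto)
qed

text \<open>Only binary additivity is available, so the vector is built up one coordinate at a
  time.\<close>

lemma lin_maps_eqI:
 assumes \<phi>: "\<phi> \<in> lin_maps d n" "\<psi> \<in> lin_maps d n"
  and eq: "!!i. i < d ==> \<phi> (unit_vec d i) = \<psi> (unit_vec d i)"
 shows "\<phi> = (\<psi> :: 'a::field vec => 'a vec)"
proof (rule PiE_ext)
 show "\<phi> \<in> carrier_vec d \<rightarrow>\<^sub>E carrier_vec n" "\<psi> \<in> carrier_vec d \<rightarrow>\<^sub>E carrier_vec n"
  using \<phi> by (simp_all add: lin_maps_def)
 fix v :: "'a vec" assume v: "v \<in> carrier_vec d"
 have add: "\<phi> (u + w) = \<phi> u + \<phi> w" "\<psi> (u + w) = \<psi> u + \<psi> w"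
  if "u \<in> carrier_vec d" "w \<in> carrier_vec d" for u w using \<phi> that by (simp_all add: lin_maps_def)
 have scale: "\<phi> (c \<cdot>\<^sub>v u) = c \<cdot>\<^sub>v \<phi> u" "\<psi> (c \<cdot>\<^sub>v u) = c \<cdot>\<^sub>v \<psi> u"
  if "u \<in> carrier_vec d" for u c using \<phi> that by (simp_all add: lin_maps_def)
 have car: "\<phi> u \<in> carrier_vec n" "\<psi> u \<in> carrier_vec n" if "u \<in> carrier_vec d" for u
  using \<phi> that by (auto simp: lin_maps_def)
 let ?v = "%k. vec d (%i. if i < k then v $ i else 0)"
 have "\<phi> (?v k) = \<psi> (?v k)" if "k \<le> d" for k
  using that
 proof (induction k)
  case 0
  \<comment> \<open>Homogeneity yields the value at zero once the zero vector is written as a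
    multiple.\<close>
  have "?v 0 = 0 \<cdot>\<^sub>v 0\<^sub>v d" by (intro eq_vecI) auto
  then have "\<phi> (?v 0) = 0 \<cdot>\<^sub>v \<phi> (0\<^sub>v d)" "\<psi> (?v 0) = 0 \<cdot>\<^sub>v \<psi> (0\<^sub>v d)"
   using scale[of "0\<^sub>v d" 0] by (metis zero_carrier_vec)+
  moreover have "0 \<cdot>\<^sub>v \<phi> (0\<^sub>v d) = 0\<^sub>v n" "0 \<cdot>\<^sub>v \<psi> (0\<^sub>v d) = 0\<^sub>v n"
   using car[of "0\<^sub>v d"] by (auto intro!: eq_vecI)
  ultimately show ?case by simp
 next
  case (Suc k)
  have "?v (Suc k) = ?v k + v $ k \<cdot>\<^sub>v unit_vec d k"
   using Suc.prems by (intro eq_vecI) (auto simp: less_Suc_eq)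
  with Suc show ?case by (simp add: add scale eq)
 qed
 from this[of d] show "\<phi> v = \<psi> v"
 proof -
  have "?v d = v" using v by (intro eq_vecI) auto
  with \<open>d \<le> d ==> \<phi> (?v d) = \<psi> (?v d)\<close> show ?thesis by simp
 qed
qed

lemma mat_map_image: "mat_map d ` carrier_mat d n = (lin_maps d n :: ('a::field vec => 'a vec) set)"
proof
 show "mat_map d ` carrier_mat d n \<subseteq> (lin_maps d n :: ('a vec => 'a vec) set)" using mat_map_mem_lin_maps by blast
 show "(lin_maps d n :: ('a vec => 'a vec) set) \<subseteq> mat_map d ` carrier_mat d n"
 proof
  fix \<phi> :: "'a vec => 'a vec" assume \<phi>: "\<phi> \<in> lin_maps d n"
  let ?\<Phi> = "mat d n (%(i, j). \<phi> (unit_vec d i) $ j)"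
  have "\<phi> = mat_map d ?\<Phi>"
  proof (rule lin_maps_eqI[OF \<phi> mat_map_mem_lin_maps])
   fix i assume i: "i < d"
   have car: "\<phi> (unit_vec d i) \<in> carrier_vec n" "mat_map d ?\<Phi> (unit_vec d i) \<in> carrier_vec n"
    using \<phi> mat_map_mem_lin_maps[of ?\<Phi> d n] by (auto simp: lin_maps_def)
   show "\<phi> (unit_vec d i) = mat_map d ?\<Phi> (unit_vec d i)"
   proof (rule eq_vecI)
    fix j assume "j < dim_vec (mat_map d ?\<Phi> (unit_vec d i))"
    then have "j < n" using car by simp
    then show "\<phi> (unit_vec d i) $ j = mat_map d ?\<Phi> (unit_vec d i) $ j"
     using i by (subst mat_map_unit_vec[of _ d n]) auto
   qed (use car in simp)
  qed simp
  then show "\<phi> \<in> mat_map d ` carrier_mat d n" by (rule image_eqI) simp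
 qed
qed

text \<open>On row vectors \<open>(v A) \<Phi> = v (A \<Phi>)\<close>: the action on linear maps
  becomes left multiplication, hence a separate action on each column of the matrix.\<close>

lemma lin_maps_act_mat_map:
 assumes "A \<in> carrier_mat d d" "\<Phi> \<in> carrier_mat d n"
 shows "lin_maps_act d A (mat_map d \<Phi>) = mat_map d (A * \<Phi>)"
 unfolding lin_maps_act_def mat_map_def
proof (rule restrict_ext)
 fix v :: "'a vec" assume v: "v \<in> carrier_vec d"
 have "transpose_mat (A * \<Phi>) = transpose_mat \<Phi> * transpose_mat A"
  using assms by (rule transpose_mult)
 moreover have "(transpose_mat \<Phi> * transpose_mat A) *\<^sub>v v = transpose_mat \<Phi> *\<^sub>v (transpose_mat A *\<^sub>v v)"
  using assms v by (intro assoc_mult_mat_vec) auto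
 moreover have "row_mult v A \<in> carrier_vec d"
  unfolding row_mult_def using assms(1) v by (intro mult_mat_vec_carrier) auto
 ultimately show "(\<lambda>v\<in>carrier_vec d. row_mult v \<Phi>) (row_mult v A) = row_mult v (A * \<Phi>)"
  by (simp add: row_mult_def)
qed

lemma card_carrier_mat_finite:
 "finite (carrier_mat d n :: 'a::finite mat set)" "card (carrier_mat d n :: 'a mat set) = CARD('a) ^ (d * n)"
proof -
 have bij: "bij_betw (%M. \<lambda>ij\<in>{..<d} \<times> {..<n}. M $$ ij) (carrier_mat d n)
   ({..<d} \<times> {..<n} \<rightarrow>\<^sub>E (UNIV :: 'a set))"
 proof (rule bij_betwI[where g = "mat d n"])
  show "mat d n \<in> ({..<d} \<times> {..<n} \<rightarrow>\<^sub>E (UNIV :: 'a set)) \<rightarrow> carrier_mat d n"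
   by (rule funcsetI) simp
  fix M :: "'a mat" assume "M \<in> carrier_mat d n"
  then show "mat d n (\<lambda>ij\<in>{..<d} \<times> {..<n}. M $$ ij) = M" by (intro eq_matI) auto
 next
  fix f assume f: "f \<in> {..<d} \<times> {..<n} \<rightarrow>\<^sub>E (UNIV :: 'a set)"
  show "(\<lambda>ij\<in>{..<d} \<times> {..<n}. mat d n f $$ ij) = f"
  proof
   fix ij show "(\<lambda>ij\<in>{..<d} \<times> {..<n}. mat d n f $$ ij) ij = f ij"
    using f by (cases ij) (auto simp: PiE_iff extensional_def)
  qed
 qed (rule funcsetI, simp)
 then show "finite (carrier_mat d n :: 'a mat set)"
  using bij_betw_finite[OF bij] by (simp add: finite_PiE)
 show "card (carrier_mat d n :: 'a mat set) = CARD('a) ^ (d * n)"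
  using bij_betw_same_card[OF bij] by (simp add: card_PiE)
qed

text \<open>The natural map starts from the permutation module, where the images of basis elements
  can be prescribed; the definition asks for the opposite direction.\<close>

lemma isomorphic_modulesI_inverse:
 assumes bij: "bij_betw g (carrier N) (carrier M)"
  and add: "!!x y. x \<in> carrier N ==> y \<in> carrier N ==> x \<oplus>\<^bsub>N\<^esub> y \<in> carrier N & g (x \<oplus>\<^bsub>N\<^esub> y) = g x \<oplus>\<^bsub>M\<^esub> g y"
  and smult: "!!c x. x \<in> carrier N ==> c \<odot>\<^bsub>N\<^esub> x \<in> carrier N & g (c \<odot>\<^bsub>N\<^esub> x) = c \<odot>\<^bsub>M\<^esub> g x"
  and act: "!!a x. a \<in> G ==> x \<in> carrier N ==> actN a x \<in> carrier N & g (actN a x) = actM a (g x)"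
 shows "isomorphic_modules G M actM N actN"
proof -
 let ?f = "inv_into (carrier N) g"
 have inj: "inj_on g (carrier N)" and img: "g ` carrier N = carrier M"
  using bij by (auto simp: bij_betw_def)
 have gf: "?f x \<in> carrier N" "g (?f x) = x" if "x \<in> carrier M" for x
  using that img by (auto simp: inv_into_into f_inv_into_f)
 have fg: "?f (g y) = y" if "y \<in> carrier N" for y
  using that inj by simp
 show ?thesis
  unfolding isomorphic_modules_def
 proof (intro exI[of _ ?f] conjI ballI allI)
  show "bij_betw ?f (carrier M) (carrier N)" using bij by (rule bij_betw_inv_into)
 next
  fix x y assume "x \<in> carrier M" "y \<in> carrier M"
  then show "?f (x \<oplus>\<^bsub>M\<^esub> y) = ?f x \<oplus>\<^bsub>N\<^esub> ?f y"
   using add[of "?f x" "?f y"] fg[of "?f x \<oplus>\<^bsub>N\<^esub> ?f y"] gf by simp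
 next
  fix c x assume "x \<in> carrier M"
  then show "?f (c \<odot>\<^bsub>M\<^esub> x) = c \<odot>\<^bsub>N\<^esub> ?f x"
   using smult[of "?f x" c] fg[of "c \<odot>\<^bsub>N\<^esub> ?f x"] gf by simp
 next
  fix a x assume "a \<in> G" "x \<in> carrier M"
  then show "?f (actM a x) = actN a (?f x)"
   using act[of a "?f x"] fg[of "actN a (?f x)"] gf by simp
 qed
qed

text \<open>There are \<open>p^(dn)\<close> matrices and \<open>q^d = p^(dn)\<close> box monomials,
  so a spanning family indexed by the matrices is a basis. Homogenizing in weight 0 turns it into a
  basis over the Laurent polynomials and commutes with the substitution, so equivariance and
  spanning need only be checked over the prime field.\<close>

theorem isomorphic_KBV_KHom:
 fixes f :: "'p::prime_card mod_ring mat => 'p mod_ring mpoly" and n d :: nat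
 defines "q \<equiv> CARD('p) ^ n"
 assumes n: "n \<ge> 1" and G: "G \<subseteq> carrier_mat d d"
  and f: "!!\<Phi>. \<Phi> \<in> carrier_mat d n ==> f \<Phi> \<in> mpolys d"
  and equiv: "!!A \<Phi>. A \<in> G ==> \<Phi> \<in> carrier_mat d n ==>
   mcong q d (mpoly_subst (fgl_poly n d A) (f \<Phi>)) (f (A * \<Phi>))"
  and span: "!!m. m \<in> box q d ==>
   \<exists>c. mcong q d (msingle m 1) (\<Sum>\<Phi>\<in>carrier_mat d n. mpoly_const (c \<Phi>) * f \<Phi>)"
 shows "isomorphic_modules G (KBV n d) (KBV_act n d) (KHom n d) (KHom_act d)"
proof -
 let ?S = "carrier_mat d n :: 'p mod_ring mat set"
 let ?K = "KBV n d :: ('p morava, 'p morava mpoly set) module"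
 let ?N = "KHom n d :: ('p morava, ('p mod_ring vec => 'p mod_ring vec) \<Rightarrow>\<^sub>0 'p morava) module"
 define w where "w = q - 1"
 \<comment> \<open>Truncation puts the family into the box, where its coefficient matrix is
   square.\<close>
 define f' where "f' \<Phi> = trunc q d (f \<Phi>)" for \<Phi>
 define h where "h \<Phi> = homogenize w 0 (f' \<Phi>)" for \<Phi>
 define gl :: "(('p mod_ring vec => 'p mod_ring vec) \<Rightarrow>\<^sub>0 'p morava) => 'p morava mpoly"
  where "gl y = (\<Sum>\<Phi>\<in>?S. mpoly_const (mcoeff y (mat_map d \<Phi>)) * h \<Phi>)" for y
 define g where "g y = coset q d (gl y)" for y
 note q = q_def[THEN meta_eq_to_obj_eq]
 have finS: "finite ?S" by (rule card_carrier_mat_finite)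
 have cardS: "card ?S = card (box q d)"
  by (simp add: card_carrier_mat_finite(2) card_box q mult.commute flip: power_mult)
 have ff': "mcong q d (f' \<Phi>) (f \<Phi>)" for \<Phi> by (simp add: f'_def mcong_trunc)
 have f'_box: "f' \<Phi> \<in> box_polys q d" for \<Phi> by (simp add: f'_def truncate_mem_box_polys)
 have span': "\<exists>c. mcong q d (msingle m 1) (\<Sum>\<Phi>\<in>?S. mpoly_const (c \<Phi>) * f' \<Phi>)"
  if m: "m \<in> box q d" for m
 proof -
  from span[OF m] obtain c where "mcong q d (msingle m 1) (\<Sum>\<Phi>\<in>?S. mpoly_const (c \<Phi>) * f \<Phi>)"
   by blast
  moreover have "mcong q d (\<Sum>\<Phi>\<in>?S. mpoly_const (c \<Phi>) * f \<Phi>) (\<Sum>\<Phi>\<in>?S. mpoly_const (c \<Phi>) * f' \<Phi>)"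
   by (intro mcong_sum mcong_mult mcong_refl mcong_sym[OF ff'])
  ultimately show ?thesis using mcong_trans by blast
 qed
 have basis_span: "\<exists>c. mcong q d P (\<Sum>\<Phi>\<in>?S. mpoly_const (c \<Phi>) * h \<Phi>)" for P
  unfolding h_def by (rule homogenized_basis(1)[OF finS cardS f'_box span'])
 have basis_unique: "b \<Phi> = c \<Phi>" if "\<Phi> \<in> ?S"
  "mcong q d (\<Sum>\<Phi>\<in>?S. mpoly_const (b \<Phi>) * h \<Phi>) (\<Sum>\<Phi>\<in>?S. mpoly_const (c \<Phi>) * h \<Phi>)"
  for b c \<Phi>
  using that unfolding h_def by (intro homogenized_basis(2)[OF finS cardS f'_box span'])
 have h_mp: "h \<Phi> \<in> mpolys d" for \<Phi> by (simp add: h_def f'_def mpolys_homogenize)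
 have gl_mp: "gl y \<in> mpolys d" for y
  unfolding gl_def by (intro mpolys_sum mpolys_mult mpolys_const h_mp)
 have gl_add: "gl (x + y) = gl x + gl y" for x y
  by (simp add: gl_def lookup_add mpoly_const_add ring_distribs sum.distrib)
 have gl_sum: "gl (sum y A) = (\<Sum>i\<in>A. gl (y i))" for A and y :: "'i => _"
  by (induction A rule: infinite_finite_induct) (simp_all add: gl_add, simp_all add: gl_def)
 have gl_single: "gl (msingle (mat_map d \<Phi>) c) = mpoly_const c * h \<Phi>" if "\<Phi> \<in> ?S" for \<Phi> c
 proof -
  have "gl (msingle (mat_map d \<Phi>) c) = (\<Sum>\<Psi>\<in>?S. if \<Psi> = \<Phi> then mpoly_const c * h \<Psi> else 0)"
   unfolding gl_def
  proof (rule sum.cong[OF refl])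
   fix \<Psi> assume "\<Psi> \<in> ?S"
   then have "mat_map d \<Psi> = mat_map d \<Phi> \<longleftrightarrow> \<Psi> = \<Phi>"
    using that by (rule inj_on_eq_iff[OF inj_on_mat_map])
   then show "mpoly_const (mcoeff (msingle (mat_map d \<Phi>) c) (mat_map d \<Psi>)) * h \<Psi> =
     (if \<Psi> = \<Phi> then mpoly_const c * h \<Psi> else 0)"
    by (auto simp: lookup_single when_def)
  qed
  then show ?thesis using that finS by simp
 qed
 have carN: "y \<in> carrier ?N \<longleftrightarrow> mkeys y \<subseteq> mat_map d ` ?S" for y
  by (simp add: KHom_def perm_module_def mat_map_image)
 \<comment> \<open>The permutation action is defined by a sum over the support, which depends on the
   element; it is rewritten as a sum over all matrices.\<close>
 have expand: "(\<Sum>s\<in>mkeys y. F s (mcoeff y s)) =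
   (\<Sum>\<Phi>\<in>?S. F (mat_map d \<Phi>) (mcoeff y (mat_map d \<Phi>)))"
  if "y \<in> carrier ?N" "!!s. F s 0 = 0"
  for y and F :: "_ => 'p morava => 'c::comm_monoid_add"
 proof -
  have "(\<Sum>s\<in>mkeys y. F s (mcoeff y s)) =
    (\<Sum>s\<in>mat_map d ` ?S. F s (mcoeff y s))"
   using that finS by (intro sum.mono_neutral_left) (auto simp: carN in_keys_iff)
  also have "\<dots> = (\<Sum>\<Phi>\<in>?S. F (mat_map d \<Phi>) (mcoeff y (mat_map d \<Phi>)))"
   using inj_on_mat_map[of d n] by (subst sum.reindex) simp_all
  finally show ?thesis .
 qed
 show ?thesis
 proof (rule isomorphic_modulesI_inverse)
  show "bij_betw g (carrier ?N) (carrier ?K)"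
   unfolding bij_betw_def
  proof
   show "inj_on g (carrier ?N)"
   proof (rule inj_onI)
    fix x y assume *: "x \<in> carrier ?N" "y \<in> carrier ?N" "g x = g y"
    then have "mcong q d (gl x) (gl y)"
     by (simp add: g_def coset_eq_iff gl_mp)
    then have eq: "mcoeff x (mat_map d \<Phi>) = mcoeff y (mat_map d \<Phi>)" if "\<Phi> \<in> ?S" for \<Phi>
     unfolding gl_def using that
     by (intro basis_unique[where b = "%\<Phi>. mcoeff x (mat_map d \<Phi>)"
       and c = "%\<Phi>. mcoeff y (mat_map d \<Phi>)"])
    show "x = y"
    proof (rule poly_mapping_eqI)
     fix s show "mcoeff x s = mcoeff y s"
     proof (cases "s \<in> mat_map d ` ?S")
      case False
      then have "s \<notin> mkeys x" "s \<notin> mkeys y" using * carN by blast+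
      then show ?thesis by (simp add: in_keys_iff)
     qed (use eq in blast)
    qed
   qed
   show "g ` carrier ?N = carrier ?K"
   proof
    show "g ` carrier ?N \<subseteq> carrier ?K"
     unfolding carrier_KBV[OF q refl] g_def using gl_mp by blast
    show "carrier ?K \<subseteq> g ` carrier ?N"
    proof
     fix X assume "X \<in> carrier ?K"
     then obtain P where P: "P \<in> mpolys d" "X = coset q d P" unfolding carrier_KBV[OF q refl] by blast
     obtain c where c: "mcong q d P (\<Sum>\<Phi>\<in>?S. mpoly_const (c \<Phi>) * h \<Phi>)" using basis_span by blast
     define y where "y = (\<Sum>\<Phi>\<in>?S. msingle (mat_map d \<Phi>) (c \<Phi>))"
     have "gl y = (\<Sum>\<Phi>\<in>?S. mpoly_const (c \<Phi>) * h \<Phi>)"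
      unfolding y_def gl_sum by (intro sum.cong refl gl_single)
     with c have "mcong q d P (gl y)" by (simp only:)
     then have "X = g y" unfolding P(2) g_def by (simp only: coset_eq_iff[OF P(1) gl_mp])
     moreover have "mkeys y \<subseteq> mat_map d ` ?S"
     proof -
      have "mkeys y \<subseteq> (\<Union>\<Phi>\<in>?S. mkeys (msingle (mat_map d \<Phi>) (c \<Phi>)))"
       unfolding y_def by (rule Poly_Mapping.keys_sum)
      then show ?thesis by (auto split: if_splits)
     qed
     ultimately show "X \<in> g ` carrier ?N" using carN by blast
    qed
   qed
  qed
 next
  fix x y assume *: "x \<in> carrier ?N" "y \<in> carrier ?N"
  have eq: "x \<oplus>\<^bsub>?N\<^esub> y = x + y" by (simp add: KHom_def perm_module_def)
  have "x + y \<in> carrier ?N" using * keys_add[of x y] unfolding carN by blast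
  moreover have "g (x + y) = g x \<oplus>\<^bsub>?K\<^esub> g y"
   unfolding g_def gl_add by (rule add_KBV[OF q refl, symmetric]) (simp_all add: gl_mp)
  ultimately show "x \<oplus>\<^bsub>?N\<^esub> y \<in> carrier ?N & g (x \<oplus>\<^bsub>?N\<^esub> y) = g x \<oplus>\<^bsub>?K\<^esub> g y"
   unfolding eq by blast
 next
  fix c x assume x: "x \<in> carrier ?N"
  have eq: "c \<odot>\<^bsub>?N\<^esub> x = Poly_Mapping.map ((*) c) x" by (simp add: KHom_def perm_module_def)
  have lk: "mcoeff (Poly_Mapping.map ((*) c) x) s = c * mcoeff x s" for s
   by (simp add: Poly_Mapping.map.rep_eq when_def)
  have "Poly_Mapping.map ((*) c) x \<in> carrier ?N"
   using x unfolding carN by (auto simp: in_keys_iff lk)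
  moreover have "gl (Poly_Mapping.map ((*) c) x) = mpoly_const c * gl x"
   by (simp add: gl_def lk mpoly_const_mult sum_distrib_left mult.assoc)
  then have "g (Poly_Mapping.map ((*) c) x) = c \<odot>\<^bsub>?K\<^esub> g x"
   unfolding g_def by (simp add: smult_KBV[OF q refl] gl_mp)
  ultimately show "c \<odot>\<^bsub>?N\<^esub> x \<in> carrier ?N & g (c \<odot>\<^bsub>?N\<^esub> x) = c \<odot>\<^bsub>?K\<^esub> g x"
   unfolding eq by blast
 next
  fix A y assume A: "A \<in> G" and y: "y \<in> carrier ?N"
  have Ac: "A \<in> carrier_mat d d" using A G by blast
  have act: "KHom_act d A y = (\<Sum>\<Phi>\<in>?S. msingle (mat_map d (A * \<Phi>)) (mcoeff y (mat_map d \<Phi>)))"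
   unfolding KHom_act_def perm_act_def
   using expand[OF y, of "%s. msingle (lin_maps_act d A s)"] Ac
   by (simp add: lin_maps_act_mat_map cong: sum.cong)
  have AS: "A * \<Phi> \<in> ?S" if "\<Phi> \<in> ?S" for \<Phi> using that Ac by simp
  have "KHom_act d A y \<in> carrier ?N"
  proof -
   have "mkeys (KHom_act d A y) \<subseteq>
     (\<Union>\<Phi>\<in>?S. mkeys (msingle (mat_map d (A * \<Phi>)) (mcoeff y (mat_map d \<Phi>))))"
    unfolding act by (rule Poly_Mapping.keys_sum)
   then show ?thesis unfolding carN using AS by (auto split: if_splits)
  qed
  moreover have "g (KHom_act d A y) = KBV_act n d A (g y)"
  proof -
   let ?F = "%j. truncate_mps q d (fgl_sum_series n d A j)"
   have F: "?F = (%j. homogenize w 1 (fgl_poly n d A j))" "!!j. homogenizable w 1 (fgl_poly n d A j)"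
    using fgl_sum_series_homogenize[OF n, of d A] unfolding q w_def by auto
   \<comment> \<open>Since substitution commutes with homogenization, equivariance over the prime
     field lifts.\<close>
   have hA: "mcong q d (mpoly_subst ?F (h \<Phi>)) (h (A * \<Phi>))" if \<Phi>: "\<Phi> \<in> ?S" for \<Phi>
   proof -
    have "mcong q d (mpoly_subst (fgl_poly n d A) (f' \<Phi>)) (mpoly_subst (fgl_poly n d A) (f \<Phi>))"
     using fgl_poly_power_0(1)[OF n, of d A] unfolding q[symmetric]
     by (intro mcong_subst_arg ff') (auto simp: f \<Phi> f'_def)
    also have "mcong q d (mpoly_subst (fgl_poly n d A) (f \<Phi>)) (f (A * \<Phi>))"
     using A \<Phi> by (rule equiv)
    also have "mcong q d (f (A * \<Phi>)) (f' (A * \<Phi>))" using ff' by (rule mcong_sym)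
    finally have "mcong q d (homogenize w 0 (mpoly_subst (fgl_poly n d A) (f' \<Phi>))) (homogenize w 0 (f' (A * \<Phi>)))"
     by (rule mcong_homogenize)
    then show ?thesis unfolding h_def F(1) mpoly_subst_homogenize[OF F(2)] .
   qed
   have "gl (KHom_act d A y) = (\<Sum>\<Phi>\<in>?S. mpoly_const (mcoeff y (mat_map d \<Phi>)) * h (A * \<Phi>))"
    unfolding act gl_sum by (intro sum.cong refl gl_single AS)
   moreover have "mpoly_subst ?F (gl y) =
     (\<Sum>\<Phi>\<in>?S. mpoly_const (mcoeff y (mat_map d \<Phi>)) * mpoly_subst ?F (h \<Phi>))"
    by (simp add: gl_def mpoly_subst_sum mpoly_subst_mult)
   ultimately have "mcong q d (gl (KHom_act d A y)) (mpoly_subst ?F (gl y))"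
    using hA by (auto intro!: mcong_sum mcong_mult intro: mcong_sym)
   moreover have "mpoly_subst ?F (gl y) \<in> mpolys d"
    by (rule mpolys_subst[OF gl_mp]) simp
   ultimately show ?thesis
    unfolding g_def KBV_act_coset[OF q refl n gl_mp] by (simp only: coset_eq_iff[OF gl_mp])
  qed
  ultimately show "KHom_act d A y \<in> carrier ?N & g (KHom_act d A y) = KBV_act n d A (g y)" by blast
 qed
qed

section \<open>The action in two variables\<close>

text \<open>The cofactor of \<open>a - b\<close> in \<open>a ^ p - b ^ p\<close> is a sum of
  \<open>p\<close> terms congruent to \<open>b ^ (p - 1)\<close> modulo \<open>c\<close>, so it is
  divisible by \<open>c\<close> as well.\<close>

lemma power_diff_dvd_square:
 fixes a b c :: "'a::comm_ring_1"
 assumes "c dvd a - b" "c dvd of_nat p"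
 shows "c ^ 2 dvd a ^ p - b ^ p"
proof -
 have pw: "c dvd a ^ i - b ^ i" for i
 proof (induction i)
  case (Suc i)
  have "a ^ Suc i - b ^ Suc i = a * (a ^ i - b ^ i) + (a - b) * b ^ i"
   by (simp add: algebra_simps)
  then show ?case using Suc assms(1) by simp
 qed simp
 have "c dvd (\<Sum>i<p. a ^ i * b ^ (p - Suc i))"
 proof -
  have "(\<Sum>i<p. a ^ i * b ^ (p - Suc i)) - of_nat p * b ^ (p - 1) = (\<Sum>i<p. a ^ i * b ^ (p - Suc i) - b ^ (p - 1))"
   by (simp add: sum_subtractf)
  also have "\<dots> = (\<Sum>i<p. (a ^ i - b ^ i) * b ^ (p - Suc i))"
   by (intro sum.cong) (simp_all add: left_diff_distrib flip: power_add)
  finally have "c dvd (\<Sum>i<p. a ^ i * b ^ (p - Suc i)) - of_nat p * b ^ (p - 1)"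
   using pw by (simp add: dvd_sum)
  moreover have "c dvd of_nat p * b ^ (p - 1)" using assms(2) by simp
  ultimately show ?thesis by (metis diff_add_cancel dvd_add)
 qed
 moreover have "a ^ p - b ^ p = (a - b) * (\<Sum>i<p. a ^ i * b ^ (p - Suc i))"
  using power_diff_sumr2[of a p b] by (simp add: mult.commute)
 ultimately show ?thesis using assms(1) by (simp add: power2_eq_square mult_dvd_mono)
qed

lemma prime_dvd_binomial_power_diff:
 fixes y :: "'a::comm_ring_1"
 assumes "prime p"
 shows "of_nat p dvd (1 + y) ^ p - (1 + y ^ p)"
proof -
 have "(1 + y) ^ p = (\<Sum>k\<in>insert 0 (insert p {0<..<p}). of_nat (p choose k) * y ^ k)"
  using binomial_ring[of y 1 p]
  by (simp add: add.commute) (intro sum.cong, auto)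
 also have "\<dots> = 1 + y ^ p + (\<Sum>k\<in>{0<..<p}. of_nat (p choose k) * y ^ k)"
  using prime_gt_0_nat[OF assms] by (simp add: add.assoc)
 finally have "(1 + y) ^ p - (1 + y ^ p) = (\<Sum>k\<in>{0<..<p}. of_nat (p choose k) * y ^ k)" by simp
 moreover have "of_nat p dvd (of_nat (p choose k) :: 'a)" if "k \<in> {0<..<p}" for k
  using dvd_choose_prime[of k p] that assms by (auto elim!: dvdE)
 ultimately show ?thesis by (auto intro!: dvd_sum dvd_mult2)
qed

text \<open>Modulo \<open>p^2\<close> the polynomials \<open>(1 + t)^(p^(n+1))\<close> and
  \<open>(1 + t^(p^n))^p\<close> agree, by induction with \<open>power_diff_dvd_square\<close>. This
  precision is needed because the exponential contributes a factor \<open>1/p\<close>.\<close>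

lemma binomial_prime_power_cong:
 fixes p n i :: nat
 assumes p: "prime p" and i: "i \<le> p ^ Suc n"
 shows "int p ^ 2 dvd int (p ^ Suc n choose i) - (if p ^ n dvd i then int (p choose (i div p ^ n)) else 0)"
proof -
 have dvd: "(of_nat p :: int poly) ^ 2 dvd (1 + Polynomial.monom 1 1) ^ (p ^ Suc n) - (1 + Polynomial.monom 1 (p ^ n)) ^ p"
 proof (induction n)
  case 0
  then show ?case by simp
 next
  case (Suc n)
  let ?y = "Polynomial.monom 1 (p ^ n) :: int poly"
  have y: "?y ^ p = Polynomial.monom 1 (p ^ Suc n)"
   by (simp add: monom_power mult.commute)
  have "(of_nat p :: int poly) dvd (1 + Polynomial.monom 1 1) ^ (p ^ Suc n) - (1 + ?y) ^ p"
   using Suc by (rule dvd_trans[rotated]) (simp add: power2_eq_square)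
  moreover have "of_nat p dvd (1 + ?y) ^ p - (1 + ?y ^ p)"
   using p by (rule prime_dvd_binomial_power_diff)
  ultimately have "of_nat p dvd ((1 + Polynomial.monom 1 1) ^ (p ^ Suc n) - (1 + ?y) ^ p) + ((1 + ?y) ^ p - (1 + ?y ^ p))"
   by (rule dvd_add)
  then have "of_nat p dvd (1 + Polynomial.monom 1 1) ^ (p ^ Suc n) - (1 + ?y ^ p)"
   by (simp only: diff_add_cancel add_diff_eq)
  then have "(of_nat p) ^ 2 dvd ((1 + Polynomial.monom 1 1) ^ (p ^ Suc n)) ^ p - (1 + ?y ^ p) ^ p"
   by (rule power_diff_dvd_square) simp
  then show ?case unfolding y by (simp add: mult.commute flip: power_mult)
 qed
 have "(1 + Polynomial.monom 1 1 :: int poly) = [:1, 1:]" by (simp add: monom_altdef one_pCons)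
 then have c1: "Polynomial.coeff ((1 + Polynomial.monom 1 1 :: int poly) ^ (p ^ Suc n)) i = int (p ^ Suc n choose i)"
  using coeff_linear_poly_power[OF i, of "1::int" 1] by simp
 have "(1 + Polynomial.monom 1 (p ^ n) :: int poly) ^ p = (\<Sum>k\<le>p. of_nat (p choose k) * Polynomial.monom 1 (p ^ n * k))"
  using binomial_ring[of "Polynomial.monom 1 (p ^ n)" "1 :: int poly" p] by (simp add: add.commute monom_power)
 then have "Polynomial.coeff ((1 + Polynomial.monom 1 (p ^ n) :: int poly) ^ p) i = (\<Sum>k\<le>p. if p ^ n * k = i then int (p choose k) else 0)"
  by (simp add: coeff_sum of_nat_poly smult_monom)
 also have "\<dots> = (if p ^ n dvd i then int (p choose (i div p ^ n)) else 0)"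
 proof (cases "p ^ n dvd i")
  case True
  then obtain k where k: "i = p ^ n * k" by (elim dvdE)
  have pos: "p ^ n > 0" using p prime_gt_0_nat by simp
  with i k prime_gt_0_nat[OF p] have "k \<le> p" by simp
  with pos prime_gt_0_nat[OF p] show ?thesis by (simp add: k)
 next
  case False
  then have "p ^ n * k \<noteq> i" for k by auto
  with False show ?thesis by simp
 qed
 finally have c2: "Polynomial.coeff ((1 + Polynomial.monom 1 (p ^ n) :: int poly) ^ p) i = (if p ^ n dvd i then int (p choose (i div p ^ n)) else 0)" .
 have "(of_nat p :: int poly) ^ 2 = [:int p ^ 2:]"
  by (simp add: of_nat_poly power2_eq_square)
 with dvd have "[:int p ^ 2:] dvd (1 + Polynomial.monom 1 1 :: int poly) ^ (p ^ Suc n) - (1 + Polynomial.monom 1 (p ^ n)) ^ p" by simp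
 then have "int p ^ 2 dvd Polynomial.coeff ((1 + Polynomial.monom 1 1 :: int poly) ^ (p ^ Suc n) - (1 + Polynomial.monom 1 (p ^ n)) ^ p) i"
  by (simp only: const_poly_dvd_iff)
 then show ?thesis by (simp only: coeff_diff c1 c2)
qed

lemma reduce_rat_of_int [simp]: "reduce_rat (of_int z) = of_int z"
 by (simp add: reduce_rat_def)

lemma of_int_to_int_mod_ring: "of_int (to_int_mod_ring (x :: 'p::prime_card mod_ring)) = x"
 by (simp add: of_int_of_int_mod_ring)

lemma of_int_mod_ring_eq_0: "int CARD('p) dvd z ==> (of_int z :: 'p::prime_card mod_ring) = 0"
 by (auto elim!: dvdE)

definition mono2 :: "nat => nat => monomial" where
 "mono2 i k = msingle 0 i + msingle 1 k"

lemma lookup_mono2: "mcoeff (mono2 i k) j = (if j = 0 then i else if j = 1 then k else 0)"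
 by (simp add: mono2_def lookup_add lookup_single when_def)

lemma mono2_inject [simp]: "mono2 i k = mono2 i' k' \<longleftrightarrow> i = i' & k = k'"
 by (auto simp: poly_mapping_eq_iff fun_eq_iff lookup_mono2)

lemma mono2_mem_box: "mono2 i k \<in> box q 2 \<longleftrightarrow> i < q & k < q"
 by (auto simp: box_def in_keys_iff lookup_mono2 numeral_2_eq_2 less_Suc_eq split: if_splits)

lemma box_2E:
 assumes "m \<in> box q 2"
 obtains i k where "m = mono2 i k" "i < q" "k < q"
proof -
 have "m = mono2 (mcoeff m 0) (mcoeff m 1)"
  using assms by (intro poly_mapping_eqI) (auto simp: lookup_mono2 box_def in_keys_iff subset_iff)
 with assms that show ?thesis by (metis mono2_mem_box)
qed

lemma total_degree_mono2 [simp]: "total_degree (mono2 i k) = i + k"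
 by (simp add: mono2_def)

lemma pvar_power_mult: "pvar 0 ^ i * pvar 1 ^ k = msingle (mono2 i k) 1"
 by (simp add: pvar_power mult_single mono2_def)

lemma lookup_monomial2:
 "mcoeff (mpoly_const c * (pvar 0 ^ i * pvar 1 ^ k)) (mono2 i' k') = (if i = i' & k = k' then c else 0)"
 unfolding pvar_power_mult lookup_const_mult by (simp add: lookup_single when_def)

lemma exp_series_1:
 assumes "prime p" "n \<ge> 1"
 shows "fps_nth (exp_series p n) 1 = 1"
 using exp_series_rec[OF assms refl, of 1] by (simp add: exp_series_0[OF assms refl])

text \<open>At \<open>q\<close> only the index 1 contributes to the recursion, and there the
  logarithm has coefficient \<open>1/p\<close>.\<close>

lemma exp_series_q:
 assumes p: "prime p" "n \<ge> 1"
 shows "fps_nth (exp_series p n) (p ^ n) = - 1 / of_nat p"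
proof -
 let ?q = "p ^ n"
 have q2: "?q \<ge> 2" by (rule q_ge_2[OF p refl])
 have "(\<Sum>i<?q. fps_nth (exp_series p n) i * fps_nth (log_series p n ^ i) ?q) =
   (\<Sum>i\<in>{1}. fps_nth (exp_series p n) i * fps_nth (log_series p n ^ i) ?q)"
 proof (rule sum.mono_neutral_right)
  show "\<forall>i\<in>{..<?q} - {1}. fps_nth (exp_series p n) i * fps_nth (log_series p n ^ i) ?q = 0"
  proof
   fix i assume i: "i \<in> {..<?q} - {1}"
   have "fps_nth (exp_series p n) i = 0"
   proof (rule ccontr)
    assume "fps_nth (exp_series p n) i \<noteq> 0"
    then have "1 \<le> i" "?q - 1 dvd i - 1" using exp_series_support[OF p refl] by blast+
    with i have "i - 1 > 0" by auto
    with \<open>?q - 1 dvd i - 1\<close> have "?q - 1 \<le> i - 1" by (rule dvd_imp_le)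
    with i \<open>1 \<le> i\<close> show False by auto
   qed
   then show "fps_nth (exp_series p n) i * fps_nth (log_series p n ^ i) ?q = 0" by simp
  qed
 qed (use q2 in auto)
 also have "\<dots> = 1 / of_nat p"
  using exp_series_1[OF p] log_series_power[OF p refl, of 1] by simp
 moreover have "?q \<noteq> 1" using q2 by linarith
 ultimately show ?thesis using exp_series_rec[OF p refl, of ?q] by simp
qed

text \<open>Exponents of the exponential are 1 modulo \<open>q - 1\<close>; below
  \<open>2q - 1\<close> these are only 1 and \<open>q\<close>. The bound is chosen for two
  variables, where box monomials have degree at most \<open>2q - 2\<close>.\<close>

lemma exp_series_small:
 assumes p: "prime p" "n \<ge> 1" and k: "k < 2 * p ^ n - 1" "k \<noteq> 1" "k \<noteq> p ^ n"
 shows "fps_nth (exp_series p n) k = 0"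
proof (rule ccontr)
 assume "fps_nth (exp_series p n) k \<noteq> 0"
 then have k1: "1 \<le> k" "p ^ n - 1 dvd k - 1" using exp_series_support[OF p refl] by blast+
 then obtain c where c: "k - 1 = (p ^ n - 1) * c" by (elim dvdE)
 have "c \<noteq> 0" using c k k1 by (intro notI) simp
 moreover have "c \<noteq> 1" using c k k1 by (intro notI) simp
 ultimately have "c \<ge> 2" by simp
 then have "(p ^ n - 1) * 2 \<le> k - 1" unfolding c by (rule mult_le_mono2)
 moreover obtain Q where "p ^ n = Q" by blast
 ultimately show False using k k1(1) by simp
qed

lemma mod_ring_power_card_power:
 "(x :: 'p::prime_card mod_ring) ^ (CARD('p) ^ n) = x"
 by (rule finite_field_power_card_power_eq_same) simp

text \<open>The correction comes from degree \<open>q\<close> and is \<open>-1/p\<close> times the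
  binomial coefficients of \<open>q\<close>. Modulo \<open>p\<close> only exponents divisible by
  \<open>m = q/p\<close> survive, with coefficients \<open>(p choose l)/p\<close>.\<close>

lemma fgl_poly_2:
 fixes A :: "'p::prime_card mod_ring mat" and n j :: nat
 assumes n: "n \<ge> 1"
 defines "q \<equiv> CARD('p) ^ n" and "m \<equiv> CARD('p) ^ (n - 1)"
 shows "mcong q 2 (fgl_poly n 2 A j)
  (mpoly_const (A $$ (0, j)) * pvar 0 + mpoly_const (A $$ (1, j)) * pvar 1 -
   (\<Sum>l\<in>{0<..<CARD('p)}. mpoly_const (of_nat ((CARD('p) choose l) div CARD('p)) *
     A $$ (0, j) ^ l * A $$ (1, j) ^ (CARD('p) - l)) * (pvar 0 ^ (l * m) * pvar 1 ^ ((CARD('p) - l) * m))))"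
  (is "mcong q 2 _ (?L - ?S)")
 unfolding mcong_def
proof
 fix u assume "u \<in> box q 2"
 then obtain i k where u: "u = mono2 i k" and ik: "i < q" "k < q" by (rule box_2E)
 let ?p = "CARD('p)"
 have p: "prime ?p" by (rule prime_card)
 have p2: "?p \<ge> 2" using p by (rule prime_ge_2_nat)
 have q2: "q \<ge> 2" unfolding q_def by (rule q_ge_2[OF p n refl])
 have qm: "q = ?p * m" using n by (cases n) (simp_all add: q_def m_def)
 have m0: "m > 0" using p2 by (simp add: m_def)
 define a where "a i = to_int_mod_ring (A $$ (i, j))" for i
 have a: "of_int (a i) = A $$ (i, j)" for i by (simp add: a_def of_int_to_int_mod_ring)
 have W: "multinomial_term 2 a (mono2 i k) = of_int (int (i + k choose i) * a 0 ^ i * a 1 ^ k)"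
  by (simp add: multinomial_term_def numeral_2_eq_2 lookup_mono2 binomial_fact[of i "i + k"] field_simps)
 have lhs: "mcoeff (fgl_poly n 2 A j) u =
   reduce_rat (fps_nth (exp_series ?p n) (i + k) * of_int (int (i + k choose i) * a 0 ^ i * a 1 ^ k))"
  unfolding W[symmetric] using ik by (simp add: fgl_poly_def lookup_truncate u mono2_mem_box flip: q_def a_def)
 have L: "mcoeff ?L u = (if i = 1 & k = 0 then A $$ (0, j) else 0) + (if i = 0 & k = 1 then A $$ (1, j) else 0)"
  using lookup_monomial2[of "A $$ (0, j)" 1 0 i k] lookup_monomial2[of "A $$ (1, j)" 0 1 i k]
  by (auto simp: lookup_add u)
 define c where "c l = of_nat ((?p choose l) div ?p) * A $$ (0, j) ^ l * A $$ (1, j) ^ (?p - l)" for l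
 have S: "mcoeff ?S u = (\<Sum>l\<in>{0<..<?p}. if l * m = i & (?p - l) * m = k then c l else 0)"
  unfolding lookup_sum u lookup_monomial2 c_def ..
 have S0: "mcoeff ?S u = 0" if "i + k \<noteq> q"
 proof -
  have "l * m + (?p - l) * m = q" if "l \<in> {0<..<?p}" for l
   using that by (simp add: qm flip: add_mult_distrib)
  with \<open>i + k \<noteq> q\<close> have no: "\<not> (l * m = i & (?p - l) * m = k)" if "l \<in> {0<..<?p}" for l
   using that by metis
  then show ?thesis unfolding S by (intro sum.neutral ballI) (simp only: if_False)
 qed
 consider "i + k = 1" | "i + k = q" | "i + k \<noteq> 1" "i + k \<noteq> q" by blast
 then show "mcoeff (fgl_poly n 2 A j) u = mcoeff (?L - ?S) u"
 proof cases
  case 1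
  then have "(i = 1 & k = 0) \<or> (i = 0 & k = 1)" by auto
  moreover have "i + k \<noteq> q" using 1 q2 by simp
  ultimately show ?thesis
   using exp_series_1[OF p n] S0 unfolding lookup_minus L lhs
   by (elim disjE) (simp_all del: of_int_mult of_int_power add: a)
 next
  case 2
  with ik have ik0: "i > 0" "k > 0" by auto
  have kq: "k = q - i" using 2 by simp
  have "Suc (n - 1) = n" using n by simp
  with binomial_prime_power_cong[OF p, of i "n - 1"] ik
  have cong: "int ?p ^ 2 dvd int (q choose i) - (if m dvd i then int (?p choose (i div m)) else 0)"
   unfolding q_def m_def by (simp only: less_imp_le)
  \<comment> \<open>Divisibility by \<open>p\<close> makes the quotient an integer \<open>e\<close>,
    whose residue modulo \<open>p\<close> is the coefficient sought up to sign and powers of the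
    matrix entries.\<close>
  have pdvd: "?p dvd (q choose i)"
  proof -
   from cong have "int ?p dvd int (q choose i) - (if m dvd i then int (?p choose (i div m)) else 0)"
    by (rule dvd_trans[rotated]) (simp add: power2_eq_square)
   moreover have "int ?p dvd (if m dvd i then int (?p choose (i div m)) else 0)"
   proof (cases "m dvd i")
    case True
    then obtain l where l: "i = m * l" by (elim dvdE)
    with ik0 ik m0 have "0 < l" "l < ?p" by (auto simp: qm mult.commute[of _ m])
    then have "?p dvd ?p choose l" using p by (intro dvd_choose_prime) auto
    then show ?thesis using m0 True by (simp add: l)
   qed simp
   ultimately have "int ?p dvd (int (q choose i) - (if m dvd i then int (?p choose (i div m)) else 0)) +
     (if m dvd i then int (?p choose (i div m)) else 0)" by (rule dvd_add)
   then show ?thesis by simp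
  qed
  then obtain e where e: "q choose i = ?p * e" by (elim dvdE)
  have eq: "fps_nth (exp_series ?p n) (i + k) * of_int (int (i + k choose i) * a 0 ^ i * a 1 ^ k) =
    of_int (- (int e * a 0 ^ i * a 1 ^ k))"
   unfolding 2 e using exp_series_q[OF p n] p2 by (simp add: q_def[symmetric] del: of_int_mult of_int_power) (simp add: field_simps)
  have "mcoeff (fgl_poly n 2 A j) u = of_int (- (int e * a 0 ^ i * a 1 ^ k))"
   unfolding lhs eq by (rule reduce_rat_of_int)
  then have lhs2: "mcoeff (fgl_poly n 2 A j) u = - (of_nat e * A $$ (0, j) ^ i * A $$ (1, j) ^ k)"
   by (simp only: of_int_minus of_int_mult of_int_power a of_int_of_nat_eq)
  have L0: "mcoeff ?L u = 0" unfolding L using 2 q2 by auto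
  have "of_nat e * A $$ (0, j) ^ i * A $$ (1, j) ^ k = mcoeff ?S u"
  proof (cases "m dvd i")
   case True
   then obtain l where "i = m * l" by (elim dvdE)
   then have l: "i = l * m" by (simp only: mult.commute)
   with ik0 ik m0 have l2: "0 < l" "l < ?p" by (auto simp: qm)
   then have "?p dvd ?p choose l" using p by (intro dvd_choose_prime) auto
   then obtain e' where e': "?p choose l = ?p * e'" by (elim dvdE)
   \<comment> \<open>One factor \<open>p\<close> of the congruence modulo \<open>p^2\<close> is used
     up by the denominator.\<close>
   from cong have "int ?p * int ?p dvd int ?p * (int e - int e')"
    using m0 True unfolding e by (simp add: l e' power2_eq_square right_diff_distrib)
   then have "int ?p dvd int e - int e'" using p2 by simp
   then have "(of_int (int e - int e') :: 'p mod_ring) = 0" by (rule of_int_mod_ring_eq_0)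
   then have ee': "(of_nat e :: 'p mod_ring) = of_nat e'" by simp
   have k': "k = (?p - l) * m" using 2 l2 by (simp add: l qm diff_mult_distrib)
   have "mcoeff ?S u = (\<Sum>l'\<in>{0<..<?p}. if l' = l then c l' else 0)"
    unfolding S k' l using m0 by (intro sum.cong) auto
   also have "\<dots> = c l" using l2 by simp
   \<comment> \<open>The power with exponent \<open>m\<close> acts trivially on the prime field, so
     the exponents \<open>l\<close> and \<open>l * m\<close> of the matrix entries give the same
     scalar.\<close>
   also have "\<dots> = of_nat e' * A $$ (0, j) ^ i * A $$ (1, j) ^ k"
    using p2 unfolding c_def e' k' l power_mult[of _ _ m] mod_ring_power_card_power m_def
    by (simp add: mult.commute[of _ "CARD('p) ^ (n - 1)"] power_mult mod_ring_power_card_power)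
   finally show ?thesis using ee' by simp
  next
   case False
   then have "int ?p * int ?p dvd int ?p * int e" using cong unfolding e by (simp add: power2_eq_square)
   then have "int ?p dvd int e" using p2 by simp
   then have "(of_int (int e) :: 'p mod_ring) = 0" by (rule of_int_mod_ring_eq_0)
   then have "(of_nat e :: 'p mod_ring) = 0" by simp
   moreover have "mcoeff ?S u = 0"
    unfolding S using False by (intro sum.neutral) auto
   ultimately show ?thesis by simp
  qed
  then show ?thesis unfolding lookup_minus L0 lhs2 by simp
 next
  case 3
  have "i + k < 2 * q - 1" using ik by simp
  with 3 have "fps_nth (exp_series ?p n) (i + k) = 0"
   using exp_series_small[OF p n, of "i + k"] by (simp add: q_def)
  moreover have "mcoeff ?L u = 0" unfolding L using 3 by auto
  ultimately show ?thesis using S0[OF 3(2)] unfolding lookup_minus lhs by simp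
 qed
qed

section \<open>Spanning modulo the box ideal, and Frobenius powers\<close>

definition spanned :: "nat => nat => 's set => ('s => 'a::comm_ring_1 mpoly) => 'a mpoly => bool" where
 "spanned q d S f P \<longleftrightarrow> (\<exists>c. mcong q d P (\<Sum>s\<in>S. mpoly_const (c s) * f s))"

lemma spanned_cong: "spanned q d S f Q ==> mcong q d P Q ==> spanned q d S f P"
 unfolding spanned_def using mcong_trans by blast

lemma spanned_0 [simp]: "spanned q d S f 0"
 unfolding spanned_def by (intro exI[of _ "%_. 0"]) simp

lemma spanned_add:
 assumes "spanned q d S f P" "spanned q d S f Q"
 shows "spanned q d S f (P + Q)"
proof -
 from assms obtain c c' where "mcong q d P (\<Sum>s\<in>S. mpoly_const (c s) * f s)"
  "mcong q d Q (\<Sum>s\<in>S. mpoly_const (c' s) * f s)" unfolding spanned_def by blast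
 from mcong_add[OF this] have "mcong q d (P + Q) (\<Sum>s\<in>S. mpoly_const (c s + c' s) * f s)"
  by (simp add: mpoly_const_add ring_distribs sum.distrib)
 then show ?thesis unfolding spanned_def by (rule exI[of _ "%s. c s + c' s"])
qed

lemma spanned_scale:
 assumes "spanned q d S f P"
 shows "spanned q d S f (mpoly_const a * P)"
proof -
 from assms obtain c where "mcong q d P (\<Sum>s\<in>S. mpoly_const (c s) * f s)" unfolding spanned_def by blast
 from mcong_mult[OF mcong_refl this, of "mpoly_const a"]
 have "mcong q d (mpoly_const a * P) (\<Sum>s\<in>S. mpoly_const (a * c s) * f s)"
  by (simp add: mpoly_const_mult sum_distrib_left mult.assoc)
 then show ?thesis unfolding spanned_def by (rule exI[of _ "%s. a * c s"])
qed

lemma spanned_sum: "(!!i. i \<in> A ==> spanned q d S f (g i)) ==> spanned q d S f (sum g A)"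
 by (induction A rule: infinite_finite_induct) (auto intro: spanned_add)

lemma spanned_base:
 assumes "finite S" "s \<in> S"
 shows "spanned q d S f (f s)"
 unfolding spanned_def
proof
 have "(\<Sum>t\<in>S. mpoly_const (if t = s then 1 else 0) * f t) = (\<Sum>t\<in>S. if t = s then f t else 0)"
  by (intro sum.cong) auto
 with assms show "mcong q d (f s) (\<Sum>t\<in>S. mpoly_const (if t = s then 1 else 0) * f t)" by simp
qed

lemma mpoly_const_power: "mpoly_const (a ^ k) = mpoly_const a ^ k"
 by (induction k) (simp_all add: mpoly_const_mult)

lemma CHAR_mpoly: "CHAR('p::prime_card mod_ring mpoly) = CARD('p)"
 by (simp add: CHAR_poly_mapping)

lemma frobenius_add:
 fixes P Q :: "'p::prime_card mod_ring mpoly"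
 shows "(P + Q) ^ (CARD('p) ^ k) = P ^ (CARD('p) ^ k) + Q ^ (CARD('p) ^ k)"
 using prime_card[where 'a='p] by (intro freshmans_dream') (simp_all add: CHAR_mpoly)

lemma frobenius_sum:
 fixes P :: "'i => 'p::prime_card mod_ring mpoly"
 shows "(\<Sum>i\<in>A. P i) ^ (CARD('p) ^ k) = (\<Sum>i\<in>A. P i ^ (CARD('p) ^ k))"
 using prime_card[where 'a='p] by (intro freshmans_dream_sum') (simp_all add: CHAR_mpoly)

lemma mpoly_const_frobenius:
 "mpoly_const (a :: 'p::prime_card mod_ring) ^ (CARD('p) ^ k) = mpoly_const a"
 by (simp add: mod_ring_power_card_power flip: mpoly_const_power)

lemma of_nat_card_mpoly: "of_nat CARD('p) = (0 :: 'p::prime_card mod_ring mpoly)"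
 using of_nat_CHAR[where 'a = "'p mod_ring mpoly"] by (simp only: CHAR_mpoly)

lemma mcong_pvar_power_0:
 assumes "i < d" "q \<le> k"
 shows "mcong q d (pvar i ^ k) 0"
proof -
 have "msingle i k \<notin> box q d"
  using assms by (auto simp: box_def)
 then show ?thesis by (auto simp: mcong_def pvar_power lookup_single when_def)
qed

text \<open>The nonconstant part has vanishing \<open>q\<close>-th power, and scalars are fixed by
  Frobenius. This terminates the expansion into Frobenius twists in
  \<open>spanned_perm_basis2\<close>.\<close>

lemma mcong_power_card_const:
 fixes R :: "'p::prime_card mod_ring mpoly"
 shows "mcong (CARD('p) ^ n) d (R ^ (CARD('p) ^ n)) (mpoly_const (mcoeff R 0))"
proof -
 let ?c = "mpoly_const (mcoeff R 0)"
 have "R ^ (CARD('p) ^ n) = (R - ?c) ^ (CARD('p) ^ n) + ?c ^ (CARD('p) ^ n)"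
  using frobenius_add[of "R - ?c" ?c n] by simp
 moreover have "mcong (CARD('p) ^ n) d ((R - ?c) ^ (CARD('p) ^ n)) 0"
  using mcong_power_0[of "R - ?c" n d] prime_card[where 'a='p]
  by (simp add: lookup_minus mpoly_const_def)
 ultimately show ?thesis
  using mcong_add[of _ d "(R - ?c) ^ (CARD('p) ^ n)" 0 "?c ^ (CARD('p) ^ n)" "?c ^ (CARD('p) ^ n)"]
  by (simp add: mpoly_const_frobenius)
qed

lemma mcong_box_2_sum:
 fixes P :: "'a::comm_ring_1 mpoly"
 shows "mcong q 2 P (\<Sum>m\<in>box q 2. msingle m (mcoeff P m))"
proof -
 have "mkeys (trunc q 2 P) \<subseteq> box q 2"
  using truncate_mem_box_polys[of q 2 "mcoeff P"] by (simp add: box_polys_def)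
 then have "trunc q 2 P = (\<Sum>m\<in>box q 2. msingle m (mcoeff (trunc q 2 P) m))"
  by (intro poly_mapping_eq_sum_single) auto
 also have "\<dots> = (\<Sum>m\<in>box q 2. msingle m (mcoeff P m))"
  by (intro sum.cong) (auto simp: lookup_truncate)
 finally show ?thesis using mcong_sym[OF mcong_trunc[of q 2 P]] by simp
qed

lemma single_mono2: "msingle (mono2 i k) c = mpoly_const c * (pvar 0 ^ i * pvar 1 ^ k)"
 by (subst single_eq_const_mult) (simp only: pvar_power_mult)

definition mat2_apply :: "'a::comm_semiring_1 mat => 'a \<times> 'a => 'a \<times> 'a" where
 "mat2_apply A s = (A $$ (0, 0) * fst s + A $$ (0, 1) * snd s, A $$ (1, 0) * fst s + A $$ (1, 1) * snd s)"

lemma index_mult_mat_2: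
 assumes "A \<in> carrier_mat 2 2" "B \<in> carrier_mat 2 n" "i < 2" "j < n"
 shows "(A * B) $$ (i, j) = A $$ (i, 0) * B $$ (0, j) + A $$ (i, 1) * B $$ (1, j)"
 using assms by (simp add: scalar_prod_def numeral_2_eq_2)

lemma mat2_apply_mult:
 assumes "A \<in> carrier_mat 2 2" "B \<in> carrier_mat 2 2"
 shows "mat2_apply (A * B) s = mat2_apply A (mat2_apply B s)"
proof -
 have "(A * B) $$ (i, j) = A $$ (i, 0) * B $$ (0, j) + A $$ (i, 1) * B $$ (1, j)" if "i < 2" "j < 2" for i j
  using assms that by (rule index_mult_mat_2)
 then show ?thesis by (simp add: mat2_apply_def algebra_simps del: index_mult_mat)
qed

lemma mat2_apply_one: "mat2_apply (1\<^sub>m 2) s = s"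
 by (simp add: mat2_apply_def)

lemma mat2_apply_zero [simp]: "mat2_apply A (0, 0) = (0, 0)"
 by (simp add: mat2_apply_def)

lemma bij_mat2_apply:
 assumes "A \<in> (GL 2 :: 'a::field mat set)"
 shows "bij (mat2_apply A)"
proof -
 from assms have A: "A \<in> carrier_mat 2 2" and "invertible_mat A" by (auto simp: GL_def)
 then obtain B where B: "inverts_mat A B" "inverts_mat B A" by (auto simp: invertible_mat_def)
 have "dim_row B = 2"
  using B(2) A arg_cong[OF B(2)[unfolded inverts_mat_def], of dim_col] by (metis A carrier_matD(2) index_mult_mat(3) index_one_mat(3))
 moreover have "dim_col B = 2"
  using arg_cong[OF B(1)[unfolded inverts_mat_def], of dim_col] A by simp
 ultimately have Bc: "B \<in> carrier_mat 2 2" by blast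
 have "A * B = 1\<^sub>m 2" "B * A = 1\<^sub>m 2" using B A Bc by (auto simp: inverts_mat_def)
 then have "mat2_apply A (mat2_apply B s) = s" "mat2_apply B (mat2_apply A s) = s" for s
  using mat2_apply_mult[OF A Bc, of s] mat2_apply_mult[OF Bc A, of s] by (simp_all add: mat2_apply_one)
 then show ?thesis by (intro o_bij[of "mat2_apply B"]) (auto simp: fun_eq_iff)
qed

section \<open>Rank two at the prime 2\<close>

context
 fixes n m q :: nat and ty :: "'p::prime_card itself"
 assumes p2: "CARD('p) = 2" and n: "n \<ge> 2" and m: "m = 2 ^ (n - 1)" and q: "q = 2 ^ n"
begin

abbreviation (input) "x0 \<equiv> pvar 0 :: 'p mod_ring mpoly"
abbreviation (input) "y0 \<equiv> pvar 1 :: 'p mod_ring mpoly"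

text \<open>The formal sum of \<open>fst s\<close> times \<open>x\<close> and \<open>snd s\<close>
  times \<open>y\<close>, read off from \<open>fgl_poly_2\<close> at \<open>p = 2\<close>, where
  signs are immaterial. The index \<open>s\<close> is a column vector.\<close>

definition fgl_lin2 :: "'p mod_ring \<times> 'p mod_ring => 'p mod_ring mpoly" where
 "fgl_lin2 s = mpoly_const (fst s) * x0 + mpoly_const (snd s) * y0 + mpoly_const (fst s * snd s) * (x0 ^ m * y0 ^ m)"

text \<open>The forms \<open>fgl_lin2\<close> alone would be dependent over squares: their sum over
  the three nonzero vectors is \<open>x^m y^m\<close>, a square. Adding the product of the other two
  forms repairs this and keeps the family permuted by the group.\<close>

definition basis2 :: "'p mod_ring \<times> 'p mod_ring => 'p mod_ring mpoly" where
 "basis2 s = (if s = (0, 0) then 1 else fgl_lin2 s + (\<Prod>t\<in>UNIV - {(0, 0), s}. fgl_lin2 t))"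

lemma qm: "q = 2 * m" and m2: "m \<ge> 2"
proof -
 obtain k where "n = Suc (Suc k)" using n by (metis Suc_le_D numeral_2_eq_2 Suc_le_mono)
 then show "q = 2 * m" "m \<ge> 2" by (simp_all add: q m)
qed

lemma two_eq_0: "(2 :: 'p mod_ring mpoly) = 0"
 using of_nat_card_mpoly[where 'p='p] by (simp add: p2)

lemma fgl_lin2_mpolys: "fgl_lin2 s \<in> mpolys 2"
 unfolding fgl_lin2_def by (intro mpolys_add mpolys_mult mpolys_power mpolys_const mpolys_pvar) auto

lemma basis2_mpolys: "basis2 s \<in> mpolys 2"
 unfolding basis2_def by (auto intro!: mpolys_add mpolys_prod fgl_lin2_mpolys)

lemma fgl_poly_lin2: "mcong q 2 (fgl_poly n 2 A j) (fgl_lin2 (A $$ (0, j), A $$ (1, j)))"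
proof -
 have set: "{0<..<2} = {1::nat}" by auto
 have neg: "- P = P" for P :: "'p mod_ring mpoly"
  using two_eq_0 by (metis mult_2 mult_zero_left add_eq_0_iff)
 have sub: "a - b = a + b" for a b :: "'p mod_ring mpoly"
  using neg[of b] by (metis diff_conv_add_uminus)
 show ?thesis
  using fgl_poly_2[of n A j] n unfolding sub p2 set fgl_lin2_def fst_conv snd_conv unfolding q m by simp
qed

text \<open>The exponent \<open>m\<close> is a power of Frobenius. The mixed term acquires an
  \<open>x\<close>-exponent \<open>m * m\<close>, which is at least \<open>q = 2 * m\<close> because
  \<open>m \<ge> 2\<close>; this is where \<open>n = 1\<close> is excluded.\<close>

lemma fgl_lin2_power: "mcong q 2 (fgl_lin2 s ^ m) (mpoly_const (fst s) * x0 ^ m + mpoly_const (snd s) * y0 ^ m)"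
proof -
 have fr: "(P + Q) ^ m = P ^ m + Q ^ m" and cs: "mpoly_const c ^ m = mpoly_const c"
  for P Q :: "'p mod_ring mpoly" and c :: "'p mod_ring"
  using frobenius_add[of P Q "n - 1"] mpoly_const_frobenius[of c "n - 1"] by (simp_all add: m p2)
 have "mcong q 2 ((x0 ^ m) ^ m) 0"
  unfolding power_mult[symmetric] using m2 by (intro mcong_pvar_power_0) (simp_all add: qm)
 then have "mcong q 2 (mpoly_const (fst s) * x0 ^ m + mpoly_const (snd s) * y0 ^ m
    + mpoly_const (fst s * snd s) * ((x0 ^ m) ^ m * (y0 ^ m) ^ m))
   (mpoly_const (fst s) * x0 ^ m + mpoly_const (snd s) * y0 ^ m + mpoly_const (fst s * snd s) * (0 * (y0 ^ m) ^ m))"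
  by (intro mcong_add mcong_mult mcong_refl)
 then show ?thesis
  by (simp add: fgl_lin2_def fr cs power_mult_distrib)
qed

lemma square_0: "mcong q 2 (x0 ^ m * x0 ^ m) 0" "mcong q 2 (y0 ^ m * y0 ^ m) 0"
 by (simp_all add: mcong_pvar_power_0 qm flip: power_add mult_2)

text \<open>Expanding the formal sum of two formal sums reproduces the formal sum with matrix
  coefficients, up to multiples of \<open>x^(2m)\<close> and \<open>y^(2m)\<close>, which
  vanish.\<close>

lemma subst_fgl_lin2:
 "mcong q 2 (mpoly_subst (fgl_poly n 2 A) (fgl_lin2 s)) (fgl_lin2 (mat2_apply A s))"
proof -
 let ?c = "mpoly_const :: 'p mod_ring => _"
 let ?X = "x0 ^ m" and ?Y = "y0 ^ m"
 let ?s = "?c (fst s)" and ?t = "?c (snd s)"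
 let ?a = "?c (A $$ (0, 0))" and ?b = "?c (A $$ (0, 1))" and ?e = "?c (A $$ (1, 0))" and ?d = "?c (A $$ (1, 1))"
 \<comment> \<open>Scalars of the field with two elements are idempotent.\<close>
 have sq: "?s * ?s = ?s" "?t * ?t = ?t"
  using mpoly_const_frobenius[of "fst s" 1] mpoly_const_frobenius[of "snd s" 1]
  by (simp_all add: p2 power2_eq_square)
 have "mpoly_subst (fgl_poly n 2 A) (fgl_lin2 s) =
  ?s * fgl_poly n 2 A 0 + ?t * fgl_poly n 2 A 1 + ?s * ?t * (fgl_poly n 2 A 0 ^ m * fgl_poly n 2 A 1 ^ m)"
  by (simp add: fgl_lin2_def mpoly_subst_add mpoly_subst_mult mpoly_subst_power mpoly_const_mult)
 also have "mcong q 2 \<dots> (?s * fgl_lin2 (A $$ (0, 0), A $$ (1, 0)) + ?t * fgl_lin2 (A $$ (0, 1), A $$ (1, 1))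
   + ?s * ?t * ((?a * ?X + ?e * ?Y) * (?b * ?X + ?d * ?Y)))"
  using mcong_trans[OF mcong_power[OF fgl_poly_lin2] fgl_lin2_power, of A 0]
   mcong_trans[OF mcong_power[OF fgl_poly_lin2] fgl_lin2_power, of A 1]
  by (intro mcong_add mcong_mult mcong_refl fgl_poly_lin2) simp_all
 also have "?s * fgl_lin2 (A $$ (0, 0), A $$ (1, 0)) + ?t * fgl_lin2 (A $$ (0, 1), A $$ (1, 1))
   + ?s * ?t * ((?a * ?X + ?e * ?Y) * (?b * ?X + ?d * ?Y)) =
   fgl_lin2 (mat2_apply A s) + (?X * ?X * (?s * ?t * ?a * ?b) + ?Y * ?Y * (?s * ?t * ?e * ?d))"
 proof -
  have "fgl_lin2 (mat2_apply A s) = (?a * ?s + ?b * ?t) * x0 + (?e * ?s + ?d * ?t) * y0 +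
    (?a * ?e * (?s * ?s) + ?a * ?d * ?s * ?t + ?b * ?e * ?s * ?t + ?b * ?d * (?t * ?t)) * (?X * ?Y)"
   by (simp add: fgl_lin2_def mat2_apply_def mpoly_const_mult mpoly_const_add algebra_simps)
  then show ?thesis
   unfolding sq by (simp add: fgl_lin2_def mpoly_const_mult algebra_simps)
 qed
 also have "mcong q 2 \<dots> (fgl_lin2 (mat2_apply A s) + (0 * (?s * ?t * ?a * ?b) + 0 * (?s * ?t * ?e * ?d)))"
  by (intro mcong_add mcong_mult mcong_refl square_0)
 finally show ?thesis by simp
qed

text \<open>An invertible matrix permutes the nonzero vectors, hence also the factors of the product
  over those different from \<open>s\<close>.\<close>

lemma subst_basis2:
 assumes A: "A \<in> GL 2"
 shows "mcong q 2 (mpoly_subst (fgl_poly n 2 A) (basis2 s)) (basis2 (mat2_apply A s))"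
proof (cases "s = (0, 0)")
 case True
 then show ?thesis by (simp add: basis2_def)
next
 case False
 have inj: "inj (mat2_apply A)" and surj: "surj (mat2_apply A)"
  using bij_mat2_apply[OF A] by (auto simp: bij_def)
 have nz: "mat2_apply A s \<noteq> (0, 0)"
  using False inj_eq[OF inj, of s "(0, 0)"] by simp
 have img: "mat2_apply A ` (UNIV - {(0, 0), s}) = UNIV - {(0, 0), mat2_apply A s}"
  using inj surj by (simp add: image_set_diff)
 have "(\<Prod>t\<in>UNIV - {(0, 0), mat2_apply A s}. fgl_lin2 t) = (\<Prod>t\<in>UNIV - {(0, 0), s}. fgl_lin2 (mat2_apply A t))"
  unfolding img[symmetric] by (subst prod.reindex) (use inj in \<open>auto intro: inj_on_subset\<close>)
 moreover have "mcong q 2 (mpoly_subst (fgl_poly n 2 A) (basis2 s))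
   (fgl_lin2 (mat2_apply A s) + (\<Prod>t\<in>UNIV - {(0, 0), s}. fgl_lin2 (mat2_apply A t)))"
  using False unfolding basis2_def by (simp add: mpoly_subst_add mpoly_subst_prod)
   (intro mcong_add mcong_prod subst_fgl_lin2)
 ultimately show ?thesis using nz by (simp add: basis2_def)
qed

lemma UNIV_pairs: "(UNIV :: ('p mod_ring \<times> 'p mod_ring) set) = {(0, 0), (1, 0), (0, 1), (1, 1)}"
proof -
 have "{0, 1} = (UNIV :: 'p mod_ring set)"
  by (rule card_subset_eq) (simp_all add: p2)
 then have "(UNIV :: ('p mod_ring \<times> 'p mod_ring) set) = {0, 1} \<times> {0, 1}" by simp
 also have "{0, 1} \<times> {0, 1} = {(0, 0), (1, 0), (0, 1), (1, 1 :: 'p mod_ring)}" by auto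
 finally show ?thesis .
qed

lemma basis2_values:
 defines "u \<equiv> x0 ^ m * y0 ^ m"
 shows "basis2 (0, 0) = 1" "basis2 (1, 0) = x0 + y0 * (x0 + y0 + u)"
  "basis2 (0, 1) = y0 + x0 * (x0 + y0 + u)" "basis2 (1, 1) = (x0 + y0 + u) + x0 * y0"
proof -
 have sets: "UNIV - {(0, 0), (1, 0)} = ({(0, 1), (1, 1)} :: ('p mod_ring \<times> 'p mod_ring) set)"
  "UNIV - {(0, 0), (0, 1)} = ({(1, 0), (1, 1)} :: ('p mod_ring \<times> 'p mod_ring) set)"
  "UNIV - {(0, 0), (1, 1)} = ({(1, 0), (0, 1)} :: ('p mod_ring \<times> 'p mod_ring) set)"
  unfolding UNIV_pairs by auto
 show "basis2 (0, 0) = 1" "basis2 (1, 0) = x0 + y0 * (x0 + y0 + u)"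
  "basis2 (0, 1) = y0 + x0 * (x0 + y0 + u)" "basis2 (1, 1) = (x0 + y0 + u) + x0 * y0"
  by (simp_all add: basis2_def sets fgl_lin2_def u_def)
qed

text \<open>Generation by the four polynomials over the subring of squares: one step of a
  decomposition into Frobenius twists.\<close>

definition square_spanned :: "'p mod_ring mpoly => bool" where
 "square_spanned P \<longleftrightarrow> (\<exists>R. (\<forall>s. R s \<in> mpolys 2) & mcong q 2 P (\<Sum>s\<in>UNIV. basis2 s * (R s) ^ 2))"

lemma square_spanned_cong: "square_spanned Q ==> mcong q 2 P Q ==> square_spanned P"
 unfolding square_spanned_def using mcong_trans by blast

lemma square_spanned_add:
 assumes "square_spanned P" "square_spanned Q"
 shows "square_spanned (P + Q)"
proof -
 from assms obtain R R' where R: "!!s. R s \<in> mpolys 2" "mcong q 2 P (\<Sum>s\<in>UNIV. basis2 s * (R s) ^ 2)"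
  and R': "!!s. R' s \<in> mpolys 2" "mcong q 2 Q (\<Sum>s\<in>UNIV. basis2 s * (R' s) ^ 2)"
  unfolding square_spanned_def by blast
 have "(R s + R' s) ^ 2 = (R s) ^ 2 + (R' s) ^ 2" for s
  using frobenius_add[of "R s" "R' s" 1] by (simp add: p2)
 then have "(\<Sum>s\<in>UNIV. basis2 s * (R s) ^ 2) + (\<Sum>s\<in>UNIV. basis2 s * (R' s) ^ 2) =
   (\<Sum>s\<in>UNIV. basis2 s * (R s + R' s) ^ 2)"
  by (simp add: ring_distribs sum.distrib)
 with mcong_add[OF R(2) R'(2)] have "mcong q 2 (P + Q) (\<Sum>s\<in>UNIV. basis2 s * (R s + R' s) ^ 2)" by simp
 then show ?thesis unfolding square_spanned_def
  by (intro exI[of _ "%s. R s + R' s"]) (simp add: mpolys_add R R')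
qed

lemma square_spanned_mult:
 assumes "square_spanned P" "T \<in> mpolys 2"
 shows "square_spanned (P * T ^ 2)"
proof -
 from assms obtain R where R: "!!s. R s \<in> mpolys 2" "mcong q 2 P (\<Sum>s\<in>UNIV. basis2 s * (R s) ^ 2)"
  unfolding square_spanned_def by blast
 have "(\<Sum>s\<in>UNIV. basis2 s * (R s) ^ 2) * T ^ 2 = (\<Sum>s\<in>UNIV. basis2 s * (R s * T) ^ 2)"
  by (simp add: sum_distrib_right power_mult_distrib mult.assoc)
 with mcong_mult[OF R(2) mcong_refl[of q 2 "T ^ 2"]]
 have "mcong q 2 (P * T ^ 2) (\<Sum>s\<in>UNIV. basis2 s * (R s * T) ^ 2)" by simp
 then show ?thesis unfolding square_spanned_def
  by (intro exI[of _ "%s. R s * T"]) (simp add: mpolys_mult R assms)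
qed

lemma square_spanned_basis2: "square_spanned (basis2 s)"
 unfolding square_spanned_def
proof (intro exI[of _ "%t. if t = s then 1 else 0"] conjI allI)
 have "(\<Sum>t\<in>UNIV. basis2 t * (if t = s then 1 else 0) ^ 2) = (\<Sum>t\<in>UNIV. if t = s then basis2 t else 0)"
  by (intro sum.cong) auto
 then show "mcong q 2 (basis2 s) (\<Sum>t\<in>UNIV. basis2 t * (if t = s then 1 else 0) ^ 2)" by simp
qed simp

lemma square_spanned_square: "T \<in> mpolys 2 ==> square_spanned (T ^ 2)"
 using square_spanned_mult[OF square_spanned_basis2[of "(0, 0)"], of T] by (simp add: basis2_values)

text \<open>Modulo squares the four elements \<open>basis2 s\<close> are \<open>1, x + xy, y + xy, x + y + xy\<close>, up to multiples of the
  square \<open>u\<close> of square zero; so multiplying by \<open>u\<close> first removes the error terms.\<close>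

lemma square_spanned_low:
 "square_spanned (x0 * y0)" "square_spanned x0" "square_spanned y0"
proof -
 let ?x = "x0" and ?y = "y0"
 \<comment> \<open>A square root of \<open>x^m y^m\<close>; it exists because \<open>m\<close> is
   even.\<close>
 define e where "e = ?x ^ (2 ^ (n - 2)) * ?y ^ (2 ^ (n - 2))"
 define u where "u = ?x ^ m * ?y ^ m"
 have "m = 2 ^ (n - 2) * 2"
 proof -
  obtain k where "n = Suc (Suc k)" using n by (metis Suc_le_D numeral_2_eq_2 Suc_le_mono)
  then show ?thesis by (simp add: m)
 qed
 then have u: "u = e ^ 2"
  unfolding u_def e_def power_mult_distrib by (simp only: power_mult)
 have e: "e \<in> mpolys 2" unfolding e_def by (intro mpolys_mult mpolys_power mpolys_pvar) auto
 have xy: "?x \<in> mpolys 2" "?y \<in> mpolys 2" by (auto intro: mpolys_pvar)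
 have uu: "mcong q 2 (u * u) 0"
 proof -
  have "u * u = (?x ^ m * ?x ^ m) * (?y ^ m * ?y ^ m)" by (simp add: u_def ac_simps)
  also have "mcong q 2 \<dots> (0 * (?y ^ m * ?y ^ m))"
   by (intro mcong_mult square_0 mcong_refl)
  finally show ?thesis by simp
 qed
 have mult_u: "square_spanned (P * u)" if "square_spanned P" for P
  using square_spanned_mult[OF that e] by (simp add: u)
 have two: "P + P = 0" for P :: "'p mod_ring mpoly"
  using two_eq_0 by (metis mult_2 mult_zero_left)
 have drop: "square_spanned P" if "square_spanned (P + u * u * Q)" for P Q
  using mcong_sym[OF mcong_add[OF mcong_refl[of q 2 P] mcong_mult[OF uu mcong_refl[of q 2 Q]]]]
  by (intro square_spanned_cong[OF that]) simp
 have cancel: "square_spanned P" if "square_spanned (P + Q)" "square_spanned Q" for P Q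
  using square_spanned_add[OF that] by (simp add: add.assoc two)
 note b = basis2_values[folded u_def]
 \<comment> \<open>The squares \<open>x^2\<close>, \<open>y^2\<close> and \<open>u\<close> can be
   adjusted freely. What then remains of the sum of the three nonconstant basis elements is
   \<open>x y\<close> plus error terms with a factor \<open>u\<close>.\<close>
 have s1: "square_spanned (?x * ?y + ?x * u + ?y * u)"
 proof -
  have "square_spanned (basis2 (1, 0) + basis2 (0, 1) + basis2 (1, 1) + ?x ^ 2 + ?y ^ 2 + e ^ 2)"
   by (intro square_spanned_add square_spanned_basis2 square_spanned_square xy e)
  also have "basis2 (1, 0) + basis2 (0, 1) + basis2 (1, 1) + ?x ^ 2 + ?y ^ 2 + e ^ 2 =
    (?x * ?y + ?x * u + ?y * u) + ((?x + ?y + ?x * ?y + ?x ^ 2 + ?y ^ 2 + u) + (?x + ?y + ?x * ?y + ?x ^ 2 + ?y ^ 2 + u))"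
   unfolding b u[symmetric] by (simp add: algebra_simps power2_eq_square)
  finally show ?thesis by (simp only: two add_0_right)
 qed
 have s2: "square_spanned (?x + ?x * ?y + ?y * u)"
 proof -
  have "square_spanned (basis2 (1, 0) + ?y ^ 2)"
   by (intro square_spanned_add square_spanned_basis2 square_spanned_square xy)
  also have "basis2 (1, 0) + ?y ^ 2 = (?x + ?x * ?y + ?y * u) + (?y ^ 2 + ?y ^ 2)"
   unfolding b by (simp add: algebra_simps power2_eq_square)
  finally show ?thesis by (simp only: two add_0_right)
 qed
 have s3: "square_spanned (?y + ?x * ?y + ?x * u)"
 proof -
  have "square_spanned (basis2 (0, 1) + ?x ^ 2)"
   by (intro square_spanned_add square_spanned_basis2 square_spanned_square xy)
  also have "basis2 (0, 1) + ?x ^ 2 = (?y + ?x * ?y + ?x * u) + (?x ^ 2 + ?x ^ 2)"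
   unfolding b by (simp add: algebra_simps power2_eq_square)
  finally show ?thesis by (simp only: two add_0_right)
 qed
 \<comment> \<open>After multiplication by \<open>u\<close> the error terms contain
   \<open>u * u\<close> and vanish.\<close>
 have xyu: "square_spanned (?x * ?y * u)"
  by (rule drop[of _ "?x + ?y"]) (use mult_u[OF s1] in \<open>simp add: algebra_simps\<close>)
 have xu: "square_spanned (?x * u)"
  by (rule cancel[OF drop[of _ "?y"] xyu]) (use mult_u[OF s2] in \<open>simp add: algebra_simps\<close>)
 have yu: "square_spanned (?y * u)"
  by (rule cancel[OF drop[of _ "?x"] xyu]) (use mult_u[OF s3] in \<open>simp add: algebra_simps\<close>)
 show xy': "square_spanned (?x * ?y)"
  using cancel[OF cancel[OF s1 yu] xu] .
 show "square_spanned ?x" using cancel[OF cancel[OF s2 yu] xy'] .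
 show "square_spanned ?y" using cancel[OF cancel[OF s3 xu] xy'] .
qed

text \<open>Every monomial is one of \<open>1, x, y, x y\<close> times a square, and scalars are
  their own squares.\<close>

lemma square_spanned_all: "square_spanned P"
proof -
 have mono: "square_spanned (mpoly_const c * (x0 ^ i * y0 ^ k))" for c i k
 proof -
  have xy: "x0 \<in> mpolys 2" "y0 \<in> mpolys 2" by (auto intro: mpolys_pvar)
  have "i mod 2 = 0 \<or> i mod 2 = 1" "k mod 2 = 0 \<or> k mod 2 = 1" by auto
  then have "square_spanned (x0 ^ (i mod 2) * y0 ^ (k mod 2))"
   using square_spanned_low square_spanned_square[of 1] by (elim disjE) simp_all
  then have "square_spanned (x0 ^ (i mod 2) * y0 ^ (k mod 2) * (mpoly_const c * (x0 ^ (i div 2) * y0 ^ (k div 2))) ^ 2)"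
   by (intro square_spanned_mult mpolys_mult mpolys_power mpolys_const xy)
  moreover have "(mpoly_const c * (x0 ^ (i div 2) * y0 ^ (k div 2))) ^ 2 =
    mpoly_const c * (x0 ^ (2 * (i div 2)) * y0 ^ (2 * (k div 2)))"
   using mpoly_const_frobenius[of c 1] by (simp add: p2 power_mult_distrib mult.commute[of 2] power_mult)
  moreover have "x0 ^ i = x0 ^ (i mod 2) * x0 ^ (2 * (i div 2))" "y0 ^ k = y0 ^ (k mod 2) * y0 ^ (2 * (k div 2))"
   by (simp_all flip: power_add)
  ultimately show ?thesis by (simp only: ac_simps)
 qed
 have zero: "square_spanned 0" using square_spanned_square[of 0] by simp
 have "square_spanned (\<Sum>m\<in>A. msingle m (mcoeff P m))" if "finite A" "A \<subseteq> box q 2" for A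
  using that
 proof (induction A rule: finite_induct)
  case (insert u A)
  then obtain i k where "u = mono2 i k" using box_2E[of u q] by blast
  then have "square_spanned (msingle u (mcoeff P u))"
   using mono by (simp only: single_mono2)
  with insert show ?case by (simp add: square_spanned_add)
 qed (simp add: zero)
 from this[of "box q 2"] show ?thesis
  using square_spanned_cong[OF _ mcong_box_2_sum[of q P]] by simp
qed

text \<open>Column \<open>i\<close> enters through the \<open>i\<close>-th Frobenius twist, so that
  the family is the tensor product of the twists of \<open>basis2\<close>.\<close>

definition perm_basis2 :: "'p mod_ring mat => 'p mod_ring mpoly" where
 "perm_basis2 \<Phi> = (\<Prod>i<n. basis2 (\<Phi> $$ (0, i), \<Phi> $$ (1, i)) ^ (2 ^ i))"

lemma subst_perm_basis2:
 assumes A: "A \<in> GL 2" and \<Phi>: "\<Phi> \<in> carrier_mat 2 n"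
 shows "mcong q 2 (mpoly_subst (fgl_poly n 2 A) (perm_basis2 \<Phi>)) (perm_basis2 (A * \<Phi>))"
proof -
 have Ac: "A \<in> carrier_mat 2 2" using A by (simp add: GL_def)
 have "mat2_apply A (\<Phi> $$ (0, i), \<Phi> $$ (1, i)) = ((A * \<Phi>) $$ (0, i), (A * \<Phi>) $$ (1, i))" if "i < n" for i
  using index_mult_mat_2[OF Ac \<Phi> _ that] by (simp add: mat2_apply_def)
 then have "perm_basis2 (A * \<Phi>) = (\<Prod>i<n. basis2 (mat2_apply A (\<Phi> $$ (0, i), \<Phi> $$ (1, i))) ^ (2 ^ i))"
  unfolding perm_basis2_def by (intro prod.cong) simp_all
 moreover have "mcong q 2 (mpoly_subst (fgl_poly n 2 A) (perm_basis2 \<Phi>))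
   (\<Prod>i<n. basis2 (mat2_apply A (\<Phi> $$ (0, i), \<Phi> $$ (1, i))) ^ (2 ^ i))"
  unfolding perm_basis2_def mpoly_subst_prod mpoly_subst_power
  by (intro mcong_prod mcong_power subst_basis2 A)
 ultimately show ?thesis by simp
qed

text \<open>A polynomial is expanded with square coefficients, the roots of these are expanded
  again, and so on. After \<open>k\<close> rounds the columns below \<open>k\<close> are chosen and
  the remaining coefficient is a \<open>2^k\<close>-th power; at \<open>k = n\<close> it is a
  scalar.\<close>

lemma spanned_perm_basis2: "spanned q 2 (carrier_mat 2 n) perm_basis2 P"
proof -
 have fr: "(\<Sum>s\<in>A. R s) ^ (2 ^ k) = (\<Sum>s\<in>A. R s ^ (2 ^ k))" for A :: "('p mod_ring \<times> 'p mod_ring) set" and R :: "_ => 'p mod_ring mpoly" and k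
  using frobenius_sum[of R A k] by (simp add: p2)
 have step: "spanned q 2 (carrier_mat 2 n) perm_basis2 ((\<Prod>i<k. basis2 (t i) ^ (2 ^ i)) * R ^ (2 ^ k))"
  if "k \<le> n" for k t R
  using that
 proof (induction "n - k" arbitrary: k t R)
  case 0
  then have kn: "k = n" by simp
  let ?M = "mat 2 n (%(r, i). if r = 0 then fst (t i) else snd (t i))"
  have "perm_basis2 ?M = (\<Prod>i<n. basis2 (t i) ^ (2 ^ i))"
   unfolding perm_basis2_def by (intro prod.cong) auto
  moreover have "spanned q 2 (carrier_mat 2 n) perm_basis2 (mpoly_const (mcoeff R 0) * perm_basis2 ?M)"
   by (intro spanned_scale spanned_base card_carrier_mat_finite(1)) simp
  ultimately have "spanned q 2 (carrier_mat 2 n) perm_basis2 ((\<Prod>i<n. basis2 (t i) ^ (2 ^ i)) * mpoly_const (mcoeff R 0))"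
   by (simp add: mult.commute)
  moreover have "mcong q 2 (R ^ (2 ^ n)) (mpoly_const (mcoeff R 0))"
   using mcong_power_card_const[where n=n and d=2 and R=R] by (simp add: p2 q)
  ultimately show ?case
   unfolding kn by (rule spanned_cong[OF _ mcong_mult[OF mcong_refl]])
 next
  case (Suc l)
  obtain R' where R': "mcong q 2 R (\<Sum>s\<in>UNIV. basis2 s * (R' s) ^ 2)"
   using square_spanned_all[of R] unfolding square_spanned_def by blast
  have "spanned q 2 (carrier_mat 2 n) perm_basis2 ((\<Prod>i<k. basis2 (t i) ^ (2 ^ i)) * (basis2 s * (R' s) ^ 2) ^ (2 ^ k))" for s
  proof -
   \<comment> \<open>The summand with index \<open>s\<close> makes \<open>s\<close> the column
     \<open>k\<close>.\<close>
   have "spanned q 2 (carrier_mat 2 n) perm_basis2 ((\<Prod>i<Suc k. basis2 ((t(k := s)) i) ^ (2 ^ i)) * R' s ^ (2 ^ Suc k))"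
    using Suc.hyps(2) Suc.prems by (intro Suc.hyps(1)) auto
   moreover have "(\<Prod>i<k. basis2 ((t(k := s)) i) ^ (2 ^ i)) = (\<Prod>i<k. basis2 (t i) ^ (2 ^ i))"
    by (intro prod.cong) auto
   ultimately show ?thesis by (simp add: power_mult_distrib mult.assoc power_mult)
  qed
  then have "spanned q 2 (carrier_mat 2 n) perm_basis2
    (\<Sum>s\<in>UNIV. (\<Prod>i<k. basis2 (t i) ^ (2 ^ i)) * (basis2 s * (R' s) ^ 2) ^ (2 ^ k))"
   by (intro spanned_sum)
  moreover have "mcong q 2 ((\<Prod>i<k. basis2 (t i) ^ (2 ^ i)) * R ^ (2 ^ k))
    (\<Sum>s\<in>UNIV. (\<Prod>i<k. basis2 (t i) ^ (2 ^ i)) * (basis2 s * (R' s) ^ 2) ^ (2 ^ k))"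
   using mcong_mult[OF mcong_refl mcong_power[OF R', of "2 ^ k"], of "\<Prod>i<k. basis2 (t i) ^ (2 ^ i)"]
   unfolding fr sum_distrib_left .
  ultimately show ?case by (rule spanned_cong)
 qed
 from step[of 0 undefined P] show ?thesis by simp
qed

theorem isomorphic_rank2_prime2:
 "isomorphic_modules (GL 2 :: 'p mod_ring mat set) (KBV n 2) (KBV_act n 2) (KHom n 2) (KHom_act 2)"
proof (rule isomorphic_KBV_KHom[where f = perm_basis2])
 show "1 \<le> n" using n by simp
 show "GL 2 \<subseteq> carrier_mat 2 2" by (auto simp: GL_def)
 show "perm_basis2 \<Phi> \<in> mpolys 2" for \<Phi>
  unfolding perm_basis2_def by (intro mpolys_prod mpolys_power basis2_mpolys)
 show "mcong (CARD('p) ^ n) 2 (mpoly_subst (fgl_poly n 2 A) (perm_basis2 \<Phi>)) (perm_basis2 (A * \<Phi>))"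
  if "A \<in> GL 2" "\<Phi> \<in> carrier_mat 2 n" for A \<Phi>
  using subst_perm_basis2[OF that] by (simp add: q p2)
 show "\<exists>c. mcong (CARD('p) ^ n) 2 (msingle m 1) (\<Sum>\<Phi>\<in>carrier_mat 2 n. mpoly_const (c \<Phi>) * perm_basis2 \<Phi>)" for m
  using spanned_perm_basis2[of "msingle m 1"] by (simp add: q p2 spanned_def)
qed

end

section \<open>Integrality of the Artin--Hasse exponential\<close>

definition p_integral :: "nat => rat => bool" where
 "p_integral p r \<longleftrightarrow> (\<exists>a b :: int. \<not> int p dvd b & r = of_int a / of_int b)"

lemma p_integralI: "\<not> int p dvd b ==> r = of_int a / of_int b ==> p_integral p r"
 unfolding p_integral_def by blast

context
 fixes p :: nat
 assumes p: "prime p"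
begin

lemma p_integral_of_int [simp]: "p_integral p (of_int a)"
 by (rule p_integralI[of _ 1 _ a]) (use prime_gt_1_nat[OF p] in auto)

lemma p_integral_0 [simp]: "p_integral p 0" and p_integral_1 [simp]: "p_integral p 1"
 using p_integral_of_int[of 0] p_integral_of_int[of 1] by simp_all

lemma p_integral_add:
 assumes "p_integral p r" "p_integral p s"
 shows "p_integral p (r + s)"
proof -
 from assms obtain a b c d where *: "\<not> int p dvd b" "\<not> int p dvd d" "r = of_int a / of_int b" "s = of_int c / of_int d"
  unfolding p_integral_def by blast
 have "b \<noteq> 0" "d \<noteq> 0" using * by auto
 then have "r + s = of_int (a * d + c * b) / of_int (b * d)"
  using * by (simp add: field_simps)
 moreover have "\<not> int p dvd b * d" using * p by (simp add: prime_dvd_mult_iff)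
 ultimately show ?thesis by (rule p_integralI[rotated])
qed

lemma p_integral_mult:
 assumes "p_integral p r" "p_integral p s"
 shows "p_integral p (r * s)"
proof -
 from assms obtain a b c d where *: "\<not> int p dvd b" "\<not> int p dvd d" "r = of_int a / of_int b" "s = of_int c / of_int d"
  unfolding p_integral_def by blast
 then have "r * s = of_int (a * c) / of_int (b * d)" by simp
 moreover have "\<not> int p dvd b * d" using * p by (simp add: prime_dvd_mult_iff)
 ultimately show ?thesis by (rule p_integralI[rotated])
qed

lemma p_integral_uminus: "p_integral p r ==> p_integral p (- r)"
 using p_integral_mult[OF p_integral_of_int[of "-1"], of r] by simp

lemma p_integral_diff: "p_integral p r ==> p_integral p s ==> p_integral p (r - s)"
 using p_integral_add[of r "- s"] by (simp add: p_integral_uminus)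

lemma p_integral_sum: "(!!i. i \<in> A ==> p_integral p (f i)) ==> p_integral p (sum f A)"
 by (induction A rule: infinite_finite_induct) (auto intro: p_integral_add)

lemma p_integral_prod: "(!!i. i \<in> A ==> p_integral p (f i)) ==> p_integral p (prod f A)"
 by (induction A rule: infinite_finite_induct) (auto intro: p_integral_mult)

lemma p_integral_power: "p_integral p r ==> p_integral p (r ^ k)"
 by (induction k) (auto intro: p_integral_mult)

lemma p_integral_fps_power:
 assumes "!!k. p_integral p (fps_nth f k)"
 shows "p_integral p (fps_nth (f ^ i) k)"
proof (induction i arbitrary: k)
 case 0
 then show ?case by (cases k) simp_all
next
 case (Suc i)
 then show ?case using assms unfolding power_Suc fps_mult_nth by (intro p_integral_sum p_integral_mult)
qed

text \<open>Only every \<open>p\<close>-th factor of the factorial is divisible by \<open>p\<close>: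
  the recursion behind Legendre's formula.\<close>

lemma multiplicity_fact:
 shows "r < p ==> multiplicity p (fact (p * m + r) :: nat) = multiplicity p (fact (p * m) :: nat)"
  and "multiplicity p (fact (p * m) :: nat) = m + multiplicity p (fact m :: nat)"
proof -
 have pe: "prime_elem p" using p by simp
 have A: "multiplicity p (fact (p * m + r) :: nat) = multiplicity p (fact (p * m) :: nat)" if "r < p" for m r
  using that
 proof (induction r)
  case (Suc r)
  have "\<not> p dvd p * m + Suc r"
   using Suc.prems by (metis dvd_add_right_iff dvd_triv_left nat_dvd_not_less zero_less_Suc)
  then have "multiplicity p (p * m + Suc r) = 0" by (rule not_dvd_imp_multiplicity_0)
  moreover have e: "(fact (p * m + Suc r) :: nat) = (p * m + Suc r) * fact (p * m + r)" by simp
  moreover have "multiplicity p ((p * m + Suc r) * fact (p * m + r) :: nat) =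
    multiplicity p (p * m + Suc r) + multiplicity p (fact (p * m + r) :: nat)"
   by (rule prime_elem_multiplicity_mult_distrib[OF pe]) simp_all
  ultimately show ?case using Suc.IH Suc.prems unfolding e by linarith
 qed simp
 then show "r < p ==> multiplicity p (fact (p * m + r) :: nat) = multiplicity p (fact (p * m) :: nat)" .
 show "multiplicity p (fact (p * m) :: nat) = m + multiplicity p (fact m :: nat)"
 proof (induction m)
  case (Suc m)
  have p0: "p > 0" using prime_gt_0_nat[OF p] .
  have f1: "(fact (p * Suc m) :: nat) = (p * Suc m) * fact (p * m + (p - 1))"
  proof -
   have "p * Suc m = Suc (p * m + (p - 1))" using p0 by simp
   then show ?thesis by (metis fact_Suc of_nat_id)
  qed
  have f2: "multiplicity p (p * Suc m * fact (p * m + (p - 1)) :: nat) =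
    (multiplicity p p + multiplicity p (Suc m)) + multiplicity p (fact (p * m + (p - 1)) :: nat)"
   using p0 by (simp add: prime_elem_multiplicity_mult_distrib[OF pe] del: mult_Suc_right)
  have f3: "multiplicity p (fact (Suc m) :: nat) = multiplicity p (Suc m) + multiplicity p (fact m :: nat)"
  proof -
   have e: "(fact (Suc m) :: nat) = Suc m * fact m" by simp
   show ?thesis unfolding e by (rule prime_elem_multiplicity_mult_distrib[OF pe]) simp_all
  qed
  have f4: "multiplicity p p = 1" using p by simp
  have f5: "multiplicity p (fact (p * m + (p - 1)) :: nat) = multiplicity p (fact (p * m) :: nat)"
   using A[of "p - 1" m] p0 by simp
  show ?case unfolding f1 f2 f3 f4 f5 Suc by simp
 qed simp
qed

text \<open>For \<open>m = k div p\<close> positive the multiplicity is \<open>m\<close> plus that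
  for \<open>m\<close>, hence at most \<open>2m - 1\<close> by induction, while
  \<open>2m \<le> k\<close>.\<close>

lemma multiplicity_fact_le: "k > 0 ==> multiplicity p (fact k :: nat) \<le> k - 1"
proof (induction k rule: less_induct)
 case (less k)
 have p2: "p \<ge> 2" using p by (rule prime_ge_2_nat)
 define m r where "m = k div p" and "r = k mod p"
 have k: "k = p * m + r" and r: "r < p" using p2 by (simp_all add: m_def r_def)
 have mk: "multiplicity p (fact k :: nat) = m + multiplicity p (fact m :: nat)"
  unfolding k using multiplicity_fact(1)[OF r, of m] multiplicity_fact(2)[of m] by simp
 show ?case
 proof (cases "m = 0")
  case False
  have "2 * m \<le> p * m" using p2 by simp
  then have "2 * m \<le> k" unfolding k by (rule trans_le_add1)
  moreover have "multiplicity p (fact m :: nat) \<le> m - 1"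
   using less.IH[of m] False \<open>2 * m \<le> k\<close> by simp
  ultimately show ?thesis using mk False by linarith
 qed (use mk in simp)
qed

text \<open>The bound \<open>k - 1\<close> on the multiplicity of \<open>p\<close> in
  \<open>fact k\<close> is exactly what is available. It means that \<open>exp(p x)\<close> is
  congruent to 1 modulo \<open>p\<close>, as Dwork's lemma asks of its factor
  \<open>E\<close>.\<close>

lemma p_integral_exp_coeff:
 assumes "k > 0"
 shows "p_integral p (of_nat p ^ (k - 1) / fact k)"
proof -
 have "\<not> is_unit p" "fact k \<noteq> (0 :: nat)" using p by auto
 then obtain u where u: "fact k = p ^ multiplicity p (fact k :: nat) * u" "\<not> p dvd u"
  using multiplicity_decompose'[of "fact k :: nat" p] by blast
 define e where "e = multiplicity p (fact k :: nat)"
 have "e \<le> k - 1" unfolding e_def using assms by (rule multiplicity_fact_le)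
 then have "(of_nat p :: rat) ^ (k - 1) = of_nat p ^ (k - 1 - e) * of_nat p ^ e"
  by (simp only: power_add[symmetric] le_add_diff_inverse2)
 moreover have "(fact k :: rat) = of_nat p ^ e * of_nat u"
  using arg_cong[OF u(1), of "of_nat :: nat => rat"] by (simp add: e_def)
 moreover have "p > 0" using prime_gt_0_nat[OF p] .
 ultimately have "of_nat p ^ (k - 1) / fact k = (of_int (int p ^ (k - 1 - e)) / of_int (int u) :: rat)"
  by simp
 moreover have "\<not> int p dvd int u" using u by simp
 ultimately show ?thesis by (rule p_integralI[rotated])
qed

end

text \<open>\<open>reduce_rat\<close> is defined by the fraction in lowest terms; its denominator
  divides \<open>b\<close>, so any denominator prime to \<open>p\<close> may be used
  instead.\<close>

lemma reduce_rat_quotient: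
 assumes "\<not> int CARD('p) dvd b"
 shows "reduce_rat (of_int a / of_int b) = (of_int a / of_int b :: 'p::prime_card mod_ring)"
proof -
 obtain a' b' where q: "quotient_of (of_int a / of_int b) = (a', b')" by (cases "quotient_of (of_int a / of_int b)")
 have b': "b' > 0" "coprime a' b'" using quotient_of_denom_pos[OF q] quotient_of_coprime[OF q] by auto
 have b: "b \<noteq> 0" using assms by auto
 have "(of_int a / of_int b :: rat) = of_int a' / of_int b'" using quotient_of_div[OF q] .
 then have "(of_int (a * b') :: rat) = of_int (a' * b)" using b b' by (simp add: field_simps)
 then have eq: "a * b' = a' * b" by (simp only: of_int_eq_iff)
 then have "b' dvd a' * b" by (metis dvd_triv_right)
 then have "b' dvd b" using b'(2) by (simp add: coprime_commute coprime_dvd_mult_right_iff)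
 then have nb': "\<not> int CARD('p) dvd b'" using assms dvd_trans by blast
 have nz: "(of_int c :: 'p mod_ring) \<noteq> 0" if "\<not> int CARD('p) dvd c" for c
  using that by (simp add: of_int_eq_0_iff_char_dvd)
 have "(of_int (a * b') :: 'p mod_ring) = of_int (a' * b)" using eq by simp
 then have "(of_int a / of_int b :: 'p mod_ring) = of_int a' / of_int b'"
  using nz[OF assms] nz[OF nb'] by (simp add: field_simps)
 then show ?thesis by (simp add: reduce_rat_def q)
qed

section \<open>Reduction modulo p of p-integral numbers and power series\<close>

context
 fixes ty :: "'p::prime_card itself"
begin

abbreviation (input) "red \<equiv> reduce_rat :: rat => 'p mod_ring"

lemma of_int_nonzero: "\<not> int CARD('p) dvd b ==> (of_int b :: 'p mod_ring) \<noteq> 0"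
 by (simp add: of_int_eq_0_iff_char_dvd)

lemma reduce_rat_add:
 assumes "p_integral CARD('p) r" "p_integral CARD('p) s"
 shows "red (r + s) = red r + red s"
proof -
 from assms obtain a b c d where *: "\<not> int CARD('p) dvd b" "\<not> int CARD('p) dvd d" "r = of_int a / of_int b" "s = of_int c / of_int d"
  unfolding p_integral_def by blast
 have "b \<noteq> 0" "d \<noteq> 0" using * by auto
 then have "r + s = of_int (a * d + c * b) / of_int (b * d)"
  using * by (simp add: field_simps)
 moreover have nd: "\<not> int CARD('p) dvd b * d"
  using * prime_card_int[where 'a='p] by (simp add: prime_dvd_mult_iff)
 ultimately have "red (r + s) = of_int (a * d + c * b) / of_int (b * d)"
  using reduce_rat_quotient[OF nd, of "a * d + c * b"] by (simp only:)
 moreover have "(of_int (a * d + c * b) / of_int (b * d) :: 'p mod_ring) = of_int a / of_int b + of_int c / of_int d"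
  using of_int_nonzero[OF *(1)] of_int_nonzero[OF *(2)] by (simp add: add_frac_eq)
 ultimately show ?thesis
  unfolding *(3,4) by (simp only: reduce_rat_quotient[OF *(1)] reduce_rat_quotient[OF *(2)])
qed

lemma reduce_rat_mult:
 assumes "p_integral CARD('p) r" "p_integral CARD('p) s"
 shows "red (r * s) = red r * red s"
proof -
 from assms obtain a b c d where *: "\<not> int CARD('p) dvd b" "\<not> int CARD('p) dvd d" "r = of_int a / of_int b" "s = of_int c / of_int d"
  unfolding p_integral_def by blast
 have "r * s = of_int (a * c) / of_int (b * d)" using * by simp
 moreover have nd: "\<not> int CARD('p) dvd b * d"
  using * prime_card_int[where 'a='p] by (simp add: prime_dvd_mult_iff)
 ultimately have "red (r * s) = of_int (a * c) / of_int (b * d)"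
  using reduce_rat_quotient[OF nd, of "a * c"] by (simp only:)
 moreover have "(of_int (a * c) / of_int (b * d) :: 'p mod_ring) = (of_int a / of_int b) * (of_int c / of_int d)"
  by simp
 ultimately show ?thesis
  unfolding *(3,4) by (simp only: reduce_rat_quotient[OF *(1)] reduce_rat_quotient[OF *(2)])
qed

lemma reduce_rat_1 [simp]: "red 1 = 1"
 using reduce_rat_of_int[of 1, where 'a='p] by simp

lemma reduce_rat_uminus:
 assumes "p_integral CARD('p) r"
 shows "red (- r) = - red r"
proof -
 note p = prime_card[where 'a='p]
 have "red (of_int (-1) * r) = red (of_int (-1)) * red r"
  by (rule reduce_rat_mult[OF p_integral_of_int[OF p] assms])
 then show ?thesis by (simp only: reduce_rat_of_int) simp
qed

lemma reduce_rat_diff: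
 "p_integral CARD('p) r ==> p_integral CARD('p) s ==> red (r - s) = red r - red s"
 using reduce_rat_add[of r "- s"] p_integral_uminus[OF prime_card[where 'a='p]]
 by (simp add: reduce_rat_uminus)

lemma reduce_rat_sum:
 "(!!i. i \<in> A ==> p_integral CARD('p) (f i)) ==> red (sum f A) = (\<Sum>i\<in>A. red (f i))"
 by (induction A rule: infinite_finite_induct)
  (simp_all add: reduce_rat_add p_integral_sum[OF prime_card[where 'a='p]])

lemma reduce_rat_prod:
 "(!!i. i \<in> A ==> p_integral CARD('p) (f i)) ==> red (prod f A) = (\<Prod>i\<in>A. red (f i))"
 by (induction A rule: infinite_finite_induct)
  (simp_all add: reduce_rat_mult p_integral_prod[OF prime_card[where 'a='p]])

lemma reduce_rat_power:
 "p_integral CARD('p) r ==> red (r ^ k) = red r ^ k"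
 by (induction k) (simp_all add: reduce_rat_mult p_integral_power[OF prime_card[where 'a='p]])

text \<open>The denominator is invertible modulo \<open>p\<close>, so it is the numerator that
  vanishes there and absorbs the division.\<close>

lemma reduce_rat_eq_0:
 assumes "p_integral CARD('p) r" "red r = 0"
 shows "p_integral CARD('p) (r / of_nat CARD('p))"
proof -
 from assms(1) obtain a b where *: "\<not> int CARD('p) dvd b" "r = of_int a / of_int b"
  unfolding p_integral_def by blast
 then have "(of_int a :: 'p mod_ring) / of_int b = 0" using assms(2) reduce_rat_quotient[OF *(1), of a] by (simp only:)
 then have "(of_int a :: 'p mod_ring) = 0" using of_int_nonzero[OF *(1)] by simp
 then have "int CARD('p) dvd a" by (simp add: of_int_eq_0_iff_char_dvd)
 then obtain c where "a = int CARD('p) * c" by (elim dvdE)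
 then have "r / of_nat CARD('p) = of_int c / of_int b"
  using * prime_gt_0_nat[OF prime_card[where 'a='p]] by simp
 with *(1) show ?thesis by (rule p_integralI)
qed

definition reduce_fps :: "rat fps => 'p mod_ring fps" where
 "reduce_fps f = Abs_fps (%k. red (fps_nth f k))"

lemma reduce_fps_power:
 assumes "!!k. p_integral CARD('p) (fps_nth f k)"
 shows "reduce_fps (f ^ i) = reduce_fps f ^ i"
proof (induction i)
 case 0
 show ?case by (rule fps_ext) (simp add: reduce_fps_def)
next
 case (Suc i)
 note p = prime_card[where 'a='p]
 show ?case
 proof (rule fps_ext)
  fix k
  have "fps_nth (reduce_fps (f ^ Suc i)) k = (\<Sum>j=0..k. red (fps_nth f j * fps_nth (f ^ i) (k - j)))"
   unfolding reduce_fps_def power_Suc fps_mult_nth fps_nth_Abs_fps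
   by (rule reduce_rat_sum) (intro p_integral_mult[OF p] p_integral_fps_power[OF p] assms)
  also have "\<dots> = (\<Sum>j=0..k. fps_nth (reduce_fps f) j * fps_nth (reduce_fps (f ^ i)) (k - j))"
   by (simp add: reduce_fps_def reduce_rat_mult assms p_integral_fps_power[OF p assms])
  finally show "fps_nth (reduce_fps (f ^ Suc i)) k = fps_nth (reduce_fps f ^ Suc i) k"
   by (simp add: Suc.IH fps_mult_nth)
 qed
qed

text \<open>Frobenius fixes scalars, so the \<open>p\<close>-th power amounts to replacing
  \<open>x\<close> by \<open>x^p\<close>. The series is cut at \<open>k\<close> to make the
  freshman's dream a finite statement; the \<open>p\<close>-th power of the tail starts in degree
  \<open>(k + 1) p\<close>.\<close>

lemma fps_power_card:
 fixes F :: "'p mod_ring fps"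
 shows "fps_nth (F ^ CARD('p)) k = (if CARD('p) dvd k then fps_nth F (k div CARD('p)) else 0)"
proof -
 let ?p = "CARD('p)"
 have p: "prime ?p" by (rule prime_card)
 have p0: "?p > 0" using prime_gt_0_nat[OF p] .
 have fr: "(A + B) ^ ?p = A ^ ?p + B ^ ?p" for A B :: "'p mod_ring fps"
  using p by (intro freshmans_dream) simp_all
 have frs: "(\<Sum>i\<in>S. A i) ^ ?p = (\<Sum>i\<in>S. A i ^ ?p)" for S and A :: "nat => 'p mod_ring fps"
  using p by (intro freshmans_dream_sum) simp_all
 have cp: "fps_const c ^ ?p = fps_const c" for c :: "'p mod_ring"
  using mod_ring_power_card_power[of c 1] by simp
 have coeff: "fps_nth (fps_const c * fps_X ^ i) j = (if i = j then c else 0)" for c :: "'p mod_ring" and i j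
  by simp
 have "F = (\<Sum>i\<le>k. fps_const (fps_nth F i) * fps_X ^ i) + fps_X ^ Suc k * fps_shift (Suc k) F" (is "F = ?A + ?B")
 proof (rule fps_ext)
  fix j
  show "fps_nth F j = fps_nth (?A + ?B) j"
   by (auto simp: fps_sum_nth coeff fps_X_power_mult_nth simp del: power_Suc fps_mult_left_const_nth)
 qed
 then have "F ^ ?p = ?A ^ ?p + ?B ^ ?p" using fr[of ?A ?B] by simp
 moreover have "?A ^ ?p = (\<Sum>i\<le>k. fps_const (fps_nth F i) * fps_X ^ (i * ?p))"
  unfolding frs by (intro sum.cong refl)
   (simp only: power_mult_distrib power_mult cp)
 moreover have "fps_nth (?B ^ ?p) k = 0"
 proof -
  have "?B ^ ?p = fps_X ^ (Suc k * ?p) * fps_shift (Suc k) F ^ ?p"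
   by (simp only: power_mult_distrib power_mult)
  moreover have "k < Suc k * ?p" using p0 by (cases ?p) auto
  ultimately show ?thesis by (simp add: fps_X_power_mult_nth del: mult_Suc)
 qed
 ultimately have eq: "fps_nth (F ^ ?p) k = (\<Sum>i\<le>k. if k = i * ?p then fps_nth F i else 0)"
  by (simp add: fps_sum_nth coeff eq_commute[of k] del: fps_mult_left_const_nth)
 show ?thesis
 proof (cases "?p dvd k")
  case True
  then obtain j where j: "k = j * ?p" by (metis dvd_def mult.commute)
  then have "(\<Sum>i\<le>k. if k = i * ?p then fps_nth F i else 0) = (\<Sum>i\<le>k. if i = j then fps_nth F i else 0)"
   using p0 by (intro sum.cong) auto
  moreover have "j \<le> k" using j p0 by simp
  ultimately show ?thesis using eq True j p0 by simp
 next
  case False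
  then have "(\<Sum>i\<le>k. if k = i * ?p then fps_nth F i else 0) = 0" by (intro sum.neutral) auto
  with eq False show ?thesis by simp
 qed
qed

text \<open>Dwork's lemma: a series \<open>f\<close> with \<open>f(x)^p \<equiv> f(x^p)\<close> modulo \<open>p\<close>, in the multiplicative sense, is integral.\<close>

lemma dwork:
 fixes f E :: "rat fps"
 assumes f0: "fps_nth f 0 = 1"
  and E0: "fps_nth E 0 = 1" and E: "!!k. k > 0 ==> p_integral CARD('p) (fps_nth E k / of_nat CARD('p))"
  and eq: "!!k. fps_nth (f ^ CARD('p)) k =
   (\<Sum>i\<le>k. (if CARD('p) dvd i then fps_nth f (i div CARD('p)) else 0) * fps_nth E (k - i))"
 shows "p_integral CARD('p) (fps_nth f k)"
proof (induction k rule: less_induct)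
 case (less k)
 let ?p = "CARD('p)"
 have p: "prime ?p" by (rule prime_card)
 have p2: "?p \<ge> 2" using prime_ge_2_nat[OF p] .
 show ?case
 proof (cases "k = 0")
  case False
  \<comment> \<open>The part of \<open>f\<close> below degree \<open>k\<close>, integral by the
    induction hypothesis.\<close>
  define g where "g = fps_cutoff k f"
  have gint: "p_integral ?p (fps_nth g i)" for i
   using less.IH p by (simp add: g_def p_integral_0[OF p])
  have small: "i div ?p < k" if "i \<le> k" for i
  proof (cases "i = 0")
   case i0: False
   have "i div ?p < i" using p2 i0 by (intro div_less_dividend) auto
   with that show ?thesis by linarith
  qed (use False in simp)
  have decomp: "f = g + fps_X ^ k * fps_shift k f"
   by (rule fps_ext) (simp add: g_def fps_X_power_mult_nth)
  define h where "h = fps_shift k f"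
  have h0: "fps_nth h 0 = fps_nth f k" by (simp add: h_def)
  have g0: "fps_nth g 0 = 1" using False f0 by (simp add: g_def)
  \<comment> \<open>As \<open>f = g + x^k h\<close> and \<open>g\<close> starts with 1, the new
    coefficient enters the \<open>i\<close>-th power only through the linear term
    \<open>i x^k h\<close>.\<close>
  have pw: "fps_nth ((g + fps_X ^ k * h) ^ i) k = fps_nth (g ^ i) k + of_nat i * fps_nth h 0" for i
  proof (induction i)
   case (Suc i)
   have "(g + fps_X ^ k * h) ^ Suc i = g * (g + fps_X ^ k * h) ^ i + fps_X ^ k * (h * (g + fps_X ^ k * h) ^ i)"
    by (simp add: algebra_simps)
   moreover have "fps_nth ((g + fps_X ^ k * h) ^ i) 0 = 1"
    using g0 False by (simp add: fps_X_power_mult_nth fps_power_zeroth power_0_left)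
   then have "fps_nth (fps_X ^ k * (h * (g + fps_X ^ k * h) ^ i)) k = fps_nth h 0"
    by (simp add: fps_X_power_mult_nth)
   moreover have "fps_nth (g * (g + fps_X ^ k * h) ^ i) k = fps_nth (g * g ^ i) k + of_nat i * fps_nth h 0"
   proof -
    have low: "fps_nth ((g + fps_X ^ k * h) ^ i) j = fps_nth (g ^ i) j" if "j < k" for j
    proof -
     have "fps_cutoff k (g + fps_X ^ k * h) = fps_cutoff k g"
      by (rule fps_ext) (simp add: fps_X_power_mult_nth)
     then have "fps_cutoff k ((g + fps_X ^ k * h) ^ i) = fps_cutoff k (g ^ i)"
     proof (induction i)
      case (Suc i)
      have "fps_nth ((g + fps_X ^ k * h) ^ Suc i) j = fps_nth (g ^ Suc i) j" if "j < k" for j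
       unfolding power_Suc fps_mult_nth using Suc that
       by (intro sum.cong refl) (auto simp: fps_cutoff_eq_fps_cutoff_iff)
      then show ?case by (simp add: fps_cutoff_eq_fps_cutoff_iff)
     qed simp
     with that show ?thesis by (simp add: fps_cutoff_eq_fps_cutoff_iff)
    qed
    have split: "{0..k} = insert 0 {1..k}" by auto
    have "(\<Sum>j=1..k. fps_nth g j * fps_nth ((g + fps_X ^ k * h) ^ i) (k - j)) =
      (\<Sum>j=1..k. fps_nth g j * fps_nth (g ^ i) (k - j))"
     using low by (intro sum.cong) auto
    then show ?thesis unfolding fps_mult_nth split using Suc.IH g0 by simp
   qed
   ultimately show ?case by (simp add: algebra_simps)
  qed simp
  have lhs: "fps_nth (f ^ ?p) k = fps_nth (g ^ ?p) k + of_nat ?p * fps_nth f k"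
   using pw[of ?p] decomp h0 by (simp add: h_def)
  define f' where "f' i = (if ?p dvd i then fps_nth f (i div ?p) else 0)" for i
  have f'int: "p_integral ?p (f' i)" if "i \<le> k" for i
   unfolding f'_def using less.IH[OF small[OF that]] p_integral_0[OF p] by simp
  have "(\<Sum>i<k. f' i * fps_nth E (k - i)) = of_nat ?p * (\<Sum>i<k. f' i * (fps_nth E (k - i) / of_nat ?p))"
   using p2 by (simp add: sum_distrib_left)
  then have rhs: "fps_nth (f ^ ?p) k = of_nat ?p * (\<Sum>i<k. f' i * (fps_nth E (k - i) / of_nat ?p)) + f' k"
   unfolding eq f'_def[symmetric] by (simp add: E0 flip: lessThan_Suc_atMost)
  have int1: "p_integral ?p (\<Sum>i<k. f' i * (fps_nth E (k - i) / of_nat ?p))"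
   by (intro p_integral_sum[OF p] p_integral_mult[OF p] f'int E) auto
  have f'k: "f' k = (if ?p dvd k then fps_nth g (k div ?p) else 0)"
   using small[of k] by (simp add: f'_def g_def)
  have gp: "p_integral ?p (fps_nth (g ^ ?p) k)" by (rule p_integral_fps_power[OF p gint])
  \<comment> \<open>Modulo \<open>p\<close> the power \<open>g^p\<close> equals
    \<open>g(x^p)\<close>, so the two contributions that are not visibly divisible by
    \<open>p\<close> cancel. What is left can be solved for the coefficient of \<open>f\<close> at
    \<open>k\<close> within the integral numbers.\<close>
  have "red (f' k - fps_nth (g ^ ?p) k) = red (f' k) - fps_nth (reduce_fps g ^ ?p) k"
  proof -
   have "red (fps_nth (g ^ ?p) k) = fps_nth (reduce_fps g ^ ?p) k"
    unfolding reduce_fps_power[OF gint, symmetric] by (simp add: reduce_fps_def)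
   then show ?thesis using reduce_rat_diff[OF f'int[OF order_refl] gp] by (simp only:)
  qed
  also have "\<dots> = 0" unfolding fps_power_card f'k by (simp add: reduce_fps_def)
  finally have "p_integral ?p ((f' k - fps_nth (g ^ ?p) k) / of_nat ?p)"
   by (intro reduce_rat_eq_0 p_integral_diff[OF p] f'int gp order_refl)
  moreover have "fps_nth f k = (\<Sum>i<k. f' i * (fps_nth E (k - i) / of_nat ?p)) + (f' k - fps_nth (g ^ ?p) k) / of_nat ?p"
   using lhs rhs p2 by (simp add: field_simps)
  ultimately show ?thesis using p_integral_add[OF p int1] by simp
 qed (simp add: f0 p_integral_1[OF p])
qed

end

text \<open>In characteristic zero the equation determines the coefficient at \<open>k + 1\<close>
  from those up to \<open>k\<close>.\<close>

lemma fps_ode_unique: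
 fixes y z h :: "rat fps"
 assumes "fps_deriv y = y * h" "fps_deriv z = z * h" "fps_nth y 0 = fps_nth z 0"
 shows "y = z"
proof (rule fps_ext)
 fix k show "fps_nth y k = fps_nth z k"
 proof (induction k rule: less_induct)
  case (less k)
  show ?case
  proof (cases k)
   case (Suc j)
   have "(\<Sum>i=0..j. fps_nth y i * fps_nth h (j - i)) = (\<Sum>i=0..j. fps_nth z i * fps_nth h (j - i))"
    using less Suc by (intro sum.cong) auto
   then have "fps_nth (fps_deriv y) j = fps_nth (fps_deriv z) j"
    by (simp only: assms(1,2) fps_mult_nth)
   then show ?thesis using Suc by (simp del: of_nat_Suc)
  qed (use assms in simp)
 qed
qed

lemma fps_compose_X_power_nth:
 fixes f :: "'a::comm_ring_1 fps"
 assumes "n > 0"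
 shows "fps_nth (f oo fps_X ^ n) k = (if n dvd k then fps_nth f (k div n) else 0)"
proof -
 have "fps_nth (f oo fps_X ^ n) k = (\<Sum>i=0..k. if k = n * i then fps_nth f i else 0)"
  unfolding fps_compose_nth by (intro sum.cong) (auto simp flip: power_mult)
 also have "\<dots> = (if n dvd k then fps_nth f (k div n) else 0)"
 proof (cases "n dvd k")
  case True
  then obtain j where j: "k = n * j" by (elim dvdE)
  then have "(\<Sum>i=0..k. if k = n * i then fps_nth f i else 0) = (\<Sum>i=0..k. if i = j then fps_nth f i else 0)"
   using assms by (intro sum.cong) auto
  moreover have "j \<le> k" using j assms by simp
  ultimately show ?thesis using True j assms by simp
 next
  case False
  then have "(\<Sum>i=0..k. if k = n * i then fps_nth f i else 0) = 0" by (intro sum.neutral) auto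
  with False show ?thesis by simp
 qed
 finally show ?thesis .
qed

lemma compose_inverse_rec:
 fixes a b :: "'a::idom fps"
 assumes "b oo a = fps_X" "fps_nth a 0 = 0" "fps_nth a 1 = 1"
 shows "fps_nth b k = (if k = 1 then 1 else 0) - (\<Sum>i<k. fps_nth b i * fps_nth (a ^ i) k)"
proof -
 have "(\<Sum>i=0..k. fps_nth b i * fps_nth (a ^ i) k) = (if k = 1 then 1 else 0)"
  using arg_cong[OF assms(1), of "%f. fps_nth f k"] by (simp add: fps_compose_nth)
 moreover have "fps_nth (a ^ k) k = 1"
  using startsby_zero_power_nth_same[OF assms(2), of k] assms(3) by simp
 ultimately show ?thesis
  by (simp add: atLeast0AtMost algebra_simps flip: lessThan_Suc_atMost)
qed

section \<open>The Artin-Hasse exponential and the formal group law of height one\<close>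

context
 fixes ty :: "'p::prime_card itself"
begin

lemma p_pr: "prime CARD('p)" by (rule prime_card)
lemma p_ge2: "CARD('p) \<ge> 2" using p_pr by (rule prime_ge_2_nat)
lemma one_le1: "1 \<le> (1::nat)" by simp
lemma p_pow1: "CARD('p) = CARD('p) ^ 1" by simp

lemma lg_0: "fps_nth (log_series CARD('p) 1) 0 = 0" by (rule log_series_0[OF p_pr one_le1 p_pow1])
lemma lg_1: "fps_nth (log_series CARD('p) 1) 1 = 1" using log_series_1[OF p_pr one_le1 p_pow1] by simp
lemma lg_power: "fps_nth (log_series CARD('p) 1) (CARD('p) ^ i) = 1 / of_nat CARD('p) ^ i" by (rule log_series_power[OF p_pr one_le1 p_pow1])
lemma lg_other: "(!!i. k \<noteq> CARD('p) ^ i) ==> fps_nth (log_series CARD('p) 1) k = 0" by (rule log_series_other[OF p_pr one_le1 p_pow1])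

text \<open>For \<open>n = 1\<close> the logarithm is \<open>x + x^p/p + x^(p^2)/p^2 + ...\<close>,
  whose exponential is the classical Artin-Hasse series.\<close>

definition artin_hasse :: "rat fps" where
 "artin_hasse = fps_exp 1 oo (log_series CARD('p) 1)"

text \<open>Replacing \<open>x\<close> by \<open>x^p\<close> shifts the terms of the logarithm by
  one and costs a factor \<open>p\<close>; only the term \<open>x\<close> has no
  predecessor.\<close>

lemma log_frobenius: "(log_series CARD('p) 1) oo fps_X ^ CARD('p) = fps_const (of_nat CARD('p)) * ((log_series CARD('p) 1) - fps_X)"
proof (rule fps_ext)
 fix k
 have p0: "CARD('p) > 0" using p_ge2 by simp
 show "fps_nth ((log_series CARD('p) 1) oo fps_X ^ CARD('p)) k = fps_nth (fps_const (of_nat CARD('p)) * ((log_series CARD('p) 1) - fps_X)) k"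
 proof (cases "\<exists>i. k = CARD('p) ^ i")
  case True
  then obtain i where k: "k = CARD('p) ^ i" by blast
  show ?thesis
  proof (cases i)
   case 0
   then have "k = 1" "\<not> CARD('p) dvd k" using k p_ge2 by auto
   then show ?thesis using lg_1 by (simp add: fps_compose_X_power_nth[OF p0])
  next
   case (Suc j)
   have k1: "k \<noteq> 1" using k Suc p_ge2 by (metis One_nat_def nat_power_eq_Suc_0_iff numeral_2_eq_2 not_less_eq_eq order_refl nat.distinct(1))
   have "k div CARD('p) = CARD('p) ^ j" "CARD('p) dvd k" using k Suc p0 by simp_all
   then show ?thesis using lg_power[of j] lg_power[of i] k k1 Suc p0
    by (simp add: fps_compose_X_power_nth[OF p0])
  qed
 next
  case False
  then have "k \<noteq> 1" by (metis power_0)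
  moreover have "fps_nth (log_series CARD('p) 1) (k div CARD('p)) = 0" if "CARD('p) dvd k"
  proof (rule lg_other)
   fix i show "k div CARD('p) \<noteq> CARD('p) ^ i"
   proof
    assume "k div CARD('p) = CARD('p) ^ i"
    with that have "k = CARD('p) ^ Suc i" by (metis dvd_mult_div_cancel power_Suc)
    with False show False by blast
   qed
  qed
  ultimately show ?thesis using False lg_other[of k]
   by (simp add: fps_compose_X_power_nth[OF p0])
 qed
qed

text \<open>This is the exponential of \<open>log_frobenius\<close>: both sides solve the linear
  differential equation \<open>y' = y p l'\<close>, with \<open>l\<close> the logarithm, and have
  the same constant term.\<close>

lemma artin_hasse_frobenius: "artin_hasse ^ CARD('p) = (artin_hasse oo fps_X ^ CARD('p)) * fps_exp (of_nat CARD('p))"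
proof (rule fps_ode_unique)
 let ?f = artin_hasse and ?c = "fps_const (of_nat CARD('p)) :: rat fps"
 have p0: "CARD('p) > 0" using p_ge2 by simp
 have Xp0: "fps_nth (fps_X ^ CARD('p) :: rat fps) 0 = 0" using p0 by simp
 have df: "fps_deriv ?f = ?f * fps_deriv (log_series CARD('p) 1)"
  unfolding artin_hasse_def by (subst fps_compose_deriv[OF lg_0]) simp
 have "fps_deriv (?f ^ CARD('p)) = ?c * fps_deriv ?f * ?f ^ (CARD('p) - 1)"
  by (rule fps_deriv_power)
 also have "\<dots> = (?f * ?f ^ (CARD('p) - 1)) * (?c * fps_deriv (log_series CARD('p) 1))" unfolding df by (simp only: ac_simps)
 also have "?f * ?f ^ (CARD('p) - 1) = ?f ^ CARD('p)" using p0 by (metis power_eq_if not_gr0)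
 finally show "fps_deriv (?f ^ CARD('p)) = ?f ^ CARD('p) * (?c * fps_deriv (log_series CARD('p) 1))" .
 have "fps_deriv (?f oo fps_X ^ CARD('p)) = (fps_deriv ?f oo fps_X ^ CARD('p)) * fps_deriv (fps_X ^ CARD('p))"
  by (rule fps_compose_deriv[OF Xp0])
 also have "fps_deriv ?f oo fps_X ^ CARD('p) = (?f oo fps_X ^ CARD('p)) * (fps_deriv (log_series CARD('p) 1) oo fps_X ^ CARD('p))"
  unfolding df by (rule fps_compose_mult_distrib[OF Xp0])
 also have "(?f oo fps_X ^ CARD('p)) * (fps_deriv (log_series CARD('p) 1) oo fps_X ^ CARD('p)) * fps_deriv (fps_X ^ CARD('p)) =
   (?f oo fps_X ^ CARD('p)) * fps_deriv ((log_series CARD('p) 1) oo fps_X ^ CARD('p))"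
  by (simp only: fps_compose_deriv[OF Xp0] mult.assoc)
 also have "fps_deriv ((log_series CARD('p) 1) oo fps_X ^ CARD('p)) = ?c * (fps_deriv (log_series CARD('p) 1) - 1)"
  unfolding log_frobenius by simp
 finally have d2: "fps_deriv (?f oo fps_X ^ CARD('p)) = (?f oo fps_X ^ CARD('p)) * (?c * (fps_deriv (log_series CARD('p) 1) - 1))" .
 show "fps_deriv ((?f oo fps_X ^ CARD('p)) * fps_exp (of_nat CARD('p))) = (?f oo fps_X ^ CARD('p)) * fps_exp (of_nat CARD('p)) * (?c * fps_deriv (log_series CARD('p) 1))"
  unfolding fps_deriv_mult d2 fps_exp_deriv by (simp only: algebra_simps) simp
 show "fps_nth (?f ^ CARD('p)) 0 = fps_nth ((?f oo fps_X ^ CARD('p)) * fps_exp (of_nat CARD('p))) 0"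
  by (simp add: artin_hasse_def fps_power_zeroth)
qed

lemma artin_hasse_integral: "p_integral CARD('p) (fps_nth artin_hasse k)"
proof (rule dwork[where E = "fps_exp (of_nat CARD('p))"])
 show "fps_nth artin_hasse 0 = 1" by (simp add: artin_hasse_def)
 show "fps_nth (fps_exp (of_nat CARD('p)) :: rat fps) 0 = 1" by simp
 fix k :: nat assume k: "k > 0"
 have "fps_nth (fps_exp (of_nat CARD('p))) k / of_nat CARD('p) = (of_nat CARD('p) ^ (k - 1) / fact k :: rat)"
  using k p_ge2 by (cases k) (simp_all del: fact_Suc)
 then show "p_integral CARD('p) (fps_nth (fps_exp (of_nat CARD('p))) k / of_nat CARD('p))"
  using p_integral_exp_coeff[OF p_pr k] by (simp only:)
next
 fix k
 have "CARD('p) > 0" using p_ge2 by simp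
 then show "fps_nth (artin_hasse ^ CARD('p)) k = (\<Sum>i\<le>k. (if CARD('p) dvd i then fps_nth artin_hasse (i div CARD('p)) else 0) * fps_nth (fps_exp (of_nat CARD('p))) (k - i))"
  unfolding artin_hasse_frobenius fps_mult_nth by (simp only: fps_compose_X_power_nth atLeast0AtMost)
qed

text \<open>The exponents of \<open>l^i\<close> are \<open>i\<close> modulo \<open>p - 1\<close>, so
  below degree \<open>p\<close> only the leading term of each power contributes, just as for
  \<open>exp(x)\<close>.\<close>

lemma artin_hasse_small:
 assumes "k < CARD('p)"
 shows "fps_nth artin_hasse k = 1 / fact k"
proof -
 have z: "fps_nth ((log_series CARD('p) 1) ^ i) k = 0" if "i < k" for i
 proof (rule ccontr)
  assume nz: "fps_nth ((log_series CARD('p) 1) ^ i) k \<noteq> 0"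
  then have "CARD('p) - 1 dvd k - i"
   using log_series_power_support[OF p_pr one_le1 p_pow1, of i k] by simp
  then have "CARD('p) - 1 \<le> k - i" using that by (intro dvd_imp_le) auto
  with assms that have "i = 0" by linarith
  with nz that show False by simp
 qed
 have "fps_nth artin_hasse k = (\<Sum>i<k. 1 / fact i * fps_nth ((log_series CARD('p) 1) ^ i) k) + 1 / fact k * fps_nth ((log_series CARD('p) 1) ^ k) k"
  by (simp add: artin_hasse_def fps_compose_nth atLeast0AtMost flip: lessThan_Suc_atMost)
 moreover have "fps_nth ((log_series CARD('p) 1) ^ k) k = 1"
  using startsby_zero_power_nth_same[OF lg_0, of k] lg_1 by simp
 ultimately show ?thesis using z by simp
qed

definition ah_inverse :: "rat fps" where
 "ah_inverse = fps_inv (artin_hasse - 1)"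

lemma ah_minus_one: "fps_nth (artin_hasse - 1) 0 = 0" "fps_nth (artin_hasse - 1) 1 = 1"
 using artin_hasse_small[of 0] artin_hasse_small[of 1] p_ge2 by simp_all

lemma ah_inverse_left: "ah_inverse oo (artin_hasse - 1) = fps_X"
 unfolding ah_inverse_def by (rule fps_inv) (simp_all add: ah_minus_one[simplified])

lemma ah_inverse_right: "(artin_hasse - 1) oo ah_inverse = fps_X"
 unfolding ah_inverse_def by (rule fps_inv_right) (simp_all add: ah_minus_one[simplified])

lemma ah_inverse_0: "fps_nth ah_inverse 0 = 0"
 by (simp add: ah_inverse_def fps_inv_def)

lemma ah_minus_one_integral: "p_integral CARD('p) (fps_nth (artin_hasse - 1) k)"
 by (cases k) (auto intro!: p_integral_diff[OF p_pr] artin_hasse_integral p_integral_1[OF p_pr])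

text \<open>The recursion for the inverse of a series with leading coefficient 1 involves no
  division.\<close>

lemma ah_inverse_integral: "p_integral CARD('p) (fps_nth ah_inverse k)"
proof (induction k rule: less_induct)
 case (less k)
 have "p_integral CARD('p) ((if k = 1 then 1 else 0) - (\<Sum>i<k. fps_nth ah_inverse i * fps_nth ((artin_hasse - 1) ^ i) k))"
  using less by (intro p_integral_diff[OF p_pr] p_integral_sum[OF p_pr] p_integral_mult[OF p_pr]
    p_integral_fps_power[OF p_pr] ah_minus_one_integral) (simp_all add: p_integral_1[OF p_pr] p_integral_0[OF p_pr])
 then show ?case by (subst compose_inverse_rec[OF ah_inverse_left ah_minus_one])
qed

text \<open>Since \<open>exp(l(x)) - 1\<close> is the Artin-Hasse series minus 1, the exponential of
  the formal group is that of the multiplicative group followed by an integral change of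
  coordinate.\<close>

lemma exp_series_ah: "exp_series CARD('p) 1 = ah_inverse oo (fps_exp 1 - 1)"
proof (rule sym, rule fps_compose_inverse_unique[OF lg_0])
 have "(fps_exp 1 - 1) oo (log_series CARD('p) 1) = artin_hasse - 1"
  by (simp add: artin_hasse_def fps_compose_sub_distrib)
 moreover have "ah_inverse oo ((fps_exp 1 - 1) oo (log_series CARD('p) 1)) = ah_inverse oo (fps_exp 1 - 1) oo (log_series CARD('p) 1)"
  by (rule fps_compose_assoc) (simp_all add: lg_0[simplified])
 ultimately show "(ah_inverse oo (fps_exp 1 - 1)) oo (log_series CARD('p) 1) = fps_X"
  using ah_inverse_left by simp
 show "(log_series CARD('p) 1) oo exp_series CARD('p) 1 = fps_X" by (rule exp_series_right[OF p_pr one_le1 p_pow1])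
 show "fps_nth (exp_series CARD('p) 1) 0 = 0" by (rule exp_series_0[OF p_pr one_le1 p_pow1])
qed

lemma fps_exp_minus_one_power:
 "fps_nth ((fps_exp 1 - 1 :: rat fps) ^ i) k =
  (\<Sum>r\<le>i. of_nat (i choose r) * (-1) ^ (i - r) * (of_nat r ^ k / fact k))"
proof -
 have "(fps_exp 1 - 1 :: rat fps) ^ i = (\<Sum>r\<le>i. of_nat (i choose r) * fps_exp 1 ^ r * (-1) ^ (i - r))"
  using binomial_ring[of "fps_exp 1 :: rat fps" "-1" i] by simp
 also have "\<dots> = (\<Sum>r\<le>i. fps_const (of_nat (i choose r) * (-1) ^ (i - r)) * fps_exp (of_nat r))"
  by (intro sum.cong refl) (simp add: fps_exp_power_mult fps_of_nat[symmetric] mult.commute mult.left_commute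
    flip: fps_const_mult fps_const_power fps_const_neg fps_const_1_eq_1)
 finally show ?thesis by (simp add: fps_sum_nth)
qed

lemma reduce_fps_compose:
 assumes "!!k. p_integral CARD('p) (fps_nth f k)" "!!k. p_integral CARD('p) (fps_nth g k)"
 shows "(reduce_fps (f oo g) :: 'p mod_ring fps) = reduce_fps f oo reduce_fps g"
proof (rule fps_ext)
 fix k
 have "fps_nth (reduce_fps (f oo g) :: 'p mod_ring fps) k = (\<Sum>i=0..k. reduce_rat (fps_nth f i * fps_nth (g ^ i) k))"
  unfolding reduce_fps_def fps_compose_nth fps_nth_Abs_fps
  by (rule reduce_rat_sum) (intro p_integral_mult[OF p_pr] p_integral_fps_power[OF p_pr] assms)
 also have "\<dots> = (\<Sum>i=0..k. reduce_rat (fps_nth f i) * reduce_rat (fps_nth (g ^ i) k))"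
  by (intro sum.cong refl reduce_rat_mult assms p_integral_fps_power[OF p_pr])
 also have "\<dots> = fps_nth (reduce_fps f oo (reduce_fps g :: 'p mod_ring fps)) k"
  unfolding fps_compose_nth reduce_fps_power[OF assms(2), symmetric] by (simp add: reduce_fps_def)
 finally show "fps_nth (reduce_fps (f oo g) :: 'p mod_ring fps) k = fps_nth (reduce_fps f oo reduce_fps g) k" .
qed

definition ah_mod :: "'p mod_ring fps" where "ah_mod = reduce_fps (artin_hasse - 1)"
definition ahi_mod :: "'p mod_ring fps" where "ahi_mod = reduce_fps ah_inverse"

lemma reduce_fps_X: "(reduce_fps fps_X :: 'p mod_ring fps) = fps_X"
 by (rule fps_ext) (simp add: reduce_fps_def fps_X_def)

lemma ah_mod_inverse: "ah_mod oo ahi_mod = fps_X" "ahi_mod oo ah_mod = fps_X"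
 unfolding ah_mod_def ahi_mod_def
 using reduce_fps_compose[of "artin_hasse - 1" ah_inverse, OF ah_minus_one_integral ah_inverse_integral]
  reduce_fps_compose[of ah_inverse "artin_hasse - 1", OF ah_inverse_integral ah_minus_one_integral]
 by (simp_all only: ah_inverse_left ah_inverse_right reduce_fps_X)

lemma ahi_mod_0: "fps_nth ahi_mod 0 = 0" and ah_mod_0: "fps_nth ah_mod 0 = 0"
 unfolding ahi_mod_def ah_mod_def reduce_fps_def fps_nth_Abs_fps ah_inverse_0 ah_minus_one by simp_all

lemma fact_mod_ring_nonzero: "k < CARD('p) ==> (of_nat (fact k) :: 'p mod_ring) \<noteq> 0"
 using prime_dvd_fact_iff[OF p_pr, of k] by (simp add: of_nat_eq_0_iff_char_dvd del: of_nat_fact)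

lemma reduce_rat_inverse_fact:
 assumes "k < CARD('p)"
 shows "(reduce_rat (1 / fact k) :: 'p mod_ring) = 1 / of_nat (fact k)" "p_integral CARD('p) (1 / fact k)"
proof -
 have nd: "\<not> int CARD('p) dvd int (fact k)"
  using prime_dvd_fact_iff[OF p_pr, of k] assms by (simp only: int_dvd_int_iff)
 have eq: "(1 / fact k :: rat) = of_int 1 / of_int (int (fact k))" by simp
 show "(reduce_rat (1 / fact k) :: 'p mod_ring) = 1 / of_nat (fact k)"
  unfolding eq reduce_rat_quotient[OF nd] by (simp del: of_nat_fact)
 show "p_integral CARD('p) (1 / fact k)" using nd eq by (rule p_integralI)
qed

lemma ah_mod_small: "k < CARD('p) ==> fps_nth ah_mod k = (if k = 0 then 0 else 1 / of_nat (fact k))"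
 using artin_hasse_small[of k] reduce_rat_inverse_fact(1)[of k]
 by (cases k) (simp_all add: ah_mod_def reduce_fps_def del: of_nat_fact fact_Suc)

end

section \<open>Height one\<close>

text \<open>Meant for elements that are nilpotent modulo the box ideal, with \<open>N\<close> a
  bound on the nonvanishing powers; then this is evaluation of the full power series.\<close>

definition poly_eval_fps :: "nat => 'a::comm_ring_1 fps => 'a mpoly => 'a mpoly" where
 "poly_eval_fps N F U = (\<Sum>i\<le>N. mpoly_const (fps_nth F i) * U ^ i)"

lemma lookup_power_low:
 assumes "mcoeff U 0 = 0" "mcoeff (U ^ i) m \<noteq> 0"
 shows "i \<le> total_degree m"
 using assms(2)
proof (induction i arbitrary: m)
 case (Suc i)
 then have "m \<in> mkeys (U * U ^ i)" by (simp add: in_keys_iff)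
 then obtain a b where ab: "a \<in> mkeys U" "b \<in> mkeys (U ^ i)" "m = a + b"
  using keys_mult[of U "U ^ i"] by auto
 then have "a \<noteq> 0" using assms(1) by (auto simp: in_keys_iff)
 then have "total_degree a \<noteq> 0"
  by (auto simp: total_degree_def in_keys_iff poly_mapping_eq_iff fun_eq_iff)
 moreover have "i \<le> total_degree b" using Suc.IH ab(2) by (simp add: in_keys_iff)
 ultimately show ?case using ab(3) by simp
qed simp

text \<open>Without constant term, \<open>U ^ i\<close> starts in total degree \<open>i\<close>, and
  the box stays within total degree \<open>d * q\<close>. Hence the bound
  \<open>d * CARD('p)\<close> used for height one.\<close>

lemma mcong_power_high:
 assumes "mcoeff U 0 = 0" "d * q < i"
 shows "mcong q d (U ^ i) 0"
 unfolding mcong_def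
proof
 fix m assume m: "m \<in> box q d"
 have "total_degree m = (\<Sum>i<d. mcoeff m i)" by (rule total_degree_box[OF m])
 also have "\<dots> \<le> (\<Sum>i<d. q)" using m by (intro sum_mono) (auto simp: box_def less_imp_le)
 finally have "total_degree m \<le> d * q" by simp
 then have "mcoeff (U ^ i) m = 0"
  using lookup_power_low[OF assms(1), of i m] assms(2) by force
 then show "mcoeff (U ^ i) m = mcoeff 0 m" by simp
qed

lemma poly_eval_fps_cong: "mcong q d U V ==> mcong q d (poly_eval_fps N F U) (poly_eval_fps N F V)"
 unfolding poly_eval_fps_def by (intro mcong_sum mcong_mult mcong_refl mcong_power)

lemma mpoly_const_sum: "mpoly_const (sum f A) = (\<Sum>i\<in>A. mpoly_const (f i))"
 by (induction A rule: infinite_finite_induct) (simp_all add: mpoly_const_add)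

text \<open>Terms with \<open>i + j > N\<close> vanish by nilpotency; the remaining ones form the
  triangle of the Cauchy product.\<close>

lemma poly_eval_fps_mult:
 assumes U: "!!i. N < i ==> mcong q d (U ^ i) 0"
 shows "mcong q d (poly_eval_fps N F U * poly_eval_fps N G U) (poly_eval_fps N (F * G) U)"
proof -
 let ?t = "%i j. mpoly_const (fps_nth F i * fps_nth G j) * U ^ (i + j)"
 have "poly_eval_fps N F U * poly_eval_fps N G U = (\<Sum>(i, j)\<in>{..N} \<times> {..N}. ?t i j)"
  unfolding poly_eval_fps_def sum_product sum.cartesian_product
  by (intro sum.cong refl) (auto simp: mpoly_const_mult power_add ac_simps)
 also have "mcong q d \<dots> (\<Sum>x\<in>{..N} \<times> {..N}. if fst x + snd x \<le> N then ?t (fst x) (snd x) else 0)"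
  unfolding case_prod_unfold
 proof (rule mcong_sum)
  fix x :: "nat \<times> nat"
  show "mcong q d (?t (fst x) (snd x)) (if fst x + snd x \<le> N then ?t (fst x) (snd x) else 0)"
  proof (cases "fst x + snd x \<le> N")
   case False
   then have "mcong q d (?t (fst x) (snd x)) (mpoly_const (fps_nth F (fst x) * fps_nth G (snd x)) * 0)"
    by (intro mcong_mult mcong_refl U) simp
   with False show ?thesis by simp
  qed simp
 qed
 also have "(\<Sum>x\<in>{..N} \<times> {..N}. if fst x + snd x \<le> N then ?t (fst x) (snd x) else 0) =
   (\<Sum>x\<in>{(i, j). i + j \<le> N}. ?t (fst x) (snd x))"
  by (rule sum.mono_neutral_cong_right) auto
 also have "\<dots> = (\<Sum>(i, j)\<in>{(i, j). i + j \<le> N}. ?t i j)" by (simp add: case_prod_unfold)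
 also have "\<dots> = (\<Sum>k\<le>N. \<Sum>i\<le>k. ?t i (k - i))" by (rule sum.triangle_reindex_eq)
 also have "\<dots> = poly_eval_fps N (F * G) U"
  unfolding poly_eval_fps_def fps_mult_nth mpoly_const_sum sum_distrib_right atLeast0AtMost
  by (intro sum.cong refl) auto
 finally show ?thesis .
qed

lemma poly_eval_fps_1: "poly_eval_fps N 1 U = 1"
proof -
 have "poly_eval_fps N 1 U = (\<Sum>i\<le>N. if i = 0 then 1 else 0)"
  unfolding poly_eval_fps_def by (intro sum.cong refl) auto
 then show ?thesis by simp
qed

lemma poly_eval_fps_X:
 assumes "N \<ge> 1"
 shows "poly_eval_fps N fps_X U = U"
proof -
 have "poly_eval_fps N fps_X U = (\<Sum>i\<le>N. if i = 1 then U else 0)"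
  unfolding poly_eval_fps_def by (intro sum.cong refl) auto
 then show ?thesis using assms by simp
qed

lemma poly_eval_fps_power:
 assumes U: "!!i. N < i ==> mcong q d (U ^ i) 0"
 shows "mcong q d (poly_eval_fps N G U ^ k) (poly_eval_fps N (G ^ k) U)"
proof (induction k)
 case (Suc k)
 have "mcong q d (poly_eval_fps N G U ^ Suc k) (poly_eval_fps N G U * poly_eval_fps N (G ^ k) U)"
  unfolding power_Suc by (intro mcong_mult mcong_refl Suc)
 also have "mcong q d \<dots> (poly_eval_fps N (G ^ Suc k) U)"
  unfolding power_Suc by (rule poly_eval_fps_mult[OF U])
 finally show ?case .
qed (simp add: poly_eval_fps_1)

lemma poly_eval_fps_compose:
 assumes U: "!!i. N < i ==> mcong q d (U ^ i) 0" and G: "fps_nth G 0 = 0"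
 shows "mcong q d (poly_eval_fps N F (poly_eval_fps N G U)) (poly_eval_fps N (F oo G) U)"
proof -
 have "mcong q d (poly_eval_fps N F (poly_eval_fps N G U)) (\<Sum>k\<le>N. mpoly_const (fps_nth F k) * poly_eval_fps N (G ^ k) U)"
  unfolding poly_eval_fps_def[of N F] by (intro mcong_sum mcong_mult mcong_refl poly_eval_fps_power U)
 also have "(\<Sum>k\<le>N. mpoly_const (fps_nth F k) * poly_eval_fps N (G ^ k) U) =
   (\<Sum>i\<le>N. \<Sum>k\<le>N. mpoly_const (fps_nth F k * fps_nth (G ^ k) i) * U ^ i)"
  unfolding poly_eval_fps_def sum_distrib_left by (subst sum.swap) (simp add: mpoly_const_mult mult.assoc)
 also have "\<dots> = (\<Sum>i\<le>N. \<Sum>k\<le>i. mpoly_const (fps_nth F k * fps_nth (G ^ k) i) * U ^ i)"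
 proof (rule sum.cong[OF refl])
  fix i assume i: "i \<in> {..N}"
  show "(\<Sum>k\<le>N. mpoly_const (fps_nth F k * fps_nth (G ^ k) i) * U ^ i) =
    (\<Sum>k\<le>i. mpoly_const (fps_nth F k * fps_nth (G ^ k) i) * U ^ i)"
  proof (rule sum.mono_neutral_right)
   show "\<forall>k\<in>{..N} - {..i}. mpoly_const (fps_nth F k * fps_nth (G ^ k) i) * U ^ i = 0"
    using startsby_zero_power_prefix[OF G] by auto
  qed (use i in auto)
 qed
 also have "\<dots> = poly_eval_fps N (F oo G) U"
  unfolding poly_eval_fps_def fps_compose_nth mpoly_const_sum sum_distrib_right atLeast0AtMost ..
 finally show ?thesis .
qed

context
 fixes ty :: "'p::prime_card itself"
begin

text \<open>The truncated exponential \<open>exp(c x\<^sub>l)\<close>, which agrees with the Artin--Hasse exponential for \<open>c = 1\<close>.\<close>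

definition texp :: "'p mod_ring => nat => 'p mod_ring mpoly" where
 "texp c l = (\<Sum>k<CARD('p). mpoly_const (c ^ k / of_nat (fact k)) * pvar l ^ k)"

lemma texp_mpolys: "l < d ==> texp c l \<in> mpolys d"
 unfolding texp_def by (intro mpolys_sum mpolys_mult mpolys_const mpolys_power mpolys_pvar)

lemma texp_0: "texp 0 l = 1"
proof -
 have "texp 0 l = (\<Sum>k<CARD('p). if k = 0 then 1 else 0)"
  unfolding texp_def by (intro sum.cong refl) (auto simp: power_0_left)
 then show ?thesis using p_ge2[where 'p='p] by simp
qed

text \<open>The factorials below \<open>p\<close> are invertible and \<open>x_l^p\<close> vanishes,
  so the functional equation of the exponential holds for the truncated series.\<close>

lemma texp_add:
 assumes l: "l < d"
 shows "mcong CARD('p) d (texp a l * texp b l) (texp (a + b) l)"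
proof -
 let ?x = "pvar l :: 'p mod_ring mpoly"
 let ?N = "CARD('p) - 1"
 have N: "{..<CARD('p)} = {..?N}" using p_ge2[where 'p='p] by auto
 have U: "mcong CARD('p) d (?x ^ i) 0" if "?N < i" for i
  using that l by (intro mcong_pvar_power_0) auto
 define E where "E c = Abs_fps (%k. c ^ k / of_nat (fact k))" for c :: "'p mod_ring"
 have tE: "texp c l = poly_eval_fps ?N (E c) ?x" for c
  by (simp add: texp_def poly_eval_fps_def N E_def)
 have "fps_nth (E a * E b) k = fps_nth (E (a + b)) k" if k: "k \<le> ?N" for k
 proof -
  have kp: "k < CARD('p)" using k p_ge2[where 'p='p] by simp
  have nz: "(of_nat (fact i) :: 'p mod_ring) \<noteq> 0" if "i \<le> k" for i
   using that kp by (intro fact_mod_ring_nonzero) simp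
  have "a ^ i / of_nat (fact i) * (b ^ (k - i) / of_nat (fact (k - i))) =
    of_nat (k choose i) * a ^ i * b ^ (k - i) / of_nat (fact k)" if i: "i \<le> k" for i
  proof -
   have "(of_nat (fact i) * of_nat (fact (k - i)) * of_nat (k choose i) :: 'p mod_ring) = of_nat (fact k)"
    using arg_cong[OF binomial_fact_lemma[OF i], of "of_nat :: nat => 'p mod_ring"] by (simp only: of_nat_mult)
   then show ?thesis using nz[OF i] nz[of "k - i"] nz[of k] by (simp add: divide_simps del: of_nat_fact) (simp add: ac_simps del: of_nat_fact)
  qed
  then have "fps_nth (E a * E b) k = (\<Sum>i\<le>k. of_nat (k choose i) * a ^ i * b ^ (k - i) / of_nat (fact k))"
   unfolding E_def fps_mult_nth fps_nth_Abs_fps atLeast0AtMost by (intro sum.cong refl) auto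
  also have "\<dots> = (a + b) ^ k / of_nat (fact k)"
   unfolding binomial_ring sum_divide_distrib ..
  finally show ?thesis by (simp add: E_def)
 qed
 then have "poly_eval_fps ?N (E a * E b) ?x = poly_eval_fps ?N (E (a + b)) ?x"
  unfolding poly_eval_fps_def by (intro sum.cong refl) simp
 then show ?thesis unfolding tE using poly_eval_fps_mult[OF U, of ?N "E a" "E b"] by simp
qed

lemma texp_power:
 assumes l: "l < d"
 shows "mcong CARD('p) d (texp a l ^ r) (texp (of_nat r * a) l)"
proof (induction r)
 case 0
 then show ?case by (simp add: texp_0)
next
 case (Suc r)
 have "mcong CARD('p) d (texp a l ^ Suc r) (texp a l * texp (of_nat r * a) l)"
  unfolding power_Suc by (intro mcong_mult mcong_refl Suc)
 also have "mcong CARD('p) d \<dots> (texp (a + of_nat r * a) l)" by (rule texp_add[OF l])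
 finally show ?case by (simp add: ring_distribs)
qed

lemma lookup_prod_texp:
 assumes m: "m \<in> box CARD('p) d"
 shows "mcoeff (\<Prod>l<d. texp (c l) l) m =
  (\<Prod>l<d. c l ^ mcoeff m l / of_nat (fact (mcoeff m l)))"
proof -
 let ?t = "%k l. c l ^ k / of_nat (fact k) :: 'p mod_ring"
 have const_prod: "mpoly_const (prod f A) = (\<Prod>i\<in>A. mpoly_const (f i))" for f :: "nat => 'p mod_ring" and A
  by (induction A rule: infinite_finite_induct) (simp_all add: mpoly_const_mult)
 have mono: "(\<Prod>l<d. pvar l ^ g l) = (msingle (monomial_of d g) 1 :: 'p mod_ring mpoly)" for g
 proof -
  have "(\<Prod>l\<in>A. pvar l ^ g l) = (msingle (\<Sum>l\<in>A. msingle l (g l)) 1 :: 'p mod_ring mpoly)" if "finite A" for A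
   using that by (induction A rule: finite_induct) (simp_all add: pvar_power mult_single)
  then show ?thesis by (simp add: monomial_of_def)
 qed
 have "(\<Prod>l<d. texp (c l) l) = (\<Sum>g\<in>PiE {..<d} (%_. {..<CARD('p)}). \<Prod>l<d. mpoly_const (?t (g l) l) * pvar l ^ g l)"
  unfolding texp_def by (rule prod_sum_PiE) auto
 also have "\<dots> = (\<Sum>g\<in>PiE {..<d} (%_. {..<CARD('p)}). mpoly_const (\<Prod>l<d. ?t (g l) l) * msingle (monomial_of d g) 1)"
  by (intro sum.cong refl) (simp only: prod.distrib const_prod mono)
 finally have "mcoeff (\<Prod>l<d. texp (c l) l) m =
   (\<Sum>g\<in>PiE {..<d} (%_. {..<CARD('p)}). if monomial_of d g = m then \<Prod>l<d. ?t (g l) l else 0)"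
  by (simp only: lookup_sum lookup_const_mult lookup_single when_def) (intro sum.cong, auto)
 also have "\<dots> = (\<Sum>g\<in>PiE {..<d} (%_. {..<CARD('p)}). if g = (\<lambda>l\<in>{..<d}. mcoeff m l) then \<Prod>l<d. ?t (g l) l else 0)"
 proof (intro sum.cong refl)
  fix g assume g: "g \<in> PiE {..<d} (%_. {..<CARD('p)})"
  have "monomial_of d g = m \<longleftrightarrow> g = (\<lambda>l\<in>{..<d}. mcoeff m l)"
  proof
   assume "monomial_of d g = m"
   then show "g = (\<lambda>l\<in>{..<d}. mcoeff m l)"
    using g by (intro ext) (auto simp: lookup_monomial_of PiE_iff extensional_def)
  next
   assume "g = (\<lambda>l\<in>{..<d}. mcoeff m l)"
   then have "monomial_of d g = monomial_of d (mcoeff m)"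
    by (intro poly_mapping_eqI) (simp add: lookup_monomial_of)
   then show "monomial_of d g = m" using monomial_of_lookup[OF m] by simp
  qed
  then show "(if monomial_of d g = m then \<Prod>l<d. ?t (g l) l else 0) =
    (if g = (\<lambda>l\<in>{..<d}. mcoeff m l) then \<Prod>l<d. ?t (g l) l else 0)" by simp
 qed
 also have "\<dots> = (\<Prod>l<d. ?t ((\<lambda>l\<in>{..<d}. mcoeff m l) l) l)"
 proof -
  have "(\<lambda>l\<in>{..<d}. mcoeff m l) \<in> PiE {..<d} (%_. {..<CARD('p)})"
   using m by (simp add: PiE_iff box_def)
  then show ?thesis by (simp add: finite_PiE)
 qed
 finally show ?thesis by simp
qed

definition texp_prod :: "nat => (nat => 'p mod_ring) => 'p mod_ring mpoly" where
 "texp_prod d c = (\<Prod>l<d. texp (c l) l)"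

lemma texp_prod_mpolys: "texp_prod d c \<in> mpolys d"
 unfolding texp_prod_def by (intro mpolys_prod texp_mpolys) simp

lemma texp_prod_lookup_0: "mcoeff (texp_prod d c - 1) 0 = 0"
proof -
 have "0 \<in> box CARD('p) d" using p_ge2[where 'p='p] by (simp add: box_def)
 then show ?thesis by (simp add: texp_prod_def lookup_minus lookup_prod_texp lookup_one)
qed

lemma texp_prod_add: "mcong CARD('p) d (texp_prod d a * texp_prod d b) (texp_prod d (%l. a l + b l))"
 unfolding texp_prod_def prod.distrib[symmetric] by (intro mcong_prod texp_add) simp

lemma texp_prod_power: "mcong CARD('p) d (texp_prod d a ^ r) (texp_prod d (%l. of_nat r * a l))"
 unfolding texp_prod_def prod_power_distrib by (intro mcong_prod texp_power) simp

text \<open>A binomial expansion parallel to \<open>fps_exp_minus_one_power\<close>; the two are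
  matched in \<open>fgl_poly_height_one\<close>.\<close>

lemma lookup_texp_prod_power:
 assumes m: "m \<in> box CARD('p) d"
 shows "mcoeff ((texp_prod d c - 1) ^ i) m =
  (\<Sum>r\<le>i. of_nat (i choose r) * (-1) ^ (i - r) *
   (\<Prod>l<d. (of_nat r * c l) ^ mcoeff m l / of_nat (fact (mcoeff m l))))"
proof -
 have "(texp_prod d c - 1) ^ i = (\<Sum>r\<le>i. mpoly_const (of_nat (i choose r) * (-1) ^ (i - r)) * texp_prod d c ^ r)"
 proof -
  have cn: "mpoly_const (of_nat k) = (of_nat k :: 'p mod_ring mpoly)" for k
   by (induction k) (simp_all add: mpoly_const_add)
  have cm: "mpoly_const (- 1) = (- 1 :: 'p mod_ring mpoly)"
   by (simp add: mpoly_const_def single_uminus)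
  show ?thesis
   using binomial_ring[of "texp_prod d c" "-1" i]
   by (simp add: mpoly_const_mult mpoly_const_power cn cm ac_simps)
 qed
 then have "mcoeff ((texp_prod d c - 1) ^ i) m =
   (\<Sum>r\<le>i. of_nat (i choose r) * (-1) ^ (i - r) * mcoeff (texp_prod d c ^ r) m)"
  by (simp only: lookup_sum lookup_const_mult)
 also have "\<dots> = (\<Sum>r\<le>i. of_nat (i choose r) * (-1) ^ (i - r) *
   mcoeff (\<Prod>l<d. texp (of_nat r * c l) l) m)"
  using texp_prod_power[of d c] m by (intro sum.cong refl) (simp add: mcong_def texp_prod_def)
 finally show ?thesis by (simp only: lookup_prod_texp[OF m])
qed

text \<open>By \<open>exp_series_ah\<close> the formal sum is the inverse of the Artin-Hasse series
  minus 1, applied to a product of exponentials minus 1. Inside the box all exponents are below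
  \<open>p\<close>, so their factorials are invertible modulo \<open>p\<close>.\<close>

lemma fgl_poly_height_one:
 fixes A :: "'p mod_ring mat"
 shows "mcong CARD('p) d (fgl_poly 1 d A j) (poly_eval_fps (d * CARD('p)) ahi_mod (texp_prod d (%l. A $$ (l, j)) - 1))"
 unfolding mcong_def
proof
 fix m assume m: "m \<in> box CARD('p) d"
 let ?U = "texp_prod d (%l. A $$ (l, j)) - 1"
 let ?N = "d * CARD('p)"
 define a where "a l = to_int_mod_ring (A $$ (l, j))" for l
 have a: "of_int (a l) = A $$ (l, j)" for l by (simp add: a_def of_int_to_int_mod_ring)
 have mp: "mcoeff m l < CARD('p)" if "l < d" for l using m that by (simp add: box_def)
 let ?k = "total_degree m"
 have deg: "?k = (\<Sum>l<d. mcoeff m l)" by (rule total_degree_box[OF m])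
 have kN: "?k \<le> ?N"
  unfolding deg using sum_mono[of "{..<d}" "mcoeff m" "%_. CARD('p)"] mp by (simp add: less_imp_le)
 \<comment> \<open>The rational lift of the coefficient of \<open>m\<close> in
   \<open>?U ^ i\<close>; its summands are integral, so it can be reduced term by term.\<close>
 define T :: "nat => rat" where "T i = (\<Sum>r\<le>i. of_int (int (i choose r) * (-1) ^ (i - r)) *
   (\<Prod>l<d. of_int (int r * a l) ^ mcoeff m l * (1 / fact (mcoeff m l))))" for i
 note pr = p_pr[where 'p='p]
 have Tfac: "p_integral CARD('p) (of_int z ^ mcoeff m l * (1 / fact (mcoeff m l)))"
  if "l < d" for z l
  using mp[OF that] by (intro p_integral_mult[OF pr] p_integral_power[OF pr] p_integral_of_int[OF pr] reduce_rat_inverse_fact(2))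
 have Tprod: "p_integral CARD('p) (\<Prod>l<d. of_int (int r * a l) ^ mcoeff m l * (1 / fact (mcoeff m l)))" for r
  by (intro p_integral_prod[OF pr] Tfac) simp
 have Tint: "p_integral CARD('p) (T i)" for i
  unfolding T_def by (intro p_integral_sum[OF pr] p_integral_mult[OF pr] p_integral_of_int[OF pr] Tprod)
 have redfac: "(reduce_rat (of_int z ^ mcoeff m l * (1 / fact (mcoeff m l))) :: 'p mod_ring) =
   of_int z ^ mcoeff m l / of_nat (fact (mcoeff m l))" if "l < d" for z l
 proof -
  have "(reduce_rat (of_int z ^ mcoeff m l * (1 / fact (mcoeff m l))) :: 'p mod_ring) =
    reduce_rat (of_int z ^ mcoeff m l) * reduce_rat (1 / fact (mcoeff m l))"
   using mp[OF that] by (intro reduce_rat_mult p_integral_power[OF pr] p_integral_of_int[OF pr] reduce_rat_inverse_fact(2))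
  moreover have "(reduce_rat (of_int z ^ mcoeff m l) :: 'p mod_ring) = of_int z ^ mcoeff m l"
   using reduce_rat_power[OF p_integral_of_int[OF pr], of z] by (simp only: reduce_rat_of_int)
  ultimately show ?thesis using reduce_rat_inverse_fact(1)[OF mp[OF that]] by (simp only: times_divide_eq_right mult_1_right)
 qed
 have redT: "(reduce_rat (T i) :: 'p mod_ring) = mcoeff (?U ^ i) m" for i
 proof -
  have "(reduce_rat (T i) :: 'p mod_ring) = (\<Sum>r\<le>i. of_int (int (i choose r) * (-1) ^ (i - r)) *
   (\<Prod>l<d. of_int (int r * a l) ^ mcoeff m l / of_nat (fact (mcoeff m l))))"
  proof -
   have "(reduce_rat (T i) :: 'p mod_ring) = (\<Sum>r\<le>i. reduce_rat (of_int (int (i choose r) * (-1) ^ (i - r)) *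
     (\<Prod>l<d. of_int (int r * a l) ^ mcoeff m l * (1 / fact (mcoeff m l)))))"
    unfolding T_def by (rule reduce_rat_sum) (intro p_integral_mult[OF pr] p_integral_of_int[OF pr] Tprod)
   also have "\<dots> = (\<Sum>r\<le>i. reduce_rat (of_int (int (i choose r) * (-1) ^ (i - r))) *
     (\<Prod>l<d. reduce_rat (of_int (int r * a l) ^ mcoeff m l * (1 / fact (mcoeff m l)))))"
   proof (intro sum.cong refl)
    fix r
    show "(reduce_rat (of_int (int (i choose r) * (-1) ^ (i - r)) *
     (\<Prod>l<d. of_int (int r * a l) ^ mcoeff m l * (1 / fact (mcoeff m l)))) :: 'p mod_ring) =
     reduce_rat (of_int (int (i choose r) * (-1) ^ (i - r))) *
     (\<Prod>l<d. reduce_rat (of_int (int r * a l) ^ mcoeff m l * (1 / fact (mcoeff m l))))"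
     using reduce_rat_mult[OF p_integral_of_int[OF pr] Tprod, of "int (i choose r) * (-1) ^ (i - r)" r]
      reduce_rat_prod[of "{..<d}" "%l. of_int (int r * a l) ^ mcoeff m l * (1 / fact (mcoeff m l))", OF Tfac]
     by (simp only: lessThan_iff)
   qed
   also have "\<dots> = (\<Sum>r\<le>i. of_int (int (i choose r) * (-1) ^ (i - r)) *
     (\<Prod>l<d. of_int (int r * a l) ^ mcoeff m l / of_nat (fact (mcoeff m l))))"
    unfolding reduce_rat_of_int by (intro sum.cong refl arg_cong2[of _ _ _ _ "(*)"] prod.cong redfac) simp
   finally show ?thesis .
  qed
  then show ?thesis unfolding lookup_texp_prod_power[OF m] by (simp only: of_int_mult of_int_of_nat_eq of_int_power of_int_minus of_int_1 a)
 qed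
 \<comment> \<open>The factorial of the total degree, which need not be prime to \<open>p\<close>,
   cancels against the one in the multinomial coefficient.\<close>
 have coeff: "fps_nth ((fps_exp 1 - 1 :: rat fps) ^ i) ?k * multinomial_term d a m = T i" for i
 proof -
  have w: "of_nat r ^ ?k / fact ?k * multinomial_term d a m =
    (\<Prod>l<d. of_int (int r * a l) ^ mcoeff m l * (1 / fact (mcoeff m l)) :: rat)" for r
  proof -
   have "(of_nat r :: rat) ^ ?k = (\<Prod>l<d. of_nat r ^ mcoeff m l)"
    unfolding deg by (rule power_sum)
   then show ?thesis by (simp add: multinomial_term_def power_mult_distrib flip: prod.distrib)
  qed
  show ?thesis unfolding fps_exp_minus_one_power T_def sum_distrib_right
   by (intro sum.cong refl)
    (simp only: mult.assoc w of_int_mult of_int_power of_int_minus of_int_1 of_int_of_nat_eq)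
 qed
 have "mcoeff (fgl_poly 1 d A j) m = reduce_rat (fps_nth (exp_series CARD('p) 1) ?k * multinomial_term d a m)"
  using m by (simp add: fgl_poly_def lookup_truncate a_def[abs_def])
 also have "fps_nth (exp_series CARD('p) 1) ?k * multinomial_term d a m = (\<Sum>i=0..?k. fps_nth (ah_inverse TYPE('p)) i * T i)"
  unfolding exp_series_ah fps_compose_nth sum_distrib_right by (simp only: mult.assoc coeff)
 also have "reduce_rat (\<Sum>i=0..?k. fps_nth (ah_inverse TYPE('p)) i * T i) = (\<Sum>i=0..?k. fps_nth (ahi_mod :: 'p mod_ring fps) i * mcoeff (?U ^ i) m)"
 proof -
  have "(reduce_rat (\<Sum>i=0..?k. fps_nth (ah_inverse TYPE('p)) i * T i) :: 'p mod_ring) = (\<Sum>i=0..?k. reduce_rat (fps_nth (ah_inverse TYPE('p)) i * T i))"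
   by (rule reduce_rat_sum) (intro p_integral_mult[OF pr] ah_inverse_integral Tint)
  also have "\<dots> = (\<Sum>i=0..?k. reduce_rat (fps_nth (ah_inverse TYPE('p)) i) * reduce_rat (T i))"
   by (intro sum.cong refl reduce_rat_mult ah_inverse_integral Tint)
  finally show ?thesis by (simp add: redT ahi_mod_def reduce_fps_def)
 qed
 \<comment> \<open>Powers of \<open>?U\<close> beyond the total degree of \<open>m\<close> do not
   reach \<open>m\<close>.\<close>
 also have "\<dots> = (\<Sum>i\<le>?N. fps_nth (ahi_mod :: 'p mod_ring fps) i * mcoeff (?U ^ i) m)"
 proof (rule sum.mono_neutral_left)
  show "\<forall>i\<in>{..?N} - {0..?k}. fps_nth (ahi_mod :: 'p mod_ring fps) i * mcoeff (?U ^ i) m = 0"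
   using lookup_power_low[OF texp_prod_lookup_0] by fastforce
 qed (use kN in auto)
 also have "\<dots> = mcoeff (poly_eval_fps ?N ahi_mod ?U) m"
  by (simp only: poly_eval_fps_def lookup_sum lookup_const_mult)
 finally show "mcoeff (fgl_poly 1 d A j) m = mcoeff (poly_eval_fps ?N ahi_mod ?U) m" .
qed

end

section \<open>Truncated exponentials as the group elements of a group ring\<close>

context
 fixes ty :: "'p::prime_card itself"
begin

text \<open>Below degree \<open>p\<close> the Artin-Hasse series is the exponential, and the higher
  powers of \<open>U\<close> vanish.\<close>

lemma texp_poly_eval:
 assumes U: "mcong q d (U ^ CARD('p)) 0" and N: "N \<ge> CARD('p) - 1"
 shows "mcong q d (poly_eval_fps N (1 + ah_mod) U) (\<Sum>k<CARD('p). mpoly_const (1 / of_nat (fact k) :: 'p mod_ring) * U ^ k)"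
proof -
 have high: "mcong q d (U ^ k) 0" if "k \<ge> CARD('p)" for k
 proof -
  have "U ^ k = U ^ CARD('p) * U ^ (k - CARD('p))" using that by (simp flip: power_add)
  then show ?thesis using mcong_mult[OF U mcong_refl[of q d "U ^ (k - CARD('p))"]] by simp
 qed
 have "mcong q d (poly_eval_fps N (1 + ah_mod) U)
   (\<Sum>k\<le>N. if k < CARD('p) then mpoly_const (1 / of_nat (fact k) :: 'p mod_ring) * U ^ k else 0)"
  unfolding poly_eval_fps_def
 proof (rule mcong_sum)
  fix k
  show "mcong q d (mpoly_const (fps_nth (1 + ah_mod) k) * U ^ k)
    (if k < CARD('p) then mpoly_const (1 / of_nat (fact k) :: 'p mod_ring) * U ^ k else 0)"
  proof (cases "k < CARD('p)")
   case True
   then have "fps_nth (1 + ah_mod) k = (1 / of_nat (fact k) :: 'p mod_ring)"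
    using ah_mod_small[where 'p='p, OF True] by simp
   with True show ?thesis by simp
  next
   case False
   then have "mcong q d (mpoly_const (fps_nth (1 + ah_mod) k) * U ^ k) (mpoly_const (fps_nth (1 + ah_mod :: 'p mod_ring fps) k) * 0)"
    by (intro mcong_mult mcong_refl high) simp
   with False show ?thesis by simp
  qed
 qed
 also have "(\<Sum>k\<le>N. if k < CARD('p) then mpoly_const (1 / of_nat (fact k) :: 'p mod_ring) * U ^ k else 0) =
   (\<Sum>k<CARD('p). mpoly_const (1 / of_nat (fact k) :: 'p mod_ring) * U ^ k)"
  using N by (intro sum.mono_neutral_cong_right) auto
 finally show ?thesis .
qed

lemma texp_1: "texp (1 :: 'p mod_ring) l = (\<Sum>k<CARD('p). mpoly_const (1 / of_nat (fact k)) * pvar l ^ k)"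
 by (simp add: texp_def)

lemma texp_as_unit_vector:
 assumes "l < d"
 shows "texp_prod d (%i. if i = l then (1 :: 'p mod_ring) else 0) = texp 1 l"
proof -
 have "texp_prod d (%i. if i = l then (1 :: 'p mod_ring) else 0) = (\<Prod>i<d. if i = l then texp 1 i else 1)"
  unfolding texp_prod_def by (intro prod.cong) (auto simp: texp_0)
 then show ?thesis using assms by simp
qed

text \<open>The Artin-Hasse series meets its own inverse from \<open>fgl_poly_height_one\<close>,
  which leaves a product of exponentials. In the exponents the action has thus become
  linear.\<close>

lemma subst_texp:
 fixes A :: "'p mod_ring mat"
 assumes j: "j < d"
 shows "mcong CARD('p) d (mpoly_subst (fgl_poly 1 d A) (texp 1 j)) (texp_prod d (%l. A $$ (l, j)))"
proof -
 let ?U = "texp_prod d (%l. A $$ (l, j)) - 1"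
 let ?S = "fgl_poly 1 d A j"
 have N: "d * CARD('p) \<ge> CARD('p) - 1" "d * CARD('p) \<ge> 1"
  using j p_ge2[where 'p='p] by (cases d; simp)+
 have "mpoly_subst (fgl_poly 1 d A) (texp 1 j) = (\<Sum>k<CARD('p). mpoly_const (1 / of_nat (fact k)) * ?S ^ k)"
  unfolding texp_1 by (simp add: mpoly_subst_sum mpoly_subst_mult mpoly_subst_power)
 also have "mcong CARD('p) d \<dots> (poly_eval_fps (d * CARD('p)) (1 + ah_mod) ?S)"
  using fgl_poly_power_0(1)[of 1 d A j] N by (intro mcong_sym[OF texp_poly_eval]) simp_all
 also have "mcong CARD('p) d \<dots> (poly_eval_fps (d * CARD('p)) (1 + ah_mod) (poly_eval_fps (d * CARD('p)) ahi_mod ?U))"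
  by (intro poly_eval_fps_cong fgl_poly_height_one)
 also have "mcong CARD('p) d \<dots> (poly_eval_fps (d * CARD('p)) ((1 + ah_mod) oo ahi_mod) ?U)"
  by (intro poly_eval_fps_compose mcong_power_high texp_prod_lookup_0 ahi_mod_0)
 also have "(1 + ah_mod) oo ahi_mod = (1 + fps_X :: 'p mod_ring fps)"
  by (simp add: fps_compose_add_distrib ah_mod_inverse)
 also have "poly_eval_fps (d * CARD('p)) (1 + fps_X) ?U = poly_eval_fps (d * CARD('p)) 1 ?U + poly_eval_fps (d * CARD('p)) fps_X ?U"
  by (simp add: poly_eval_fps_def mpoly_const_add ring_distribs sum.distrib)
 also have "\<dots> = texp_prod d (%l. A $$ (l, j))"
  using N by (simp add: poly_eval_fps_1 poly_eval_fps_X)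
 finally show ?thesis .
qed

text \<open>The inverse series applied to an exponential minus 1 returns the variable, so the
  exponentials generate the algebra.\<close>

lemma pvar_texp:
 assumes l: "l < d"
 shows "mcong CARD('p) d (pvar l) (poly_eval_fps (d * CARD('p)) ahi_mod (texp (1 :: 'p mod_ring) l - 1))"
proof -
 let ?x = "pvar l :: 'p mod_ring mpoly"
 have N: "d * CARD('p) \<ge> CARD('p)" "d * CARD('p) \<ge> 1" using l p_ge2[where 'p='p] by (cases d; simp)+
 have high: "mcong CARD('p) d (?x ^ i) 0" if "d * CARD('p) < i" for i
  by (rule mcong_pvar_power_0[OF l]) (use that N(1) in linarith)
 have xp: "mcong CARD('p) d (?x ^ CARD('p)) 0" using l by (intro mcong_pvar_power_0) auto
 have "mcong CARD('p) d (poly_eval_fps (d * CARD('p)) (1 + ah_mod) ?x) (texp 1 l)"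
  unfolding texp_1 by (intro texp_poly_eval xp) (use N(1) in linarith)
 moreover have "poly_eval_fps (d * CARD('p)) (1 + ah_mod) ?x = 1 + poly_eval_fps (d * CARD('p)) ah_mod ?x"
 proof -
  have "poly_eval_fps (d * CARD('p)) (1 + ah_mod) ?x = poly_eval_fps (d * CARD('p)) 1 ?x + poly_eval_fps (d * CARD('p)) ah_mod ?x"
   by (simp add: poly_eval_fps_def mpoly_const_add ring_distribs sum.distrib)
  then show ?thesis by (simp add: poly_eval_fps_1)
 qed
 ultimately have "mcong CARD('p) d (1 + poly_eval_fps (d * CARD('p)) ah_mod ?x - 1) (texp 1 l - 1)"
  by (intro mcong_diff mcong_refl) simp
 then have E: "mcong CARD('p) d (poly_eval_fps (d * CARD('p)) ah_mod ?x) (texp 1 l - 1)" by simp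
 have "?x = poly_eval_fps (d * CARD('p)) fps_X ?x" using N by (simp add: poly_eval_fps_X)
 also have "\<dots> = poly_eval_fps (d * CARD('p)) (ahi_mod oo ah_mod) ?x" by (simp add: ah_mod_inverse)
 also have "mcong CARD('p) d \<dots> (poly_eval_fps (d * CARD('p)) ahi_mod (poly_eval_fps (d * CARD('p)) ah_mod ?x))"
  by (intro mcong_sym[OF poly_eval_fps_compose] high ah_mod_0)
 also have "mcong CARD('p) d \<dots> (poly_eval_fps (d * CARD('p)) ahi_mod (texp 1 l - 1))"
  by (rule poly_eval_fps_cong[OF E])
 finally show ?thesis .
qed

text \<open>For \<open>n = 1\<close> a matrix is a single column. As a vector of exponents it gives
  a product of exponentials that is additive in the vector, that is, a group element.\<close>

definition char_poly :: "nat => 'p mod_ring mat => 'p mod_ring mpoly" where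
 "char_poly d \<Phi> = texp_prod d (%l. \<Phi> $$ (l, 0))"

text \<open>Substitution is known on the basic exponentials only; integral lifts of the exponents
  express every group element through powers of these.\<close>

lemma texp_prod_nat:
 fixes c :: "nat => 'p mod_ring"
 shows "mcong CARD('p) d (texp_prod d c) (\<Prod>j<d. texp 1 j ^ nat (to_int_mod_ring (c j)))"
 unfolding texp_prod_def
proof (rule mcong_prod)
 fix j assume j: "j \<in> {..<d}"
 have "to_int_mod_ring (c j) \<in> range (to_int_mod_ring :: 'p mod_ring => int)" by (rule rangeI)
  then have "to_int_mod_ring (c j) \<ge> 0" unfolding range_to_int_mod_ring by simp
 then have "(of_nat (nat (to_int_mod_ring (c j))) :: 'p mod_ring) = of_int (to_int_mod_ring (c j))"
  by (rule of_nat_nat)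
 then have "(of_nat (nat (to_int_mod_ring (c j))) :: 'p mod_ring) = c j"
  by (simp only: of_int_to_int_mod_ring)
 then show "mcong CARD('p) d (texp (c j) j) (texp 1 j ^ nat (to_int_mod_ring (c j)))"
  using texp_power[of j d "1 :: 'p mod_ring" "nat (to_int_mod_ring (c j))"] j by (simp add: mcong_sym)
qed

lemma texp_prod_prod:
 fixes c :: "nat => nat => 'p mod_ring"
 shows "mcong CARD('p) d (\<Prod>j<k. texp_prod d (c j)) (texp_prod d (%l. \<Sum>j<k. c j l))"
proof (induction k)
 case 0
 then show ?case by (simp add: texp_prod_def texp_0)
next
 case (Suc k)
 have "mcong CARD('p) d (\<Prod>j<Suc k. texp_prod d (c j)) (texp_prod d (%l. \<Sum>j<k. c j l) * texp_prod d (c k))"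
  unfolding prod.lessThan_Suc by (intro mcong_mult mcong_refl Suc)
 also have "mcong CARD('p) d \<dots> (texp_prod d (%l. (\<Sum>j<k. c j l) + c k l))" by (rule texp_prod_add)
 finally show ?case by simp
qed

lemma subst_char_poly:
 assumes A: "A \<in> carrier_mat d d" and \<Phi>: "\<Phi> \<in> carrier_mat d 1"
 shows "mcong CARD('p) d (mpoly_subst (fgl_poly 1 d A) (char_poly d \<Phi>)) (char_poly d (A * \<Phi>))"
proof -
 let ?F = "fgl_poly 1 d A"
 let ?n = "%j. nat (to_int_mod_ring (\<Phi> $$ (j, 0)))"
 have n: "(of_nat (?n j) :: 'p mod_ring) = \<Phi> $$ (j, 0)" for j
 proof -
  have "to_int_mod_ring (\<Phi> $$ (j, 0)) \<in> range (to_int_mod_ring :: 'p mod_ring => int)" by (rule rangeI)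
  then have "to_int_mod_ring (\<Phi> $$ (j, 0)) \<ge> 0" unfolding range_to_int_mod_ring by simp
  then have "(of_nat (?n j) :: 'p mod_ring) = of_int (to_int_mod_ring (\<Phi> $$ (j, 0)))"
   by (rule of_nat_nat)
  then show ?thesis by (simp only: of_int_to_int_mod_ring)
 qed
 have F0: "mcong CARD('p) d (?F j ^ CARD('p)) 0" for j
  using fgl_poly_power_0(1)[of 1 d A j] by simp
 have "mcong CARD('p) d (mpoly_subst ?F (char_poly d \<Phi>)) (mpoly_subst ?F (\<Prod>j<d. texp 1 j ^ ?n j))"
  unfolding char_poly_def
  by (rule mcong_subst_arg[OF F0 texp_prod_mpolys _ texp_prod_nat]) (intro mpolys_prod mpolys_power texp_mpolys, simp)
 also have "mpoly_subst ?F (\<Prod>j<d. texp 1 j ^ ?n j) = (\<Prod>j<d. mpoly_subst ?F (texp 1 j) ^ ?n j)"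
  by (simp only: mpoly_subst_prod mpoly_subst_power)
 also have "mcong CARD('p) d \<dots> (\<Prod>j<d. texp_prod d (%l. A $$ (l, j)) ^ ?n j)"
  by (intro mcong_prod mcong_power subst_texp) simp
 also have "mcong CARD('p) d \<dots> (\<Prod>j<d. texp_prod d (%l. of_nat (?n j) * A $$ (l, j)))"
  by (intro mcong_prod texp_prod_power)
 also have "mcong CARD('p) d \<dots> (texp_prod d (%l. \<Sum>j<d. of_nat (?n j) * A $$ (l, j)))"
  by (rule texp_prod_prod)
 also have "\<dots> = char_poly d (A * \<Phi>)"
  unfolding char_poly_def texp_prod_def n
 proof (intro prod.cong refl arg_cong2[of _ _ _ _ texp])
  fix l assume "l \<in> {..<d}"
  then show "(\<Sum>j<d. \<Phi> $$ (j, 0) * A $$ (l, j)) = (A * \<Phi>) $$ (l, 0)"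
   using A \<Phi> by (simp add: scalar_prod_def lessThan_atLeast0 mult.commute)
 qed
 finally show ?thesis .
qed

text \<open>Products of group elements are group elements, so the span is a subalgebra.\<close>

lemma spanned_char_poly_mult:
 assumes "spanned CARD('p) d (carrier_mat d 1) (char_poly d) P" "spanned CARD('p) d (carrier_mat d 1) (char_poly d) Q"
 shows "spanned CARD('p) d (carrier_mat d 1) (char_poly d) (P * Q)"
proof -
 let ?S = "carrier_mat d 1 :: 'p mod_ring mat set"
 from assms obtain a b where a: "mcong CARD('p) d P (\<Sum>s\<in>?S. mpoly_const (a s) * char_poly d s)"
  and b: "mcong CARD('p) d Q (\<Sum>s\<in>?S. mpoly_const (b s) * char_poly d s)" unfolding spanned_def by blast
 have base: "spanned CARD('p) d ?S (char_poly d) (char_poly d s * char_poly d t)" if "s \<in> ?S" "t \<in> ?S" for s t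
 proof (rule spanned_cong[OF spanned_base])
  show "finite ?S" by (rule card_carrier_mat_finite)
  show st: "s + t \<in> ?S" using that by simp
  have "mcong CARD('p) d (char_poly d s * char_poly d t) (texp_prod d (%l. s $$ (l, 0) + t $$ (l, 0)))"
   unfolding char_poly_def by (rule texp_prod_add)
  also have "\<dots> = char_poly d (s + t)"
   unfolding char_poly_def texp_prod_def using that by (intro prod.cong) auto
  finally show "mcong CARD('p) d (char_poly d s * char_poly d t) (char_poly d (s + t))" .
 qed
 have "spanned CARD('p) d ?S (char_poly d) (\<Sum>s\<in>?S. \<Sum>t\<in>?S. mpoly_const (a s) * (mpoly_const (b t) * (char_poly d s * char_poly d t)))"
  by (intro spanned_sum spanned_scale base)
 moreover have eq: "(\<Sum>s\<in>?S. mpoly_const (a s) * char_poly d s) * (\<Sum>s\<in>?S. mpoly_const (b s) * char_poly d s) =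
   (\<Sum>s\<in>?S. \<Sum>t\<in>?S. mpoly_const (a s) * (mpoly_const (b t) * (char_poly d s * char_poly d t)))"
  unfolding sum_product by (intro sum.cong refl) (simp only: ac_simps)
 ultimately show ?thesis by (intro spanned_cong[OF _ mcong_mult[OF a b]]) (simp only:)
qed

text \<open>The span is a subalgebra that contains 1 and, by \<open>pvar_texp\<close>, every
  variable.\<close>

lemma spanned_char_poly:
 assumes m: "m \<in> box CARD('p) d"
 shows "spanned CARD('p) d (carrier_mat d 1) (char_poly d) (msingle m 1)"
proof -
 let ?sp = "spanned CARD('p) d (carrier_mat d 1) (char_poly d) :: 'p mod_ring mpoly => bool"
 have unit: "?sp (texp_prod d c)" for c
 proof -
  have "?sp (char_poly d (mat d 1 (%(l, _). c l)))"
   by (rule spanned_base[OF card_carrier_mat_finite(1)]) simp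
  moreover have "char_poly d (mat d 1 (%(l, _). c l)) = texp_prod d c"
   unfolding char_poly_def texp_prod_def by (intro prod.cong) auto
  ultimately show ?thesis by simp
 qed
 have one: "?sp 1" using unit[of "%_. 0"] by (simp add: texp_prod_def texp_0)
 have pow: "?sp (P ^ k)" if "?sp P" for P k
  by (induction k) (simp_all only: power_0 power_Suc one spanned_char_poly_mult that)
 have x: "?sp (pvar l)" if l: "l < d" for l
 proof (rule spanned_cong[OF _ pvar_texp[OF l]])
  have "?sp (texp 1 l + mpoly_const (-1) * 1)"
   using unit[of "%i. if i = l then 1 else 0"] texp_as_unit_vector[OF l]
   by (intro spanned_add spanned_scale one) simp
  moreover have "texp (1 :: 'p mod_ring) l + mpoly_const (-1) * 1 = texp 1 l - 1"
   by (simp add: mpoly_const_def single_uminus)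
  ultimately have "?sp (texp 1 l - 1)" by simp
  then show "?sp (poly_eval_fps (d * CARD('p)) ahi_mod (texp 1 l - 1))"
   unfolding poly_eval_fps_def by (intro spanned_sum spanned_scale pow)
 qed
 have "?sp (\<Prod>l\<in>A. pvar l ^ mcoeff m l)" if "finite A" "A \<subseteq> {..<d}" for A
  using that
 proof (induction A rule: finite_induct)
  case (insert l A)
  then have "l < d" "A \<subseteq> {..<d}" by simp_all
  then show ?case unfolding prod.insert[OF insert.hyps(1,2)]
   by (intro spanned_char_poly_mult pow x insert.IH)
 qed (use one in \<open>simp only: prod.empty\<close>)
 then have "?sp (mon_eval pvar m)" unfolding mon_eval_def using m by (simp add: box_def)
 then show ?thesis by (simp only: mon_eval_pvar)
qed

theorem isomorphic_height_one:
 "isomorphic_modules (GL d :: 'p mod_ring mat set) (KBV 1 d) (KBV_act 1 d) (KHom 1 d) (KHom_act d)"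
proof (rule isomorphic_KBV_KHom[where f = "char_poly d"])
 show "1 \<le> (1::nat)" by simp
 show "GL d \<subseteq> carrier_mat d d" by (auto simp: GL_def)
 show "char_poly d \<Phi> \<in> mpolys d" for \<Phi> unfolding char_poly_def by (rule texp_prod_mpolys)
 show "mcong (CARD('p) ^ 1) d (mpoly_subst (fgl_poly 1 d A) (char_poly d \<Phi>)) (char_poly d (A * \<Phi>))"
  if "A \<in> GL d" "\<Phi> \<in> carrier_mat d 1" for A \<Phi>
  using subst_char_poly[of A d \<Phi>] that by (simp add: GL_def)
 show "\<exists>c. mcong (CARD('p) ^ 1) d (msingle m 1) (\<Sum>\<Phi>\<in>carrier_mat d 1. mpoly_const (c \<Phi>) * char_poly d \<Phi>)"
  if "m \<in> box (CARD('p) ^ 1) d" for m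
  using spanned_char_poly[of m d] that by (simp add: spanned_def)
qed

end

section \<open>Finite groups of exponent three\<close>

text \<open>Finite subgroups, for use in groups of exponent three, where \<open>- x = x + x\<close>
  supplies the inverses.\<close>

definition sub3 :: "'m::ab_group_add set => bool" where
 "sub3 V \<longleftrightarrow> finite V & 0 \<in> V & (\<forall>x\<in>V. \<forall>y\<in>V. x + y \<in> V)"

locale exponent_three =
 fixes ty :: "'m::ab_group_add itself"
 assumes three: "!!x::'m. x + (x + x) = 0"
begin

lemma double: "x + x = - (x::'m)"
 using three[of x] by (simp add: eq_neg_iff_add_eq_0 add.assoc)

lemma three_simps [simp]: "(x::'m) + (x + x) = 0" "x + (x + (x + y)) = y" "- x - x = x" "- x - x - x = (0::'m)"
proof -
 show "(x::'m) + (x + x) = 0" by (rule three)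
 then show "x + (x + (x + y)) = y" by (simp add: add.assoc[symmetric])
 show "- x - x = x" using double[of "- x"] by simp
 then show "- x - x - x = 0" by simp
qed

lemma sub3_0: "sub3 V ==> (0::'m) \<in> V" and sub3_finite: "sub3 V ==> finite V"
 and sub3_add: "sub3 V ==> (x::'m) \<in> V ==> y \<in> V ==> x + y \<in> V"
 by (auto simp: sub3_def)

lemma sub3_uminus: "sub3 V ==> (x::'m) \<in> V ==> - x \<in> V"
 unfolding double[symmetric] by (rule sub3_add)

lemma sub3_diff: "sub3 V ==> (x::'m) \<in> V ==> y \<in> V ==> x - y \<in> V"
 unfolding diff_conv_add_uminus by (intro sub3_add sub3_uminus)

text \<open>All nonempty fibres are translates of the kernel.\<close>

lemma card_kernel_image:
 fixes f :: "'m => 'm"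
 assumes V: "sub3 V" and f: "!!x y. f (x + y) = f x + f y"
 shows "card V = card {x \<in> V. f x = 0} * card (f ` V)"
proof -
 have fd: "f (x - y) = f x - f y" for x y using f[of "x - y" y] by (simp add: algebra_simps)
 have fib: "card {x \<in> V. f x = f x0} = card {x \<in> V. f x = 0}" if x0: "x0 \<in> V" for x0
 proof -
  have "{x \<in> V. f x = f x0} = (%x. x0 + x) ` {x \<in> V. f x = 0}"
  proof (intro equalityI subsetI)
   fix x assume x: "x \<in> {x \<in> V. f x = f x0}"
   then have "x - x0 \<in> {x \<in> V. f x = 0}" using sub3_diff[OF V _ x0] by (simp add: fd)
   then show "x \<in> (%x. x0 + x) ` {x \<in> V. f x = 0}" by (intro image_eqI[of _ _ "x - x0"]) simp_all
  next
   fix x assume "x \<in> (%x. x0 + x) ` {x \<in> V. f x = 0}"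
   then show "x \<in> {x \<in> V. f x = f x0}" using sub3_add[OF V x0] by (auto simp: f)
  qed
  then show ?thesis by (simp add: card_image)
 qed
 have "card V = (\<Sum>y\<in>f ` V. \<Sum>x\<in>{x \<in> V. f x = y}. 1)"
  using sum.image_gen[OF sub3_finite[OF V], of "%_. 1::nat" f] by simp
 also have "\<dots> = (\<Sum>y\<in>f ` V. card {x \<in> V. f x = 0})"
  using fib by (intro sum.cong) auto
 finally show ?thesis by simp
qed

lemma sub3_image:
 fixes f :: "'m => 'm"
 assumes V: "sub3 V" and f: "!!x y. f (x + y) = f x + f y"
 shows "sub3 (f ` V)"
proof -
 have "f 0 = 0" using f[of 0 0] by simp
 then have "0 \<in> f ` V" using sub3_0[OF V] by (intro image_eqI[of _ _ 0]) simp_all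
 moreover have "f x + f y \<in> f ` V" if "x \<in> V" "y \<in> V" for x y
  unfolding f[symmetric] by (rule imageI) (rule sub3_add[OF V that])
 ultimately show ?thesis using sub3_finite[OF V] unfolding sub3_def by blast
qed

lemma sub3_Collect:
 fixes V :: "'m set"
 assumes V: "sub3 V" and "P 0" "!!x y. P x ==> P y ==> P (x + y)"
 shows "sub3 {x \<in> V. P x}"
 using assms by (auto simp: sub3_def)

definition setsum2 :: "'m set => 'm set => 'm set" where
 "setsum2 A B = (%(x, y). x + y) ` (A \<times> B)"

lemma setsum2I: "x \<in> A ==> y \<in> B ==> x + y \<in> setsum2 A B"
 unfolding setsum2_def by (rule image_eqI[of _ _ "(x, y)"]) simp_all

lemma setsum2E:
 assumes "z \<in> setsum2 A B"
 obtains x y where "x \<in> A" "y \<in> B" "z = x + y"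
 using assms unfolding setsum2_def by auto

lemma sub3_setsum2:
 assumes A: "sub3 A" and B: "sub3 B"
 shows "sub3 (setsum2 A B)"
 unfolding sub3_def
proof (intro conjI ballI)
 show "finite (setsum2 A B)" unfolding setsum2_def using sub3_finite[OF A] sub3_finite[OF B] by simp
 show "0 \<in> setsum2 A B" using setsum2I[OF sub3_0[OF A] sub3_0[OF B]] by simp
 fix z z' assume "z \<in> setsum2 A B" "z' \<in> setsum2 A B"
 from \<open>z \<in> setsum2 A B\<close> obtain x y where xy: "x \<in> A" "y \<in> B" "z = x + y" by (rule setsum2E)
 from \<open>z' \<in> setsum2 A B\<close> obtain x' y' where xy': "x' \<in> A" "y' \<in> B" "z' = x' + y'" by (rule setsum2E)
 have "(x + x') + (y + y') \<in> setsum2 A B"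
  by (intro setsum2I sub3_add[OF A] sub3_add[OF B] xy xy')
 moreover have "z + z' = (x + x') + (y + y')"
  unfolding xy(3) xy'(3) by (simp only: ac_simps)
 ultimately show "z + z' \<in> setsum2 A B" by simp
qed

text \<open>Each fibre of addition is a translate of the antidiagonal copy of the
  intersection.\<close>

lemma card_setsum2:
 assumes A: "sub3 A" and B: "sub3 B"
 shows "card (setsum2 A B) * card (A \<inter> B) = card A * card B"
proof -
 let ?g = "%(x, y). x + y"
 have fin: "finite (A \<times> B)" using sub3_finite[OF A] sub3_finite[OF B] by simp
 have fib: "card {z \<in> A \<times> B. ?g z = x + y} = card (A \<inter> B)" if x: "x \<in> A" and y: "y \<in> B" for x y
 proof -
  have "{z \<in> A \<times> B. ?g z = x + y} = (%c. (x + c, y - c)) ` (A \<inter> B)"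
  proof (intro equalityI subsetI)
   fix z assume "z \<in> {z \<in> A \<times> B. ?g z = x + y}"
   then obtain a b where z: "z = (a, b)" "a \<in> A" "b \<in> B" "a + b = x + y" by auto
   have e: "a - x = y - b" using z(4) by (simp add: algebra_simps)
   have "a - x \<in> A" using sub3_diff[OF A z(2) x] .
   moreover have "a - x \<in> B" unfolding e using sub3_diff[OF B y z(3)] .
   moreover have "x + (a - x) = a" by simp
   moreover have "y - (a - x) = b" unfolding e by simp
   ultimately have "a - x \<in> A" "a - x \<in> B" "z = (x + (a - x), y - (a - x))" by (simp_all only: z(1))
   then show "z \<in> (%c. (x + c, y - c)) ` (A \<inter> B)" by blast
  next
   fix z assume "z \<in> (%c. (x + c, y - c)) ` (A \<inter> B)"
   then show "z \<in> {z \<in> A \<times> B. ?g z = x + y}" using sub3_add[OF A x] sub3_diff[OF B y] by auto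
  qed
  moreover have "inj_on (%c. (x + c, y - c)) (A \<inter> B)" by (rule inj_onI) simp
  ultimately show ?thesis by (simp add: card_image)
 qed
 have "card (A \<times> B) = (\<Sum>s\<in>?g ` (A \<times> B). \<Sum>z\<in>{z \<in> A \<times> B. ?g z = s}. 1)"
  using sum.image_gen[OF fin, of "%_. 1::nat" ?g] by simp
 also have "\<dots> = (\<Sum>s\<in>?g ` (A \<times> B). card (A \<inter> B))"
 proof (rule sum.cong[OF refl])
  fix s assume "s \<in> ?g ` (A \<times> B)"
  then obtain x y where "x \<in> A" "y \<in> B" "s = x + y" by auto
  then show "(\<Sum>z\<in>{z \<in> A \<times> B. ?g z = s}. 1) = card (A \<inter> B)" using fib[of x y] by simp
 qed
 finally show ?thesis by (simp add: setsum2_def card_cartesian_product)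
qed

text \<open>An element outside a subgroup triples its order when adjoined, so \<open>k\<close>
  elements bridge an index of at most \<open>3 ^ k\<close>. Quantifying over additively closed
  \<open>W\<close> allows later use with sets that are not yet known to be subgroups.\<close>

lemma exists_generators:
 assumes A: "sub3 A" and B: "sub3 B" and sub: "A \<subseteq> B" and card: "card B \<le> 3 ^ k * card A"
 shows "\<exists>b :: nat => 'm. (\<forall>i<k. b i \<in> B) &
  (\<forall>W. (\<forall>x\<in>W. \<forall>y\<in>W. x + y \<in> W) --> A \<subseteq> W --> (\<forall>i<k. b i \<in> W) --> B \<subseteq> W)"
 using A sub card
proof (induction k arbitrary: A)
 case 0
 then have "A = B" using sub3_finite[OF B] by (intro card_seteq) auto
 then show ?case by auto
next
 case (Suc k)
 show ?case
 proof (cases "A = B")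
  case True
  then show ?thesis using sub3_0[OF B] by (intro exI[of _ "%_. 0"]) auto
 next
  case False
  then obtain x where x: "x \<in> B" "x \<notin> A" using Suc.prems by blast
  let ?X = "{0, x, - x}"
  have X: "sub3 ?X" unfolding sub3_def using double[of x] double[of "- x"] by auto
  have nx: "- x \<notin> A" using sub3_uminus[OF Suc.prems(1), of "- x"] x by auto
  have x0: "x \<noteq> 0" using x sub3_0[OF Suc.prems(1)] by auto
  have xx: "x \<noteq> - x"
  proof
   assume "x = - x"
   then have "x + x = 0" by (metis add.right_inverse)
   then show False using double[of x] x0 by simp
  qed
  have "card ?X = 3" using x0 xx by simp
  moreover have "A \<inter> ?X = {0}" using x nx sub3_0[OF Suc.prems(1)] by auto
  ultimately have cA': "card (setsum2 A ?X) = card A * 3"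
   using card_setsum2[OF Suc.prems(1) X] by simp
  have "setsum2 A ?X \<subseteq> B"
  proof
   fix z assume "z \<in> setsum2 A ?X"
   then obtain a y where "a \<in> A" "y \<in> ?X" "z = a + y" by (rule setsum2E)
   moreover have "?X \<subseteq> B" using x sub3_0[OF B] sub3_uminus[OF B x(1)] by auto
   ultimately show "z \<in> B" using Suc.prems(2) sub3_add[OF B] by blast
  qed
  moreover have "card B \<le> 3 ^ k * card (setsum2 A ?X)"
   using Suc.prems(3) unfolding cA' by (simp add: ac_simps)
  ultimately obtain b where b: "\<forall>i<k. b i \<in> B"
   "\<forall>W. (\<forall>x\<in>W. \<forall>y\<in>W. x + y \<in> W) --> setsum2 A ?X \<subseteq> W --> (\<forall>i<k. b i \<in> W) --> B \<subseteq> W"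
   using Suc.IH[OF sub3_setsum2[OF Suc.prems(1) X]] by blast
  show ?thesis
  proof (intro exI[of _ "b(k := x)"] conjI allI impI)
   fix i assume "i < Suc k"
   then show "(b(k := x)) i \<in> B" using b(1) x by (auto simp: less_Suc_eq)
  next
   fix W assume W: "\<forall>x\<in>W. \<forall>y\<in>W. x + y \<in> W" "A \<subseteq> W" "\<forall>i<Suc k. (b(k := x)) i \<in> W"
   have xW: "x \<in> W" using W(3) by auto
   then have "- x \<in> W" using W(1) double[of x] by metis
   have "setsum2 A ?X \<subseteq> W"
   proof
    fix z assume "z \<in> setsum2 A ?X"
    then obtain a y where "a \<in> A" "y \<in> ?X" "z = a + y" by (rule setsum2E)
    then show "z \<in> W" using W(1,2) xW \<open>- x \<in> W\<close> sub3_0[OF Suc.prems(1)] by auto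
   qed
   moreover have "\<forall>i<k. b i \<in> W"
   proof (intro allI impI)
    fix i assume "i < k"
    then show "b i \<in> W" using W(3)[rule_format, of i] by simp
   qed
   ultimately show "B \<subseteq> W" using b(2) W(1) by blast
  qed
 qed
qed

end

section \<open>Operators of order three in characteristic three\<close>

locale order_three = exponent_three "TYPE('m::ab_group_add)" +
 fixes T :: "'m::ab_group_add => 'm" and V :: "'m set"
 assumes V: "sub3 V" and T_add: "!!x y. T (x + y) = T x + T y"
  and T_V: "!!x. x \<in> V ==> T x \<in> V" and TTT: "!!x. x \<in> V ==> T (T (T x)) = x"
begin

definition \<nu> :: "'m => 'm" where "\<nu> x = T x - x"

lemma \<nu>_add: "\<nu> (x + y) = \<nu> x + \<nu> y"
 by (simp add: \<nu>_def T_add)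

lemma T_0: "T 0 = 0" using T_add[of 0 0] by simp

lemma T_uminus: "T (- x) = - T x"
 using T_add[of x "- x"] by (simp add: T_0 eq_neg_iff_add_eq_0 add.commute)

lemma T_diff: "T (x - y) = T x - T y"
 using T_add[of x "- y"] by (simp add: T_uminus)

lemma \<nu>_V: "x \<in> V ==> \<nu> x \<in> V"
 unfolding \<nu>_def by (intro sub3_diff V T_V)

text \<open>As \<open>-2 = 1\<close>, the square of \<open>T - 1\<close> is the trace
  \<open>1 + T + T^2\<close>; trace images are therefore images of \<open>\<nu>^2\<close>.\<close>

lemma \<nu>\<nu>: "\<nu> (\<nu> x) = x + T x + T (T x)"
proof -
 have e: "\<nu> (\<nu> x) = T (T x) + (- T x - T x) + x" by (simp add: \<nu>_def T_diff del: three_simps)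
 show ?thesis unfolding e three_simps(3) by (simp only: ac_simps)
qed

lemma \<nu>\<nu>\<nu>: "x \<in> V ==> \<nu> (\<nu> (\<nu> x)) = 0"
 unfolding \<nu>\<nu>[of "\<nu> x"] by (simp add: \<nu>_def T_diff TTT)

text \<open>Nakayama: \<open>\<nu>\<close> is nilpotent, so that generators of \<open>V\<close> modulo \<open>\<nu> V\<close> generate \<open>V\<close>.\<close>

lemma generators:
 assumes B: "sub3 B" "\<nu> ` V \<subseteq> B" "B \<subseteq> V"
  and card: "card B \<le> 3 ^ \<alpha> * card (\<nu> ` V)" "card V \<le> 3 ^ \<beta> * card B"
 obtains b b' :: "nat => 'm" where "!!i. i < \<alpha> ==> b i \<in> B" "!!i. i < \<beta> ==> b' i \<in> V"
  "!!W. (!!x y. x \<in> W ==> y \<in> W ==> x + y \<in> W) ==> 0 \<in> W ==> (!!x. x \<in> W ==> T x \<in> W) ==>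
   (!!i. i < \<alpha> ==> \<exists>y\<in>V. b i + \<nu> y \<in> W) ==> (!!i. i < \<beta> ==> b' i \<in> W) ==> V \<subseteq> W"
proof -
 have nV: "sub3 (\<nu> ` V)" by (rule sub3_image[OF V \<nu>_add])
 obtain b where b: "\<forall>i<\<alpha>. b i \<in> B"
  "!!W. (\<forall>x\<in>W. \<forall>y\<in>W. x + y \<in> W) ==> \<nu> ` V \<subseteq> W ==> (\<forall>i<\<alpha>. b i \<in> W) ==> B \<subseteq> W"
  using exists_generators[OF nV B(1,2) card(1)] by blast
 obtain b' where b': "\<forall>i<\<beta>. b' i \<in> V"
  "!!W. (\<forall>x\<in>W. \<forall>y\<in>W. x + y \<in> W) ==> B \<subseteq> W ==> (\<forall>i<\<beta>. b' i \<in> W) ==> V \<subseteq> W"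
  using exists_generators[OF B(1) V B(3) card(2)] by blast
 show ?thesis
 proof (rule that[of b b'])
  fix W assume W: "!!x y. x \<in> W ==> y \<in> W ==> x + y \<in> W" "0 \<in> W" "!!x. x \<in> W ==> T x \<in> W"
   and bW: "!!i. i < \<alpha> ==> \<exists>y\<in>V. b i + \<nu> y \<in> W" and b'W: "!!i. i < \<beta> ==> b' i \<in> W"
  have Wm: "- x \<in> W" if "x \<in> W" for x unfolding double[symmetric] using that by (intro W(1))
  have W\<nu>: "\<nu> x \<in> W" if "x \<in> W" for x
   unfolding \<nu>_def diff_conv_add_uminus using that by (intro W(1,3) Wm)
  \<comment> \<open>It suffices that \<open>W\<close> is everything modulo \<open>\<nu> V\<close>;
    for the same reason the elements \<open>b i\<close> are required in \<open>W\<close> only modulo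
    \<open>\<nu> V\<close>.\<close>
  define W' where "W' = setsum2 W (\<nu> ` V)"
  have W'add: "\<forall>x\<in>W'. \<forall>y\<in>W'. x + y \<in> W'"
  proof (intro ballI)
   fix z z' assume "z \<in> W'" "z' \<in> W'"
   then have zz: "z \<in> setsum2 W (\<nu> ` V)" "z' \<in> setsum2 W (\<nu> ` V)" by (simp_all add: W'_def)
   from zz(1) obtain x y where *: "x \<in> W" "y \<in> \<nu> ` V" "z = x + y" by (rule setsum2E)
   from zz(2) obtain x' y' where **: "x' \<in> W" "y' \<in> \<nu> ` V" "z' = x' + y'" by (rule setsum2E)
   have "(x + x') + (y + y') \<in> W'"
    unfolding W'_def by (intro setsum2I W(1) sub3_add[OF nV] * **)
   moreover have "z + z' = (x + x') + (y + y')" unfolding *(3) **(3) by (simp only: ac_simps)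
   ultimately show "z + z' \<in> W'" by simp
  qed
  have nW': "\<nu> ` V \<subseteq> W'"
  proof
   fix z assume "z \<in> \<nu> ` V"
   then show "z \<in> W'" using setsum2I[OF W(2), of z "\<nu> ` V"] by (simp add: W'_def)
  qed
  have WW': "x \<in> W'" if "x \<in> W" for x
   using setsum2I[OF that sub3_0[OF nV]] by (simp add: W'_def)
  have "b i \<in> W'" if i: "i < \<alpha>" for i
  proof -
   from bW[OF i] obtain y where y: "y \<in> V" "b i + \<nu> y \<in> W" by blast
   have "- \<nu> y \<in> \<nu> ` V" using sub3_uminus[OF nV] y by blast
   then have "(b i + \<nu> y) + (- \<nu> y) \<in> W'" unfolding W'_def by (intro setsum2I y)
   then show ?thesis by simp
  qed
  then have "B \<subseteq> W'" using b(2)[OF W'add nW'] by blast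
  then have VW': "V \<subseteq> W'" using b'(2)[OF W'add] b'W WW' by blast
  have step: "\<exists>w y. w \<in> W & y \<in> V & x = w + \<nu> y" if "x \<in> V" for x
  proof -
   have "x \<in> setsum2 W (\<nu> ` V)" using VW' that W'_def by blast
   then obtain w z where "w \<in> W" "z \<in> \<nu> ` V" "x = w + z" by (rule setsum2E)
   then show ?thesis by blast
  qed
  show "V \<subseteq> W"
  proof
   fix x assume "x \<in> V"
   then obtain w y where 1: "w \<in> W" "y \<in> V" "x = w + \<nu> y" using step by blast
   obtain w' y' where 2: "w' \<in> W" "y' \<in> V" "y = w' + \<nu> y'" using step[OF 1(2)] by blast
   obtain w'' y'' where 3: "w'' \<in> W" "y'' \<in> V" "y' = w'' + \<nu> y''" using step[OF 2(2)] by blast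
   \<comment> \<open>Three rounds of \<open>V = W + \<nu> V\<close> end with
     \<open>\<nu>^3 = 0\<close>.\<close>
   have "x = w + (\<nu> w' + \<nu> (\<nu> w''))"
    unfolding 1(3) 2(3) 3(3) by (simp add: \<nu>_add \<nu>\<nu>\<nu>[OF 3(2)])
   moreover have "w + (\<nu> w' + \<nu> (\<nu> w'')) \<in> W" using 1 2 3 by (intro W(1) W\<nu>)
   ultimately show "x \<in> W" by simp
  qed
 qed (use b(1) b'(1) in auto)
qed

text \<open>The two cases: Jordan blocks of sizes 1 and 3 only, and of sizes 2 and 3 only.\<close>

lemma generators_1_3:
 assumes cV: "card V = 3 ^ (\<alpha> + 3 * N)" and fx: "3 ^ (\<alpha> + N) \<le> card {x \<in> V. T x = x}"
  and n2: "3 ^ N \<le> card ((%x. \<nu> (\<nu> x)) ` V)"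
 obtains b b' :: "nat => 'm" where "!!i. i < \<alpha> ==> b i \<in> V & T (b i) = b i" "!!i. i < N ==> b' i \<in> V"
  "!!W. (!!x y. x \<in> W ==> y \<in> W ==> x + y \<in> W) ==> 0 \<in> W ==> (!!x. x \<in> W ==> T x \<in> W) ==>
   (!!i. i < \<alpha> ==> b i \<in> W) ==> (!!i. i < N ==> b' i \<in> W) ==> V \<subseteq> W"
proof -
 let ?F = "{x \<in> V. T x = x}" and ?n = "\<nu> ` V"
 have F: "sub3 ?F" by (rule sub3_Collect[OF V]) (simp_all add: T_0 T_add)
 have nV: "sub3 ?n" by (rule sub3_image[OF V \<nu>_add])
 have Feq: "{x \<in> V. \<nu> x = 0} = ?F" by (simp add: \<nu>_def)
 have c1: "card V = card ?F * card ?n" using card_kernel_image[OF V \<nu>_add] unfolding Feq .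
 have n_sub: "?n \<subseteq> V" using \<nu>_V by blast
 have "{x \<in> ?n. \<nu> x = 0} = ?F \<inter> ?n" using n_sub by (auto simp: \<nu>_def)
 moreover have "\<nu> ` ?n = (%x. \<nu> (\<nu> x)) ` V" by (simp add: image_image)
 ultimately have c2: "card ?n = card (?F \<inter> ?n) * card ((%x. \<nu> (\<nu> x)) ` V)"
  using card_kernel_image[OF nV \<nu>_add] by simp
 have "(%x. \<nu> (\<nu> x)) ` V \<subseteq> ?F \<inter> ?n"
  using \<nu>_V \<nu>\<nu>\<nu> by (auto simp: \<nu>_def[of "\<nu> (\<nu> _)"])
 then have c3: "card ((%x. \<nu> (\<nu> x)) ` V) \<le> card (?F \<inter> ?n)"
  using sub3_finite[OF F] by (intro card_mono) auto
 \<comment> \<open>The middle term of a chain from \<open>\<nu> V\<close> to \<open>V\<close>: the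
   lower step accounts for the blocks of size 1, of rank \<open>\<alpha>\<close>, and the upper one
   for the blocks of size 3, of rank \<open>N\<close>.\<close>
 let ?B = "setsum2 ?F ?n"
 have c4: "card ?B * card (?F \<inter> ?n) = card V" using card_setsum2[OF F nV] c1 by simp
 define kF kn kk k2 kB where k: "kF = card ?F" "kn = card ?n" "kk = card (?F \<inter> ?n)"
  "k2 = card ((%x. \<nu> (\<nu> x)) ` V)" "kB = card ?B"
 note c = c1[folded k] c2[folded k] c3[folded k] c4[folded k] fx[folded k] n2[folded k]
 have pos: "(3::nat) ^ j > 0" for j by simp
 have pV: "card V > 0" unfolding cV by simp
 \<comment> \<open>Many fixed vectors mean a small image of \<open>\<nu>\<close>. Together with the
   lower bound on \<open>\<nu>^2 V\<close> this forces the exact sizes.\<close>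
 have kn2: "kn \<le> 3 ^ (2 * N)"
 proof -
  have "3 ^ (\<alpha> + N) * kn \<le> kF * kn" using c(5) by simp
  also have "\<dots> = 3 ^ (\<alpha> + 3 * N)" using c(1) cV by simp
  also have "\<alpha> + 3 * N = (\<alpha> + N) + 2 * N" by simp
  also have "(3::nat) ^ ((\<alpha> + N) + 2 * N) = 3 ^ (\<alpha> + N) * 3 ^ (2 * N)" by (rule power_add)
  finally show ?thesis by simp
 qed
 have kk: "kk \<le> 3 ^ N"
 proof -
  have "kk * 3 ^ N \<le> kk * k2" using c(6) by simp
  also have "\<dots> \<le> 3 ^ N * 3 ^ N" using c(2) kn2 by (simp add: mult_2 power_add)
  finally show ?thesis by simp
 qed
 have i1: "card V \<le> 3 ^ N * kB" unfolding c(4)[symmetric] mult.commute[of kB] using kk by (rule mult_le_mono1)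
 have i2: "kB \<le> 3 ^ \<alpha> * kn"
 proof -
  have kk0: "kk > 0" using c(4) pV by (cases kk) auto
  have "kn \<ge> 3 ^ N * 3 ^ N"
   unfolding c(2) using c(3,6) by (intro mult_le_mono) auto
  then have "kB * kk * (3 ^ N * 3 ^ N) \<le> card V * kn" unfolding c(4) by simp
  also have "\<dots> = 3 ^ \<alpha> * kn * 3 ^ N * (3 ^ N * 3 ^ N)"
   unfolding cV by (simp add: power_add numeral_3_eq_3)
  finally have "kB * kk \<le> 3 ^ \<alpha> * kn * 3 ^ N" by simp
  moreover have "3 ^ N \<le> kk" using c(3,6) by simp
  then have "kB * 3 ^ N \<le> kB * kk" by simp
  ultimately have "kB * 3 ^ N \<le> 3 ^ \<alpha> * kn * 3 ^ N" by linarith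
  then show ?thesis by simp
 qed
 have Bsub: "?B \<subseteq> V"
 proof
  fix z assume "z \<in> ?B"
  then obtain x y where xy: "x \<in> ?F" "y \<in> ?n" "z = x + y" by (rule setsum2E)
  have "x \<in> V" "y \<in> V" using xy n_sub by blast+
  then show "z \<in> V" unfolding xy(3) by (rule sub3_add[OF V])
 qed
 have nB: "?n \<subseteq> ?B" using setsum2I[OF sub3_0[OF F], of _ ?n] by auto
 obtain b b' where b: "!!i. i < \<alpha> ==> b i \<in> ?B" "!!i. i < N ==> b' i \<in> V"
  "!!W. (!!x y. x \<in> W ==> y \<in> W ==> x + y \<in> W) ==> 0 \<in> W ==> (!!x. x \<in> W ==> T x \<in> W) ==>
   (!!i. i < \<alpha> ==> \<exists>y\<in>V. b i + \<nu> y \<in> W) ==> (!!i. i < N ==> b' i \<in> W) ==> V \<subseteq> W"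
  using generators[OF sub3_setsum2[OF F nV] nB Bsub i2[unfolded k] i1[unfolded k]] by blast
 \<comment> \<open>Each generator of \<open>?B\<close> modulo \<open>\<nu> V\<close> is replaced by
   a fixed vector in its class.\<close>
 have "\<exists>e y. e \<in> ?F & y \<in> V & b i + \<nu> y = e" if i: "i < \<alpha>" for i
 proof -
  from b(1)[OF i] obtain e z where e: "e \<in> ?F" "z \<in> ?n" "b i = e + z" by (rule setsum2E)
  have "- z \<in> ?n" using sub3_uminus[OF nV e(2)] .
  then obtain y where "y \<in> V" "- z = \<nu> y" by blast
  then show ?thesis using e by (intro exI[of _ e] exI[of _ y]) (simp flip: \<open>- z = \<nu> y\<close>)
 qed
 then have "\<forall>i. \<exists>p. i < \<alpha> --> fst p \<in> ?F & snd p \<in> V & b i + \<nu> (snd p) = fst p" by force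
 from choice[OF this] obtain p where p: "!!i. i < \<alpha> ==> fst (p i) \<in> ?F & snd (p i) \<in> V & b i + \<nu> (snd (p i)) = fst (p i)" by blast
 define e y where "e i = fst (p i)" and "y i = snd (p i)" for i
 have e: "!!i. i < \<alpha> ==> e i \<in> ?F" "!!i. i < \<alpha> ==> y i \<in> V" "!!i. i < \<alpha> ==> b i + \<nu> (y i) = e i"
  using p unfolding e_def y_def by blast+
 show ?thesis
 proof (rule that[of e b'])
  fix W assume W: "!!x y. x \<in> W ==> y \<in> W ==> x + y \<in> W" "0 \<in> W" "!!x. x \<in> W ==> T x \<in> W"
   "!!i. i < \<alpha> ==> e i \<in> W" "!!i. i < N ==> b' i \<in> W"
  show "V \<subseteq> W"
  proof (rule b(3)[OF W(1,2,3)])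
   fix i assume "i < \<alpha>"
   then show "\<exists>y\<in>V. b i + \<nu> y \<in> W" using e W(4) by (intro bexI[of _ "y i"]) simp_all
  qed (use W(5) in auto)
 qed (use e(1) b(2) in auto)
qed

lemma generators_2_3:
 assumes cV: "card V = 3 ^ (2 * \<alpha> + 3 * N)" and k2: "3 ^ (2 * \<alpha> + 2 * N) \<le> card {x \<in> V. \<nu> (\<nu> x) = 0}"
  and n1: "3 ^ (\<alpha> + 2 * N) \<le> card (\<nu> ` V)"
 obtains b b' :: "nat => 'm" where "!!i. i < \<alpha> ==> b i \<in> V & \<nu> (\<nu> (b i)) = 0" "!!i. i < N ==> b' i \<in> V"
  "!!W. (!!x y. x \<in> W ==> y \<in> W ==> x + y \<in> W) ==> 0 \<in> W ==> (!!x. x \<in> W ==> T x \<in> W) ==>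
   (!!i. i < \<alpha> ==> b i \<in> W) ==> (!!i. i < N ==> b' i \<in> W) ==> V \<subseteq> W"
proof -
 \<comment> \<open>Here the kernel of \<open>\<nu>^2\<close> is the middle term: above
   \<open>\<nu> V\<close> it has rank at most \<open>\<alpha>\<close>, from the blocks of size 2,
   and \<open>V\<close> has rank at most \<open>N\<close> above it, from the blocks of size
   3.\<close>
 let ?B = "{x \<in> V. \<nu> (\<nu> x) = 0}" and ?n = "\<nu> ` V"
 have \<nu>0: "\<nu> 0 = 0" by (simp add: \<nu>_def T_0)
 have B: "sub3 ?B" by (rule sub3_Collect[OF V]) (simp_all add: \<nu>0 \<nu>_add)
 have nV: "sub3 ?n" by (rule sub3_image[OF V \<nu>_add])
 have nB: "?n \<subseteq> ?B" using \<nu>_V \<nu>\<nu>\<nu> by auto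
 have n_sub: "?n \<subseteq> V" using \<nu>_V by blast
 define kB kn k0 kk n2 where k: "kB = card ?B" "kn = card ?n" "k0 = card {x \<in> V. \<nu> x = 0}"
  "kk = card {x \<in> ?n. \<nu> x = 0}" "n2 = card ((%x. \<nu> (\<nu> x)) ` V)"
 have c1: "card V = kB * n2"
  using card_kernel_image[OF V, of "%x. \<nu> (\<nu> x)"] unfolding k by (simp add: \<nu>_add)
 have c2: "card V = k0 * kn" using card_kernel_image[OF V \<nu>_add] unfolding k .
 have c3: "kn = kk * n2"
  using card_kernel_image[OF nV \<nu>_add] unfolding k by (simp add: image_image)
 have c4: "kk \<le> k0" unfolding k using n_sub sub3_finite[OF V] by (intro card_mono) auto
 note c = k2[folded k] n1[folded k]
 have i1: "card V \<le> 3 ^ N * kB"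
 proof -
  have "2 * \<alpha> + 3 * N = (2 * \<alpha> + 2 * N) + N" by simp
  then have "card V = 3 ^ (2 * \<alpha> + 2 * N) * 3 ^ N" unfolding cV by (simp only: power_add)
  also have "\<dots> \<le> kB * 3 ^ N" using c(1) by simp
  finally show ?thesis by (simp add: mult.commute)
 qed
 \<comment> \<open>The size of \<open>\<nu> V\<close> bounds the kernel of \<open>\<nu>\<close> by
   \<open>3 ^ (\<alpha> + N)\<close>. The kernel of \<open>\<nu>\<close> on \<open>\<nu> V\<close>
   is no larger, so \<open>\<nu>^2 V\<close> cannot be small.\<close>
 have n2: "3 ^ N \<le> n2"
 proof -
  have "k0 * 3 ^ (\<alpha> + 2 * N) \<le> 3 ^ (\<alpha> + N) * 3 ^ (\<alpha> + 2 * N)"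
  proof -
   have "k0 * 3 ^ (\<alpha> + 2 * N) \<le> k0 * kn" using c(2) by simp
   also have "\<dots> = 3 ^ (2 * \<alpha> + 3 * N)" using c2 cV by simp
   also have "2 * \<alpha> + 3 * N = (\<alpha> + N) + (\<alpha> + 2 * N)" by simp
   finally show ?thesis by (simp only: power_add)
  qed
  then have "k0 \<le> 3 ^ (\<alpha> + N)" by simp
  with c4 have "kk \<le> 3 ^ (\<alpha> + N)" by simp
  have "\<alpha> + 2 * N = (\<alpha> + N) + N" by simp
  then have "3 ^ (\<alpha> + N) * 3 ^ N = (3::nat) ^ (\<alpha> + 2 * N)" by (simp only: power_add)
  also have "\<dots> \<le> kk * n2" using c(2) c3 by simp
  also have "\<dots> \<le> 3 ^ (\<alpha> + N) * n2" using \<open>kk \<le> 3 ^ (\<alpha> + N)\<close> by simp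
  finally show ?thesis by simp
 qed
 have i2: "kB \<le> 3 ^ \<alpha> * kn"
 proof -
  have "kB * 3 ^ N \<le> kB * n2" using n2 by simp
  also have "\<dots> = 3 ^ (2 * \<alpha> + 3 * N)" using c1 cV by simp
  also have "2 * \<alpha> + 3 * N = \<alpha> + (\<alpha> + 2 * N) + N" by simp
  also have "(3::nat) ^ (\<alpha> + (\<alpha> + 2 * N) + N) = 3 ^ \<alpha> * 3 ^ (\<alpha> + 2 * N) * 3 ^ N" by (simp only: power_add)
  also have "\<dots> \<le> 3 ^ \<alpha> * kn * 3 ^ N" using c(2) by simp
  finally show ?thesis by simp
 qed
 have Bsub: "?B \<subseteq> V" by auto
 obtain b b' where b: "!!i. i < \<alpha> ==> b i \<in> ?B" "!!i. i < N ==> b' i \<in> V"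
  "!!W. (!!x y. x \<in> W ==> y \<in> W ==> x + y \<in> W) ==> 0 \<in> W ==> (!!x. x \<in> W ==> T x \<in> W) ==>
   (!!i. i < \<alpha> ==> \<exists>y\<in>V. b i + \<nu> y \<in> W) ==> (!!i. i < N ==> b' i \<in> W) ==> V \<subseteq> W"
  using generators[OF B nB Bsub i2[unfolded k] i1[unfolded k]] by blast
 show ?thesis
 proof (rule that[of b b'])
  fix W assume W: "!!x y. x \<in> W ==> y \<in> W ==> x + y \<in> W" "0 \<in> W" "!!x. x \<in> W ==> T x \<in> W"
   "!!i. i < \<alpha> ==> b i \<in> W" "!!i. i < N ==> b' i \<in> W"
  show "V \<subseteq> W"
  proof (rule b(3)[OF W(1,2,3)])
   fix i assume "i < \<alpha>"
   then show "\<exists>y\<in>V. b i + \<nu> y \<in> W" using W(4) sub3_0[OF V] by (intro bexI[of _ 0]) (simp_all add: \<nu>0)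
  qed (use W(5) in auto)
 qed (use b(1,2) in auto)
qed

end

section \<open>Modules over SL(2,3) in characteristic three\<close>

text \<open>\<open>T\<close> is the unipotent generator and \<open>I\<close>, \<open>J = T I T\<^sup>-\<^sup>1\<close> generate the quaternion group, with
  \<open>K = J I = T J T\<^sup>-\<^sup>1\<close> and central element \<open>I\<^sup>2\<close>. The \<open>I\<^sup>2 = 1\<close> part of a module is the sum of the
  quaternion invariants \<open>inv_part\<close> and of three parts permuted by \<open>T\<close>, the first of which is \<open>chr_part\<close>; the
  \<open>I\<^sup>2 = -1\<close> part is \<open>spin_part + I spin_part\<close>, where \<open>spin_part\<close> is the kernel of \<open>I + J + K\<close>.\<close>

locale sl23_module = exponent_three "TYPE('m::ab_group_add)" +
 fixes M :: "'m::ab_group_add set" and T I J :: "'m => 'm"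
 assumes M: "sub3 M"
  and T_add: "!!x y. T (x + y) = T x + T y" and I_add: "!!x y. I (x + y) = I x + I y"
  and J_add: "!!x y. J (x + y) = J x + J y"
  and T_M: "!!x. x \<in> M ==> T x \<in> M" and I_M: "!!x. x \<in> M ==> I x \<in> M" and J_M: "!!x. x \<in> M ==> J x \<in> M"
  and TTT: "!!x. x \<in> M ==> T (T (T x)) = x"
  and JT: "!!x. x \<in> M ==> J (T x) = T (I x)"
  and IT: "!!x. x \<in> M ==> I (T x) = T (J (I x))"
  and JJ: "!!x. x \<in> M ==> J (J x) = I (I x)"
  and IJ: "!!x. x \<in> M ==> I (J x) = J (I (I (I x)))"
  and IIII: "!!x. x \<in> M ==> I (I (I (I x))) = x"
begin

lemma add_0: "T 0 = 0" "I 0 = 0" "J 0 = 0"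
 using T_add[of 0 0] I_add[of 0 0] J_add[of 0 0] by simp_all

lemma uminus: "T (- x) = - T x" "I (- x) = - I x" "J (- x) = - J x"
 using T_add[of x "- x"] I_add[of x "- x"] J_add[of x "- x"]
 by (simp_all add: add_0 eq_neg_iff_add_eq_0 add.commute)

lemma diff: "T (x - y) = T x - T y" "I (x - y) = I x - I y" "J (x - y) = J x - J y"
 using T_add[of x "- y"] I_add[of x "- y"] J_add[of x "- y"] by (simp_all add: uminus)

lemmas additive = T_add I_add J_add add_0 uminus diff

lemmas M_closed = sub3_add[OF M] sub3_diff[OF M] sub3_uminus[OF M] sub3_0[OF M] T_M I_M J_M

definition plus_part where "plus_part = {x \<in> M. I (I x) = x}"
definition minus_part where "minus_part = {x \<in> M. I (I x) = - x}"
definition inv_part where "inv_part = {x \<in> M. I x = x & J x = x}"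
definition chr_part where "chr_part = {x \<in> M. I x = x & J x = - x}"
definition spin_part where "spin_part = {x \<in> M. I (I x) = - x & J x = - x + I x}"

lemma sub3_parts: "sub3 plus_part" "sub3 minus_part" "sub3 inv_part" "sub3 chr_part" "sub3 spin_part"
 unfolding plus_part_def minus_part_def inv_part_def chr_part_def spin_part_def
 by (rule sub3_Collect[OF M]; simp add: additive)+

lemma inv_partD: "x \<in> inv_part ==> x \<in> M & I x = x & J x = x"
 and chr_partD: "x \<in> chr_part ==> x \<in> M & I x = x & J x = - x"
 and spin_partD: "x \<in> spin_part ==> x \<in> M & I (I x) = - x & J x = - x + I x"
 by (auto simp: inv_part_def chr_part_def spin_part_def)

lemma T_inv: "x \<in> inv_part ==> T x \<in> inv_part"
 using JT[of x] IT[of x] by (auto simp: inv_part_def T_M)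

text \<open>Conjugation by \<open>T\<close> permutes \<open>I\<close>, \<open>J\<close>,
  \<open>K\<close> cyclically, hence also the three nontrivial sign characters.\<close>

lemma T_chr: assumes "x \<in> chr_part"
 shows "I (T x) = - T x" "J (T x) = T x" "I (T (T x)) = - T (T x)" "J (T (T x)) = - T (T x)"
proof -
 have x: "x \<in> M" "I x = x" "J x = - x" using chr_partD[OF assms] by auto
 show 1: "I (T x) = - T x" "J (T x) = T x"
  using JT[OF x(1)] IT[OF x(1)] x by (simp_all add: additive)
 show "I (T (T x)) = - T (T x)" "J (T (T x)) = - T (T x)"
  using JT[OF T_M[OF x(1)]] IT[OF T_M[OF x(1)]] 1 by (simp_all add: additive)
qed

lemma J_I_spin: assumes "x \<in> spin_part" shows "J (I x) = x + I x"
proof -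
 have x: "x \<in> M" "I (I x) = - x" "J x = - x + I x" using spin_partD[OF assms] by auto
 have "I (J x) = - J (I x)" using IJ[OF x(1)] x by (simp add: additive)
 then have "J (I x) = - I (J x)" by simp
 then show ?thesis using x(2) unfolding x(3) by (simp add: additive)
qed

text \<open>The cyclic permutation of \<open>I\<close>, \<open>J\<close>, \<open>K\<close> by
  \<open>T\<close> preserves the kernel of their sum.\<close>

lemma T_spin: assumes "x \<in> spin_part" shows "T x \<in> spin_part"
proof -
 have x: "x \<in> M" "I (I x) = - x" "J x = - x + I x" using spin_partD[OF assms] by auto
 have IT': "I (T x) = T x + T (I x)" using IT[OF x(1)] J_I_spin[OF assms] by (simp add: additive)
 have "I (I (T x)) = I (T x) + I (T (I x))" unfolding IT' by (simp only: I_add IT')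
 also have "I (T (I x)) = T (J (I (I x)))" using IT[OF I_M[OF x(1)]] .
 also have "\<dots> = T (x - I x)" using x by (simp add: additive)
 finally have "I (I (T x)) = T x + T x" unfolding IT' by (simp add: additive)
 then have "I (I (T x)) = - T x" by (simp only: double)
 moreover have "J (T x) = - T x + I (T x)" unfolding IT' using JT[OF x(1)] by simp
 ultimately show ?thesis using T_M[OF x(1)] by (simp add: spin_part_def)
qed

text \<open>The \<open>I^2 = 1\<close> part is assembled from the invariants and the three character
  parts, the latter all transported to \<open>chr_part\<close>; in these coordinates
  \<open>T\<close> shifts the last three entries cyclically.\<close>

definition compose :: "'m => 'm => 'm => 'm => 'm" where
 "compose e x1 x2 x3 = e + (x1 + (T x2 + T (T x3)))"

text \<open>Since 4 is 1 modulo 3, the character sums over a four-group are projections without any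
  denominator.\<close>

lemma four: "x + (x + (x + x)) = (x::'m)"
 using three_simps(2)[of x x] .

text \<open>The right-hand sides are the projections to the four sign characters of the four-group
  generated by \<open>I\<close> and \<open>J\<close>, transported back by \<open>T\<close>.\<close>

lemma compose_extract:
 assumes "e \<in> inv_part" "x1 \<in> chr_part" "x2 \<in> chr_part" "x3 \<in> chr_part"
 defines "y \<equiv> compose e x1 x2 x3"
 shows "y \<in> plus_part" "e = y + I y + J y + J (I y)" "x1 = y + I y - J y - J (I y)"
  "x2 = T (T (y - I y + J y - J (I y)))" "x3 = T (y - I y - J y + J (I y))"
proof -
 have e: "e \<in> M" "I e = e" "J e = e" using inv_partD[OF assms(1)] by auto
 have x1: "x1 \<in> M" "I x1 = x1" "J x1 = - x1" using chr_partD[OF assms(2)] by auto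
 have x2: "x2 \<in> M" and x3: "x3 \<in> M" using chr_partD assms(3,4) by auto
 define y2 y3 where "y2 = T x2" and "y3 = T (T x3)"
 have y2: "I y2 = - y2" "J y2 = y2" and y3: "I y3 = - y3" "J y3 = - y3"
  unfolding y2_def y3_def using T_chr[OF assms(3)] T_chr[OF assms(4)] by auto
 have y: "y = e + (x1 + (y2 + y3))" by (simp add: y_def compose_def y2_def y3_def)
 have Iy: "I y = e + (x1 + (- y2 - y3))" unfolding y by (simp add: additive e x1 y2 y3)
 have Jy: "J y = e + (- x1 + (y2 - y3))" unfolding y by (simp add: additive e x1 y2 y3)
 have JIy: "J (I y) = e + (- x1 + (- y2 + y3))" unfolding Iy by (simp add: additive e x1 y2 y3)
 have "y \<in> M" unfolding y y2_def y3_def using e x1 x2 x3 by (intro M_closed)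
 moreover have "I (I y) = y" unfolding Iy unfolding y by (simp add: additive e x1 y2 y3)
 ultimately show "y \<in> plus_part" by (simp add: plus_part_def)
 have "y + I y + J y + J (I y) = e + (e + (e + e))" unfolding JIy unfolding Iy Jy unfolding y by (simp add: algebra_simps del: three_simps)
 then show "e = y + I y + J y + J (I y)" by (simp only: four)
 have "y + I y - J y - J (I y) = x1 + (x1 + (x1 + x1))" unfolding JIy unfolding Iy Jy unfolding y by (simp add: algebra_simps del: three_simps)
 then show "x1 = y + I y - J y - J (I y)" by (simp only: four)
 have "y - I y + J y - J (I y) = y2 + (y2 + (y2 + y2))" unfolding JIy unfolding Iy Jy unfolding y by (simp add: algebra_simps del: three_simps)
 then have "y - I y + J y - J (I y) = y2" by (simp only: four)
 then show "x2 = T (T (y - I y + J y - J (I y)))" using TTT[OF x2] by (simp add: y2_def)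
 have "y - I y - J y + J (I y) = y3 + (y3 + (y3 + y3))" unfolding JIy unfolding Iy Jy unfolding y by (simp add: algebra_simps del: three_simps)
 then have "y - I y - J y + J (I y) = y3" by (simp only: four)
 then show "x3 = T (y - I y - J y + J (I y))" using TTT[OF x3] by (simp add: y3_def)
qed

lemma compose_surj:
 assumes "y \<in> plus_part"
 obtains e x1 x2 x3 where "e \<in> inv_part" "x1 \<in> chr_part" "x2 \<in> chr_part" "x3 \<in> chr_part" "y = compose e x1 x2 x3"
proof -
 have y: "y \<in> M" "I (I y) = y" using assms by (auto simp: plus_part_def)
 have JJy: "J (J y) = y" using JJ[OF y(1)] y by simp
 have IJy: "I (J y) = J (I y)" using IJ[OF y(1)] y by simp
 have IJIy: "I (J (I y)) = J y" using IJ[OF I_M[OF y(1)]] y by simp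
 have JJIy: "J (J (I y)) = I y" using JJ[OF I_M[OF y(1)]] y by simp
 note r = additive y JJy IJy IJIy JJIy
 let ?e = "y + I y + J y + J (I y)" and ?y1 = "y + I y - J y - J (I y)"
  and ?y2 = "y - I y + J y - J (I y)" and ?y3 = "y - I y - J y + J (I y)"
 have mem: "?e \<in> M" "?y1 \<in> M" "?y2 \<in> M" "?y3 \<in> M" by (intro M_closed y(1))+
 have y2: "I ?y2 = - ?y2" "J ?y2 = ?y2" and y3: "I ?y3 = - ?y3" "J ?y3 = - ?y3"
  by (simp_all add: r algebra_simps del: three_simps)
 have T2: "I (T ?y2) = - T ?y2" "J (T ?y2) = - T ?y2" by (simp_all only: IT[OF mem(3)] JT[OF mem(3)] y2 uminus minus_minus)
 have TT2: "I (T (T ?y2)) = T (T ?y2)" "J (T (T ?y2)) = - T (T ?y2)"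
  by (simp_all only: IT[OF T_M[OF mem(3)]] JT[OF T_M[OF mem(3)]] T2 uminus minus_minus)
 have T3: "I (T ?y3) = T ?y3" "J (T ?y3) = - T ?y3" by (simp_all only: IT[OF mem(4)] JT[OF mem(4)] y3 uminus minus_minus)
 show ?thesis
 proof (rule that[of ?e ?y1 "T (T ?y2)" "T ?y3"])
  show "?e \<in> inv_part" using mem(1) by (simp add: inv_part_def r algebra_simps del: three_simps)
  show "?y1 \<in> chr_part" using mem(2) by (simp add: chr_part_def r algebra_simps del: three_simps)
  show "T (T ?y2) \<in> chr_part" using TT2 mem(3) unfolding chr_part_def by (simp add: T_M del: three_simps)
  show "T ?y3 \<in> chr_part" using T3 mem(4) unfolding chr_part_def by (simp add: T_M del: three_simps)
  have "compose ?e ?y1 (T (T ?y2)) (T ?y3) = ?e + (?y1 + (?y2 + ?y3))"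
   unfolding compose_def TTT[OF mem(3)] TTT[OF mem(4)] ..
  also have "\<dots> = y + (y + (y + y))" by (simp add: algebra_simps del: three_simps)
  finally show "y = compose ?e ?y1 (T (T ?y2)) (T ?y3)" by (simp only: four)
 qed
qed

lemma card_plus_part: "card plus_part = card inv_part * card chr_part ^ 3"
proof -
 let ?S = "inv_part \<times> chr_part \<times> chr_part \<times> chr_part"
 let ?f = "%(e, x1, x2, x3). compose e x1 x2 x3"
 have "inj_on ?f ?S"
 proof (rule inj_onI)
  fix s t assume "s \<in> ?S" "t \<in> ?S" and eq: "?f s = ?f t"
  then obtain e x1 x2 x3 e' x1' x2' x3' where s: "s = (e, x1, x2, x3)" "t = (e', x1', x2', x3')"
   and m: "e \<in> inv_part" "x1 \<in> chr_part" "x2 \<in> chr_part" "x3 \<in> chr_part"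
    "e' \<in> inv_part" "x1' \<in> chr_part" "x2' \<in> chr_part" "x3' \<in> chr_part" by auto
  have "compose e x1 x2 x3 = compose e' x1' x2' x3'" using eq s by simp
  then show "s = t"
   using compose_extract(2-5)[OF m(1-4)] compose_extract(2-5)[OF m(5-8)] unfolding s by metis
 qed
 moreover have "?f ` ?S = plus_part"
 proof
  show "?f ` ?S \<subseteq> plus_part" using compose_extract(1) by auto
  show "plus_part \<subseteq> ?f ` ?S"
  proof
   fix y assume "y \<in> plus_part"
   then obtain e x1 x2 x3 where "(e, x1, x2, x3) \<in> ?S" "y = compose e x1 x2 x3" by (metis compose_surj mem_Sigma_iff)
   then show "y \<in> ?f ` ?S" by (intro image_eqI[of _ _ "(e, x1, x2, x3)"]) auto
  qed
 qed
 ultimately have "card plus_part = card ?S" by (metis card_image)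
 then show ?thesis by (simp add: card_cartesian_product power3_eq_cube)
qed

text \<open>\<open>I\<close> is \<open>-1\<close> exactly on the second and third character parts.
  This determines the size of \<open>chr_part\<close> from data about \<open>I\<close> alone, which
  is monomial in the application.\<close>

lemma card_I_minus: "card {x \<in> plus_part. I x = - x} = card chr_part ^ 2"
proof -
 let ?f = "%(x2, x3). compose 0 0 x2 x3"
 have z: "0 \<in> inv_part" "0 \<in> chr_part" using sub3_0 sub3_parts by auto
 have "inj_on ?f (chr_part \<times> chr_part)"
 proof (rule inj_onI)
  fix s t assume "s \<in> chr_part \<times> chr_part" "t \<in> chr_part \<times> chr_part" and eq: "?f s = ?f t"
  then obtain x y x' y' where s: "s = (x, y)" "t = (x', y')" and m: "x \<in> chr_part" "y \<in> chr_part" "x' \<in> chr_part" "y' \<in> chr_part" by auto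
  have "compose 0 0 x y = compose 0 0 x' y'" using eq s by simp
  then show "s = t"
   using compose_extract(4,5)[OF z m(1,2)] compose_extract(4,5)[OF z m(3,4)] unfolding s by metis
 qed
 moreover have "?f ` (chr_part \<times> chr_part) = {x \<in> plus_part. I x = - x}"
 proof (intro equalityI subsetI)
  fix y assume "y \<in> ?f ` (chr_part \<times> chr_part)"
  then obtain x2 x3 where x: "x2 \<in> chr_part" "x3 \<in> chr_part" "y = compose 0 0 x2 x3" by auto
  then have "I y = - y" by (simp add: compose_def additive T_chr)
  with compose_extract(1)[OF z x(1,2)] x(3) show "y \<in> {x \<in> plus_part. I x = - x}" by simp
 next
  fix y assume y: "y \<in> {x \<in> plus_part. I x = - x}"
  then obtain e x1 x2 x3 where x: "e \<in> inv_part" "x1 \<in> chr_part" "x2 \<in> chr_part" "x3 \<in> chr_part" "y = compose e x1 x2 x3"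
   using compose_surj by blast
  have Iy: "I y = - y" using y by simp
  have "e = 0" using compose_extract(2)[OF x(1-4)] unfolding x(5)[symmetric] Iy by (simp add: additive)
  moreover have "x1 = 0" using compose_extract(3)[OF x(1-4)] unfolding x(5)[symmetric] Iy by (simp add: additive)
  ultimately show "y \<in> ?f ` (chr_part \<times> chr_part)" using x by (intro image_eqI[of _ _ "(x2, x3)"]) auto
 qed
 ultimately have "card {x \<in> plus_part. I x = - x} = card (chr_part \<times> chr_part)" by (metis card_image)
 then show ?thesis by (simp add: card_cartesian_product power2_eq_square)
qed

lemma T_compose:
 assumes "x3 \<in> M"
 shows "T (compose e x1 x2 x3) = compose (T e) x3 x1 x2"
 unfolding compose_def T_add TTT[OF assms] by (simp add: ac_simps del: three_simps)

text \<open>The cyclic shift forces the three character components of a fixed vector to agree and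
  its invariant component to be fixed.\<close>

lemma card_plus_fixed: "card {x \<in> plus_part. T x = x} \<le> card {x \<in> inv_part. T x = x} * card chr_part"
proof -
 have "{x \<in> plus_part. T x = x} \<subseteq> (%(e, x). compose e x x x) ` ({x \<in> inv_part. T x = x} \<times> chr_part)"
 proof
  fix y assume y: "y \<in> {x \<in> plus_part. T x = x}"
  then obtain e x1 x2 x3 where x: "e \<in> inv_part" "x1 \<in> chr_part" "x2 \<in> chr_part" "x3 \<in> chr_part" "y = compose e x1 x2 x3"
   using compose_surj by blast
  have "compose (T e) x3 x1 x2 = compose e x1 x2 x3"
   using y T_compose[of x3 e x1 x2] chr_partD[OF x(4)] x(5) by simp
  then have "T e = e" "x3 = x1" "x1 = x2"
   using compose_extract(2-4)[OF x(1-4)] compose_extract(2-4)[OF T_inv[OF x(1)] x(4,2,3)] by metis+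
  then show "y \<in> (%(e, x). compose e x x x) ` ({x \<in> inv_part. T x = x} \<times> chr_part)"
   using x by (intro image_eqI[of _ _ "(e, x1)"]) auto
 qed
 moreover have "finite ({x \<in> inv_part. T x = x} \<times> chr_part)" using sub3_finite sub3_parts by auto
 ultimately have "card {x \<in> plus_part. T x = x} \<le> card ({x \<in> inv_part. T x = x} \<times> chr_part)"
  by (meson card_image_le card_mono finite_imageI le_trans)
 then show ?thesis by (simp add: card_cartesian_product)
qed

abbreviation "tr x \<equiv> x + T x + T (T x)"

text \<open>On the three shifted components the trace is the diagonal of their sum, an arbitrary
  element of \<open>chr_part\<close>.\<close>

lemma card_plus_trace: "card ((%x. tr x) ` plus_part) \<le> card ((%x. tr x) ` inv_part) * card chr_part"
proof -
 have "(%x. tr x) ` plus_part \<subseteq> (%(e, x). compose e x x x) ` ((%x. tr x) ` inv_part \<times> chr_part)"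
 proof
  fix z assume "z \<in> (%x. tr x) ` plus_part"
  then obtain y where y: "y \<in> plus_part" "z = tr y" by blast
  then obtain e x1 x2 x3 where x: "e \<in> inv_part" "x1 \<in> chr_part" "x2 \<in> chr_part" "x3 \<in> chr_part" "y = compose e x1 x2 x3"
   using compose_surj by blast
  have m: "x1 \<in> M" "x2 \<in> M" "x3 \<in> M" using chr_partD x by auto
  let ?x = "x1 + x2 + x3"
  have "?x \<in> chr_part" using x by (intro sub3_add[OF sub3_parts(4)])
  moreover have "z = compose (tr e) ?x ?x ?x"
   unfolding y(2) x(5) T_compose[OF m(3)] T_compose[OF m(2)] by (simp add: compose_def T_add ac_simps del: three_simps)
  ultimately show "z \<in> (%(e, x). compose e x x x) ` ((%x. tr x) ` inv_part \<times> chr_part)"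
   using x(1) by (intro image_eqI[of _ _ "(tr e, ?x)"]) auto
 qed
 moreover have "finite ((%x. tr x) ` inv_part \<times> chr_part)" using sub3_finite sub3_parts by auto
 ultimately have "card ((%x. tr x) ` plus_part) \<le> card ((%x. tr x) ` inv_part \<times> chr_part)"
  by (meson card_image_le card_mono finite_imageI le_trans)
 then show ?thesis by (simp add: card_cartesian_product)
qed

text \<open>On this part \<open>I + J + K\<close> kills \<open>spin_part\<close>, and its
  anticommutator with \<open>I\<close> is \<open>-2 = 1\<close>; so it reads off
  \<open>u'\<close>.\<close>

lemma spin_extract:
 assumes "u \<in> spin_part" "u' \<in> spin_part"
 defines "y \<equiv> u + I u'"
 shows "y \<in> minus_part" "u' = I y + J y + J (I y)" "u = y - I (I y + J y + J (I y))"
proof -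
 have u: "u \<in> M" "I (I u) = - u" "J u = - u + I u" using spin_partD[OF assms(1)] by auto
 have u': "u' \<in> M" "I (I u') = - u'" "J u' = - u' + I u'" using spin_partD[OF assms(2)] by auto
 note Ju = J_I_spin[OF assms(1)] J_I_spin[OF assms(2)]
 have "y \<in> M" unfolding y_def using u u' by (intro M_closed)
 moreover have "I (I y) = - y" unfolding y_def by (simp add: additive u u')
 ultimately show "y \<in> minus_part" by (simp add: minus_part_def)
 have Iy: "I y = I u - u'" unfolding y_def by (simp add: additive u')
 have Jy: "J y = (- u + I u) + (u' + I u')" unfolding y_def J_add u(3) Ju(2) ..
 have JIy: "J (I y) = (u + I u) - (- u' + I u')" unfolding Iy diff(3) Ju(1) u'(3) ..
 have "I y + J y + J (I y) = u' + (I u + (I u + I u))"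
  unfolding JIy unfolding Iy Jy by (simp add: algebra_simps del: three_simps)
 then show e: "u' = I y + J y + J (I y)" by (simp only: three add_0_right)
 show "u = y - I (I y + J y + J (I y))" unfolding e[symmetric] by (simp add: y_def)
qed

text \<open>Where \<open>I^2 = -1\<close>, the operator \<open>N = I + J + K\<close> satisfies
  \<open>N^2 = -3 = 0\<close>, so its values lie in \<open>spin_part\<close>; then
  \<open>N I + I N = -2 = 1\<close> is the decomposition.\<close>

lemma spin_surj:
 assumes "y \<in> minus_part"
 obtains u u' where "u \<in> spin_part" "u' \<in> spin_part" "y = u + I u'"
proof -
 have N: "I y + J y + J (I y) \<in> spin_part" if "y \<in> minus_part" for y
 proof -
  have y: "y \<in> M" "I (I y) = - y" using that by (auto simp: minus_part_def)
  have r: "J (J y) = - y" "I (J y) = - J (I y)" "I (J (I y)) = J y" "J (J (I y)) = - I y"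
   using JJ[OF y(1)] IJ[OF y(1)] IJ[OF I_M[OF y(1)]] JJ[OF I_M[OF y(1)]] y by (simp_all add: additive)
  have mem: "I y + J y + J (I y) \<in> M" using y(1) by (intro M_closed)
  have a: "I (I y + J y + J (I y)) = - y - J (I y) + J y"
   by (simp add: additive y r del: three_simps)
  have "J (I y + J y + J (I y)) = J (I y) + (- y - I y)"
   by (simp add: additive y r del: three_simps)
  moreover have "- (I y + J y + J (I y)) + I (I y + J y + J (I y)) = (- J (I y) - J (I y)) + (- y - I y)"
   unfolding a by (simp add: algebra_simps del: three_simps)
  ultimately have b: "J (I y + J y + J (I y)) = - (I y + J y + J (I y)) + I (I y + J y + J (I y))"
   by (simp only: three_simps(3))
  have "I (I (I y + J y + J (I y))) = - (I y + J y + J (I y))"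
   unfolding a by (simp add: additive y r algebra_simps del: three_simps)
  with b mem show ?thesis by (simp add: spin_part_def)
 qed
 have y: "y \<in> M" "I (I y) = - y" using assms by (auto simp: minus_part_def)
 have Iy: "I y \<in> minus_part" using y by (simp add: minus_part_def additive I_M)
 have r: "I (J y) = - J (I y)" "I (J (I y)) = J y"
  using IJ[OF y(1)] IJ[OF I_M[OF y(1)]] y by (simp_all add: additive)
 show ?thesis
 proof (rule that[OF N[OF Iy] N[OF assms]])
  have "I (I y) + J (I y) + J (I (I y)) + I (I y + J y + J (I y)) = - y + - y"
   by (simp add: additive y r algebra_simps del: three_simps)
  then show "y = I (I y) + J (I y) + J (I (I y)) + I (I y + J y + J (I y))"
   by (simp only: double minus_minus)
 qed
qed

lemma card_minus_part: "card minus_part = card spin_part ^ 2"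
proof -
 let ?f = "%(u, u'). u + I u'"
 have "inj_on ?f (spin_part \<times> spin_part)"
 proof (rule inj_onI)
  fix s t assume "s \<in> spin_part \<times> spin_part" "t \<in> spin_part \<times> spin_part" and eq: "?f s = ?f t"
  then obtain x y x' y' where s: "s = (x, y)" "t = (x', y')" and m: "x \<in> spin_part" "y \<in> spin_part" "x' \<in> spin_part" "y' \<in> spin_part" by auto
  have "x + I y = x' + I y'" using eq s by simp
  then show "s = t" using spin_extract(2,3)[OF m(1,2)] spin_extract(2,3)[OF m(3,4)] unfolding s by metis
 qed
 moreover have "?f ` (spin_part \<times> spin_part) = minus_part"
 proof
  show "?f ` (spin_part \<times> spin_part) \<subseteq> minus_part" using spin_extract(1) by auto
  show "minus_part \<subseteq> ?f ` (spin_part \<times> spin_part)"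
  proof
   fix y assume "y \<in> minus_part"
   then obtain u u' where "u \<in> spin_part" "u' \<in> spin_part" "y = u + I u'" by (rule spin_surj)
   then show "y \<in> ?f ` (spin_part \<times> spin_part)" by (intro image_eqI[of _ _ "(u, u')"]) auto
  qed
 qed
 ultimately have "card minus_part = card (spin_part \<times> spin_part)" by (metis card_image)
 then show ?thesis by (simp add: card_cartesian_product power2_eq_square)
qed

end

sublocale sl23_module \<subseteq> E: order_three T inv_part
 by unfold_locales (use sub3_parts T_add T_inv TTT inv_partD in auto)

sublocale sl23_module \<subseteq> U: order_three T spin_part
 by unfold_locales (use sub3_parts T_add T_spin TTT spin_partD in auto)

context sl23_module
begin

lemma T_I_spin: assumes "x \<in> spin_part" shows "T (I x) = I (T x) - T x"
proof -
 have x: "x \<in> M" using spin_partD[OF assms] by auto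
 have "I (T x) = T x + T (I x)" using IT[OF x] J_I_spin[OF assms] by (simp add: T_add)
 then show ?thesis by simp
qed

lemma T_spin_sum:
 assumes "u \<in> spin_part" "u' \<in> spin_part"
 shows "T (u + I u') = (T u - T u') + I (T u')"
 unfolding T_add T_I_spin[OF assms(2)] by (simp add: algebra_simps del: three_simps)

text \<open>For a fixed \<open>u + I u'\<close> the equations read \<open>T u' = u'\<close> and
  \<open>T u = u + u'\<close>; thus \<open>u' = \<nu> u\<close>, and \<open>u\<close> determines
  everything.\<close>

lemma card_minus_fixed: "card {x \<in> minus_part. T x = x} \<le> card {u \<in> spin_part. E.\<nu> (E.\<nu> u) = 0}"
proof (rule surj_card_le)
 show "finite {u \<in> spin_part. E.\<nu> (E.\<nu> u) = 0}" using sub3_finite[OF sub3_parts(5)] by simp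
 show "{x \<in> minus_part. T x = x} \<subseteq> (%u. u + I (E.\<nu> u)) ` {u \<in> spin_part. E.\<nu> (E.\<nu> u) = 0}"
 proof
  fix y assume y: "y \<in> {x \<in> minus_part. T x = x}"
  then have ym: "y \<in> minus_part" and yT: "T y = y" by auto
  obtain u u' where u: "u \<in> spin_part" "u' \<in> spin_part" "y = u + I u'" using ym by (rule spin_surj)
  have Tu: "T u - T u' \<in> spin_part" "T u' \<in> spin_part"
   using sub3_diff[OF sub3_parts(5) T_spin[OF u(1)] T_spin[OF u(2)]] T_spin[OF u(2)] by auto
  have e: "(T u - T u') + I (T u') = u + I u'" using yT T_spin_sum[OF u(1,2)] u(3) by simp
  have 1: "T u' = u'" using spin_extract(2)[OF Tu] spin_extract(2)[OF u(1,2)] unfolding e by simp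
  have "T u - T u' = u" using spin_extract(3)[OF Tu] spin_extract(3)[OF u(1,2)] unfolding e by simp
  then have 2: "E.\<nu> u = u'" unfolding E.\<nu>_def 1 by (simp add: algebra_simps del: three_simps)
  have 3: "E.\<nu> (E.\<nu> u) = 0" unfolding 2 by (simp add: E.\<nu>_def 1)
  show "y \<in> (%u. u + I (E.\<nu> u)) ` {u \<in> spin_part. E.\<nu> (E.\<nu> u) = 0}"
   using u(1) 3 by (intro image_eqI[of _ _ u]) (simp_all add: u(3) 2)
 qed
qed

text \<open>The trace of \<open>u + I u'\<close> depends only on \<open>\<nu> w\<close> for
  \<open>w = u' + \<nu> u\<close>, so there are no more traces than values of
  \<open>\<nu>\<close>.\<close>

lemma card_minus_trace: "card ((%x. tr x) ` minus_part) \<le> card (E.\<nu> ` spin_part)"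
proof (rule surj_card_le)
 show "finite (E.\<nu> ` spin_part)" using sub3_finite[OF sub3_parts(5)] by simp
 show "(%x. tr x) ` minus_part \<subseteq> (%w. T w + I (E.\<nu> w)) ` (E.\<nu> ` spin_part)"
 proof
  fix z assume "z \<in> (%x. tr x) ` minus_part"
  then obtain y where y: "y \<in> minus_part" "z = tr y" by blast
  from y(1) obtain u u' where u: "u \<in> spin_part" "u' \<in> spin_part" "y = u + I u'" by (rule spin_surj)
  let ?\<nu> = "E.\<nu>"
  have Tu: "T u - T u' \<in> spin_part" "T u' \<in> spin_part"
   using sub3_diff[OF sub3_parts(5) T_spin[OF u(1)] T_spin[OF u(2)]] T_spin[OF u(2)] by auto
  define w where "w = u' + ?\<nu> u"
  have w: "w \<in> spin_part" unfolding w_def by (intro sub3_add[OF sub3_parts(5)] u U.\<nu>_V)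
  have "?\<nu> (?\<nu> w) = ?\<nu> (?\<nu> u')" unfolding w_def by (simp add: E.\<nu>_add U.\<nu>\<nu>\<nu>[OF u(1)])
  then have nn: "?\<nu> (?\<nu> w) = tr u'" by (simp only: E.\<nu>\<nu>)
  have "T (?\<nu> (?\<nu> u)) = ?\<nu> (?\<nu> u)" using U.\<nu>\<nu>\<nu>[OF u(1)] by (simp add: E.\<nu>_def)
  then have Tw: "T (?\<nu> w) = T (?\<nu> u') + tr u" unfolding w_def E.\<nu>_add T_add E.\<nu>\<nu> by simp
  have T2: "T (T y) = (T (T u) + - (T (T u') + T (T u'))) + I (T (T u'))"
   unfolding u(3) T_spin_sum[OF u(1,2)] T_spin_sum[OF Tu] by (simp add: additive algebra_simps del: three_simps)
  have T2': "T (T y) = (T (T u) + T (T u')) + I (T (T u'))" unfolding T2 double by simp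
  have "tr y = (tr u + (T (T u') - T u')) + I (tr u')"
   unfolding T2' unfolding u(3) T_spin_sum[OF u(1,2)] by (simp add: additive algebra_simps del: three_simps)
  also have "\<dots> = T (?\<nu> w) + I (?\<nu> (?\<nu> w))"
   unfolding nn Tw by (simp add: E.\<nu>_def additive algebra_simps del: three_simps)
  finally have "z = T (?\<nu> w) + I (?\<nu> (?\<nu> w))" unfolding y(2) .
  then show "z \<in> (%w. T w + I (?\<nu> w)) ` (?\<nu> ` spin_part)" using w by blast
 qed
qed

text \<open>The dimensions are those of a permutation module with one fixed point, \<open>a\<close>
  orbits of size 8 with stabilizer generated by \<open>T\<close>, and \<open>N\<close> free orbits.
  They dictate the Jordan blocks of \<open>T\<close>: on \<open>inv_part\<close>
  \<open>1 + a\<close> of size 1 and \<open>N\<close> of size 3, on \<open>spin_part\<close>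
  \<open>a\<close> of size 2 and \<open>2 * N\<close> of size 3.\<close>

theorem module_generators:
 fixes a N :: nat
 defines "c \<equiv> a + 3 * N"
 assumes cp: "card plus_part = 3 ^ (1 + 4 * a + 12 * N)" and cm: "card minus_part = 3 ^ (4 * a + 12 * N)"
  and h1: "3 ^ ((1 + a + N) + c) \<le> card {x \<in> plus_part. T x = x}"
  and h2: "3 ^ (N + c) \<le> card ((%x. tr x) ` plus_part)"
  and h3: "3 ^ (2 * a + 4 * N) \<le> card {x \<in> minus_part. T x = x}"
  and h4: "3 ^ (a + 4 * N) \<le> card ((%x. tr x) ` minus_part)"
  and h5: "card {x \<in> plus_part. I x = - x} = 3 ^ (2 * c)"
 obtains m0 t s where "m0 \<in> M" "T m0 = m0" "I m0 = m0" "J m0 = m0"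
  "!!r. r < a ==> t r \<in> M & T (t r) = t r" "!!j. j < N ==> s j \<in> M"
  "!!W. (!!x y. x \<in> W ==> y \<in> W ==> x + y \<in> W) ==> 0 \<in> W ==>
   (!!x. x \<in> W ==> T x \<in> W) ==> (!!x. x \<in> W ==> I x \<in> W) ==> (!!x. x \<in> W ==> J x \<in> W) ==>
   m0 \<in> W ==> (!!r. r < a ==> t r \<in> W) ==> (!!j. j < N ==> s j \<in> W) ==> M \<subseteq> W"
proof -
 let ?\<nu> = "E.\<nu>"
 \<comment> \<open>The size of \<open>chr_part\<close> comes first; it is then divided out of the
   other data about the plus part, leaving those of \<open>inv_part\<close>.\<close>
 have "card chr_part ^ 2 = (3 ^ c) ^ 2" using card_I_minus h5 by (simp add: power_mult[symmetric] mult.commute)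
 then have X: "card chr_part = 3 ^ c" by (rule power_eq_imp_eq_base) simp_all
 have "(1 + 4 * a + 12 * N) = (1 + a + 3 * N) + c * 3" by (simp add: c_def)
 then have "card inv_part * (3 ^ c) ^ 3 = 3 ^ (1 + a + 3 * N) * (3 ^ c) ^ 3"
  using card_plus_part cp unfolding X by (simp only: power_add power_mult)
 then have E0: "card inv_part = 3 ^ ((1 + a) + 3 * N)" by simp
 have "4 * a + 12 * N = (2 * a + 3 * (2 * N)) * 2" by simp
 then have "card spin_part ^ 2 = (3 ^ (2 * a + 3 * (2 * N))) ^ 2"
  using card_minus_part cm by (simp only: power_mult)
 then have U0: "card spin_part = 3 ^ (2 * a + 3 * (2 * N))" by (rule power_eq_imp_eq_base) simp_all
 have "3 ^ (1 + a + N) * 3 ^ c \<le> card {x \<in> inv_part. T x = x} * 3 ^ c"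
  using le_trans[OF h1 card_plus_fixed] unfolding X by (simp only: power_add)
 then have E1: "3 ^ ((1 + a) + N) \<le> card {x \<in> inv_part. T x = x}" by simp
 have "3 ^ N * 3 ^ c \<le> card ((%x. tr x) ` inv_part) * 3 ^ c"
  using le_trans[OF h2 card_plus_trace] unfolding X by (simp only: power_add)
 then have E2: "3 ^ N \<le> card ((%x. ?\<nu> (?\<nu> x)) ` inv_part)" by (simp add: E.\<nu>\<nu>)
 have "2 * a + 4 * N = 2 * a + 2 * (2 * N)" "a + 4 * N = a + 2 * (2 * N)" by simp_all
 note h34 = le_trans[OF h3 card_minus_fixed, unfolded this(1)] le_trans[OF h4 card_minus_trace, unfolded this(2)]
 obtain e e' where e: "!!i. i < 1 + a ==> e i \<in> inv_part & T (e i) = e i" "!!i. i < N ==> e' i \<in> inv_part"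
  "!!W. (!!x y. x \<in> W ==> y \<in> W ==> x + y \<in> W) ==> 0 \<in> W ==> (!!x. x \<in> W ==> T x \<in> W) ==>
   (!!i. i < 1 + a ==> e i \<in> W) ==> (!!i. i < N ==> e' i \<in> W) ==> inv_part \<subseteq> W"
  using E.generators_1_3[OF E0 E1 E2] by blast
 obtain u u' where u: "!!i. i < a ==> u i \<in> spin_part & ?\<nu> (?\<nu> (u i)) = 0" "!!i. i < 2 * N ==> u' i \<in> spin_part"
  "!!W. (!!x y. x \<in> W ==> y \<in> W ==> x + y \<in> W) ==> 0 \<in> W ==> (!!x. x \<in> W ==> T x \<in> W) ==>
   (!!i. i < a ==> u i \<in> W) ==> (!!i. i < 2 * N ==> u' i \<in> W) ==> spin_part \<subseteq> W"
  using U.generators_2_3[OF U0 h34] by blast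
 have z3: "sub3 {0::'m}" by (simp add: sub3_def)
 have zsub: "{0} \<subseteq> chr_part" using sub3_0[OF sub3_parts(4)] by simp
 have zc: "card chr_part \<le> 3 ^ c * card {0::'m}" unfolding X by simp
 \<comment> \<open>Since \<open>T\<close> does not act on \<open>chr_part\<close>, it needs
   \<open>c = a + 3 * N\<close> generators: one for each summand with stabilizer \<open>T\<close>
   and three for each free summand.\<close>
 obtain x where x: "\<forall>i<c. x i \<in> chr_part"
  "\<forall>W. (\<forall>x\<in>W. \<forall>y\<in>W. x + y \<in> W) --> {0} \<subseteq> W --> (\<forall>i<c. x i \<in> W) --> chr_part \<subseteq> W"
  using exists_generators[OF z3 sub3_parts(4) zsub zc] by blast
 \<comment> \<open>Equal character components, and \<open>u + I (\<nu> u)\<close> with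
   \<open>\<nu> (\<nu> u) = 0\<close>, are the shapes of fixed vectors found in the counting lemmas,
   so the sum is fixed by \<open>T\<close>.\<close>
 define p1 q1 where "p1 r = compose (e (Suc r)) (x r) (x r) (x r)" and "q1 r = u r + I (?\<nu> (u r))" for r
 define p2 q2 where "p2 j = compose (e' j) (x (a + 3 * j)) (x (a + 3 * j + 1)) (x (a + 3 * j + 2))"
  and "q2 j = u' (2 * j) + I (u' (2 * j + 1))" for j
 have ex: "e (Suc r) \<in> inv_part" "x r \<in> chr_part" if "r < a" for r
  using that e(1)[of "Suc r"] x(1) by (auto simp: c_def)
 have ex': "e' j \<in> inv_part" "x (a + 3 * j) \<in> chr_part" "x (a + 3 * j + 1) \<in> chr_part" "x (a + 3 * j + 2) \<in> chr_part" if "j < N" for j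
  using that e(2)[of j] x(1)[rule_format, of "a + 3 * j"] x(1)[rule_format, of "a + 3 * j + 1"]
   x(1)[rule_format, of "a + 3 * j + 2"] by (auto simp: c_def)
 have uu: "u r \<in> spin_part" "?\<nu> (u r) \<in> spin_part" if "r < a" for r
  using u(1)[OF that] U.\<nu>_V by auto
 have uu': "u' (2 * j) \<in> spin_part" "u' (2 * j + 1) \<in> spin_part" if "j < N" for j
  using that u(2)[of "2 * j"] u(2)[of "2 * j + 1"] by auto
 have pq1: "p1 r \<in> plus_part" "q1 r \<in> minus_part" if "r < a" for r
  unfolding p1_def q1_def using compose_extract(1)[OF ex(1)[OF that] ex(2)[OF that] ex(2)[OF that] ex(2)[OF that]]
   spin_extract(1)[OF uu[OF that]] by auto
 have pq2: "p2 j \<in> plus_part" "q2 j \<in> minus_part" if "j < N" for j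
  unfolding p2_def q2_def using compose_extract(1)[OF ex'[OF that]] spin_extract(1)[OF uu'[OF that]] by auto
 have pm: "y \<in> M" if "y \<in> plus_part \<or> y \<in> minus_part" for y
  using that by (auto simp: plus_part_def minus_part_def)
 have e0: "e 0 \<in> M" "T (e 0) = e 0" "I (e 0) = e 0" "J (e 0) = e 0"
  using e(1)[of 0] inv_partD by auto
 show ?thesis
 proof (rule that[of "e 0" "%r. p1 r + q1 r" "%j. p2 j + q2 j"])
  fix r assume r: "r < a"
  have xr: "x r \<in> M" using ex(2)[OF r] chr_partD by auto
  have Te: "T (e (Suc r)) = e (Suc r)" using e(1)[of "Suc r"] r by simp
  have Tp: "T (p1 r) = p1 r" unfolding p1_def T_compose[OF xr] Te ..
  have T\<nu>: "T (?\<nu> (u r)) = ?\<nu> (u r)" using u(1)[OF r] by (simp add: E.\<nu>_def)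
  have "T (q1 r) = q1 r" unfolding q1_def T_spin_sum[OF uu[OF r]] T\<nu> by (simp add: E.\<nu>_def)
  with Tp have "T (p1 r + q1 r) = p1 r + q1 r" by (simp add: T_add)
  moreover have "p1 r + q1 r \<in> M" by (intro M_closed pm) (use pq1[OF r] in auto)
  ultimately show "p1 r + q1 r \<in> M & T (p1 r + q1 r) = p1 r + q1 r" by simp
 next
  fix j assume j: "j < N"
  show "p2 j + q2 j \<in> M" by (intro M_closed pm) (use pq2[OF j] in auto)
 next
  fix W assume Wa: "!!x y. x \<in> W ==> y \<in> W ==> x + y \<in> W" and W0: "0 \<in> W"
   and WT: "!!x. x \<in> W ==> T x \<in> W" and WI: "!!x. x \<in> W ==> I x \<in> W" and WJ: "!!x. x \<in> W ==> J x \<in> W"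
   and m0: "e 0 \<in> W" and t: "!!r. r < a ==> p1 r + q1 r \<in> W" and s: "!!j. j < N ==> p2 j + q2 j \<in> W"
  have Wm: "- x \<in> W" if "x \<in> W" for x unfolding double[symmetric] using that by (intro Wa)
  have Wd: "x - y \<in> W" if "x \<in> W" "y \<in> W" for x y
   unfolding diff_conv_add_uminus using that by (intro Wa Wm)
  \<comment> \<open>Glued generators come apart inside any stable \<open>W\<close>:
    \<open>I^2\<close> separates the two parts, and the extraction formulas separate the components
    within each.\<close>
  have split: "p \<in> W & q \<in> W" if "p + q \<in> W" "p \<in> plus_part" "q \<in> minus_part" for p q
  proof -
   have II: "I (I (p + q)) = p - q" using that(2,3) by (simp add: plus_part_def minus_part_def I_add)
   have II_W: "I (I (p + q)) \<in> W" using that(1) by (intro WI)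
   have "(p + q) + I (I (p + q)) = p + p" unfolding II by (simp add: algebra_simps del: three_simps)
   then have e1: "- ((p + q) + I (I (p + q))) = p" by (simp only: double minus_minus)
   have "(p + q) - I (I (p + q)) = q + q" unfolding II by (simp add: algebra_simps del: three_simps)
   then have e2: "- ((p + q) - I (I (p + q))) = q" by (simp only: double minus_minus)
   have "- ((p + q) + I (I (p + q))) \<in> W" "- ((p + q) - I (I (p + q))) \<in> W"
    using that(1) II_W by (blast intro: Wm Wa Wd)+
   then show ?thesis unfolding e1 e2 ..
  qed
  have comp: "f \<in> W & x1 \<in> W & x2 \<in> W & x3 \<in> W"
   if m: "f \<in> inv_part" "x1 \<in> chr_part" "x2 \<in> chr_part" "x3 \<in> chr_part" and y: "compose f x1 x2 x3 \<in> W" for f x1 x2 x3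
  proof -
   define y where "y = compose f x1 x2 x3"
   have y: "y \<in> W" "I y \<in> W" "J y \<in> W" "J (I y) \<in> W" using y WI WJ by (auto simp: y_def)
   note ce = compose_extract(2-5)[OF m, folded y_def]
   have "f \<in> W" unfolding ce(1) by (intro Wa y)
   moreover have "x1 \<in> W" unfolding ce(2) by (intro Wa Wd y)
   moreover have "x2 \<in> W" unfolding ce(3) by (intro WT Wa Wd y)
   moreover have "x3 \<in> W" unfolding ce(4) by (intro WT Wa Wd y)
   ultimately show ?thesis by blast
  qed
  have spin: "v \<in> W & v' \<in> W" if m: "v \<in> spin_part" "v' \<in> spin_part" and y: "v + I v' \<in> W" for v v'
  proof -
   define y where "y = v + I v'"
   have y: "y \<in> W" "I y \<in> W" "J y \<in> W" "J (I y) \<in> W" using y WI WJ by (auto simp: y_def)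
   note se = spin_extract(2,3)[OF m, folded y_def]
   have "v' \<in> W" unfolding se(1) by (intro Wa y)
   moreover have "v \<in> W" unfolding se(2) by (intro WI Wa Wd y)
   ultimately show ?thesis by blast
  qed
  have 1: "e (Suc r) \<in> W & x r \<in> W & u r \<in> W" if "r < a" for r
  proof -
   have pq: "p1 r \<in> W" "q1 r \<in> W" using split[OF t[OF that] pq1[OF that]] by auto
   show ?thesis using comp[OF ex(1)[OF that] ex(2)[OF that] ex(2)[OF that] ex(2)[OF that] pq(1)[unfolded p1_def]]
    spin[OF uu[OF that] pq(2)[unfolded q1_def]] by blast
  qed
  have 2: "e' j \<in> W & x (a + 3 * j) \<in> W & x (a + 3 * j + 1) \<in> W & x (a + 3 * j + 2) \<in> W
   & u' (2 * j) \<in> W & u' (2 * j + 1) \<in> W" if "j < N" for j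
  proof -
   have pq: "p2 j \<in> W" "q2 j \<in> W" using split[OF s[OF that] pq2[OF that]] by auto
   show ?thesis using comp[OF ex'[OF that] pq(1)[unfolded p2_def]] spin[OF uu'[OF that] pq(2)[unfolded q2_def]] by blast
  qed
  have "e i \<in> W" if "i < 1 + a" for i using m0 1[of "i - 1"] that by (cases i) auto
  moreover have "e' i \<in> W" if "i < N" for i using 2[OF that] by blast
  ultimately have invW: "inv_part \<subseteq> W" using Wa W0 WT by (intro e(3)) auto
  have xW: "x i \<in> W" if "i < c" for i
  proof (cases "i < a")
   case True then show ?thesis using 1 by blast
  next
   case False
   define j k where "j = (i - a) div 3" and "k = (i - a) mod 3"
   have i: "i = a + 3 * j + k" using False by (simp add: j_def k_def)
   have "j < N" using that False unfolding j_def c_def by (simp add: less_mult_imp_div_less)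
   moreover have "k = 0 \<or> k = 1 \<or> k = 2" unfolding k_def by linarith
   ultimately show ?thesis unfolding i using 2[of j] by auto
  qed
  have chrW: "chr_part \<subseteq> W" using x(2)[rule_format, of W] Wa W0 xW by blast
  have "u' i \<in> W" if "i < 2 * N" for i
  proof -
   define j where "j = i div 2"
   have "j < N" using that by (simp add: j_def less_mult_imp_div_less)
   moreover have "i = 2 * j \<or> i = 2 * j + 1" unfolding j_def by linarith
   ultimately show ?thesis using 2[of j] by auto
  qed
  then have spinW: "spin_part \<subseteq> W" using Wa W0 WT 1 by (intro u(3)) auto
  have plusW: "plus_part \<subseteq> W"
  proof
   fix y assume "y \<in> plus_part"
   then obtain f x1 x2 x3 where y: "f \<in> inv_part" "x1 \<in> chr_part" "x2 \<in> chr_part" "x3 \<in> chr_part" "y = compose f x1 x2 x3"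
    using compose_surj by blast
   have m: "f \<in> W" "x1 \<in> W" "x2 \<in> W" "x3 \<in> W" using y invW chrW by auto
   show "y \<in> W" unfolding y(5) compose_def by (intro Wa WT m)
  qed
  have minusW: "minus_part \<subseteq> W"
  proof
   fix y assume "y \<in> minus_part"
   then obtain v v' where y: "v \<in> spin_part" "v' \<in> spin_part" "y = v + I v'" by (rule spin_surj)
   have m: "v \<in> W" "v' \<in> W" using y spinW by auto
   show "y \<in> W" unfolding y(3) by (intro Wa WI m)
  qed
  show "M \<subseteq> W"
  proof
   fix y assume y: "y \<in> M"
   have "- (y + I (I y)) \<in> M" "- (y - I (I y)) \<in> M" by (intro M_closed y)+
   then have "- (y + I (I y)) \<in> plus_part" "- (y - I (I y)) \<in> minus_part"
    by (simp_all add: plus_part_def minus_part_def additive IIII[OF y] ac_simps del: three_simps)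
   then have "- (y + I (I y)) + - (y - I (I y)) \<in> W" using plusW minusW by (intro Wa) auto
   moreover have "- (y + I (I y)) + - (y - I (I y)) = - (y + y)" by (simp add: algebra_simps del: three_simps)
   ultimately show "y \<in> W" by (simp only: double minus_minus)
  qed
 qed (use e0 pq1 in auto)
qed

end

section \<open>Rank two at the prime three\<close>

definition mat2 :: "'a => 'a => 'a => 'a => 'a mat" where
 "mat2 a b c d = mat 2 2 (%(i, j). if i = 0 then (if j = 0 then a else b) else (if j = 0 then c else d))"

lemma mat2_carrier [simp]: "mat2 a b c d \<in> carrier_mat 2 2"
 by (simp add: mat2_def)

lemma mat2_index [simp]: "mat2 a b c d $$ (0, 0) = a" "mat2 a b c d $$ (0, 1) = b"
 "mat2 a b c d $$ (1, 0) = c" "mat2 a b c d $$ (1, 1) = d"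
 "mat2 a b c d $$ (0, Suc 0) = b" "mat2 a b c d $$ (Suc 0, 0) = c" "mat2 a b c d $$ (Suc 0, Suc 0) = d"
 by (simp_all add: mat2_def)

lemma mat2_eqI:
 assumes "A \<in> carrier_mat 2 2" "B \<in> carrier_mat 2 2" "A $$ (0, 0) = B $$ (0, 0)" "A $$ (0, 1) = B $$ (0, 1)"
  "A $$ (1, 0) = B $$ (1, 0)" "A $$ (1, 1) = B $$ (1, 1)"
 shows "A = B"
proof (rule eq_matI)
 fix i j assume "i < dim_row B" "j < dim_col B"
 then have "i = 0 \<or> i = 1" "j = 0 \<or> j = 1" using assms(2) by auto
 then show "A $$ (i, j) = B $$ (i, j)" using assms by auto
qed (use assms in auto)

lemma mat2_cases: "A \<in> carrier_mat 2 2 ==> A = mat2 (A $$ (0, 0)) (A $$ (0, 1)) (A $$ (1, 0)) (A $$ (1, 1))"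
 by (rule mat2_eqI) simp_all

lemma mat2_mult: "mat2 a b c d * mat2 a' b' c' d' =
 mat2 (a * a' + b * c') (a * b' + b * d') (c * a' + d * c') (c * b' + d * (d' :: 'a::comm_semiring_1))"
 by (rule mat2_eqI[OF mult_carrier_mat[OF mat2_carrier mat2_carrier] mat2_carrier])
  (simp_all add: index_mult_mat_2[OF mat2_carrier mat2_carrier] del: index_mult_mat)

lemma one_mat2: "1\<^sub>m 2 = mat2 1 0 0 (1 :: 'a::{zero,one})"
 by (rule mat2_eqI) simp_all

lemma mono2_lookup: "mkeys m \<subseteq> {..<2} ==> m = mono2 (mcoeff m 0) (mcoeff m 1)"
 by (rule poly_mapping_eqI) (auto simp: lookup_mono2 in_keys_iff subset_iff)

lemma lookup_subst_swap:
 assumes "P \<in> mpolys 2"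
 shows "mcoeff (mpoly_subst (%j. if j = 0 then - pvar 1 else pvar 0) P) (mono2 j i) =
  (- 1) ^ i * mcoeff (P :: 'a::comm_ring_1 mpoly) (mono2 i j)"
proof (induction P arbitrary: i j rule: poly_mapping_sum_induct)
 case (single m c)
 then have "mkeys m \<subseteq> {..<2}" using assms by (auto simp: mpolys_def)
 then have m: "m = mono2 (mcoeff m 0) (mcoeff m 1)" (is "m = mono2 ?k ?l") by (rule mono2_lookup)
 have "mon_eval (%j. if j = 0 then - pvar 1 else pvar 0 :: 'a mpoly) m = (- pvar 1) ^ ?k * pvar 0 ^ ?l"
  by (subst m, subst mono2_def) (simp add: mon_eval_add)
 also have "\<dots> = (- 1) ^ ?k * (pvar 0 ^ ?l * pvar 1 ^ ?k)"
  by (simp add: power_minus[of "pvar (Suc 0)"] ac_simps)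
 also have "(- 1) ^ ?k = (mpoly_const ((- 1) ^ ?k) :: 'a mpoly)"
  unfolding mpoly_const_power by (simp add: mpoly_const_def single_uminus flip: single_one)
 finally have e: "mpoly_subst (%j. if j = 0 then - pvar 1 else pvar 0) (msingle m c) =
   mpoly_const c * (mpoly_const ((- 1) ^ ?k) * msingle (mono2 ?l ?k) 1)"
  unfolding mpoly_subst_single pvar_power_mult by simp
 show ?case unfolding e lookup_const_mult by (subst (3) m) (auto simp: lookup_single when_def)
qed (simp_all add: mpoly_subst_add lookup_add ring_distribs)

lemma lookup_subst_uminus:
 assumes "P \<in> mpolys 2"
 shows "mcoeff (mpoly_subst (%j. - pvar j) P) (mono2 i j) =
  (- 1) ^ (i + j) * mcoeff (P :: 'a::comm_ring_1 mpoly) (mono2 i j)"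
proof (induction P arbitrary: i j rule: poly_mapping_sum_induct)
 case (single m c)
 then have "mkeys m \<subseteq> {..<2}" using assms by (auto simp: mpolys_def)
 then have m: "m = mono2 (mcoeff m 0) (mcoeff m 1)" (is "m = mono2 ?k ?l") by (rule mono2_lookup)
 have "mon_eval (%j. - pvar j :: 'a mpoly) m = (- pvar 0) ^ ?k * (- pvar 1) ^ ?l"
  by (subst m, subst mono2_def) (simp add: mon_eval_add)
 also have "\<dots> = (- 1) ^ (?k + ?l) * (pvar 0 ^ ?k * pvar 1 ^ ?l)"
  by (simp add: power_minus[of "pvar (Suc 0)"] power_minus[of "pvar 0"] power_add ac_simps)
 also have "(- 1) ^ (?k + ?l) = (mpoly_const ((- 1) ^ (?k + ?l)) :: 'a mpoly)"
  unfolding mpoly_const_power by (simp add: mpoly_const_def single_uminus flip: single_one)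
 finally have e: "mpoly_subst (%j. - pvar j) (msingle m c) =
   mpoly_const c * (mpoly_const ((- 1) ^ (?k + ?l)) * msingle (mono2 ?k ?l) 1)"
  unfolding mpoly_subst_single pvar_power_mult by simp
 show ?case unfolding e lookup_const_mult by (subst (4) m) (auto simp: lookup_single when_def)
qed (simp_all add: mpoly_subst_add lookup_add ring_distribs)

text \<open>The ring identity behind the additivity of the formal group law \<open>x + y - x\<^sup>m y\<^sup>2\<^sup>m - x\<^sup>2\<^sup>m y\<^sup>m\<close>.\<close>

lemma cubic_fgl_identity:
 fixes S T a b e d x y X Y :: "'a::comm_ring_1"
 assumes "S ^ 3 = S" "T ^ 3 = T"
 shows "S * (a * x + e * y - a * e^2 * (X * Y^2) - a^2 * e * (X^2 * Y))
  + T * (b * x + d * y - b * d^2 * (X * Y^2) - b^2 * d * (X^2 * Y))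
  - S * T^2 * ((a * X + e * Y) * (b * X + d * Y)^2) - S^2 * T * ((a * X + e * Y)^2 * (b * X + d * Y)) =
  (a * S + b * T) * x + (e * S + d * T) * y - (a * S + b * T) * (e * S + d * T)^2 * (X * Y^2)
  - (a * S + b * T)^2 * (e * S + d * T) * (X^2 * Y)
  - X ^ 3 * (S * T^2 * (a * b^2) + S^2 * T * (a^2 * b)) - Y ^ 3 * (S * T^2 * (e * d^2) + S^2 * T * (e^2 * d))"
proof -
 have "S * (a * x + e * y - a * e^2 * (X * Y^2) - a^2 * e * (X^2 * Y))
  + T * (b * x + d * y - b * d^2 * (X * Y^2) - b^2 * d * (X^2 * Y))
  - S * T^2 * ((a * X + e * Y) * (b * X + d * Y)^2) - S^2 * T * ((a * X + e * Y)^2 * (b * X + d * Y)) =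
  (a * S + b * T) * x + (e * S + d * T) * y - (a * S + b * T) * (e * S + d * T)^2 * (X * Y^2)
  - (a * S + b * T)^2 * (e * S + d * T) * (X^2 * Y)
  - X ^ 3 * (S * T^2 * (a * b^2) + S^2 * T * (a^2 * b)) - Y ^ 3 * (S * T^2 * (e * d^2) + S^2 * T * (e^2 * d))
  + (S ^ 3 - S) * (a * e^2 * (X * Y^2) + a^2 * e * (X^2 * Y)) + (T ^ 3 - T) * (b * d^2 * (X * Y^2) + b^2 * d * (X^2 * Y))"
  by (simp add: algebra_simps power2_eq_square power3_eq_cube)
 then show ?thesis by (simp only: assms diff_self mult_zero_left add_0_right)
qed

locale rank2_prime3 =
 fixes n m q :: nat and ty :: "'p::prime_card itself"
 assumes p3: "CARD('p) = 3" and n: "n \<ge> 2" and m: "m = 3 ^ (n - 1)" and q: "q = 3 ^ n"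
begin

abbreviation (input) "xv \<equiv> pvar 0 :: 'p mod_ring mpoly"
abbreviation (input) "yv \<equiv> pvar 1 :: 'p mod_ring mpoly"
abbreviation (input) "cst \<equiv> mpoly_const :: 'p mod_ring => 'p mod_ring mpoly"
abbreviation (input) "M3 \<equiv> box_polys q 2 :: 'p mod_ring mpoly set"

text \<open>The formal sum of \<open>fst s\<close> times \<open>x\<close> and \<open>snd s\<close>
  times \<open>y\<close> for \<open>p = 3\<close>, where both coefficients
  \<open>(3 choose l)/3\<close> are 1.\<close>

definition lin3 :: "'p mod_ring \<times> 'p mod_ring => 'p mod_ring mpoly" where
 "lin3 s = cst (fst s) * xv + cst (snd s) * yv - cst (fst s) * cst (snd s)^2 * (xv^m * (yv^m)^2)
  - cst (fst s)^2 * cst (snd s) * ((xv^m)^2 * yv^m)"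

lemma qm: "q = 3 * m" and m3: "m \<ge> 3" and odd_m: "odd m"
proof -
 have "n = Suc (Suc (n - 2))" using n by simp
 then have mm: "m = 3 * 3 ^ (n - 2)" unfolding m by (metis diff_Suc_1 power_Suc)
 then show "m \<ge> 3" by simp
 show "odd m" unfolding m by simp
 show "q = 3 * m" unfolding q m using n by (cases n) auto
qed

lemma three_0: "(3 :: 'p mod_ring) = 0" "(3 :: 'p mod_ring mpoly) = 0"
proof -
 show "(3 :: 'p mod_ring) = 0" using of_int_mod_ring_eq_0[where z = 3 and 'p = 'p] p3 by simp
 have "of_nat CARD('p) = (3 :: 'p mod_ring mpoly)" unfolding p3 by simp
 then show "(3 :: 'p mod_ring mpoly) = 0" using of_nat_card_mpoly[where 'p = 'p] by simp
qed

lemma scalar_cases: "(c :: 'p mod_ring) = 0 \<or> c = 1 \<or> c = - 1"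
proof -
 have "c ^ 3 = c" using mod_ring_power_card_power[of c 1] p3 by simp
 then have "c * ((c - 1) * (c + 1)) = 0" by (simp add: algebra_simps power3_eq_cube)
 then show ?thesis by (auto simp: eq_neg_iff_add_eq_0)
qed

lemma scalar_neg: "(c :: 'p mod_ring) = - c ==> c = 0"
proof -
 assume "c = - c"
 then have "c + c = 0" by (metis add.right_inverse)
 then have "c = c + (c + c)" by (simp only: add_0_right)
 also have "\<dots> = 3 * c" by simp
 finally show "c = 0" by (simp only: three_0 mult_zero_left)
qed

lemma exponent3: "P + (P + P) = (0 :: 'p mod_ring mpoly)"
proof -
 have "P + (P + P) = 3 * P" by simp
 then show ?thesis by (simp only: three_0 mult_zero_left)
qed

lemma const3: "cst c ^ 3 = cst c"
 using mpoly_const_frobenius[of c 1] by (simp add: p3)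

lemma cst_uminus: "cst (- c) = - cst c"
 by (simp add: mpoly_const_def single_uminus)

lemma card3: "CARD('p mod_ring) = 3"
 using p3 by simp

lemma fgl_poly_mpolys: "fgl_poly n 2 A j \<in> (mpolys 2 :: 'p mod_ring mpoly set)"
 by (simp add: fgl_poly_def)

lemma lin3_mpolys: "lin3 s \<in> mpolys 2"
 unfolding lin3_def by (intro mpolys_diff mpolys_add mpolys_mult mpolys_power mpolys_const mpolys_pvar) simp_all

lemma fgl_poly_lin3: "mcong q 2 (fgl_poly n 2 A j) (lin3 (A $$ (0, j), A $$ (1, j)))"
proof -
 have set: "{0<..<3} = {1, 2::nat}" by auto
 have bin: "(3 choose 1) div 3 = (1::nat)" "(3 choose 2) div 3 = (1::nat)" by (simp_all add: choose_two)
 have n1: "1 \<le> n" using n by simp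
 have e: "(3::nat) - 1 = 2" "(3::nat) - 2 = 1" by simp_all
 have s: "(\<Sum>l\<in>{1, 2::nat}. f l) = f 1 + f 2" for f :: "nat => 'p mod_ring mpoly" by simp
 show ?thesis
  using fgl_poly_2[OF n1, of A j] unfolding p3 set s bin e lin3_def fst_conv snd_conv q[symmetric] m[symmetric]
  by (simp add: mpoly_const_mult mpoly_const_power power_mult mult.commute[of 2 m] diff_diff_eq)
qed

text \<open>The exponent \<open>m\<close> is a power of 3. The mixed terms acquire an exponent of at
  least \<open>m * m\<close>, and \<open>m * m \<ge> 3 * m = q\<close> because
  \<open>m \<ge> 3\<close>; this is where \<open>n = 1\<close> is excluded.\<close>

lemma lin3_power: "mcong q 2 (lin3 s ^ m) (cst (fst s) * xv ^ m + cst (snd s) * yv ^ m)"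
proof -
 have fr: "(P + Q) ^ m = P ^ m + Q ^ m" and cs: "cst c ^ m = cst c" for P Q :: "'p mod_ring mpoly" and c
  using frobenius_add[of P Q "n - 1"] mpoly_const_frobenius[of c "n - 1"] by (simp_all add: m p3)
 have mm: "q \<le> m * m" unfolding qm using m3 by simp
 have x: "mcong q 2 ((xv ^ m) ^ m) 0" and y: "mcong q 2 ((yv ^ m) ^ m) 0"
  unfolding power_mult[symmetric] using mm by (intro mcong_pvar_power_0; simp)+
 define L where "L = cst (fst s) * xv + cst (snd s) * yv + cst (- (fst s * snd s ^ 2)) * (xv^m * (yv^m)^2)
  + cst (- (fst s ^ 2 * snd s)) * ((xv^m)^2 * yv^m)"
 have "lin3 s = L"
  by (simp add: L_def lin3_def cst_uminus mpoly_const_mult mpoly_const_power)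
 then have "lin3 s ^ m = cst (fst s) * xv ^ m + cst (snd s) * yv ^ m
   + cst (- (fst s * snd s ^ 2)) * ((xv^m)^m * ((yv^m)^2)^m) + cst (- (fst s ^ 2 * snd s)) * (((xv^m)^2)^m * (yv^m)^m)"
  by (simp only: L_def fr power_mult_distrib cs)
 also have "mcong q 2 \<dots> (cst (fst s) * xv ^ m + cst (snd s) * yv ^ m
   + cst (- (fst s * snd s ^ 2)) * (0 * ((yv^m)^2)^m) + cst (- (fst s ^ 2 * snd s)) * (((xv^m)^2)^m * 0))"
  by (intro mcong_add mcong_mult mcong_refl x y)
 finally show ?thesis by simp
qed

lemma cube_0: "mcong q 2 ((xv ^ m) ^ 3) 0" "mcong q 2 ((yv ^ m) ^ 3) 0"
 unfolding power_mult[symmetric] by (simp_all add: mcong_pvar_power_0 qm)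

text \<open>The identity \<open>cubic_fgl_identity\<close>, with the cubes of \<open>x^m\<close> and
  \<open>y^m\<close> vanishing because \<open>3 * m = q\<close>.\<close>

lemma subst_lin3:
 "mcong q 2 (mpoly_subst (fgl_poly n 2 A) (lin3 s)) (lin3 (mat2_apply A s))"
proof -
 let ?X = "xv ^ m" and ?Y = "yv ^ m"
 let ?S = "cst (fst s)" and ?T = "cst (snd s)"
 let ?a = "cst (A $$ (0, 0))" and ?b = "cst (A $$ (0, 1))" and ?e = "cst (A $$ (1, 0))" and ?d = "cst (A $$ (1, 1))"
 let ?F = "fgl_poly n 2 A"
 have F0: "mcong q 2 (?F 0) (lin3 (A $$ (0, 0), A $$ (1, 0)))" and F1: "mcong q 2 (?F 1) (lin3 (A $$ (0, 1), A $$ (1, 1)))"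
  by (rule fgl_poly_lin3)+
 have P0: "mcong q 2 (?F 0 ^ m) (?a * ?X + ?e * ?Y)" and P1: "mcong q 2 (?F 1 ^ m) (?b * ?X + ?d * ?Y)"
  using mcong_trans[OF mcong_power[OF F0] lin3_power] mcong_trans[OF mcong_power[OF F1] lin3_power] by simp_all
 have "mpoly_subst ?F (lin3 s) = ?S * ?F 0 + ?T * ?F 1 - ?S * ?T^2 * (?F 0 ^ m * (?F 1 ^ m)^2)
   - ?S^2 * ?T * ((?F 0 ^ m)^2 * ?F 1 ^ m)"
  unfolding lin3_def mpoly_subst_add mpoly_subst_diff mpoly_subst_mult mpoly_subst_power mpoly_subst_const mpoly_subst_pvar ..
 also have "mcong q 2 \<dots> (?S * lin3 (A $$ (0, 0), A $$ (1, 0)) + ?T * lin3 (A $$ (0, 1), A $$ (1, 1))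
   - ?S * ?T^2 * ((?a * ?X + ?e * ?Y) * (?b * ?X + ?d * ?Y)^2)
   - ?S^2 * ?T * ((?a * ?X + ?e * ?Y)^2 * (?b * ?X + ?d * ?Y)))"
  by (intro mcong_add mcong_diff mcong_mult mcong_power mcong_refl F0 F1 P0 P1)
 also have "\<dots> = lin3 (mat2_apply A s) - ?X ^ 3 * (?S * ?T^2 * (?a * ?b^2) + ?S^2 * ?T * (?a^2 * ?b))
   - ?Y ^ 3 * (?S * ?T^2 * (?e * ?d^2) + ?S^2 * ?T * (?e^2 * ?d))"
  unfolding lin3_def fst_conv snd_conv mat2_apply_def mpoly_const_add mpoly_const_mult
  by (rule cubic_fgl_identity[OF const3 const3])
 also have "mcong q 2 \<dots> (lin3 (mat2_apply A s) - 0 * (?S * ?T^2 * (?a * ?b^2) + ?S^2 * ?T * (?a^2 * ?b))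
   - 0 * (?S * ?T^2 * (?e * ?d^2) + ?S^2 * ?T * (?e^2 * ?d)))"
  by (intro mcong_diff mcong_mult mcong_refl cube_0)
 finally show ?thesis by simp
qed

abbreviation (input) sub :: "'p mod_ring mat => 'p mod_ring mpoly => 'p mod_ring mpoly" where
 "sub A \<equiv> mpoly_subst (fgl_poly n 2 A)"

text \<open>Truncation picks the representative in the box, so that the group acts on the finite set
  \<open>M3\<close> itself.\<close>

definition rho :: "'p mod_ring mat => 'p mod_ring mpoly => 'p mod_ring mpoly" where
 "rho A P = trunc q 2 (mpoly_subst (fgl_poly n 2 A) P)"

lemma sub_mpolys: "P \<in> mpolys 2 ==> sub A P \<in> mpolys 2"
 by (rule mpolys_subst) (simp_all add: fgl_poly_mpolys)

lemma sub_mcong: "P \<in> mpolys 2 ==> Q \<in> mpolys 2 ==> mcong q 2 P Q ==> mcong q 2 (sub A P) (sub A Q)"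
proof (rule mcong_subst_arg)
 have "1 \<le> n" using n by simp
 then show "mcong q 2 (fgl_poly n 2 A j ^ q) 0" for j
  using fgl_poly_power_0(1)[of n 2 A j] by (simp add: p3 q)
qed

lemma sub_lin3_trans:
 assumes "P \<in> mpolys 2" "mcong q 2 P (lin3 s)"
 shows "mcong q 2 (sub A P) (lin3 (mat2_apply A s))"
 using sub_mcong[OF assms(1) lin3_mpolys assms(2)] subst_lin3 by (rule mcong_trans)

lemma trunc_M3: "trunc q 2 P \<in> M3"
 by (rule truncate_mem_box_polys)

lemma M3_mpolys: "P \<in> M3 ==> P \<in> mpolys 2"
 using box_polys_subset_mpolys by blast

lemma rho_M3: "rho A P \<in> M3"
 unfolding rho_def by (rule trunc_M3)

lemma rho_mcong: "mcong q 2 (rho A P) (sub A P)"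
 unfolding rho_def by (rule mcong_trunc)

text \<open>On formal linear forms the substitution is multiplication of columns by the matrix, and
  a substitution is determined by its values on the variables.\<close>

lemma rho_rho:
 assumes A: "A \<in> carrier_mat 2 2" and B: "B \<in> carrier_mat 2 2" and P: "P \<in> mpolys 2"
 shows "rho A (rho B P) = rho (A * B) P"
proof -
 have "mcong q 2 (sub A (rho B P)) (sub A (sub B P))"
  by (intro sub_mcong M3_mpolys rho_M3 sub_mpolys P rho_mcong)
 also have "sub A (sub B P) = mpoly_subst (%j. sub A (fgl_poly n 2 B j)) P" by (rule mpoly_subst_subst)
 also have "mcong q 2 \<dots> (sub (A * B) P)"
 proof (rule mcong_subst_fun[OF P])
  fix j :: nat assume j: "j < 2"
  have "mcong q 2 (sub A (fgl_poly n 2 B j)) (lin3 (mat2_apply A (B $$ (0, j), B $$ (1, j))))"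
   by (intro sub_lin3_trans fgl_poly_mpolys fgl_poly_lin3)
  also have "mat2_apply A (B $$ (0, j), B $$ (1, j)) = ((A * B) $$ (0, j), (A * B) $$ (1, j))"
   using index_mult_mat_2[OF A B _ j] by (simp add: mat2_apply_def del: index_mult_mat)
  also have "mcong q 2 (lin3 \<dots>) (fgl_poly n 2 (A * B) j)" by (rule mcong_sym[OF fgl_poly_lin3])
  finally show "mcong q 2 (sub A (fgl_poly n 2 B j)) (fgl_poly n 2 (A * B) j)" .
 qed
 finally show ?thesis unfolding rho_def mcong_iff_trunc by (simp only: rho_def)
qed

lemma lin3_unit: "lin3 (1, 0) = xv" "lin3 (0, 1) = yv" "lin3 (- 1, 0) = - xv" "lin3 (0, - 1) = - yv"
 by (simp_all add: lin3_def cst_uminus)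

lemma rho_one: assumes "P \<in> M3" shows "rho (1\<^sub>m 2) P = P"
proof -
 have "mcong q 2 (sub (1\<^sub>m 2) P) (mpoly_subst pvar P)"
 proof (rule mcong_subst_fun[OF M3_mpolys[OF assms]])
  fix j :: nat assume "j < 2"
  then have "j = 0 \<or> j = 1" by auto
  then show "mcong q 2 (fgl_poly n 2 (1\<^sub>m 2) j) (pvar j :: 'p mod_ring mpoly)"
   using fgl_poly_lin3[of "1\<^sub>m 2" 0] fgl_poly_lin3[of "1\<^sub>m 2" 1] by (auto simp: lin3_unit)
 qed
 then have "mcong q 2 (sub (1\<^sub>m 2) P) P" by simp
 then show ?thesis unfolding rho_def mcong_iff_trunc using trunc_box_polys[OF assms] by simp
qed

lemma trunc_add: "trunc q 2 (P + Q) = trunc q 2 P + trunc q 2 Q"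
 and trunc_const: "trunc q 2 (cst c * P) = cst c * trunc q 2 P"
 by (rule poly_mapping_eqI; simp add: lookup_truncate lookup_add lookup_const_mult)+

lemma rho_add: "rho A (P + Q) = rho A P + rho A Q"
 by (simp add: rho_def mpoly_subst_add trunc_add)

lemma rho_const: "rho A (cst c * P) = cst c * rho A P"
 by (simp add: rho_def mpoly_subst_mult trunc_const)

lemma M3_add: "P \<in> M3 ==> Q \<in> M3 ==> P + Q \<in> M3"
 using Poly_Mapping.keys_add[of P Q] by (auto simp: box_polys_def)

lemma M3_const: "P \<in> M3 ==> cst c * P \<in> M3"
 unfolding box_polys_def by (auto simp: in_keys_iff lookup_const_mult subset_iff)

lemma M3_0: "0 \<in> M3"
 by (simp add: box_polys_def)

lemma finite_M3: "finite M3"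
proof (rule card_ge_0_finite)
 show "card M3 > 0" unfolding card_box_polys by (simp add: p3)
qed

lemma M3_eqI:
 assumes "P \<in> M3" "Q \<in> M3" "!!i j. i < q ==> j < q ==> mcoeff P (mono2 i j) = mcoeff Q (mono2 i j)"
 shows "P = Q"
proof (rule mcong_box_polys[OF assms(1,2)])
 show "mcong q 2 P Q" unfolding mcong_def
 proof
  fix k assume k: "k \<in> box q 2"
  obtain i j where "k = mono2 i j" "i < q" "j < q" using box_2E[OF k] by blast
  then show "mcoeff P k = mcoeff Q k" using assms(3) by simp
 qed
qed

abbreviation (input) "mT \<equiv> mat2 1 1 0 1 :: 'p mod_ring mat"
abbreviation (input) "mI \<equiv> mat2 0 1 (- 1) 0 :: 'p mod_ring mat"
abbreviation (input) "mJ \<equiv> mat2 (- 1) (- 1) (- 1) 1 :: 'p mod_ring mat"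

lemma two_m1: "(2 :: 'p mod_ring) = - 1"
 using three_0(1) by (simp add: eq_neg_iff_add_eq_0)

text \<open>The relations of the locale reduce to identities between 2 by 2 matrices;
  \<open>mJ\<close> is the conjugate of \<open>mI\<close> by \<open>mT\<close>.\<close>

lemma sl23: "sl23_module M3 (rho mT) (rho mI) (rho mJ)"
proof
 have s: "1 + 1 = - (1 :: 'p mod_ring)" "- 1 - 1 = (1 :: 'p mod_ring)" "- 1 + - 1 = (1 :: 'p mod_ring)"
  using two_m1 by (simp_all add: minus_equation_iff)
 note r = rho_rho[OF mat2_carrier mat2_carrier M3_mpolys] mat2_mult
 have r3: "rho A (rho B (rho C P)) = rho (A * (B * C)) P"
  if "A \<in> carrier_mat 2 2" "B \<in> carrier_mat 2 2" "C \<in> carrier_mat 2 2" "P \<in> M3" for A B C P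
  using that by (simp add: rho_rho M3_mpolys)
 have r4: "rho A (rho B (rho C (rho D P))) = rho (A * (B * (C * D))) P"
  if "A \<in> carrier_mat 2 2" "B \<in> carrier_mat 2 2" "C \<in> carrier_mat 2 2" "D \<in> carrier_mat 2 2" "P \<in> M3" for A B C D P
  using that by (simp add: rho_rho M3_mpolys)
 show "sub3 M3" unfolding sub3_def using finite_M3 M3_0 M3_add by blast
 show "P + (P + P) = 0" for P :: "'p mod_ring mpoly" by (rule exponent3)
 show "rho mT (P + Q) = rho mT P + rho mT Q" "rho mI (P + Q) = rho mI P + rho mI Q" "rho mJ (P + Q) = rho mJ P + rho mJ Q" for P Q
  by (rule rho_add)+
 show "rho mT P \<in> M3" "rho mI P \<in> M3" "rho mJ P \<in> M3" for P by (rule rho_M3)+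
 fix P assume P: "P \<in> M3"
 have "mT * (mT * mT) = 1\<^sub>m 2" unfolding one_mat2 mat2_mult by (simp add: s two_m1 three_0(1))
 then show "rho mT (rho mT (rho mT P)) = P" using r3[OF mat2_carrier mat2_carrier mat2_carrier P] rho_one[OF P] by simp
 have "mJ * mT = mT * mI" unfolding mat2_mult by (simp add: s two_m1)
 then show "rho mJ (rho mT P) = rho mT (rho mI P)" using r(1)[OF P] by simp
 have "mI * mT = mT * (mJ * mI)" unfolding mat2_mult by (simp add: s two_m1)
 then show "rho mI (rho mT P) = rho mT (rho mJ (rho mI P))" using r(1)[OF P] r3[OF mat2_carrier mat2_carrier mat2_carrier P] by simp
 have "mJ * mJ = mI * mI" unfolding mat2_mult by (simp add: s two_m1)
 then show "rho mJ (rho mJ P) = rho mI (rho mI P)" using r(1)[OF P] by simp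
 have "mI * mJ = mJ * (mI * (mI * mI))" unfolding mat2_mult by (simp add: s two_m1)
 then show "rho mI (rho mJ P) = rho mJ (rho mI (rho mI (rho mI P)))"
  using r(1)[OF P] r4[OF mat2_carrier mat2_carrier mat2_carrier mat2_carrier P] by simp
 have "mI * (mI * (mI * mI)) = 1\<^sub>m 2" unfolding one_mat2 mat2_mult by simp
 then show "rho mI (rho mI (rho mI (rho mI P))) = P"
  using rho_one[OF P] r4[OF mat2_carrier mat2_carrier mat2_carrier mat2_carrier P] by simp
qed

text \<open>\<open>mI\<close> sends coordinate vectors to signed coordinate vectors, whose formal
  linear forms have no mixed terms; so it maps monomials to signed monomials.\<close>

lemma lookup_rho_I:
 assumes P: "P \<in> M3" and ij: "i < q" "j < q"
 shows "mcoeff (rho mI P) (mono2 j i) = (- 1) ^ i * mcoeff P (mono2 i j)"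
proof -
 have "mcong q 2 (sub mI P) (mpoly_subst (%j. if j = 0 then - pvar 1 else pvar 0) P)"
 proof (rule mcong_subst_fun[OF M3_mpolys[OF P]])
  fix j :: nat assume "j < 2"
  then have "j = 0 \<or> j = 1" by auto
  then show "mcong q 2 (fgl_poly n 2 mI j) (if j = 0 then - pvar 1 else pvar 0)"
   using fgl_poly_lin3[of mI 0] fgl_poly_lin3[of mI 1] by (auto simp: lin3_unit)
 qed
 with rho_mcong have "mcong q 2 (rho mI P) (mpoly_subst (%j. if j = 0 then - pvar 1 else pvar 0) P)" by (rule mcong_trans)
 moreover have "mono2 j i \<in> box q 2" using ij by (simp add: mono2_mem_box)
 ultimately have "mcoeff (rho mI P) (mono2 j i) =
   mcoeff (mpoly_subst (%j. if j = 0 then - pvar 1 else pvar 0) P) (mono2 j i)"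
  unfolding mcong_def by blast
 then show ?thesis unfolding lookup_subst_swap[OF M3_mpolys[OF P]] .
qed

lemma lookup_rho_II:
 assumes P: "P \<in> M3" and ij: "i < q" "j < q"
 shows "mcoeff (rho mI (rho mI P)) (mono2 i j) = (- 1) ^ (i + j) * mcoeff P (mono2 i j)"
 using lookup_rho_I[OF rho_M3 ij(2,1), of mI P] lookup_rho_I[OF P ij] by (simp add: power_add ac_simps)

abbreviation (input) "plus3 \<equiv> sl23_module.plus_part M3 (rho mI)"
abbreviation (input) "minus3 \<equiv> sl23_module.minus_part M3 (rho mI)"

lemma M3_uminus: "P \<in> M3 ==> - P \<in> M3"
 by (simp add: box_polys_def)

text \<open>The square of \<open>mI\<close> is the scalar \<open>-1\<close>, which acts by the
  parity of the total degree.\<close>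

lemma plus3_iff: "P \<in> plus3 \<longleftrightarrow> P \<in> M3 & (\<forall>i<q. \<forall>j<q. odd (i + j) --> mcoeff P (mono2 i j) = 0)"
proof -
 have "rho mI (rho mI P) = P \<longleftrightarrow> (\<forall>i<q. \<forall>j<q. odd (i + j) --> mcoeff P (mono2 i j) = 0)" if P: "P \<in> M3"
 proof
  assume e: "rho mI (rho mI P) = P"
  show "\<forall>i<q. \<forall>j<q. odd (i + j) --> mcoeff P (mono2 i j) = 0"
  proof (intro allI impI)
   fix i j assume "i < q" "j < q" "odd (i + j)"
   then have "mcoeff P (mono2 i j) = - mcoeff P (mono2 i j)"
    using lookup_rho_II[OF P, of i j] unfolding e by simp
   then show "mcoeff P (mono2 i j) = 0" by (rule scalar_neg)
  qed
 next
  assume z: "\<forall>i<q. \<forall>j<q. odd (i + j) --> mcoeff P (mono2 i j) = 0"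
  show "rho mI (rho mI P) = P"
  proof (rule M3_eqI[OF rho_M3 P])
   fix i j assume "i < q" "j < q"
   then show "mcoeff (rho mI (rho mI P)) (mono2 i j) = mcoeff P (mono2 i j)"
    unfolding lookup_rho_II[OF P \<open>i < q\<close> \<open>j < q\<close>] using z by (cases "even (i + j)") auto
  qed
 qed
 then show ?thesis unfolding sl23_module.plus_part_def[OF sl23] by blast
qed

lemma minus3_iff: "P \<in> minus3 \<longleftrightarrow> P \<in> M3 & (\<forall>i<q. \<forall>j<q. even (i + j) --> mcoeff P (mono2 i j) = 0)"
proof -
 have "rho mI (rho mI P) = - P \<longleftrightarrow> (\<forall>i<q. \<forall>j<q. even (i + j) --> mcoeff P (mono2 i j) = 0)" if P: "P \<in> M3"
 proof
  assume e: "rho mI (rho mI P) = - P"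
  show "\<forall>i<q. \<forall>j<q. even (i + j) --> mcoeff P (mono2 i j) = 0"
  proof (intro allI impI)
   fix i j assume "i < q" "j < q" "even (i + j)"
   then have "mcoeff P (mono2 i j) = - mcoeff P (mono2 i j)"
    using lookup_rho_II[OF P, of i j] unfolding e by simp
   then show "mcoeff P (mono2 i j) = 0" by (rule scalar_neg)
  qed
 next
  assume z: "\<forall>i<q. \<forall>j<q. even (i + j) --> mcoeff P (mono2 i j) = 0"
  show "rho mI (rho mI P) = - P"
  proof (rule M3_eqI[OF rho_M3 M3_uminus[OF P]])
   fix i j assume "i < q" "j < q"
   then show "mcoeff (rho mI (rho mI P)) (mono2 i j) = mcoeff (- P) (mono2 i j)"
    unfolding lookup_rho_II[OF P \<open>i < q\<close> \<open>j < q\<close>] using z by (cases "even (i + j)") auto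
  qed
 qed
 then show ?thesis unfolding sl23_module.minus_part_def[OF sl23] by blast
qed

lemma card_by_lookup:
 assumes S: "finite S" and H: "finite (H :: 'p mod_ring mpoly set)"
  and inj: "!!P Q. P \<in> H ==> Q \<in> H ==>
   (!!i j. (i, j) \<in> S ==> mcoeff P (mono2 i j) = mcoeff Q (mono2 i j)) ==> P = Q"
  and surj: "!!g. \<exists>P\<in>H. \<forall>(i, j)\<in>S. mcoeff P (mono2 i j) = g (i, j)"
 shows "card H = 3 ^ card S"
proof -
 let ?r = "%P. \<lambda>s\<in>S. mcoeff P (mono2 (fst s) (snd s))"
 have inj_r: "inj_on ?r H"
 proof (rule inj_onI)
  fix P Q assume PQ: "P \<in> H" "Q \<in> H" and e: "?r P = ?r Q"
  show "P = Q"
  proof (rule inj[OF PQ])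
   fix i j assume "(i, j) \<in> S"
   then show "mcoeff P (mono2 i j) = mcoeff Q (mono2 i j)"
    using fun_cong[OF e, of "(i, j)"] by simp
  qed
 qed
 have img: "?r ` H = PiE S (%_. UNIV :: 'p mod_ring set)"
 proof
  show "?r ` H \<subseteq> PiE S (%_. UNIV)" by auto
  show "PiE S (%_. UNIV :: 'p mod_ring set) \<subseteq> ?r ` H"
  proof
   fix g :: "nat \<times> nat => 'p mod_ring" assume g: "g \<in> PiE S (%_. UNIV)"
   obtain P where P: "P \<in> H" "\<forall>(i, j)\<in>S. mcoeff P (mono2 i j) = g (i, j)" using surj by blast
   have "?r P = g"
   proof
    fix s show "?r P s = g s" using P(2) g by (cases s) (auto simp: PiE_def extensional_def restrict_def)
   qed
   with P(1) show "g \<in> ?r ` H" by blast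
  qed
 qed
 have "card H = card (PiE S (%_. UNIV :: 'p mod_ring set))" unfolding img[symmetric] by (rule card_image[OF inj_r, symmetric])
 also have "\<dots> = (\<Prod>s\<in>S. CARD('p mod_ring))" by (rule card_PiE[OF S])
 finally show ?thesis unfolding card3 prod_constant .
qed

definition poly_of :: "(nat \<times> nat => 'p mod_ring) => 'p mod_ring mpoly" where
 "poly_of g = truncate_mps q 2 (%m. g (mcoeff m 0, mcoeff m 1))"

lemma poly_of: "poly_of g \<in> M3" "i < q ==> j < q ==> mcoeff (poly_of g) (mono2 i j) = g (i, j)"
 unfolding poly_of_def by (auto simp: truncate_mem_box_polys lookup_truncate mono2_mem_box lookup_mono2)

lemma card_supported:
 assumes S: "S \<subseteq> {..<q} \<times> {..<q}"
  and H: "!!P. P \<in> H \<longleftrightarrow> P \<in> M3 & (\<forall>i<q. \<forall>j<q. (i, j) \<notin> S --> mcoeff P (mono2 i j) = 0)"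
 shows "card H = 3 ^ card S"
proof (rule card_by_lookup)
 show "finite S" using S by (rule finite_subset) simp
 have "H \<subseteq> M3" using H by blast
 then show "finite H" using finite_M3 by (rule finite_subset)
 fix P Q assume PQ: "P \<in> H" "Q \<in> H"
  "!!i j. (i, j) \<in> S ==> mcoeff P (mono2 i j) = mcoeff Q (mono2 i j)"
 show "P = Q"
 proof (rule M3_eqI)
  show "P \<in> M3" "Q \<in> M3" using PQ H by auto
  fix i j assume "i < q" "j < q"
  then show "mcoeff P (mono2 i j) = mcoeff Q (mono2 i j)"
   using PQ H by (cases "(i, j) \<in> S") auto
 qed
next
 fix g :: "nat \<times> nat => 'p mod_ring"
 let ?g = "%s. if s \<in> S then g s else 0"
 show "\<exists>P\<in>H. \<forall>(i, j)\<in>S. mcoeff P (mono2 i j) = g (i, j)"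
 proof (rule bexI[of _ "poly_of ?g"])
  show "poly_of ?g \<in> H" unfolding H using poly_of(1)[of ?g] poly_of(2)[of _ _ ?g] by simp
  show "\<forall>(i, j)\<in>S. mcoeff (poly_of ?g) (mono2 i j) = g (i, j)"
   using S poly_of(2)[of _ _ ?g] by auto
 qed
qed

lemma card_plus3: "card plus3 = 3 ^ card {(i, j). i < q & j < q & even (i + j)}"
 by (rule card_supported) (auto simp: plus3_iff)

lemma card_minus3: "card minus3 = 3 ^ card {(i, j). i < q & j < q & odd (i + j)}"
 by (rule card_supported) (auto simp: minus3_iff)

text \<open>The condition relates the coefficients at \<open>(i, j)\<close> and
  \<open>(j, i)\<close> up to a sign depending on \<open>i\<close>. On the diagonal it kills the
  coefficient for even \<open>i\<close> and leaves it free for odd \<open>i\<close>.\<close>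

lemma card_I_minus3: "card {P \<in> plus3. rho mI P = - P} =
  3 ^ card {(i, j). i < q & j < q & even (i + j) & (i < j \<or> i = j & odd i)}" (is "card ?H = 3 ^ card ?S")
proof (rule card_by_lookup)
 have "?S \<subseteq> {..<q} \<times> {..<q}" by auto
 then show "finite ?S" by (rule finite_subset) simp
 have "?H \<subseteq> M3" using plus3_iff by blast
 then show "finite ?H" using finite_M3 by (rule finite_subset)
 have sym: "mcoeff P (mono2 j i) = - ((- 1) ^ i * mcoeff P (mono2 i j))"
  if "P \<in> ?H" "i < q" "j < q" for P i j
 proof -
  have "P \<in> M3" "rho mI P = - P" using that plus3_iff by auto
  then have e: "- mcoeff P (mono2 j i) = (- 1) ^ i * mcoeff P (mono2 i j)"
   using lookup_rho_I[of P i j] that(2,3) by simp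
  show ?thesis using arg_cong[OF e, of uminus] by simp
 qed
 fix P Q assume PQ: "P \<in> ?H" "Q \<in> ?H"
  "!!i j. (i, j) \<in> ?S ==> mcoeff P (mono2 i j) = mcoeff Q (mono2 i j)"
 have diag: "mcoeff R (mono2 i i) = 0" if "R \<in> ?H" "i < q" "even i" for R i
  using sym[OF that(1,2,2)] that(3) by (intro scalar_neg) simp
 show "P = Q"
 proof (rule M3_eqI)
  show "P \<in> M3" "Q \<in> M3" using PQ plus3_iff by auto
  fix i j assume ij: "i < q" "j < q"
  consider "odd (i + j)" | "even (i + j)" "i < j" | "even (i + j)" "j < i" | "i = j" "odd i" | "i = j" "even i"
   by linarith
  then show "mcoeff P (mono2 i j) = mcoeff Q (mono2 i j)"
  proof cases
   case 1 then show ?thesis using PQ(1,2) ij plus3_iff by auto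
  next
   case 2 then show ?thesis using PQ(3)[of i j] ij by auto
  next
   case 3
   then have "(j, i) \<in> ?S" using ij by (auto simp: add.commute)
   from PQ(3)[OF this] show ?thesis using sym[OF PQ(1) ij(2,1)] sym[OF PQ(2) ij(2,1)] by simp
  next
   case 4 then show ?thesis using PQ(3)[of i j] ij by auto
  next
   case 5 then show ?thesis using diag PQ(1,2) ij by auto
  qed
 qed
next
 fix g :: "nat \<times> nat => 'p mod_ring"
 let ?g = "%(i, j). if odd (i + j) then 0 else if i < j then g (i, j) else
  if j < i then - ((- 1) ^ j * g (j, i)) else if odd i then g (i, i) else 0"
 have l: "mcoeff (poly_of ?g) (mono2 i j) = ?g (i, j)" if "i < q" "j < q" for i j
  using poly_of(2)[OF that] .
 show "\<exists>P\<in>?H. \<forall>(i, j)\<in>?S. mcoeff P (mono2 i j) = g (i, j)"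
 proof (rule bexI[of _ "poly_of ?g"])
  have "rho mI (poly_of ?g) = - poly_of ?g"
  proof (rule M3_eqI[OF rho_M3 M3_uminus[OF poly_of(1)]])
   fix i j assume ij: "i < q" "j < q"
   have "(- 1) ^ j * ?g (j, i) = - ?g (i, j)"
    by (auto simp: add.commute[of j i] minus_one_power_iff)
   then show "mcoeff (rho mI (poly_of ?g)) (mono2 i j) = mcoeff (- poly_of ?g) (mono2 i j)"
    unfolding lookup_rho_I[OF poly_of(1) ij(2,1)] lookup_uminus l[OF ij] l[OF ij(2,1)] .
  qed
  moreover have "poly_of ?g \<in> plus3" unfolding plus3_iff using poly_of(1)[of ?g] l by auto
  ultimately show "poly_of ?g \<in> ?H" by simp
  show "\<forall>(i, j)\<in>?S. mcoeff (poly_of ?g) (mono2 i j) = g (i, j)" using l by auto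
 qed
qed

end

section \<open>Traces within the two parts, and counting of exponent pairs\<close>

context sl23_module
begin

lemma IIT: assumes x: "x \<in> M" shows "I (I (T x)) = T (I (I x))"
proof -
 have "I (I (T x)) = T (J (I (J (I x))))" using IT[OF x] IT[OF J_M[OF I_M[OF x]]] by simp
 also have "I (J (I x)) = J (x)" using IJ[OF I_M[OF x]] IIII[OF x] by simp
 finally show ?thesis using JJ[OF x] by simp
qed

text \<open>\<open>I^2\<close> commutes with \<open>T\<close>, so projecting \<open>w\<close> to the
  part in question projects its trace \<open>z\<close>, which lies there already. The factor
  \<open>1/2\<close> of the projection is \<open>-1\<close> modulo 3.\<close>

lemma trace_parts:
 assumes w: "w \<in> M" and z: "z = tr w"
 shows "z \<in> plus_part ==> z \<in> (%x. tr x) ` plus_part" "z \<in> minus_part ==> z \<in> (%x. tr x) ` minus_part"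
proof -
 have Tw: "I (I (T w)) = T (I (I w))" "I (I (T (T w))) = T (T (I (I w)))"
  using IIT[OF w] IIT[OF T_M[OF w]] by simp_all
 have IIz: "I (I z) = tr (I (I w))" unfolding z by (simp add: I_add Tw)
 have IIw: "I (I (I (I w))) = w" by (rule IIII[OF w])
 show "z \<in> (%x. tr x) ` plus_part" if "z \<in> plus_part"
 proof (rule image_eqI)
  show "- (w + I (I w)) \<in> plus_part"
   using w by (auto simp: plus_part_def additive IIw ac_simps intro!: M_closed simp del: three_simps)
  have "tr (- (w + I (I w))) = - (tr w + tr (I (I w)))" by (simp add: additive algebra_simps del: three_simps)
  also have "\<dots> = - (z + I (I z))" by (simp only: IIz[symmetric] z[symmetric])
  also have "\<dots> = z" using that by (simp add: plus_part_def double del: minus_add_distrib)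
  finally show "z = tr (- (w + I (I w)))" by simp
 qed
 show "z \<in> (%x. tr x) ` minus_part" if "z \<in> minus_part"
 proof (rule image_eqI)
  show "- (w - I (I w)) \<in> minus_part"
   using w by (auto simp: minus_part_def additive IIw ac_simps intro!: M_closed simp del: three_simps)
  have "tr (- (w - I (I w))) = - (tr w - tr (I (I w)))" by (simp add: additive algebra_simps del: three_simps)
  also have "\<dots> = - (z - I (I z))" by (simp only: IIz[symmetric] z[symmetric])
  also have "\<dots> = - (z + z)" using that by (simp add: minus_part_def)
  also have "\<dots> = z" by (simp only: double minus_minus)
  finally show "z = tr (- (w - I (I w)))" by simp
 qed
qed

end

lemma dvd_diff_power: "c dvd a - b ==> c dvd a ^ k - (b :: 'a::comm_ring_1) ^ k"
 unfolding power_diff_sumr2 by (rule dvd_mult2)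

lemma lookup_eq_0_dvd:
 assumes "pvar 0 ^ k dvd (P :: 'a::comm_ring_1 mpoly)" "i < k"
 shows "mcoeff P (mono2 i j) = 0"
proof (rule ccontr)
 from assms(1) obtain R where R: "P = pvar 0 ^ k * R" by (rule dvdE)
 assume "mcoeff P (mono2 i j) \<noteq> 0"
 then have "mono2 i j \<in> mkeys (pvar 0 ^ k * R)" unfolding R by (simp add: in_keys_iff)
 then obtain a b where ab: "a \<in> mkeys (pvar 0 ^ k :: 'a mpoly)" "mono2 i j = a + b"
  using keys_mult[of "pvar 0 ^ k" R] by blast
 have "a = msingle 0 k" using ab(1) unfolding pvar_power by (auto split: if_splits)
 then have "i = k + mcoeff b 0"
  using arg_cong[OF ab(2), of "%m. mcoeff m 0"] by (simp add: lookup_mono2 lookup_add)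
 with assms(2) show False by simp
qed

text \<open>List sums can be evaluated by rewriting, which is how the counts for
  \<open>q = 9\<close> and \<open>q = 27\<close> are obtained.\<close>

lemma card_pairs:
 "card {(i, j). i < q & j < (q::nat) & P i j} = (\<Sum>i\<leftarrow>[0..<q]. \<Sum>j\<leftarrow>[0..<q]. if P i j then 1 else (0::nat))"
proof -
 have "{(i, j). i < q & j < q & P i j} = Sigma {..<q} (%i. {j\<in>{..<q}. P i j})" by auto
 then have "card {(i, j). i < q & j < q & P i j} = card (Sigma {..<q} (%i. {j\<in>{..<q}. P i j}))" by (rule arg_cong)
 also have "\<dots> = (\<Sum>i<q. card {j\<in>{..<q}. P i j})" by (rule card_SigmaI) simp_all
 also have "\<dots> = (\<Sum>i<q. \<Sum>j<q. if P i j then 1 else (0::nat))"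
  by (simp only: card_eq_sum sum.inter_filter[OF finite_lessThan])
 finally show ?thesis by (simp only: interv_sum_list_conv_sum_set_nat set_upt atLeast0LessThan)
qed

text \<open>Reflection in the diagonal matches the pairs above it with those below; the diagonal has
  \<open>q\<close> points, of which only the odd ones belong to the set on the left.\<close>

lemma card_even_half:
 fixes q :: nat
 shows "2 * card {(i, j). i < q & j < q & even (i + j) & (i < j \<or> i = j & odd i)} + q =
  card {(i, j). i < q & j < q & even (i + j)} + 2 * card {i. i < q & odd i}"
proof -
 define A B D O' where "A = {(i, j). i < q & j < q & even (i + j) & i < j}"
  and "B = {(i, j). i < q & j < q & even (i + j) & j < i}"
  and "D = {(i, j). i < q & j = i}" and "O' = {(i, j). (i < q & odd i) & j = i}"
 note defs = A_def B_def D_def O'_def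
 have "A \<subseteq> {..<q} \<times> {..<q}" "B \<subseteq> {..<q} \<times> {..<q}" "D \<subseteq> {..<q} \<times> {..<q}" "O' \<subseteq> {..<q} \<times> {..<q}"
  by (auto simp: defs)
 then have fin: "finite A" "finite B" "finite D" "finite O'" by (auto intro: finite_subset[OF _ finite_cartesian_product])
 have 1: "card (A \<union> B \<union> D) = card (A \<union> B) + card D" by (rule card_Un_disjoint) (use fin in \<open>auto simp: defs\<close>)
 have 2: "card (A \<union> B) = card A + card B" by (rule card_Un_disjoint) (use fin in \<open>auto simp: defs\<close>)
 have 3: "card (A \<union> O') = card A + card O'" by (rule card_Un_disjoint) (use fin in \<open>auto simp: defs\<close>)
 have 4: "card A = card B"
  by (rule bij_betw_same_card[of prod.swap], rule bij_betwI[where g = prod.swap]) (auto simp: defs)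
 have 5: "card D = card {..<q}"
  by (rule bij_betw_same_card[of fst], rule bij_betwI[where g = "%i. (i, i)"]) (auto simp: defs)
 have 6: "card O' = card {i. i < q & odd i}"
  by (rule bij_betw_same_card[of fst], rule bij_betwI[where g = "%i. (i, i)"]) (auto simp: defs)
 have 7: "{(i, j). i < q & j < q & even (i + j)} = A \<union> B \<union> D"
 proof (rule Set.set_eqI)
  fix s :: "nat \<times> nat"
  obtain i j where s: "s = (i, j)" by (cases s)
  show "s \<in> {(i, j). i < q & j < q & even (i + j)} \<longleftrightarrow> s \<in> A \<union> B \<union> D"
   using linorder_less_linear[of i j] by (auto simp: s defs)
 qed
 have 8: "{(i, j). i < q & j < q & even (i + j) & (i < j \<or> i = j & odd i)} = A \<union> O'"
 proof (rule Set.set_eqI)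
  fix s :: "nat \<times> nat"
  obtain i j where s: "s = (i, j)" by (cases s)
  show "s \<in> {(i, j). i < q & j < q & even (i + j) & (i < j \<or> i = j & odd i)} \<longleftrightarrow> s \<in> A \<union> O'"
   by (auto simp: s defs)
 qed
 show ?thesis unfolding 7 8 1 2 3 5 6 using 4 by simp
qed

lemma parity_pairs_9:
 "card {(i, j). i < 9 & j < (9::nat) & even (i + j)} = 41"
 "card {(i, j). i < 9 & j < (9::nat) & odd (i + j)} = 40"
 "card {(i, j). i < 9 & j < (9::nat) & even (i + j) & (j mod 3 = 0 \<or> i = 8)} = 17"
 "card {(i, j). i < 9 & j < (9::nat) & even (i + j) & (j mod 3 = 0 & 2 \<le> i \<or> i = 8 & j mod 3 = 1)} = 12"
 "card {(i, j). i < 9 & j < (9::nat) & odd (i + j) & (j mod 3 = 0 \<or> i = 8)} = 16"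
 "card {(i, j). i < 9 & j < (9::nat) & odd (i + j) & (j mod 3 = 0 & 2 \<le> i \<or> i = 8 & j mod 3 = 1)} = 12"
proof -
 have u: "[0..<9] = [0, 1, 2, 3, 4, 5, 6, 7, 8]" by (simp add: upt_rec)
 \<comment> \<open>Each row sum depends on \<open>i\<close> only through its parity and the
   conditions \<open>i = 8\<close> and \<open>2 \<le> i\<close>; afterwards the nine rows are
   added.\<close>
 have r0: "(\<Sum>j\<leftarrow>[0..<9]. if even (i + j) then 1 else (0::nat)) = (if even i then 5 else 4)" for i :: nat
  unfolding u by (cases "i = 8"; cases "even i"; cases "2 \<le> i"; simp)
 have r1: "(\<Sum>j\<leftarrow>[0..<9]. if odd (i + j) then 1 else (0::nat)) = (if even i then 4 else 5)" for i :: nat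
  unfolding u by (cases "i = 8"; cases "even i"; cases "2 \<le> i"; simp)
 have r2: "(\<Sum>j\<leftarrow>[0..<9]. if even (i + j) & (j mod 3 = 0 \<or> i = 8) then 1 else (0::nat)) = (if i = 8 then 5 else if even i then 2 else 1)" for i :: nat
  unfolding u by (cases "i = 8"; cases "even i"; cases "2 \<le> i"; simp)
 have r3: "(\<Sum>j\<leftarrow>[0..<9]. if even (i + j) & (j mod 3 = 0 & 2 \<le> i \<or> i = 8 & j mod 3 = 1) then 1 else (0::nat)) = (if i = 8 then 3 else if 2 \<le> i then if even i then 2 else 1 else 0)" for i :: nat
  unfolding u by (cases "i = 8"; cases "even i"; cases "2 \<le> i"; simp)
 have r4: "(\<Sum>j\<leftarrow>[0..<9]. if odd (i + j) & (j mod 3 = 0 \<or> i = 8) then 1 else (0::nat)) = (if i = 8 then 4 else if even i then 1 else 2)" for i :: nat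
  unfolding u by (cases "i = 8"; cases "even i"; cases "2 \<le> i"; simp)
 have r5: "(\<Sum>j\<leftarrow>[0..<9]. if odd (i + j) & (j mod 3 = 0 & 2 \<le> i \<or> i = 8 & j mod 3 = 1) then 1 else (0::nat)) = (if i = 8 then 3 else if 2 \<le> i then if even i then 1 else 2 else 0)" for i :: nat
  unfolding u by (cases "i = 8"; cases "even i"; cases "2 \<le> i"; simp)
 show "card {(i, j). i < 9 & j < (9::nat) & even (i + j)} = 41"
  "card {(i, j). i < 9 & j < (9::nat) & odd (i + j)} = 40"
  "card {(i, j). i < 9 & j < (9::nat) & even (i + j) & (j mod 3 = 0 \<or> i = 8)} = 17"
  "card {(i, j). i < 9 & j < (9::nat) & even (i + j) & (j mod 3 = 0 & 2 \<le> i \<or> i = 8 & j mod 3 = 1)} = 12"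
  "card {(i, j). i < 9 & j < (9::nat) & odd (i + j) & (j mod 3 = 0 \<or> i = 8)} = 16"
  "card {(i, j). i < 9 & j < (9::nat) & odd (i + j) & (j mod 3 = 0 & 2 \<le> i \<or> i = 8 & j mod 3 = 1)} = 12"
  unfolding card_pairs r0 r1 r2 r3 r4 r5 unfolding u by simp_all
qed

lemma parity_pairs_27:
 "card {(i, j). i < 27 & j < (27::nat) & even (i + j)} = 365"
 "card {(i, j). i < 27 & j < (27::nat) & odd (i + j)} = 364"
 "card {(i, j). i < 27 & j < (27::nat) & even (i + j) & (j mod 3 = 0 \<or> i = 26)} = 131"
 "card {(i, j). i < 27 & j < (27::nat) & even (i + j) & (j mod 3 = 0 & 2 \<le> i \<or> i = 26 & j mod 3 = 1)} = 117"
 "card {(i, j). i < 27 & j < (27::nat) & odd (i + j) & (j mod 3 = 0 \<or> i = 26)} = 130"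
 "card {(i, j). i < 27 & j < (27::nat) & odd (i + j) & (j mod 3 = 0 & 2 \<le> i \<or> i = 26 & j mod 3 = 1)} = 117"
proof -
 have u: "[0..<27] = [0, 1, 2, 3, 4, 5, 6, 7, 8, 9, 10, 11, 12, 13, 14, 15, 16, 17, 18, 19, 20, 21, 22, 23, 24, 25, 26]" by (simp add: upt_rec)
 have r0: "(\<Sum>j\<leftarrow>[0..<27]. if even (i + j) then 1 else (0::nat)) = (if even i then 14 else 13)" for i :: nat
  unfolding u by (cases "i = 26"; cases "even i"; cases "2 \<le> i"; simp)
 have r1: "(\<Sum>j\<leftarrow>[0..<27]. if odd (i + j) then 1 else (0::nat)) = (if even i then 13 else 14)" for i :: nat
  unfolding u by (cases "i = 26"; cases "even i"; cases "2 \<le> i"; simp)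
 have r2: "(\<Sum>j\<leftarrow>[0..<27]. if even (i + j) & (j mod 3 = 0 \<or> i = 26) then 1 else (0::nat)) = (if i = 26 then 14 else if even i then 5 else 4)" for i :: nat
  unfolding u by (cases "i = 26"; cases "even i"; cases "2 \<le> i"; simp)
 have r3: "(\<Sum>j\<leftarrow>[0..<27]. if even (i + j) & (j mod 3 = 0 & 2 \<le> i \<or> i = 26 & j mod 3 = 1) then 1 else (0::nat)) = (if i = 26 then 9 else if 2 \<le> i then if even i then 5 else 4 else 0)" for i :: nat
  unfolding u by (cases "i = 26"; cases "even i"; cases "2 \<le> i"; simp)
 have r4: "(\<Sum>j\<leftarrow>[0..<27]. if odd (i + j) & (j mod 3 = 0 \<or> i = 26) then 1 else (0::nat)) = (if i = 26 then 13 else if even i then 4 else 5)" for i :: nat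
  unfolding u by (cases "i = 26"; cases "even i"; cases "2 \<le> i"; simp)
 have r5: "(\<Sum>j\<leftarrow>[0..<27]. if odd (i + j) & (j mod 3 = 0 & 2 \<le> i \<or> i = 26 & j mod 3 = 1) then 1 else (0::nat)) = (if i = 26 then 9 else if 2 \<le> i then if even i then 4 else 5 else 0)" for i :: nat
  unfolding u by (cases "i = 26"; cases "even i"; cases "2 \<le> i"; simp)
 show "card {(i, j). i < 27 & j < (27::nat) & even (i + j)} = 365"
  "card {(i, j). i < 27 & j < (27::nat) & odd (i + j)} = 364"
  "card {(i, j). i < 27 & j < (27::nat) & even (i + j) & (j mod 3 = 0 \<or> i = 26)} = 131"
  "card {(i, j). i < 27 & j < (27::nat) & even (i + j) & (j mod 3 = 0 & 2 \<le> i \<or> i = 26 & j mod 3 = 1)} = 117"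
  "card {(i, j). i < 27 & j < (27::nat) & odd (i + j) & (j mod 3 = 0 \<or> i = 26)} = 130"
  "card {(i, j). i < 27 & j < (27::nat) & odd (i + j) & (j mod 3 = 0 & 2 \<le> i \<or> i = 26 & j mod 3 = 1)} = 117"
  unfolding card_pairs r0 r1 r2 r3 r4 r5 unfolding u by simp_all
qed

lemma odd_card_9_27: "card {i. i < (9::nat) & odd i} = 4" "card {i. i < (27::nat) & odd i} = 13"
proof -
 have e: "{i. i < q & odd i} = set (filter odd [0..<q])" for q :: nat by auto
 show "card {i. i < (9::nat) & odd i} = 4" "card {i. i < (27::nat) & odd i} = 13"
  unfolding e distinct_card[OF distinct_filter[OF distinct_upt]] by (simp_all add: upt_rec)
qed

section \<open>Explicit fixed vectors and traces of the unipotent generator\<close>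

context rank2_prime3
begin

text \<open>Leading terms for the order in \<open>x\<close>: lower powers of \<open>x\<close> are
  absent, and \<open>x^i\<close> carries exactly \<open>y^j\<close>.\<close>

definition leads :: "nat => nat => 'p mod_ring mpoly => bool" where
 "leads i j P \<longleftrightarrow> xv ^ Suc i dvd P - xv ^ i * yv ^ j"

lemma lookup_leads:
 assumes "leads i j P" "i < q" "i' \<le> i" "j' < q"
 shows "mcoeff (trunc q 2 P) (mono2 i' j') = (if i' = i & j' = j then 1 else 0)"
proof -
 have "mcoeff (P - xv ^ i * yv ^ j) (mono2 i' j') = 0"
  using assms(1,3) unfolding leads_def by (intro lookup_eq_0_dvd[of "Suc i"]) simp_all
 then have "mcoeff P (mono2 i' j') = mcoeff (xv ^ i * yv ^ j) (mono2 i' j')"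
  by (simp only: lookup_minus right_minus_eq)
 also have "\<dots> = (if i' = i & j' = j then 1 else 0)"
  unfolding pvar_power_mult by (auto simp: lookup_single when_def)
 finally show ?thesis using assms by (simp add: lookup_truncate mono2_mem_box)
qed

definition closed3 :: "'p mod_ring mpoly set => bool" where
 "closed3 H \<longleftrightarrow> 0 \<in> H & (\<forall>P\<in>H. \<forall>Q\<in>H. P + Q \<in> H) & (\<forall>c. \<forall>P\<in>H. cst c * P \<in> H)"

lemma closed3_sum: "closed3 H ==> (!!s. s \<in> S ==> g s \<in> H) ==> (\<Sum>s\<in>S. cst (c s) * g s) \<in> H"
 by (induction S rule: infinite_finite_induct) (simp_all add: closed3_def)

text \<open>Distinct leading monomials make the family linearly independent after truncation, and
  all combinations stay in \<open>H\<close>.\<close>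

lemma card_triangular:
 assumes S: "S \<subseteq> {..<q} \<times> {..<q}" and H: "finite H" "closed3 H"
  and g: "!!i j. (i, j) \<in> S ==> trunc q 2 (g i j) \<in> H" "!!i j. (i, j) \<in> S ==> leads i j (g i j)"
 shows "3 ^ card S \<le> card H"
proof -
 have fS: "finite S" using S by (rule finite_subset) simp
 define G where "G s = trunc q 2 (g (fst s) (snd s))" for s
 let ?f = "%c. \<Sum>s\<in>S. cst (c s) * G s"
 have lk: "mcoeff (G s) (mono2 (fst t) (snd t)) = (if t = s then 1 else 0)"
  if "s \<in> S" "t \<in> S" "fst t \<le> fst s" for s t
 proof -
  have "s \<in> {..<q} \<times> {..<q}" "t \<in> {..<q} \<times> {..<q}" using S that by blast+
  then have "fst s < q" "snd t < q" by auto
  with lookup_leads[OF g(2)[of "fst s" "snd s"] _ that(3), of "snd t"] that(1)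
  show ?thesis by (simp add: G_def prod_eq_iff)
 qed
 have "inj_on ?f (PiE S (%_. UNIV :: 'p mod_ring set))"
 proof (rule inj_onI, rule ccontr)
  fix c c' assume c: "c \<in> PiE S (%_. UNIV :: 'p mod_ring set)" "c' \<in> PiE S (%_. UNIV)" and e: "?f c = ?f c'" and ne: "c \<noteq> c'"
  \<comment> \<open>Among the indices where the coefficients differ, one with least power of
    \<open>x\<close> is tested; there no other leading term contributes.\<close>
  define D where "D = {s \<in> S. c s \<noteq> c' s}"
  have "D \<noteq> {}" using PiE_ext[OF c] ne unfolding D_def by blast
  moreover have "finite D" using fS by (simp add: D_def)
  ultimately have "Min (fst ` D) \<in> fst ` D" by (intro Min_in) auto
  then obtain s0 where s0: "s0 \<in> D" "fst s0 = Min (fst ` D)" by auto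
  have min: "fst s0 \<le> fst s" if "s \<in> D" for s
   unfolding s0(2) using \<open>finite D\<close> that by (intro Min_le) auto
  have s0S: "s0 \<in> S" and ne0: "c s0 \<noteq> c' s0" using s0(1) by (auto simp: D_def)
  have "mcoeff (?f c) (mono2 (fst s0) (snd s0)) = mcoeff (?f c') (mono2 (fst s0) (snd s0))" by (simp only: e)
  then have "(\<Sum>s\<in>S. (c s - c' s) * mcoeff (G s) (mono2 (fst s0) (snd s0))) = 0"
   by (simp add: lookup_sum lookup_const_mult left_diff_distrib sum_subtractf)
  moreover have "(\<Sum>s\<in>S. (c s - c' s) * mcoeff (G s) (mono2 (fst s0) (snd s0))) =
    (\<Sum>s\<in>S. if s = s0 then c s0 - c' s0 else 0)"
  proof (rule sum.cong[OF refl])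
   fix s assume s: "s \<in> S"
   show "(c s - c' s) * mcoeff (G s) (mono2 (fst s0) (snd s0)) = (if s = s0 then c s0 - c' s0 else 0)"
   proof (cases "s \<in> D")
    case True
    then show ?thesis using lk[OF s s0S min[OF True]] by auto
   next
    case False
    then have "c s = c' s" using s by (simp add: D_def)
    then show ?thesis using s0(1) False by auto
   qed
  qed
  ultimately have "c s0 - c' s0 = 0" using fS s0S by simp
  with ne0 show False by simp
 qed
 moreover have "?f ` PiE S (%_. UNIV) \<subseteq> H"
 proof (rule image_subsetI)
  fix c show "?f c \<in> H" by (rule closed3_sum[OF H(2)]) (use g(1) in \<open>auto simp: G_def\<close>)
 qed
 ultimately have "card (PiE S (%_. UNIV :: 'p mod_ring set)) \<le> card H" using H(1) by (rule card_inj_on_le)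
 moreover have "card (PiE S (%_. UNIV :: 'p mod_ring set)) = 3 ^ card S"
  unfolding card_PiE[OF fS] card3 prod_constant ..
 ultimately show ?thesis by simp
qed

abbreviation (input) "w1 \<equiv> xv ^ m * (yv ^ m)^2"
abbreviation (input) "w2 \<equiv> (xv ^ m)^2 * yv ^ m"
abbreviation (input) "l1 \<equiv> lin3 (1, 1)"
abbreviation (input) "l2 \<equiv> lin3 (- 1, 1)"
text \<open>Modulo the box ideal the orbit of \<open>y\<close> under \<open>mT\<close> is
  \<open>yv\<close>, \<open>l1\<close>, \<open>l2\<close>. Its product \<open>zz\<close> is
  invariant, and \<open>uu\<close> is the trace of \<open>yv ^ 2\<close>.\<close>

definition zz where "zz = yv * (l1 * l2)"
definition uu where "uu = yv^2 + l1^2 + l2^2"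

lemma l1: "l1 = xv + yv - w1 - w2" and l2: "l2 = - xv + yv + w1 - w2"
 by (simp_all add: lin3_def cst_uminus)

lemma sub_x: "mcong q 2 (sub mT xv) xv"
 and sub_y: "mcong q 2 (sub mT yv) l1"
 and sub_l1: "mcong q 2 (sub mT l1) l2"
 and sub_l2: "mcong q 2 (sub mT l2) yv"
proof -
 have "mat2_apply mT (1, 0) = (1, 0)" "mat2_apply mT (0, 1) = (1, 1)" "mat2_apply mT (1, 1) = (- 1, 1)" "mat2_apply mT (- 1, 1) = (0, 1)"
  using two_m1 by (simp_all add: mat2_apply_def)
 then show "mcong q 2 (sub mT xv) xv" "mcong q 2 (sub mT yv) l1" "mcong q 2 (sub mT l1) l2" "mcong q 2 (sub mT l2) yv"
  using subst_lin3[of mT "(1, 0)"] subst_lin3[of mT "(0, 1)"] subst_lin3[of mT "(1, 1)"] subst_lin3[of mT "(- 1, 1)"]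
  by (simp_all only: lin3_unit)
qed

lemma zz_mpolys: "zz \<in> mpolys 2" and uu_mpolys: "uu \<in> mpolys 2" and xv_mpolys: "xv \<in> mpolys 2" and yv_mpolys: "yv \<in> mpolys 2"
 unfolding zz_def uu_def by (intro mpolys_add mpolys_mult mpolys_power mpolys_pvar lin3_mpolys; simp)+

definition fixT where "fixT P \<longleftrightarrow> P \<in> mpolys 2 & mcong q 2 (sub mT P) P"

lemma fixT_mult: "fixT P ==> fixT Q ==> fixT (P * Q)"
 unfolding fixT_def mpoly_subst_mult by (auto intro: mpolys_mult mcong_mult)

lemma fixT_power: "fixT P ==> fixT (P ^ k)"
 unfolding fixT_def mpoly_subst_power by (auto intro: mpolys_power mcong_power)

lemma fixT_x: "fixT xv"
 unfolding fixT_def using sub_x xv_mpolys by blast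

lemma fixT_z: "fixT zz"
proof -
 have "mcong q 2 (sub mT zz) (l1 * (l2 * yv))"
  unfolding zz_def mpoly_subst_mult by (intro mcong_mult sub_y sub_l1 sub_l2)
 also have "l1 * (l2 * yv) = zz" by (simp only: zz_def ac_simps)
 finally show ?thesis unfolding fixT_def using zz_mpolys by blast
qed

lemma dvd_w: "k \<le> m ==> xv ^ k dvd w1" "k \<le> m ==> xv ^ k dvd w2" "k \<le> 2 * m ==> xv ^ k dvd w2"
proof -
 show "xv ^ k dvd w1" "xv ^ k dvd w2" if "k \<le> m"
  using le_imp_power_dvd[OF that, of xv] by (auto simp: power2_eq_square intro: dvd_mult2)
 show "xv ^ k dvd w2" if "k \<le> 2 * m"
  using le_imp_power_dvd[OF that, of xv] by (auto simp: power_mult mult.commute[of 2 m] intro: dvd_mult2)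
qed

lemma x_dvd_l1: "xv dvd l1 - yv" and x_dvd_l2: "xv dvd l2 - yv"
proof -
 have d: "xv dvd w1" "xv dvd w2" using dvd_w[of 1] m3 by simp_all
 have e: "l1 - yv = xv - w1 - w2" "l2 - yv = - xv + w1 - w2" unfolding l1 l2 by (simp_all add: algebra_simps)
 show "xv dvd l1 - yv" unfolding e using d by (intro dvd_diff dvd_refl)
 show "xv dvd l2 - yv" unfolding e using d by (intro dvd_diff dvd_add) simp_all
qed

lemma x_dvd_z: "xv dvd zz - yv ^ 3"
proof -
 have e: "zz - yv ^ 3 = yv * ((l1 - yv) * l2 + yv * (l2 - yv))"
  by (simp add: zz_def algebra_simps power3_eq_cube)
 show ?thesis unfolding e by (intro dvd_mult dvd_add dvd_mult2 x_dvd_l1) (intro dvd_mult x_dvd_l2)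
qed

text \<open>For the additive group the orbit product would be exactly \<open>y^3 - x^2 y\<close>;
  all corrections contain \<open>x^m\<close>.\<close>

lemma z_approx: "xv ^ m dvd zz - (yv ^ 3 - xv^2 * yv)"
proof -
 have e: "zz - (yv ^ 3 - xv^2 * yv) = yv * (w2 * (w2 - 2 * yv) + w1 * (2 * xv - w1))"
  unfolding zz_def l1 l2 by (simp add: algebra_simps power3_eq_cube power2_eq_square)
 show ?thesis unfolding e by (intro dvd_mult dvd_add dvd_mult2 dvd_w) simp_all
qed

text \<open>For the additive group the trace of \<open>y^2\<close> is
  \<open>3 y^2 + 2 x^2 = - x^2\<close>; the right-hand side collects the corrections.\<close>

lemma u_approx: "uu + xv^2 = w2 * (2 * w2 - yv) + (w1 * w1 * 2 - xv * w1)"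
proof -
 have "uu + xv^2 = w2 * (2 * w2 - yv) + (w1 * w1 * 2 - xv * w1) + 3 * (yv^2 + xv^2 - yv * w2 - xv * w1)"
  unfolding uu_def l1 l2 by (simp add: algebra_simps power2_eq_square)
 then show ?thesis by (simp only: three_0 mult_zero_left add_0_right)
qed

lemma mcong_dvd: "xv ^ q dvd P - Q ==> mcong q 2 P Q"
proof -
 assume "xv ^ q dvd P - Q"
 then obtain R where R: "P - Q = xv ^ q * R" by (rule dvdE)
 have "mcong q 2 (xv ^ q * R + Q) (0 * R + Q)"
  by (intro mcong_add mcong_mult mcong_refl mcong_pvar_power_0) simp_all
 moreover have "P = xv ^ q * R + Q" unfolding R[symmetric] by simp
 ultimately show ?thesis by simp
qed

text \<open>Both families are built to have leading term \<open>x^i y^j\<close>: powers of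
  \<open>y\<close> are traded for powers of the invariant \<open>zz\<close>, whose leading term is
  \<open>y^3\<close>. In \<open>trace_family\<close> the factor \<open>uu\<close> stands for
  \<open>- x^2\<close>, and the truncated \<open>i - 2\<close> is meant for
  \<open>2 \<le> i\<close>.\<close>

definition fixed_family where "fixed_family i j = xv ^ i * (yv ^ (j mod 3) * zz ^ (j div 3))"
definition trace_family where "trace_family i j =
 (if j mod 3 = 0 then - (xv ^ (i - 2) * (zz ^ (j div 3) * uu)) else xv ^ i * (yv * zz ^ (j div 3)))"

lemma y_power_split: "yv ^ (j mod 3) * (yv ^ 3) ^ (j div 3) = yv ^ j"
 unfolding power_mult[symmetric] power_add[symmetric] by simp

lemma leads_fixed: "leads i j (fixed_family i j)"
proof -
 have e: "fixed_family i j - xv ^ i * yv ^ j = xv ^ i * (yv ^ (j mod 3) * (zz ^ (j div 3) - (yv ^ 3) ^ (j div 3)))"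
  unfolding fixed_family_def y_power_split[of j, symmetric] by (simp add: algebra_simps)
 have "xv ^ i * xv dvd fixed_family i j - xv ^ i * yv ^ j"
  unfolding e by (intro mult_dvd_mono dvd_refl dvd_mult dvd_diff_power x_dvd_z)
 then show ?thesis by (simp only: leads_def power_Suc2)
qed

lemma leads_trace:
 assumes "j mod 3 = 0 & 2 \<le> i \<or> j mod 3 = 1"
 shows "leads i j (trace_family i j)"
proof (cases "j mod 3 = 0")
 case True
 define k where "k = i - 2"
 have i: "i = k + 2" using assms True by (auto simp: k_def)
 have xi: "xv ^ i = xv ^ k * xv^2" unfolding i by (rule power_add)
 have j: "yv ^ j = (yv ^ 3) ^ (j div 3)" using y_power_split[of j] True by simp
 have e: "trace_family i j - xv ^ i * yv ^ j =
   xv ^ k * (- (zz ^ (j div 3) * (uu + xv^2))) + xv ^ k * (xv^2 * (zz ^ (j div 3) - (yv ^ 3) ^ (j div 3)))"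
  unfolding trace_family_def j xi using True by (simp add: i algebra_simps)
 have d3: "xv ^ 3 dvd uu + xv^2"
  unfolding u_approx using m3 by (intro dvd_add dvd_diff dvd_mult dvd_mult2 dvd_w) simp_all
 have c: "xv ^ 3 = xv^2 * xv" by (simp add: power3_eq_cube power2_eq_square)
 have "xv ^ k * xv ^ 3 dvd trace_family i j - xv ^ i * yv ^ j"
  unfolding e
 proof (intro dvd_add mult_dvd_mono dvd_refl)
  show "xv ^ 3 dvd - (zz ^ (j div 3) * (uu + xv^2))" using d3 by (simp add: dvd_mult)
  show "xv ^ 3 dvd xv^2 * (zz ^ (j div 3) - (yv ^ 3) ^ (j div 3))"
   unfolding c by (intro mult_dvd_mono dvd_refl dvd_diff_power x_dvd_z)
 qed
 moreover have "Suc i = k + 3" by (simp add: i)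
 then have "xv ^ k * xv ^ 3 = xv ^ Suc i" by (simp only: power_add)
 ultimately show ?thesis by (simp only: leads_def)
next
 case False
 then have "j mod 3 = 1" using assms by simp
 then have "trace_family i j = fixed_family i j" by (simp add: trace_family_def fixed_family_def)
 then show ?thesis using leads_fixed by simp
qed

text \<open>For \<open>j\<close> divisible by 3 the element is a monomial in invariants. For
  \<open>i = q - 1\<close> the difference between \<open>l1\<close> and \<open>y\<close> is a
  multiple of \<open>x\<close>, and \<open>x^q\<close> vanishes.\<close>

lemma fixT_family:
 assumes "j mod 3 = 0 \<or> i = q - 1"
 shows "fixT (fixed_family i j)"
 using assms
proof
 assume "j mod 3 = 0"
 then have "fixed_family i j = xv ^ i * zz ^ (j div 3)" by (simp add: fixed_family_def)
 then show ?thesis by (simp add: fixT_mult fixT_power fixT_x fixT_z)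
next
 assume i: "i = q - 1"
 have "q > 0" by (simp add: q)
 then have Q: "xv ^ q = xv ^ i * xv" unfolding i by (simp flip: power_Suc2)
 have "fixT (xv ^ i * yv ^ (j mod 3))"
  unfolding fixT_def
 proof
  show "xv ^ i * yv ^ (j mod 3) \<in> mpolys 2" by (intro mpolys_mult mpolys_power xv_mpolys yv_mpolys)
  have "mcong q 2 (sub mT (xv ^ i * yv ^ (j mod 3))) (xv ^ i * l1 ^ (j mod 3))"
   unfolding mpoly_subst_mult mpoly_subst_power by (intro mcong_mult mcong_power sub_x sub_y)
  also have "mcong q 2 \<dots> (xv ^ i * yv ^ (j mod 3))"
  proof (rule mcong_dvd)
   have "xv ^ i * xv dvd xv ^ i * (l1 ^ (j mod 3) - yv ^ (j mod 3))"
    by (intro mult_dvd_mono dvd_refl dvd_diff_power x_dvd_l1)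
   then show "xv ^ q dvd xv ^ i * l1 ^ (j mod 3) - xv ^ i * yv ^ (j mod 3)"
    unfolding Q right_diff_distrib .
  qed
  finally show "mcong q 2 (sub mT (xv ^ i * yv ^ (j mod 3))) (xv ^ i * yv ^ (j mod 3))" .
 qed
 from fixT_mult[OF this fixT_power[OF fixT_z]] show ?thesis by (simp add: fixed_family_def mult.assoc)
qed

definition trace_image where
 "trace_image R \<longleftrightarrow> (\<exists>P\<in>mpolys 2. mcong q 2 (P + sub mT P + sub mT (sub mT P)) R)"

lemma trace_imageI: "P \<in> mpolys 2 ==> mcong q 2 (P + sub mT P + sub mT (sub mT P)) R ==> trace_image R"
 unfolding trace_image_def by blast

lemma trace_image_cong: "trace_image R ==> mcong q 2 R R' ==> trace_image R'"
 unfolding trace_image_def using mcong_trans by blast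

lemma trace_image_diff:
 assumes "trace_image R" "trace_image S" shows "trace_image (R - S)"
proof -
 from assms obtain P Q where P: "P \<in> mpolys 2" "mcong q 2 (P + sub mT P + sub mT (sub mT P)) R"
  and Q: "Q \<in> mpolys 2" "mcong q 2 (Q + sub mT Q + sub mT (sub mT Q)) S" unfolding trace_image_def by blast
 show ?thesis
 proof (rule trace_imageI)
  show "P - Q \<in> mpolys 2" using P Q by (intro mpolys_diff)
  show "mcong q 2 (P - Q + sub mT (P - Q) + sub mT (sub mT (P - Q))) (R - S)"
   using mcong_diff[OF P(2) Q(2)] by (simp add: mpoly_subst_diff algebra_simps)
 qed
qed

lemma trace_image_mult:
 assumes F: "fixT F" and R: "trace_image R" shows "trace_image (F * R)"
proof -
 from R obtain P where P: "P \<in> mpolys 2" "mcong q 2 (P + sub mT P + sub mT (sub mT P)) R" unfolding trace_image_def by blast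
 have F1: "F \<in> mpolys 2" "mcong q 2 (sub mT F) F" using F by (auto simp: fixT_def)
 have F2: "mcong q 2 (sub mT (sub mT F)) F"
  using sub_mcong[OF sub_mpolys[OF F1(1)] F1(1) F1(2)] F1(2) by (rule mcong_trans)
 show ?thesis
 proof (rule trace_imageI)
  show "F * P \<in> mpolys 2" using P F1 by (intro mpolys_mult)
  have "mcong q 2 (F * P + sub mT (F * P) + sub mT (sub mT (F * P))) (F * P + F * sub mT P + F * sub mT (sub mT P))"
   unfolding mpoly_subst_mult by (intro mcong_add mcong_mult mcong_refl F1 F2)
  also have "\<dots> = F * (P + sub mT P + sub mT (sub mT P))" by (simp add: algebra_simps)
  also have "mcong q 2 \<dots> (F * R)" by (intro mcong_mult mcong_refl P)
  finally show "mcong q 2 (F * P + sub mT (F * P) + sub mT (sub mT (F * P))) (F * R)" .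
 qed
qed

lemma sub_sub_y: "mcong q 2 (sub mT (sub mT yv)) l2"
 using sub_mcong[OF sub_mpolys[OF yv_mpolys] lin3_mpolys sub_y] sub_l1 by (rule mcong_trans)

lemma trace_image_u: "trace_image uu"
proof (rule trace_imageI)
 show "yv^2 \<in> mpolys 2" by (intro mpolys_power yv_mpolys)
 show "mcong q 2 (yv^2 + sub mT (yv^2) + sub mT (sub mT (yv^2))) uu"
  unfolding uu_def mpoly_subst_power by (intro mcong_add mcong_power mcong_refl sub_y sub_sub_y)
qed

text \<open>The trace of \<open>y\<close> would vanish for the additive group; in
  \<open>y + l1 + l2\<close> everything is a multiple of 3 except one \<open>w2\<close>.\<close>

lemma trace_image_w2: "trace_image w2"
proof (rule trace_imageI[OF yv_mpolys])
 have "mcong q 2 (yv + sub mT yv + sub mT (sub mT yv)) (yv + l1 + l2)"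
  by (intro mcong_add mcong_refl sub_y sub_sub_y)
 also have "yv + l1 + l2 = 3 * (yv - w2) + w2" unfolding l1 l2 by simp
 also have "\<dots> = w2" by (simp only: three_0 mult_zero_left add_0_left)
 finally show "mcong q 2 (yv + sub mT yv + sub mT (sub mT yv)) w2" .
qed

lemma trace_image_uminus: assumes "trace_image R" shows "trace_image (- R)"
proof -
 have "trace_image (R - R)" by (rule trace_image_diff[OF assms assms])
 from trace_image_diff[OF this assms] show ?thesis by simp
qed

text \<open>The trace \<open>- x^(i - 2) uu\<close> equals \<open>x^i\<close> up to corrections
  whose lowest power of \<open>x\<close> is \<open>i - 1 + m\<close>, at least \<open>q = 3m\<close>
  for \<open>i > 2m\<close>.\<close>

lemma trace_image_x_high:
 assumes "i \<ge> 2 * m + 1" shows "trace_image (xv ^ i)"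
proof -
 define k where "k = i - 2"
 have i: "i = k + 2" using assms m3 by (simp add: k_def)
 have k: "2 * m \<le> k + 1" using assms i by simp
 have xi: "xv ^ i = xv ^ k * xv^2" unfolding i by (rule power_add)
 have u: "uu = w2 * (2 * w2 - yv) + (w1 * w1 * 2 - xv * w1) - xv^2" using u_approx by (simp only: eq_diff_eq)
 have t: "trace_image (xv ^ k * uu)" by (intro trace_image_mult fixT_power fixT_x trace_image_u)
 have ww: "xv ^ m dvd w1" "xv ^ m dvd w2" "xv ^ (2 * m) dvd w2" by (rule dvd_w; simp)+
 have "xv ^ q dvd xv ^ k * xv ^ (2 * m)" unfolding power_add[symmetric] using k m3 by (intro le_imp_power_dvd) (simp add: qm)
 then have a: "xv ^ q dvd xv ^ k * w2" by (rule dvd_trans[OF _ mult_dvd_mono[OF dvd_refl ww(3)]])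
 have "xv ^ q dvd xv ^ k * (xv ^ m * xv ^ m)" unfolding power_add[symmetric] using k m3 by (intro le_imp_power_dvd) (simp add: qm)
 then have b: "xv ^ q dvd xv ^ k * (w1 * w1)" by (rule dvd_trans[OF _ mult_dvd_mono[OF dvd_refl mult_dvd_mono[OF ww(1) ww(1)]]])
 have "xv ^ q dvd xv ^ k * (xv ^ 1 * xv ^ m)" unfolding power_add[symmetric] using k by (intro le_imp_power_dvd) (simp add: qm)
 then have c: "xv ^ q dvd xv ^ k * (xv * w1)" unfolding power_one_right by (rule dvd_trans[OF _ mult_dvd_mono[OF dvd_refl mult_dvd_mono[OF dvd_refl ww(1)]]])
 have e: "- (xv ^ k * uu) - xv ^ i = - (xv ^ k * w2 * (2 * w2 - yv) + (xv ^ k * (w1 * w1) * 2 - xv ^ k * (xv * w1)))"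
  unfolding xi u by (simp add: algebra_simps)
 have "xv ^ q dvd - (xv ^ k * uu) - xv ^ i" unfolding e dvd_minus_iff by (intro dvd_add dvd_diff dvd_mult2[OF a] dvd_mult2[OF b] c)
 then have "mcong q 2 (- (xv ^ k * uu)) (xv ^ i)" by (rule mcong_dvd)
 with trace_image_uminus[OF t] show ?thesis by (rule trace_image_cong)
qed

lemma q_Suc: "q = Suc (q - 1)" by (simp add: q)

text \<open>As \<open>zz\<close> has leading term \<open>y^3\<close> and \<open>m\<close> is
  divisible by 3, modulo \<open>x^q\<close> the element is an invariant times
  \<open>x^(q - 1)\<close>, which is a trace already.\<close>

lemma trace_image_y_square: "trace_image (xv ^ (q - 1) * (yv ^ m)^2)"
proof -
 have "3 dvd m" unfolding m using n by (intro dvd_power) simp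
 then obtain k where k: "m = 3 * k" by (rule dvdE)
 have "trace_image (zz ^ (2 * k) * xv ^ (q - 1))"
  using m3 by (intro trace_image_mult fixT_power fixT_z trace_image_x_high) (simp add: qm)
 moreover have "mcong q 2 (zz ^ (2 * k) * xv ^ (q - 1)) (xv ^ (q - 1) * (yv ^ m)^2)"
 proof (rule mcong_dvd)
  have "(yv ^ m)^2 = (yv ^ 3) ^ (2 * k)" unfolding power_mult[symmetric] by (simp add: k ac_simps)
  then have e: "zz ^ (2 * k) * xv ^ (q - 1) - xv ^ (q - 1) * (yv ^ m)^2 = xv ^ (q - 1) * (zz ^ (2 * k) - (yv ^ 3) ^ (2 * k))"
   by (simp add: algebra_simps)
  have "xv ^ (q - 1) * xv dvd xv ^ (q - 1) * (zz ^ (2 * k) - (yv ^ 3) ^ (2 * k))"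
   by (intro mult_dvd_mono dvd_refl dvd_diff_power x_dvd_z)
  then show "xv ^ q dvd zz ^ (2 * k) * xv ^ (q - 1) - xv ^ (q - 1) * (yv ^ m)^2"
   unfolding e power_Suc2[symmetric] q_Suc[symmetric] .
 qed
 ultimately show ?thesis by (rule trace_image_cong)
qed

text \<open>In the boundary case \<open>i = 2m\<close> one correction survives,
  \<open>x^(q - 1) y^(2m)\<close>; it is itself a trace by
  \<open>trace_image_y_square\<close>.\<close>

lemma trace_image_x:
 assumes "i \<ge> 2 * m" shows "trace_image (xv ^ i)"
proof (cases "i = 2 * m")
 case False
 then show ?thesis using assms by (intro trace_image_x_high) simp
next
 case True
 define k where "k = 2 * m - 2"
 have i: "i = k + 2" using True m3 by (simp add: k_def)
 have km: "k + 1 + m = q - 1" using m3 by (simp add: k_def qm)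
 have xi: "xv ^ i = xv ^ k * xv^2" unfolding i by (rule power_add)
 have u: "uu = w2 * (2 * w2 - yv) + (w1 * w1 * 2 - xv * w1) - xv^2" using u_approx by (simp only: eq_diff_eq)
 have t: "trace_image (xv ^ k * uu)" by (intro trace_image_mult fixT_power fixT_x trace_image_u)
 have "xv ^ m dvd w1" "xv ^ (2 * m) dvd w2" by (rule dvd_w; simp)+
 note ww = this
 have "xv ^ q dvd xv ^ k * xv ^ (2 * m)" unfolding power_add[symmetric] k_def using m3 by (intro le_imp_power_dvd) (simp add: qm)
 then have a: "xv ^ q dvd xv ^ k * w2" by (rule dvd_trans[OF _ mult_dvd_mono[OF dvd_refl ww(2)]])
 have "xv ^ q dvd xv ^ k * (xv ^ m * xv ^ m)" unfolding power_add[symmetric] k_def using m3 by (intro le_imp_power_dvd) (simp add: qm)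
 then have b: "xv ^ q dvd xv ^ k * (w1 * w1)" by (rule dvd_trans[OF _ mult_dvd_mono[OF dvd_refl mult_dvd_mono[OF ww(1) ww(1)]]])
 have c: "xv ^ k * (xv * w1) = xv ^ (q - 1) * (yv ^ m)^2"
  unfolding km[symmetric] by (simp add: power_add ac_simps)
 have e: "(- (xv ^ k * uu) - xv ^ (q - 1) * (yv ^ m)^2) - xv ^ i = - (xv ^ k * w2 * (2 * w2 - yv) + xv ^ k * (w1 * w1) * 2)"
  unfolding c[symmetric] xi u by (simp add: algebra_simps)
 have "xv ^ q dvd (- (xv ^ k * uu) - xv ^ (q - 1) * (yv ^ m)^2) - xv ^ i"
  unfolding e dvd_minus_iff by (intro dvd_add dvd_mult2[OF a] dvd_mult2[OF b])
 then have "mcong q 2 (- (xv ^ k * uu) - xv ^ (q - 1) * (yv ^ m)^2) (xv ^ i)" by (rule mcong_dvd)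
 with trace_image_diff[OF trace_image_uminus[OF t] trace_image_y_square] show ?thesis by (rule trace_image_cong)
qed

text \<open>Multiplying \<open>z\<^sup>r \<equiv> y\<^sup>3\<^sup>r - x\<^sup>2\<^sup>r y\<^sup>r\<close>, for \<open>r\<close> a power of 3, by a power of \<open>x\<close> lowers the exponent of \<open>y\<close>.\<close>

lemma trace_image_descend:
 assumes "i \<ge> 2 * m" and r: "r = 3 ^ k" and t: "trace_image (xv ^ i * yv ^ (3 * r))"
 shows "trace_image (xv ^ (i + 2 * r) * yv ^ r)"
proof -
 have "trace_image (zz ^ r * xv ^ i)" using assms by (intro trace_image_mult fixT_power fixT_z trace_image_x)
 from trace_image_diff[OF t this] show ?thesis
 proof (rule trace_image_cong)
  have fr: "(P + Q) ^ r = P ^ r + Q ^ r" for P Q :: "'p mod_ring mpoly"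
   using frobenius_add[of P Q k] by (simp add: r p3)
  have "odd r" by (simp add: r)
  then have h: "(yv ^ 3 - xv^2 * yv) ^ r = yv ^ (3 * r) - xv ^ (2 * r) * yv ^ r"
   using fr[of "yv ^ 3" "- (xv^2 * yv)"] by (simp add: power_mult power_mult_distrib)
  have e: "xv ^ i * yv ^ (3 * r) - zz ^ r * xv ^ i - xv ^ (i + 2 * r) * yv ^ r =
    - (xv ^ i * (zz ^ r - (yv ^ 3 - xv^2 * yv) ^ r))"
   unfolding h by (simp add: algebra_simps power_add)
  have d1: "xv ^ i * xv ^ m dvd xv ^ i * (zz ^ r - (yv ^ 3 - xv^2 * yv) ^ r)"
   by (rule mult_dvd_mono[OF dvd_refl dvd_diff_power[OF z_approx]])
  have d2: "xv ^ q dvd xv ^ i * xv ^ m"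
   unfolding power_add[symmetric] using assms(1) by (intro le_imp_power_dvd) (simp add: qm)
  have "xv ^ q dvd xv ^ i * yv ^ (3 * r) - zz ^ r * xv ^ i - xv ^ (i + 2 * r) * yv ^ r"
   unfolding e dvd_minus_iff by (rule dvd_trans[OF d2 d1])
  then show "mcong q 2 (xv ^ i * yv ^ (3 * r) - zz ^ r * xv ^ i) (xv ^ (i + 2 * r) * yv ^ r)" by (rule mcong_dvd)
 qed
qed

text \<open>The trace of \<open>y\<close> is \<open>x^(q - m) y^m\<close>; \<open>n - 1\<close>
  descents lower the exponent of \<open>y\<close> to 1 while keeping the form
  \<open>x^(q - r) y^r\<close>.\<close>

lemma trace_image_y: "trace_image (xv ^ (q - 1) * yv)"
proof -
 have "trace_image (xv ^ (q - 3 ^ k) * yv ^ (3 ^ k))" if "k \<le> n - 1" for k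
  using that
 proof (induction k rule: inc_induct)
  case base
  have "q - m = 2 * m" by (simp add: qm)
  then have "xv ^ (q - 3 ^ (n - 1)) * yv ^ 3 ^ (n - 1) = w2"
   unfolding m[symmetric] by (simp only: mult.commute[of 2 m] power_mult)
  then show ?case using trace_image_w2 by (simp only:)
 next
  case (step k)
  have le: "3 * 3 ^ k \<le> m"
  proof -
   have "Suc k \<le> n - 1" using step by simp
   then have "(3::nat) ^ Suc k \<le> 3 ^ (n - 1)" by (intro power_increasing) simp_all
   then show ?thesis by (simp add: m)
  qed
  have "trace_image (xv ^ (q - 3 ^ Suc k) * yv ^ (3 * 3 ^ k))" using step.IH by simp
  from trace_image_descend[OF _ refl this] have "trace_image (xv ^ (q - 3 ^ Suc k + 2 * 3 ^ k) * yv ^ (3 ^ k))"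
   using le by (simp add: qm)
  moreover have "q - 3 ^ Suc k + 2 * 3 ^ k = q - 3 ^ k" using le by (simp add: qm)
  ultimately show ?case by simp
 qed
 from this[of 0] show ?thesis by simp
qed

lemma trace_image_family:
 assumes "j mod 3 = 0 \<or> i = q - 1 & j mod 3 = 1"
 shows "trace_image (trace_family i j)"
proof (cases "j mod 3 = 0")
 case True
 have "trace_image (xv ^ (i - 2) * (zz ^ (j div 3) * uu))"
  by (intro trace_image_mult fixT_power fixT_x fixT_z trace_image_u)
 from trace_image_uminus[OF this] show ?thesis using True by (simp add: trace_family_def)
next
 case False
 then have "trace_family i j = zz ^ (j div 3) * (xv ^ (q - 1) * yv)" using assms by (simp add: trace_family_def ac_simps)
 then show ?thesis by (simp only:) (intro trace_image_mult fixT_power fixT_z trace_image_y)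
qed

text \<open>Behaviour under \<open>x \<mapsto> - x\<close>, \<open>y \<mapsto> - y\<close>, which
  decides between \<open>plus3\<close> and \<open>minus3\<close>.\<close>

definition parity where "parity k P \<longleftrightarrow> mpoly_subst (%j. - pvar j) P = (- 1) ^ k * (P :: 'p mod_ring mpoly)"

lemma parity_mult: "parity k P ==> parity l Q ==> parity (k + l) (P * Q)"
 unfolding parity_def mpoly_subst_mult by (simp add: power_add ac_simps)

lemma parity_power: "parity k P ==> parity (k * r) (P ^ r)"
 unfolding parity_def mpoly_subst_power by (simp add: power_mult_distrib power_mult)

lemma parity_x: "parity 1 xv" and parity_y: "parity 1 yv"
 by (simp_all add: parity_def)

lemma parity_lin3: "parity 1 (lin3 s)"
 unfolding parity_def lin3_def mpoly_subst_diff mpoly_subst_add mpoly_subst_mult mpoly_subst_power mpoly_subst_const mpoly_subst_pvar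
 using odd_m by simp

lemma parity_z: "parity 3 zz"
 using parity_mult[OF parity_y parity_mult[OF parity_lin3[of "(1, 1)"] parity_lin3[of "(- 1, 1)"]]]
 unfolding zz_def by (simp add: numeral_3_eq_3)

lemma parity_u: "parity 2 uu"
 using parity_power[OF parity_y, of 2] parity_power[OF parity_lin3[of "(1, 1)"], of 2] parity_power[OF parity_lin3[of "(- 1, 1)"], of 2]
 unfolding uu_def parity_def mpoly_subst_add by simp

lemma parity_fixed_family: "parity (i + j) (fixed_family i j)"
proof -
 have "parity (1 * i + (1 * (j mod 3) + 3 * (j div 3))) (fixed_family i j)"
  unfolding fixed_family_def by (intro parity_mult parity_power parity_x parity_y parity_z)
 then show ?thesis by simp
qed

lemma parity_trace_family:
 assumes "j mod 3 = 0 & 2 \<le> i \<or> j mod 3 = 1" shows "parity (i + j) (trace_family i j)"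
proof (cases "j mod 3 = 0")
 case True
 have p: "parity (1 * (i - 2) + (3 * (j div 3) + 2)) (xv ^ (i - 2) * (zz ^ (j div 3) * uu))"
  by (intro parity_mult parity_power parity_x parity_u parity_z)
 have "2 \<le> i" using assms True by simp
 moreover have "3 * (j div 3) = j" using True by auto
 ultimately have "1 * (i - 2) + (3 * (j div 3) + 2) = i + j" by simp
 with p have "parity (i + j) (xv ^ (i - 2) * (zz ^ (j div 3) * uu))" by simp
 then show ?thesis using True by (simp add: trace_family_def parity_def mpoly_subst_uminus)
next
 case False
 then have "trace_family i j = fixed_family i j" using assms by (simp add: trace_family_def fixed_family_def)
 then show ?thesis using parity_fixed_family by simp
qed

lemma lookup_parity:
 assumes "P \<in> mpolys 2" "parity k P" "odd (i + j + k)"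
 shows "mcoeff P (mono2 i j) = 0"
proof -
 have c: "(- 1) ^ k = cst ((- 1) ^ k)" by (simp add: mpoly_const_power cst_uminus)
 define L where "L = mcoeff P (mono2 i j)"
 have "mcoeff (mpoly_subst (%j. - pvar j) P) (mono2 i j) = mcoeff (cst ((- 1) ^ k) * P) (mono2 i j)"
  using assms(2) unfolding parity_def c by (rule arg_cong)
 then have e: "(- 1) ^ (i + j) * L = (- 1) ^ k * L"
  unfolding lookup_subst_uminus[OF assms(1)] lookup_const_mult L_def .
 have "L = - L"
 proof (cases "even k")
  case True
  then have k: "(- 1) ^ k = (1 :: 'p mod_ring)" "(- 1) ^ (i + j) = (- 1 :: 'p mod_ring)" using assms(3) by simp_all
  have "- L = L" using e by (simp only: k mult_minus_left mult_1_left)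
  then show ?thesis by (rule sym)
 next
  case False
  then have k: "(- 1) ^ k = (- 1 :: 'p mod_ring)" "(- 1) ^ (i + j) = (1 :: 'p mod_ring)" using assms(3) by simp_all
  show ?thesis using e by (simp only: k mult_minus_left mult_1_left)
 qed
 then show ?thesis unfolding L_def by (rule scalar_neg)
qed

lemma parity_parts:
 assumes "P \<in> mpolys 2" "parity k P"
 shows "even k ==> trunc q 2 P \<in> plus3" "odd k ==> trunc q 2 P \<in> minus3"
 using lookup_parity[OF assms] by (auto simp: plus3_iff minus3_iff trunc_M3 lookup_truncate mono2_mem_box)

lemma closed_parts: "closed3 plus3" "closed3 minus3"
 unfolding closed3_def by (auto simp: plus3_iff minus3_iff M3_0 M3_add M3_const lookup_add lookup_const_mult)

lemma finite_parts: "finite plus3" "finite minus3"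
 by (rule finite_subset[OF _ finite_M3]; auto simp: plus3_iff minus3_iff)+

lemma family_mpolys: "fixed_family i j \<in> mpolys 2" "trace_family i j \<in> mpolys 2"
proof -
 show "fixed_family i j \<in> mpolys 2"
  unfolding fixed_family_def by (intro mpolys_mult mpolys_power xv_mpolys yv_mpolys zz_mpolys)
 show "trace_family i j \<in> mpolys 2"
  unfolding trace_family_def
  by (split if_split, intro conjI impI) (intro mpolys_uminus mpolys_mult mpolys_power xv_mpolys yv_mpolys zz_mpolys uu_mpolys)+
qed

lemma rho_0: "rho A 0 = 0"
 by (rule poly_mapping_eqI) (simp add: rho_def lookup_truncate)

text \<open>\<open>e\<close> is the parity condition that matches \<open>H\<close>. A lower bound is
  enough, since \<open>module_generators\<close> deduces the exact structure from the total
  size.\<close>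

lemma card_fixed:
 assumes H: "closed3 H" "finite H"
  and P: "!!P i j. P \<in> mpolys 2 ==> parity (i + j) P ==> e i j ==> trunc q 2 P \<in> H"
 shows "3 ^ card {(i, j). i < q & j < q & e i j & (j mod 3 = 0 \<or> i = q - 1)} \<le> card {P \<in> H. rho mT P = P}"
proof (rule card_triangular[where g = fixed_family])
 show "finite {P \<in> H. rho mT P = P}" using H(2) by simp
 show "closed3 {P \<in> H. rho mT P = P}" using H(1) by (auto simp: closed3_def rho_add rho_const rho_0)
 fix i j assume ij: "(i, j) \<in> {(i, j). i < q & j < q & e i j & (j mod 3 = 0 \<or> i = q - 1)}"
 show "leads i j (fixed_family i j)" by (rule leads_fixed)
 have f: "fixT (fixed_family i j)" using ij by (intro fixT_family) simp
 have "mcong q 2 (sub mT (trunc q 2 (fixed_family i j))) (sub mT (fixed_family i j))"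
  by (intro sub_mcong mpolys_truncate family_mpolys mcong_trunc)
 also have "mcong q 2 \<dots> (fixed_family i j)" using f by (simp add: fixT_def)
 finally have "rho mT (trunc q 2 (fixed_family i j)) = trunc q 2 (fixed_family i j)"
  unfolding rho_def mcong_iff_trunc .
 moreover have "trunc q 2 (fixed_family i j) \<in> H"
  using ij by (intro P[OF family_mpolys(1) parity_fixed_family]) simp
 ultimately show "trunc q 2 (fixed_family i j) \<in> {P \<in> H. rho mT P = P}" by simp
qed auto

text \<open>By the condition \<open>tr\<close>, supplied by \<open>trace_parts\<close>, a trace that
  lies in \<open>H\<close> is the trace of an element of \<open>H\<close>.\<close>

lemma card_trace:
 assumes H: "closed3 H" "finite H"
  and P: "!!P i j. P \<in> mpolys 2 ==> parity (i + j) P ==> e i j ==> trunc q 2 P \<in> H"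
  and tr: "!!w. w \<in> M3 ==> w + rho mT w + rho mT (rho mT w) \<in> H ==>
   w + rho mT w + rho mT (rho mT w) \<in> (%x. x + rho mT x + rho mT (rho mT x)) ` H"
 shows "3 ^ card {(i, j). i < q & j < q & e i j & (j mod 3 = 0 & 2 \<le> i \<or> i = q - 1 & j mod 3 = 1)}
  \<le> card ((%x. x + rho mT x + rho mT (rho mT x)) ` H)"
proof (rule card_triangular[where g = trace_family])
 let ?t = "%x. x + rho mT x + rho mT (rho mT x)"
 show "finite (?t ` H)" using H(2) by simp
 show "closed3 (?t ` H)"
  unfolding closed3_def
 proof (intro conjI ballI allI)
  show "0 \<in> ?t ` H" using H(1) by (intro image_eqI[of _ _ 0]) (simp_all add: rho_0 closed3_def)
  fix y assume "y \<in> ?t ` H"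
  then obtain x where x: "x \<in> H" "y = ?t x" by blast
  show "cst c * y \<in> ?t ` H" for c
   using H(1) x by (intro image_eqI[of _ _ "cst c * x"]) (simp_all add: rho_const closed3_def distrib_left)
  fix y' assume "y' \<in> ?t ` H"
  then obtain x' where x': "x' \<in> H" "y' = ?t x'" by blast
  show "y + y' \<in> ?t ` H"
   using H(1) x x' by (intro image_eqI[of _ _ "x + x'"]) (simp_all add: rho_add closed3_def add_ac)
 qed
 fix i j assume ij: "(i, j) \<in> {(i, j). i < q & j < q & e i j & (j mod 3 = 0 & 2 \<le> i \<or> i = q - 1 & j mod 3 = 1)}"
 let ?f = "trace_family i j"
 show "leads i j ?f" using ij by (intro leads_trace) auto
 have "trace_image ?f" using ij by (intro trace_image_family) auto
 then obtain Q where Q: "Q \<in> mpolys 2" "mcong q 2 (Q + sub mT Q + sub mT (sub mT Q)) ?f" unfolding trace_image_def by blast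
 define w where "w = trunc q 2 Q"
 have w: "w \<in> M3" unfolding w_def by (rule trunc_M3)
 have wQ: "mcong q 2 w Q" unfolding w_def by (rule mcong_trunc)
 have 1: "mcong q 2 (rho mT w) (sub mT Q)"
  using rho_mcong sub_mcong[OF M3_mpolys[OF w] Q(1) wQ] by (rule mcong_trans)
 have 2: "mcong q 2 (rho mT (rho mT w)) (sub mT (sub mT Q))"
  using rho_mcong sub_mcong[OF M3_mpolys[OF rho_M3] sub_mpolys[OF Q(1)] 1] by (rule mcong_trans)
 have "mcong q 2 (?t w) (Q + sub mT Q + sub mT (sub mT Q))" by (intro mcong_add wQ 1 2)
 also have "mcong q 2 \<dots> ?f" by (rule Q(2))
 also have "mcong q 2 ?f (trunc q 2 ?f)" by (rule mcong_sym[OF mcong_trunc])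
 finally have "?t w = trunc q 2 ?f"
  by (intro mcong_box_polys[of _ q 2] trunc_M3 M3_add w rho_M3)
 moreover have "trunc q 2 ?f \<in> H"
  using ij by (intro P[OF family_mpolys(2) parity_trace_family]) auto
 ultimately show "trunc q 2 ?f \<in> ?t ` H" using tr[OF w] by simp
qed auto

text \<open>The two pairs satisfy \<open>1 + 8 * a + 24 * N = q ^ 2\<close>, and the counted
  exponents agree exactly with those required by \<open>module_generators\<close>.\<close>

lemma module_generators3:
 fixes a N :: nat
 assumes "n = 2 & a = 4 & N = 2 \<or> n = 3 & a = 13 & N = 26"
 obtains m0 t s where "m0 \<in> M3" "rho mT m0 = m0" "rho mI m0 = m0"
  "!!r. r < a ==> t r \<in> M3 & rho mT (t r) = t r" "!!j. j < N ==> s j \<in> M3"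
  "!!W. (!!x y. x \<in> W ==> y \<in> W ==> x + y \<in> W) ==> 0 \<in> W ==>
   (!!x. x \<in> W ==> rho mT x \<in> W) ==> (!!x. x \<in> W ==> rho mI x \<in> W) ==> (!!x. x \<in> W ==> rho mJ x \<in> W) ==>
   m0 \<in> W ==> (!!r. r < a ==> t r \<in> W) ==> (!!j. j < N ==> s j \<in> W) ==> M3 \<subseteq> W"
proof -
 let ?t = "%x. x + rho mT x + rho mT (rho mT x)"
 have f1: "3 ^ card {(i, j). i < q & j < q & even (i + j) & (j mod 3 = 0 \<or> i = q - 1)} \<le> card {P \<in> plus3. rho mT P = P}"
  by (rule card_fixed[OF closed_parts(1) finite_parts(1)]) (rule parity_parts)
 have f2: "3 ^ card {(i, j). i < q & j < q & odd (i + j) & (j mod 3 = 0 \<or> i = q - 1)} \<le> card {P \<in> minus3. rho mT P = P}"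
  by (rule card_fixed[OF closed_parts(2) finite_parts(2)]) (rule parity_parts)
 have t1: "3 ^ card {(i, j). i < q & j < q & even (i + j) & (j mod 3 = 0 & 2 \<le> i \<or> i = q - 1 & j mod 3 = 1)} \<le> card (?t ` plus3)"
  by (rule card_trace[OF closed_parts(1) finite_parts(1)]) (rule parity_parts, assumption+, rule sl23_module.trace_parts[OF sl23 _ refl])
 have t2: "3 ^ card {(i, j). i < q & j < q & odd (i + j) & (j mod 3 = 0 & 2 \<le> i \<or> i = q - 1 & j mod 3 = 1)} \<le> card (?t ` minus3)"
  by (rule card_trace[OF closed_parts(2) finite_parts(2)]) (rule parity_parts, assumption+, rule sl23_module.trace_parts[OF sl23 _ refl])
 note c = card_plus3 card_minus3 f1 t1 f2 t2 card_I_minus3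
 from assms have h: "card plus3 = 3 ^ (1 + 4 * a + 12 * N) & card minus3 = 3 ^ (4 * a + 12 * N)
  & 3 ^ ((1 + a + N) + (a + 3 * N)) \<le> card {P \<in> plus3. rho mT P = P} & 3 ^ (N + (a + 3 * N)) \<le> card (?t ` plus3)
  & 3 ^ (2 * a + 4 * N) \<le> card {P \<in> minus3. rho mT P = P} & 3 ^ (a + 4 * N) \<le> card (?t ` minus3)
  & card {P \<in> plus3. rho mI P = - P} = 3 ^ (2 * (a + 3 * N))"
 proof
  assume h: "n = 2 & a = 4 & N = 2"
  have q9: "q = 9" "q - 1 = 8" using h by (simp_all add: q)
  have k: "card {(i, j). i < q & j < q & even (i + j)} = 41"
   "card {(i, j). i < q & j < q & odd (i + j)} = 40"
   "card {(i, j). i < q & j < q & even (i + j) & (j mod 3 = 0 \<or> i = q - 1)} = 17"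
   "card {(i, j). i < q & j < q & even (i + j) & (j mod 3 = 0 & 2 \<le> i \<or> i = q - 1 & j mod 3 = 1)} = 12"
   "card {(i, j). i < q & j < q & odd (i + j) & (j mod 3 = 0 \<or> i = q - 1)} = 16"
   "card {(i, j). i < q & j < q & odd (i + j) & (j mod 3 = 0 & 2 \<le> i \<or> i = q - 1 & j mod 3 = 1)} = 12"
   "card {(i, j). i < q & j < q & even (i + j) & (i < j \<or> i = j & odd i)} = 20"
   unfolding q9(2) unfolding q9(1) using parity_pairs_9 card_even_half[of 9] odd_card_9_27 by simp_all
  have num: "1 + 4 * a + 12 * N = 41" "4 * a + 12 * N = 40" "(1 + a + N) + (a + 3 * N) = 17" "N + (a + 3 * N) = 12"
   "2 * a + 4 * N = 16" "a + 4 * N = 12" "2 * (a + 3 * N) = 20" using h by simp_all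
  show ?thesis unfolding num by (intro conjI c[unfolded k])
 next
  assume h: "n = 3 & a = 13 & N = 26"
  have q27: "q = 27" "q - 1 = 26" using h by (simp_all add: q)
  have k: "card {(i, j). i < q & j < q & even (i + j)} = 365"
   "card {(i, j). i < q & j < q & odd (i + j)} = 364"
   "card {(i, j). i < q & j < q & even (i + j) & (j mod 3 = 0 \<or> i = q - 1)} = 131"
   "card {(i, j). i < q & j < q & even (i + j) & (j mod 3 = 0 & 2 \<le> i \<or> i = q - 1 & j mod 3 = 1)} = 117"
   "card {(i, j). i < q & j < q & odd (i + j) & (j mod 3 = 0 \<or> i = q - 1)} = 130"
   "card {(i, j). i < q & j < q & odd (i + j) & (j mod 3 = 0 & 2 \<le> i \<or> i = q - 1 & j mod 3 = 1)} = 117"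
   "card {(i, j). i < q & j < q & even (i + j) & (i < j \<or> i = j & odd i)} = 182"
   unfolding q27(2) unfolding q27(1) using parity_pairs_27 card_even_half[of 27] odd_card_9_27 by simp_all
  have num: "1 + 4 * a + 12 * N = 365" "4 * a + 12 * N = 364" "(1 + a + N) + (a + 3 * N) = 131" "N + (a + 3 * N) = 117"
   "2 * a + 4 * N = 130" "a + 4 * N = 117" "2 * (a + 3 * N) = 182" using h by simp_all
  show ?thesis unfolding num by (intro conjI c[unfolded k])
 qed
 show ?thesis
 proof (rule sl23_module.module_generators[OF sl23, of a N])
  show "card plus3 = 3 ^ (1 + 4 * a + 12 * N)" "card minus3 = 3 ^ (4 * a + 12 * N)"
   "3 ^ ((1 + a + N) + (a + 3 * N)) \<le> card {P \<in> plus3. rho mT P = P}" "3 ^ (N + (a + 3 * N)) \<le> card (?t ` plus3)"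
   "3 ^ (2 * a + 4 * N) \<le> card {P \<in> minus3. rho mT P = P}" "3 ^ (a + 4 * N) \<le> card (?t ` minus3)"
   "card {P \<in> plus3. rho mI P = - P} = 3 ^ (2 * (a + 3 * N))"
   using h by blast+
 next
  fix m0 t s assume g: "m0 \<in> M3" "rho mT m0 = m0" "rho mI m0 = m0" "rho mJ m0 = m0"
   "!!r. r < a ==> t r \<in> M3 & rho mT (t r) = t r" "!!j. j < N ==> s j \<in> M3"
   "!!W. (!!x y. x \<in> W ==> y \<in> W ==> x + y \<in> W) ==> 0 \<in> W ==>
    (!!x. x \<in> W ==> rho mT x \<in> W) ==> (!!x. x \<in> W ==> rho mI x \<in> W) ==> (!!x. x \<in> W ==> rho mJ x \<in> W) ==>
    m0 \<in> W ==> (!!r. r < a ==> t r \<in> W) ==> (!!j. j < N ==> s j \<in> W) ==> M3 \<subseteq> W"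
  show thesis by (rule that[of m0 t s]) (fact g)+
 qed
qed

end

section \<open>Orbits of SL(2,3) on pairs of rows\<close>

lemma isomorphic_modules_subset:
 "isomorphic_modules G M actM N actN ==> H \<subseteq> G ==> isomorphic_modules H M actM N actN"
 unfolding isomorphic_modules_def by blast

lemma det_2:
 assumes "(A :: 'a::field mat) \<in> carrier_mat 2 2"
 shows "det A = A $$ (0, 0) * A $$ (1, 1) - A $$ (0, 1) * A $$ (1, 0)"
proof -
 have s: "(\<Sum>j<2. f j) = f 0 + f (1::nat)" for f :: "nat => 'a" by (simp add: numeral_2_eq_2)
 have d: "det (mat_delete A 0 0) = A $$ (1, 1)" "det (mat_delete A 0 1) = A $$ (1, 0)"
  using assms mat_delete_carrier[OF assms, of 0 0] mat_delete_carrier[OF assms, of 0 1]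
  by (auto simp: det_single mat_delete_def)
 have "det A = (\<Sum>j<2. A $$ (0, j) * cofactor A 0 j)" by (rule laplace_expansion_row[OF assms]) simp
 then show ?thesis unfolding s cofactor_def d by simp
qed

context rank2_prime3
begin

abbreviation (input) "K \<equiv> carrier_mat 2 n :: 'p mod_ring mat set"

text \<open>The determinant is spelled out, so that membership of explicit matrices is a matter of
  rewriting.\<close>

definition sl2 :: "'p mod_ring mat set" where
 "sl2 = {A \<in> carrier_mat 2 2. A $$ (0, 0) * A $$ (1, 1) - A $$ (0, 1) * A $$ (1, 0) = 1}"

lemma SL_sl2: "(SL 2 :: 'p mod_ring mat set) \<subseteq> sl2"
proof
 fix A :: "'p mod_ring mat" assume "A \<in> SL 2"
 then have "A \<in> carrier_mat 2 2" "det A = 1" by (auto simp: SL_def GL_def)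
 then show "A \<in> sl2" using det_2[of A] by (simp add: sl2_def)
qed

lemma sl2_carrier: "A \<in> sl2 ==> A \<in> carrier_mat 2 2"
 by (simp add: sl2_def)

lemma mat2_sl2: "mat2 a b c d \<in> sl2 \<longleftrightarrow> a * d - b * c = 1"
 unfolding sl2_def mem_Collect_eq mat2_index by simp

lemma sl2_E:
 assumes "A \<in> sl2"
 obtains a b c d where "A = mat2 a b c d" "a * d - b * c = 1"
 by (rule that[OF mat2_cases[OF sl2_carrier[OF assms]]]) (use assms in \<open>simp add: sl2_def\<close>)

lemma sl2_mult:
 assumes "A \<in> sl2" "B \<in> sl2" shows "A * B \<in> sl2"
proof -
 obtain a b c d where A: "A = mat2 a b c d" "a * d - b * c = 1" using assms(1) by (rule sl2_E)
 obtain a' b' c' d' where B: "B = mat2 a' b' c' d'" "a' * d' - b' * c' = 1" using assms(2) by (rule sl2_E)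
 have "(a * a' + b * c') * (c * b' + d * d') - (a * b' + b * d') * (c * a' + d * c') = (a * d - b * c) * (a' * d' - b' * c')"
  by (simp add: algebra_simps)
 then show ?thesis unfolding A(1) B(1) mat2_mult mat2_sl2 A(2) B(2) by simp
qed

lemma sl2_inverse:
 assumes "A \<in> sl2"
 obtains B where "B \<in> sl2" "B * A = 1\<^sub>m 2" "A * B = 1\<^sub>m 2"
proof -
 obtain a b c d where A: "A = mat2 a b c d" "a * d - b * c = 1" using assms by (rule sl2_E)
 show ?thesis
 proof (rule that[of "mat2 d (- b) (- c) a"])
  show "mat2 d (- b) (- c) a \<in> sl2" unfolding mat2_sl2 using A(2) by (simp add: mult.commute)
  have e: "d * a + - b * c = 1" "d * b + - b * d = 0" "- c * a + a * c = 0" "- c * b + a * d = 1"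
   "a * d + b * - c = 1" "a * - b + b * a = 0" "c * d + d * - c = 0" "c * - b + d * a = 1"
   using A(2) by (simp_all add: mult.commute)
  show "mat2 d (- b) (- c) a * A = 1\<^sub>m 2" "A * mat2 d (- b) (- c) a = 1\<^sub>m 2"
   unfolding A(1) one_mat2 mat2_mult e by (rule refl)+
 qed
qed

lemma sl2_generators: "mT \<in> sl2" "mI \<in> sl2" "mJ \<in> sl2"
 unfolding mat2_sl2 by (simp_all add: two_m1)

lemma rho_fixed_mult:
 assumes "v \<in> M3" "A \<in> carrier_mat 2 2" "B \<in> carrier_mat 2 2" "rho A v = v" "rho B v = v"
 shows "rho (A * B) v = v"
 using rho_rho[OF assms(2,3) M3_mpolys[OF assms(1)]] assms(4,5) by simp

lemma rho_unipotent:
 assumes v: "v \<in> M3" and T: "rho mT v = v"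
 shows "rho (mat2 1 \<alpha> 0 1) v = v"
proof -
 consider "\<alpha> = 0" | "\<alpha> = 1" | "\<alpha> = - 1" using scalar_cases by blast
 then show ?thesis
 proof cases
  case 1 then show ?thesis using rho_one[OF v] by (simp add: one_mat2)
 next
  case 2 then show ?thesis using T by simp
 next
  case 3
  have "mT * mT = mat2 1 \<alpha> 0 1" unfolding mat2_mult 3 by (simp add: two_m1)
  then show ?thesis using rho_fixed_mult[OF v mat2_carrier mat2_carrier T T] by simp
 qed
qed

text \<open>Bruhat decomposition by the lower left entry: every matrix of determinant 1 is a product
  of upper unipotent matrices and powers of \<open>mI\<close>.\<close>

lemma rho_fixed_sl2:
 assumes v: "v \<in> M3" and T: "rho mT v = v" and I: "rho mI v = v" and A: "A \<in> sl2"
 shows "rho A v = v"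
proof -
 note U = rho_unipotent[OF v T]
 note fm = rho_fixed_mult[OF v]
 have II: "rho (mI * mI) v = v" by (rule fm[OF mat2_carrier mat2_carrier I I])
 have III: "rho (mI * (mI * mI)) v = v"
  by (rule fm[OF mat2_carrier mult_carrier_mat[OF mat2_carrier mat2_carrier] I II])
 obtain a b c d where abcd: "A = mat2 a b c d" "a * d - b * c = 1" using A by (rule sl2_E)
 consider "c = 0" | "c = 1" | "c = - 1" using scalar_cases by blast
 then show ?thesis
 proof cases
  case 1
  have "a \<noteq> 0" using abcd 1 by auto
  then consider "a = 1" | "a = - 1" using scalar_cases by blast
  then show ?thesis
  proof cases
   case 1
   then have "d = 1" using abcd \<open>c = 0\<close> by simp
   then show ?thesis using U[of b] abcd 1 \<open>c = 0\<close> by simp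
  next
   case 2
   then have "- d = 1" using abcd \<open>c = 0\<close> by simp
   then have d: "d = - 1" by (metis minus_minus)
   have "(mI * mI) * mat2 1 (- b) 0 1 = A" unfolding abcd(1) mat2_mult 2 d \<open>c = 0\<close> by simp
   then show ?thesis using fm[OF mult_carrier_mat[OF mat2_carrier mat2_carrier] mat2_carrier II U[of "- b"]] by simp
  qed
 next
  case 2
  have b: "b = a * d - 1" using abcd(2) 2 by (simp add: algebra_simps)
  have prod: "mat2 1 a 0 1 * ((mI * (mI * mI)) * mat2 1 d 0 1) = A"
   unfolding abcd(1) mat2_mult 2 b by (simp add: algebra_simps)
  have "rho ((mI * (mI * mI)) * mat2 1 d 0 1) v = v"
   by (rule fm[OF mult_carrier_mat[OF mat2_carrier mult_carrier_mat[OF mat2_carrier mat2_carrier]] mat2_carrier III U])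
  from fm[OF mat2_carrier mult_carrier_mat[OF mult_carrier_mat[OF mat2_carrier mult_carrier_mat[OF mat2_carrier mat2_carrier]] mat2_carrier] U[of a] this]
  show ?thesis unfolding prod .
 next
  case 3
  have b: "b = 1 - a * d" using abcd(2) 3 by (simp add: algebra_simps)
  have prod: "mat2 1 (- a) 0 1 * (mI * mat2 1 (- d) 0 1) = A"
   unfolding abcd(1) mat2_mult 3 b by (simp add: algebra_simps)
  have "rho (mI * mat2 1 (- d) 0 1) v = v" by (rule fm[OF mat2_carrier mat2_carrier I U])
  from fm[OF mat2_carrier mult_carrier_mat[OF mat2_carrier mat2_carrier] U[of "- a"] this]
  show ?thesis unfolding prod .
 qed
qed

text \<open>On each orbit the value is transported from its representative: \<open>orbits\<close>
  makes the representative unique, and \<open>stab\<close> makes the result independent of the group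
  element. Orbits that miss \<open>S\<close> are sent to 0.\<close>

lemma equivariant_extension:
 assumes S: "S \<subseteq> K" and v: "!!\<Phi>. \<Phi> \<in> S ==> v \<Phi> \<in> M3"
  and orbits: "!!A \<Phi> \<Psi>. A \<in> sl2 ==> \<Phi> \<in> S ==> \<Psi> \<in> S ==> A * \<Phi> = \<Psi> ==> \<Phi> = \<Psi>"
  and stab: "!!A \<Phi>. A \<in> sl2 ==> \<Phi> \<in> S ==> A * \<Phi> = \<Phi> ==> rho A (v \<Phi>) = v \<Phi>"
 obtains f where "!!\<Phi>. f \<Phi> \<in> M3" "!!A \<Phi>. A \<in> sl2 ==> \<Phi> \<in> K ==> rho A (f \<Phi>) = f (A * \<Phi>)"
  "!!\<Phi>. \<Phi> \<in> S ==> f \<Phi> = v \<Phi>"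
proof -
 define R where "R \<Phi> p \<longleftrightarrow> fst p \<in> sl2 & snd p \<in> S & \<Phi> = fst p * snd p" for \<Phi> p
 define f where "f \<Phi> = (if \<exists>p. R \<Phi> p then rho (fst (SOME p. R \<Phi> p)) (v (snd (SOME p. R \<Phi> p))) else 0)" for \<Phi>
 have assoc: "A * (B * \<Phi>) = (A * B) * \<Phi>" if "A \<in> sl2" "B \<in> sl2" "\<Phi> \<in> K" for A B \<Phi>
  using assoc_mult_mat[OF sl2_carrier[OF that(1)] sl2_carrier[OF that(2)] that(3)] by simp
 \<comment> \<open>The pair picked by the choice operator may differ from
   \<open>(A, \<Psi>)\<close>; \<open>C * B\<close> carries its representative to
   \<open>\<Psi>\<close>, so both coincide and \<open>C * B\<close> stabilizes
   \<open>\<Psi>\<close>.\<close>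
 have f: "f \<Phi> = rho A (v \<Psi>)" if A: "A \<in> sl2" and \<Psi>: "\<Psi> \<in> S" and e: "\<Phi> = A * \<Psi>" for A \<Psi> \<Phi>
 proof -
  have "R \<Phi> (A, \<Psi>)" using that by (simp add: R_def)
  then have ex: "\<exists>p. R \<Phi> p" by blast
  define B \<Psi>' where "B = fst (SOME p. R \<Phi> p)" and "\<Psi>' = snd (SOME p. R \<Phi> p)"
  have "R \<Phi> (SOME p. R \<Phi> p)" using someI_ex[OF ex] .
  then have B: "B \<in> sl2" "\<Psi>' \<in> S" "\<Phi> = B * \<Psi>'" by (simp_all add: R_def B_def \<Psi>'_def)
  obtain C where C: "C \<in> sl2" "C * A = 1\<^sub>m 2" "A * C = 1\<^sub>m 2" using A by (rule sl2_inverse)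
  have \<Psi>K: "\<Psi> \<in> K" "\<Psi>' \<in> K" using \<Psi> B(2) S by auto
  have CB: "C * B \<in> sl2" by (rule sl2_mult[OF C(1) B(1)])
  have "(C * B) * \<Psi>' = C * (A * \<Psi>)" using assoc[OF C(1) B(1) \<Psi>K(2)] B(3) e by simp
  also have "\<dots> = \<Psi>" using assoc[OF C(1) A \<Psi>K(1)] C(2) \<Psi>K(1) by simp
  finally have 1: "(C * B) * \<Psi>' = \<Psi>" .
  have eq: "\<Psi>' = \<Psi>" by (rule orbits[OF CB B(2) \<Psi> 1])
  have st: "rho (C * B) (v \<Psi>) = v \<Psi>" using stab[OF CB \<Psi>] 1 eq by simp
  have ACB: "A * (C * B) = B"
   using assoc_mult_mat[OF sl2_carrier[OF A] sl2_carrier[OF C(1)] sl2_carrier[OF B(1)]] C(3) sl2_carrier[OF B(1)] by simp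
  have "rho A (v \<Psi>) = rho A (rho (C * B) (v \<Psi>))" by (simp only: st)
  also have "\<dots> = rho B (v \<Psi>)"
   using rho_rho[OF sl2_carrier[OF A] sl2_carrier[OF CB] M3_mpolys[OF v[OF \<Psi>]]] unfolding ACB .
  finally have "rho A (v \<Psi>) = rho B (v \<Psi>')" unfolding eq .
  then show ?thesis unfolding f_def B_def[symmetric] \<Psi>'_def[symmetric] using ex by simp
 qed
 show ?thesis
 proof (rule that[of f])
  show "f \<Phi> \<in> M3" for \<Phi> unfolding f_def by (simp add: rho_M3 M3_0)
  have one: "1\<^sub>m 2 \<in> sl2" unfolding one_mat2 mat2_sl2 by simp
  show "f \<Phi> = v \<Phi>" if "\<Phi> \<in> S" for \<Phi>
   using f[OF one that refl] rho_one[OF v[OF that]] S that by auto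
  show "rho A (f \<Phi>) = f (A * \<Phi>)" if A: "A \<in> sl2" and \<Phi>: "\<Phi> \<in> K" for A \<Phi>
  proof (cases "\<exists>p. R \<Phi> p")
   case True
   then obtain B \<Psi> where B: "B \<in> sl2" "\<Psi> \<in> S" "\<Phi> = B * \<Psi>" by (auto simp: R_def)
   have \<Psi>K: "\<Psi> \<in> K" using B(2) S by auto
   have "f (A * \<Phi>) = rho (A * B) (v \<Psi>)"
    by (rule f[OF sl2_mult[OF A B(1)] B(2)]) (simp only: B(3) assoc[OF A B(1) \<Psi>K])
   also have "\<dots> = rho A (rho B (v \<Psi>))"
    using rho_rho[OF sl2_carrier[OF A] sl2_carrier[OF B(1)] M3_mpolys[OF v[OF B(2)]]] by simp
   also have "rho B (v \<Psi>) = f \<Phi>" using f[OF B] by simp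
   finally show ?thesis by simp
  next
   case False
   have "\<not> (\<exists>p. R (A * \<Phi>) p)"
   proof
    assume "\<exists>p. R (A * \<Phi>) p"
    then obtain B \<Psi> where B: "B \<in> sl2" "\<Psi> \<in> S" "A * \<Phi> = B * \<Psi>" by (auto simp: R_def)
    have \<Psi>K: "\<Psi> \<in> K" using B(2) S by auto
    obtain C where C: "C \<in> sl2" "C * A = 1\<^sub>m 2" using A by (rule sl2_inverse)
    have "\<Phi> = C * (A * \<Phi>)" using assoc[OF C(1) A \<Phi>] C(2) \<Phi> by simp
    also have "\<dots> = (C * B) * \<Psi>" unfolding B(3) by (rule assoc[OF C(1) B(1) \<Psi>K])
    finally have "R \<Phi> (C * B, \<Psi>)" using B(2) sl2_mult[OF C(1) B(1)] by (simp add: R_def)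
    with False show False by blast
   qed
   then show ?thesis using False by (simp add: f_def rho_0)
  qed
 qed
qed

definition minor :: "'p mod_ring mat => nat => nat => 'p mod_ring" where
 "minor \<Phi> k l = \<Phi> $$ (0, k) * \<Phi> $$ (1, l) - \<Phi> $$ (0, l) * \<Phi> $$ (1, k)"

text \<open>Pluecker coordinates of the pair of rows, invariant under \<open>sl2\<close>. For
  \<open>n = 2\<close> only the determinant remains, and the other slots are filled with 0.\<close>

definition minors :: "'p mod_ring mat => 'p mod_ring \<times> 'p mod_ring \<times> 'p mod_ring" where
 "minors \<Phi> = (minor \<Phi> 0 1, if n = 3 then minor \<Phi> 0 2 else 0, if n = 3 then minor \<Phi> 1 2 else 0)"

lemma minor_mult:
 assumes A: "A \<in> sl2" and \<Phi>: "\<Phi> \<in> K" and kl: "k < n" "l < n"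
 shows "minor (A * \<Phi>) k l = minor \<Phi> k l"
proof -
 obtain a b c d where A': "A = mat2 a b c d" "a * d - b * c = 1" using A by (rule sl2_E)
 have i: "(A * \<Phi>) $$ (0, j) = a * \<Phi> $$ (0, j) + b * \<Phi> $$ (1, j)" "(A * \<Phi>) $$ (1, j) = c * \<Phi> $$ (0, j) + d * \<Phi> $$ (1, j)"
  if "j < n" for j
  using index_mult_mat_2[OF sl2_carrier[OF A] \<Phi> _ that] unfolding A'(1) by (simp_all del: index_mult_mat)
 have "minor (A * \<Phi>) k l = (a * d - b * c) * minor \<Phi> k l"
  unfolding minor_def i[OF kl(1)] i[OF kl(2)] by (simp add: algebra_simps)
 then show ?thesis unfolding A'(2) by simp
qed

lemma minors_mult:
 assumes A: "A \<in> sl2" and \<Phi>: "\<Phi> \<in> K"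
 shows "minors (A * \<Phi>) = minors \<Phi>"
 using minor_mult[OF A \<Phi>, of 0 1] minor_mult[OF A \<Phi>, of 0 2] minor_mult[OF A \<Phi>, of 1 2] n
 by (auto simp: minors_def)

text \<open>Two columns with nonzero minor are fixed and form an invertible matrix; Cramer's rule
  then gives the entries of \<open>A\<close>.\<close>

lemma minors_stabilizer:
 assumes A: "A \<in> sl2" and \<Phi>: "\<Phi> \<in> K" and nz: "minors \<Phi> \<noteq> (0, 0, 0)" and e: "A * \<Phi> = \<Phi>"
 shows "A = 1\<^sub>m 2"
proof -
 obtain k l where kl: "k < n" "l < n" "minor \<Phi> k l \<noteq> 0"
 proof -
  have "minor \<Phi> 0 1 \<noteq> 0 \<or> n = 3 & minor \<Phi> 0 2 \<noteq> 0 \<or> n = 3 & minor \<Phi> 1 2 \<noteq> 0"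
   using nz by (auto simp: minors_def split: if_splits)
  then show ?thesis using that[of 0 1] that[of 0 2] that[of 1 2] n by auto
 qed
 obtain a b c d where A': "A = mat2 a b c d" "a * d - b * c = 1" using A by (rule sl2_E)
 have i: "a * \<Phi> $$ (0, j) + b * \<Phi> $$ (1, j) = \<Phi> $$ (0, j)" "c * \<Phi> $$ (0, j) + d * \<Phi> $$ (1, j) = \<Phi> $$ (1, j)"
  if "j < n" for j
 proof -
  have x: "(A * \<Phi>) $$ (0, j) = a * \<Phi> $$ (0, j) + b * \<Phi> $$ (1, j)" "(A * \<Phi>) $$ (1, j) = c * \<Phi> $$ (0, j) + d * \<Phi> $$ (1, j)"
   using index_mult_mat_2[OF sl2_carrier[OF A] \<Phi> _ that] unfolding A'(1) by (simp_all del: index_mult_mat)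
  show "a * \<Phi> $$ (0, j) + b * \<Phi> $$ (1, j) = \<Phi> $$ (0, j)" using x(1) unfolding e by (rule sym)
  show "c * \<Phi> $$ (0, j) + d * \<Phi> $$ (1, j) = \<Phi> $$ (1, j)" using x(2) unfolding e by (rule sym)
 qed
 define r s r' s' where "r = \<Phi> $$ (0, k)" and "s = \<Phi> $$ (1, k)" and "r' = \<Phi> $$ (0, l)" and "s' = \<Phi> $$ (1, l)"
 have m: "r * s' - r' * s \<noteq> 0" using kl(3) by (simp add: minor_def r_def s_def r'_def s'_def)
 have eqs: "a * r + b * s = r" "c * r + d * s = s" "a * r' + b * s' = r'" "c * r' + d * s' = s'"
  using i[OF kl(1)] i[OF kl(2)] by (simp_all only: r_def s_def r'_def s'_def)
 have "(a - 1) * (r * s' - r' * s) = s' * (a * r + b * s - r) - s * (a * r' + b * s' - r')"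
  "b * (r * s' - r' * s) = r * (a * r' + b * s' - r') - r' * (a * r + b * s - r)"
  "c * (r * s' - r' * s) = s' * (c * r + d * s - s) - s * (c * r' + d * s' - s')"
  "(d - 1) * (r * s' - r' * s) = r * (c * r' + d * s' - s') - r' * (c * r + d * s - s)"
  by (simp_all add: algebra_simps)
 then have "(a - 1) * (r * s' - r' * s) = 0" "b * (r * s' - r' * s) = 0" "c * (r * s' - r' * s) = 0" "(d - 1) * (r * s' - r' * s) = 0"
  unfolding eqs by simp_all
 then have "a = 1" "b = 0" "c = 0" "d = 1" using m by simp_all
 then show ?thesis unfolding A'(1) one_mat2 by simp
qed

definition rows :: "'p mod_ring \<times> 'p mod_ring \<times> 'p mod_ring => 'p mod_ring \<times> 'p mod_ring \<times> 'p mod_ring => 'p mod_ring mat" where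
 "rows r s = mat 2 n (%(i, j). let t = if i = 0 then r else s in if j = 0 then fst t else if j = 1 then fst (snd t) else snd (snd t))"

lemma rows_carrier: "rows r s \<in> K"
 by (simp add: rows_def)

lemma rows_index:
 "rows r s $$ (0, 0) = fst r" "rows r s $$ (1, 0) = fst s" "rows r s $$ (0, 1) = fst (snd r)" "rows r s $$ (1, 1) = fst (snd s)"
 "n = 3 ==> rows r s $$ (0, 2) = snd (snd r)" "n = 3 ==> rows r s $$ (1, 2) = snd (snd s)"
proof -
 show "rows r s $$ (0, 0) = fst r" "rows r s $$ (1, 0) = fst s" "rows r s $$ (0, 1) = fst (snd r)" "rows r s $$ (1, 1) = fst (snd s)"
  using n by (simp_all add: rows_def)
 assume "n = 3"
 then have "2 < n" by simp
 then show "rows r s $$ (0, 2) = snd (snd r)" "rows r s $$ (1, 2) = snd (snd s)" by (simp_all add: rows_def)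
qed

text \<open>Points of the projective line or plane, normalized by first nonzero coordinate 1.
  Written above a zero row, they represent the orbits of matrices of rank one.\<close>

definition line_reps :: "('p mod_ring \<times> 'p mod_ring \<times> 'p mod_ring) set" where "line_reps =
 (if n = 3 then {1} \<times> UNIV \<times> UNIV \<union> {0} \<times> {1} \<times> UNIV \<union> {0} \<times> {0} \<times> {1}
  else {1} \<times> UNIV \<times> {0} \<union> {0} \<times> {1} \<times> {0 :: 'p mod_ring})"

lemma card_line_reps: "n = 2 ==> card line_reps = 4" "n = 3 ==> card line_reps = 13"
proof -
 define X2 Y2 X3 Y3 Z3 :: "('p mod_ring \<times> 'p mod_ring \<times> 'p mod_ring) set"
  where "X2 = {1} \<times> UNIV \<times> {0}" and "Y2 = {0} \<times> {1} \<times> {0}"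
   and "X3 = {1} \<times> UNIV \<times> UNIV" and "Y3 = {0} \<times> {1} \<times> UNIV" and "Z3 = {0} \<times> {0} \<times> {1}"
 note defs = X2_def Y2_def X3_def Y3_def Z3_def
 have U: "card (UNIV :: 'p mod_ring set) = 3" by (rule card3)
 have c: "card X2 = 3" "card Y2 = 1" "card X3 = 9" "card Y3 = 3" "card Z3 = 1"
  unfolding defs card_cartesian_product U by simp_all
 have "card (X2 \<union> Y2) = card X2 + card Y2" by (rule card_Un_disjoint) (auto simp: defs)
 then have 2: "card (X2 \<union> Y2) = 4" unfolding c by simp
 have "card (X3 \<union> Y3 \<union> Z3) = card (X3 \<union> Y3) + card Z3" by (rule card_Un_disjoint) (auto simp: defs)
 also have "card (X3 \<union> Y3) = card X3 + card Y3" by (rule card_Un_disjoint) (auto simp: defs)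
 finally have 3: "card (X3 \<union> Y3 \<union> Z3) = 13" unfolding c by simp
 show "card line_reps = 4" if "n = 2"
 proof -
  have "n \<noteq> 3" using that by simp
  then have "line_reps = X2 \<union> Y2" unfolding line_reps_def defs by (rule if_not_P)
  then show ?thesis using 2 by (simp only:)
 qed
 show "card line_reps = 13" if "n = 3"
 proof -
  have "line_reps = X3 \<union> Y3 \<union> Z3" unfolding line_reps_def defs using that by (rule if_P)
  then show ?thesis using 3 by (simp only:)
 qed
qed

text \<open>The second row of the image is \<open>c\<close> times \<open>h\<close>, so
  \<open>c = 0\<close>; normalization forces \<open>a = 1\<close>, and the determinant gives
  \<open>d = 1\<close>.\<close>

lemma line_rep_orbits:
 assumes A: "A \<in> sl2" and h: "h \<in> line_reps" "h' \<in> line_reps" and n23: "n = 2 \<or> n = 3" and e: "A * rows h (0, 0, 0) = rows h' (0, 0, 0)"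
 shows "h = h'" "\<exists>\<alpha>. A = mat2 1 \<alpha> 0 1"
proof -
 obtain a b c d where A': "A = mat2 a b c d" "a * d - b * c = 1" using A by (rule sl2_E)
 have i: "a * rows h (0, 0, 0) $$ (0, j) + b * rows h (0, 0, 0) $$ (1, j) = rows h' (0, 0, 0) $$ (0, j)"
   "c * rows h (0, 0, 0) $$ (0, j) + d * rows h (0, 0, 0) $$ (1, j) = rows h' (0, 0, 0) $$ (1, j)"
  if "j < n" for j
  using index_mult_mat_2[OF sl2_carrier[OF A] rows_carrier _ that, of _ h "(0, 0, 0)"] unfolding e unfolding A'(1) by (simp_all del: index_mult_mat)
 obtain h0 h1 h2 h0' h1' h2' where hh: "h = (h0, h1, h2)" "h' = (h0', h1', h2')" by (cases h, cases h')
 have 0: "a * h0 = h0'" "c * h0 = 0" using i[of 0] n unfolding rows_index(1-4) hh by auto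
 have 1: "a * h1 = h1'" "c * h1 = 0" using i[of 1] n unfolding rows_index(1-4) hh by auto
 have 2: "a * h2 = h2' & c * h2 = 0" if n3: "n = 3"
 proof -
  have "2 < n" using n3 by simp
  from i[OF this] show ?thesis unfolding rows_index(5)[OF n3] rows_index(6)[OF n3] hh by simp
 qed
 from n23 have "a = 1 & c = 0 & h = h'"
 proof
  assume "n = 2"
  then show ?thesis using h 0 1 A'(2) unfolding line_reps_def hh by auto
 next
  assume n3: "n = 3"
  show ?thesis using n3 h 0 1 2[OF n3] A'(2) unfolding line_reps_def hh by auto
 qed
 then show "h = h'" "\<exists>\<alpha>. A = mat2 1 \<alpha> 0 1" using A' by auto
qed

text \<open>In dimension three every vector of the exterior square is decomposable, so all 26
  nonzero triples occur; in dimension two both nonzero determinants occur.\<close>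

lemma card_minors:
 "n = 2 ==> 2 \<le> card (minors ` K - {(0, 0, 0)})" "n = 3 ==> 26 \<le> card (minors ` K - {(0, 0, 0)})"
proof -
 have fin: "finite (minors ` K - {(0, 0, 0)})" by simp
 have im: "x \<in> minors ` K" if "minors (rows r s) = x" for x r s
  using imageI[OF rows_carrier, of minors r s] unfolding that .
 show "2 \<le> card (minors ` K - {(0, 0, 0)})" if n2: "n = 2"
 proof -
  have "minors (rows (1, 0, 0) (0, w, 0)) = (w, 0, 0)" for w
   unfolding minors_def minor_def rows_index(1-4) using n2 by simp
  then have img: "(w, 0, 0) \<in> minors ` K" for w by (rule im)
  have "(%w. (w, 0, 0)) ` {1, - 1} \<subseteq> minors ` K - {(0, 0, 0)}" using img by auto
  then have "card ((%w. (w, 0 :: 'p mod_ring, 0 :: 'p mod_ring)) ` {1, - 1 :: 'p mod_ring}) \<le> card (minors ` K - {(0, 0, 0)})"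
   by (rule card_mono[OF fin])
  moreover have "(1 :: 'p mod_ring) \<noteq> - 1" using scalar_neg[of 1] by auto
  ultimately show ?thesis by (simp add: card_image inj_on_def)
 qed
 show "26 \<le> card (minors ` K - {(0, 0, 0)})" if n3: "n = 3"
 proof -
  have mr: "minors (rows (r0, r1, r2) (s0, s1, s2)) = (r0 * s1 - r1 * s0, r0 * s2 - r2 * s0, r1 * s2 - r2 * s1)" for r0 r1 r2 s0 s1 s2
   unfolding minors_def minor_def rows_index(1-4) rows_index(5)[OF n3] rows_index(6)[OF n3] if_P[OF n3] by simp
  have all: "(w0, w1, w2) \<in> minors ` K" for w0 w1 w2
  proof -
   consider "w0 \<noteq> 0" | "w0 = 0" "w1 \<noteq> 0" | "w0 = 0" "w1 = 0" by blast
   then show ?thesis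
   proof cases
    case 1
    then have "minors (rows (1, 0, - w2 / w0) (0, w0, w1)) = (w0, w1, w2)" unfolding mr by simp
    then show ?thesis by (rule im)
   next
    case 2
    then have "minors (rows (1, w2 / w1, 0) (0, 0, w1)) = (w0, w1, w2)" unfolding mr by simp
    then show ?thesis by (rule im)
   next
    case 3
    then have "minors (rows (0, 1, 0) (0, 0, w2)) = (w0, w1, w2)" unfolding mr by simp
    then show ?thesis by (rule im)
   qed
  qed
  have "x \<in> minors ` K" for x using all[of "fst x" "fst (snd x)" "snd (snd x)"] by simp
  then have eq: "minors ` K = UNIV" by blast
  have c27: "card (UNIV :: ('p mod_ring \<times> 'p mod_ring \<times> 'p mod_ring) set) = 27"
   unfolding UNIV_Times_UNIV[symmetric] card_cartesian_product card3 by simp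
  have "card (UNIV - {(0, 0, 0) :: 'p mod_ring \<times> 'p mod_ring \<times> 'p mod_ring}) = 27 - 1"
   unfolding c27[symmetric] by (rule card_Diff_singleton) simp
  then show ?thesis unfolding eq by simp
 qed
qed

lemma rho_sum: "rho A (\<Sum>s\<in>S. cst (c s) * g s) = (\<Sum>s\<in>S. cst (c s) * rho A (g s))"
 by (induction S rule: infinite_finite_induct) (simp_all add: rho_0 rho_add rho_const)

lemma M3_sum: "(!!s. s \<in> S ==> g s \<in> M3) ==> (\<Sum>s\<in>S. cst (c s) * g s) \<in> M3"
 by (induction S rule: infinite_finite_induct) (simp_all add: M3_0 M3_add M3_const)

text \<open>The zero matrix is sent to \<open>m0\<close>, representatives of rank one to
  \<open>t r\<close>, representatives of nonzero minors to \<open>s j\<close>, with stabilizers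
  matching. The orbits of these values span by \<open>gen\<close>, and
  \<open>isomorphic_KBV_KHom\<close> turns spanning into an isomorphism.\<close>

theorem isomorphic_SL:
 assumes n23: "n = 2 \<or> n = 3"
 shows "isomorphic_modules (SL 2 :: 'p mod_ring mat set) (KBV n 2) (KBV_act n 2) (KHom n 2) (KHom_act 2)"
proof -
 define a N :: nat where "a = (if n = 2 then 4 else 13)" and "N = (if n = 2 then 2 else 26)"
 have aN: "n = 2 & a = 4 & N = 2 \<or> n = 3 & a = 13 & N = 26" using n23 by (auto simp: a_def N_def)
 show ?thesis
 proof (rule module_generators3[OF aN])
 fix m0 t s assume m0: "m0 \<in> M3" "rho mT m0 = m0" "rho mI m0 = m0"
  and t: "!!r. r < a ==> t r \<in> M3 & rho mT (t r) = t r" and s: "!!j. j < N ==> s j \<in> M3"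
  and gen: "!!W. (!!x y. x \<in> W ==> y \<in> W ==> x + y \<in> W) ==> 0 \<in> W ==>
   (!!x. x \<in> W ==> rho mT x \<in> W) ==> (!!x. x \<in> W ==> rho mI x \<in> W) ==> (!!x. x \<in> W ==> rho mJ x \<in> W) ==>
   m0 \<in> W ==> (!!r. r < a ==> t r \<in> W) ==> (!!j. j < N ==> s j \<in> W) ==> M3 \<subseteq> W"
 have "a \<le> card line_reps" using aN
 proof
  assume h: "n = 2 & a = 4 & N = 2"
  then have "card line_reps = 4" by (intro card_line_reps(1)) (rule conjunct1)
  then show ?thesis using h by linarith
 next
  assume h: "n = 3 & a = 13 & N = 26"
  then have "card line_reps = 13" by (intro card_line_reps(2)) (rule conjunct1)
  then show ?thesis using h by linarith
 qed
 then have cL: "card {..<a} \<le> card line_reps" by simp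
 have finL: "finite line_reps" by simp
 \<comment> \<open>An injective numbering of orbit representatives is enough here, because the span
   of the resulting values is controlled by \<open>gen\<close>.\<close>
 obtain h where h: "h ` {..<a} \<subseteq> line_reps" "inj_on h {..<a}" using card_le_inj[OF finite_lessThan finL cL] by blast
 have "N \<le> card (minors ` K - {(0, 0, 0)})" using aN
 proof
  assume h: "n = 2 & a = 4 & N = 2"
  then have "2 \<le> card (minors ` K - {(0, 0, 0)})" by (intro card_minors(1)) (rule conjunct1)
  then show ?thesis using h by linarith
 next
  assume h: "n = 3 & a = 13 & N = 26"
  then have "26 \<le> card (minors ` K - {(0, 0, 0)})" by (intro card_minors(2)) (rule conjunct1)
  then show ?thesis using h by linarith
 qed
 then have cN: "card {..<N} \<le> card (minors ` K - {(0, 0, 0)})" by simp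
 have finN: "finite (minors ` K - {(0, 0, 0)})" by simp
 obtain w where w: "w ` {..<N} \<subseteq> minors ` K - {(0, 0, 0)}" "inj_on w {..<N}"
  using card_le_inj[OF finite_lessThan finN cN] by blast
 define H where "H r = rows (h r) (0, 0, 0)" for r
 define G where "G j = (SOME \<Phi>. \<Phi> \<in> K & minors \<Phi> = w j)" for j
 have G: "G j \<in> K" "minors (G j) = w j" "w j \<noteq> (0, 0, 0)" if "j < N" for j
 proof -
  have "w j \<in> minors ` K - {(0, 0, 0)}" using w(1) that by auto
  then have "\<exists>\<Phi>. \<Phi> \<in> K & minors \<Phi> = w j" and "w j \<noteq> (0, 0, 0)" by auto
  from someI_ex[OF this(1)] this(2) show "G j \<in> K" "minors (G j) = w j" "w j \<noteq> (0, 0, 0)" by (simp_all add: G_def)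
 qed
 have hL: "h r \<in> line_reps" if "r < a" for r using h(1) that by auto
 have HK: "H r \<in> K" for r by (simp add: H_def rows_carrier)
 have minH: "minors (H r) = (0, 0, 0)" for r
 proof (cases "n = 3")
  case True
  show ?thesis unfolding H_def minors_def minor_def rows_index(1-4) rows_index(5)[OF True] rows_index(6)[OF True] by simp
 next
  case False
  show ?thesis unfolding H_def minors_def minor_def rows_index(1-4) if_not_P[OF False] by simp
 qed
 have min0: "minors (0\<^sub>m 2 n) = (0, 0, 0)"
 proof -
  have "(0\<^sub>m 2 n :: 'p mod_ring mat) $$ (0, j) = 0" if "j < n" for j using that by simp
  then have z: "minor (0\<^sub>m 2 n) k l = 0" if "k < n" "l < n" for k l using that by (simp add: minor_def)
  show ?thesis using z[of 0 1] z[of 0 2] z[of 1 2] n unfolding minors_def by (cases "n = 3") (simp_all only: if_True if_False, simp_all)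
 qed
 have H0: "H r \<noteq> 0\<^sub>m 2 n" if "r < a" for r
 proof
  assume e: "H r = 0\<^sub>m 2 n"
  have z: "H r $$ (0, j) = 0" if "j < n" for j unfolding e using that by simp
  have 01: "fst (h r) = 0" "fst (snd (h r)) = 0" using z[of 0] z[of 1] n unfolding H_def rows_index(1-4) by simp_all
  have 2: "snd (snd (h r)) = 0" if n3: "n = 3"
  proof -
   have "2 < n" using n3 by simp
   from z[OF this] show ?thesis unfolding H_def rows_index(5)[OF n3] by simp
  qed
  from n23 show False
  proof
   assume "n = 2"
   then show False using hL[OF that] 01 unfolding line_reps_def by auto
  next
   assume n3: "n = 3"
   show False using n3 hL[OF that] 01 2[OF n3] unfolding line_reps_def by auto
  qed
 qed
 \<comment> \<open>The three cases are disjoint: each \<open>H r\<close> is nonzero with zero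
   minors, whereas each \<open>G j\<close> has nonzero minors.\<close>
 define v where "v \<Phi> = (if \<Phi> = 0\<^sub>m 2 n then m0 else if \<exists>r<a. \<Phi> = H r then t (SOME r. r < a & \<Phi> = H r)
  else s (SOME j. j < N & \<Phi> = G j))" for \<Phi>
 have Hinj: "r = r'" if "r < a" "r' < a" "H r = H r'" for r r'
 proof -
  have one: "1\<^sub>m 2 \<in> sl2" unfolding one_mat2 mat2_sl2 by simp
  have "1\<^sub>m 2 * H r = H r'" using HK[of r] that(3) by simp
  from line_rep_orbits(1)[OF one hL[OF that(1)] hL[OF that(2)] n23 this[unfolded H_def]] show ?thesis
   using h(2) that by (auto simp: inj_on_def)
 qed
 have Ginj: "j = j'" if "j < N" "j' < N" "minors (G j) = minors (G j')" for j j'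
  using that G w(2) by (auto simp: inj_on_def)
 have v0: "v (0\<^sub>m 2 n) = m0" by (simp add: v_def)
 have vH: "v (H r) = t r" if r: "r < a" for r
 proof -
  have "(SOME r'. r' < a & H r = H r') = r" using Hinj r by (intro some_equality) auto
  then show ?thesis using H0[OF r] r unfolding v_def by auto
 qed
 have vG: "v (G j) = s j" if j: "j < N" for j
 proof -
  have ne: "G j \<noteq> 0\<^sub>m 2 n" "\<not> (\<exists>r<a. G j = H r)" using G(2,3)[OF j] min0 minH by auto
  have "(SOME j'. j' < N & G j = G j') = j" using Ginj j by (intro some_equality) auto
  then show ?thesis unfolding v_def if_not_P[OF ne(1)] if_not_P[OF ne(2)] by (rule arg_cong)
 qed
 define S where "S = {0\<^sub>m 2 n} \<union> H ` {..<a} \<union> G ` {..<N}"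
 have SE: "\<Phi> = 0\<^sub>m 2 n \<or> (\<exists>r<a. \<Phi> = H r) \<or> (\<exists>j<N. \<Phi> = G j)" if "\<Phi> \<in> S" for \<Phi> using that by (auto simp: S_def)
 have SK: "S \<subseteq> K" using HK G(1) by (auto simp: S_def)
 have A0: "A * 0\<^sub>m 2 n = 0\<^sub>m 2 n" if "A \<in> sl2" for A using sl2_carrier[OF that] by simp
 have A0': "\<Phi> = 0\<^sub>m 2 n" if A: "A \<in> sl2" and \<Phi>: "\<Phi> \<in> K" and e: "A * \<Phi> = 0\<^sub>m 2 n" for A \<Phi>
 proof -
  obtain B where B: "B \<in> sl2" "B * A = 1\<^sub>m 2" using A by (rule sl2_inverse)
  have "\<Phi> = (B * A) * \<Phi>" using B(2) \<Phi> by simp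
  also have "\<dots> = B * (A * \<Phi>)" by (rule assoc_mult_mat[OF sl2_carrier[OF B(1)] sl2_carrier[OF A] \<Phi>])
  finally show ?thesis unfolding e A0[OF B(1)] .
 qed
 show ?thesis
 proof (rule equivariant_extension[OF SK, of v])
  show "v \<Phi> \<in> M3" if "\<Phi> \<in> S" for \<Phi> using SE[OF that] v0 vH vG m0(1) t s by auto
  fix A \<Phi> assume A: "A \<in> sl2" and \<Phi>: "\<Phi> \<in> S"
  have \<Phi>K: "\<Phi> \<in> K" using SK \<Phi> by blast
  show "\<Phi> = \<Psi>" if \<Psi>: "\<Psi> \<in> S" and e: "A * \<Phi> = \<Psi>" for \<Psi>
  proof -
   have min: "minors \<Phi> = minors \<Psi>" using minors_mult[OF A \<Phi>K] e by simp
   consider "\<Psi> = 0\<^sub>m 2 n" | "\<Phi> = 0\<^sub>m 2 n" | r r' where "r < a" "r' < a" "\<Phi> = H r" "\<Psi> = H r'"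
    | r j where "r < a" "j < N" "\<Phi> = H r" "\<Psi> = G j" | r j where "r < a" "j < N" "\<Phi> = G j" "\<Psi> = H r"
    | j j' where "j < N" "j' < N" "\<Phi> = G j" "\<Psi> = G j'" using SE[OF \<Phi>] SE[OF \<Psi>] by blast
   then show ?thesis
   proof cases
    case 1 then show ?thesis using A0'[OF A \<Phi>K] e by simp
   next
    case 2 then show ?thesis using A0[OF A] e by simp
   next
    case 3
    have "A * rows (h r) (0, 0, 0) = rows (h r') (0, 0, 0)" using e 3 by (simp add: H_def)
    then show ?thesis using line_rep_orbits(1)[OF A hL[OF 3(1)] hL[OF 3(2)] n23] 3 by (simp add: H_def)
   next
    case 4 then show ?thesis using min minH G[of j] by simp
   next
    case 5 then show ?thesis using min minH G[of j] by simp
   next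
    case 6 then show ?thesis using min Ginj by auto
   qed
  qed
  show "rho A (v \<Phi>) = v \<Phi>" if e: "A * \<Phi> = \<Phi>"
  proof -
   consider "\<Phi> = 0\<^sub>m 2 n" | r where "r < a" "\<Phi> = H r" | j where "j < N" "\<Phi> = G j" using SE[OF \<Phi>] by blast
   then show ?thesis
   proof cases
    case 1 then show ?thesis using rho_fixed_sl2[OF m0 A] v0 by simp
   next
    case 2
    have "A * rows (h r) (0, 0, 0) = rows (h r) (0, 0, 0)" using e 2 by (simp add: H_def)
    then obtain \<alpha> where "A = mat2 1 \<alpha> 0 1" using line_rep_orbits(2)[OF A hL[OF 2(1)] hL[OF 2(1)] n23] by blast
    then show ?thesis using rho_unipotent t[OF 2(1)] vH[OF 2(1)] 2 by simp
   next
    case 3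
    have "A = 1\<^sub>m 2" using minors_stabilizer[OF A \<Phi>K _ e] G[OF 3(1)] 3 by simp
    then show ?thesis using rho_one s[OF 3(1)] vG[OF 3(1)] 3 by simp
   qed
  qed
 next
 fix f assume f: "!!\<Phi>. f \<Phi> \<in> M3" "!!A \<Phi>. A \<in> sl2 ==> \<Phi> \<in> K ==> rho A (f \<Phi>) = f (A * \<Phi>)"
  "!!\<Phi>. \<Phi> \<in> S ==> f \<Phi> = v \<Phi>"
 have finK: "finite K" by (rule card_carrier_mat_finite(1))
 \<comment> \<open>The part of \<open>M3\<close> spanned by the values of \<open>f\<close> is stable
   under the group and contains all generators, hence is all of \<open>M3\<close>.\<close>
 define W where "W = {P \<in> M3. spanned q 2 K f P}"
 have Wrho: "rho A P \<in> W" if P: "P \<in> W" and A: "A \<in> sl2" for A P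
 proof -
  from P obtain c where c: "mcong q 2 P (\<Sum>\<Phi>\<in>K. cst (c \<Phi>) * f \<Phi>)" and PM: "P \<in> M3" unfolding W_def spanned_def by blast
  have "P = (\<Sum>\<Phi>\<in>K. cst (c \<Phi>) * f \<Phi>)" by (rule mcong_box_polys[OF PM M3_sum[OF f(1)] c])
  then have "rho A P = (\<Sum>\<Phi>\<in>K. cst (c \<Phi>) * rho A (f \<Phi>))" by (simp only: rho_sum)
  also have "\<dots> = (\<Sum>\<Phi>\<in>K. cst (c \<Phi>) * f (A * \<Phi>))" using f(2)[OF A] by (intro sum.cong) simp_all
  finally have e: "rho A P = (\<Sum>\<Phi>\<in>K. cst (c \<Phi>) * f (A * \<Phi>))" .
  have "spanned q 2 K f (rho A P)" unfolding e
  proof (rule spanned_sum)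
   fix \<Phi> assume "\<Phi> \<in> K"
   then have "A * \<Phi> \<in> K" by (rule mult_carrier_mat[OF sl2_carrier[OF A]])
   then show "spanned q 2 K f (cst (c \<Phi>) * f (A * \<Phi>))" by (rule spanned_scale[OF spanned_base[OF finK]])
  qed
  then show ?thesis unfolding W_def using rho_M3 by blast
 qed
 have Wv: "v \<Phi> \<in> W" if "\<Phi> \<in> S" for \<Phi>
 proof -
  have "\<Phi> \<in> K" using SK that by blast
  then have "spanned q 2 K f (f \<Phi>)" by (rule spanned_base[OF finK])
  then show ?thesis unfolding W_def using f(1)[of \<Phi>] f(3)[OF that] by simp
 qed
 have MW: "M3 \<subseteq> W"
 proof (rule gen)
  show "x + y \<in> W" if "x \<in> W" "y \<in> W" for x y using that M3_add spanned_add unfolding W_def by blast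
  show "0 \<in> W" unfolding W_def using M3_0 by simp
  show "rho mT x \<in> W" "rho mI x \<in> W" "rho mJ x \<in> W" if "x \<in> W" for x using Wrho[OF that] sl2_generators by blast+
  show "m0 \<in> W" using Wv[of "0\<^sub>m 2 n"] v0 by (simp add: S_def)
  show "t r \<in> W" if "r < a" for r using Wv[of "H r"] vH[OF that] that by (simp add: S_def)
  show "s j \<in> W" if "j < N" for j using Wv[of "G j"] vG[OF that] that by (simp add: S_def)
 qed
 have n1: "1 \<le> n" using n by simp
 have cq: "CARD('p) ^ n = q" by (simp add: p3 q)
 show ?thesis
 proof (rule isomorphic_KBV_KHom[where f = f, OF n1, unfolded cq])
  show "(SL 2 :: 'p mod_ring mat set) \<subseteq> carrier_mat 2 2" by (auto simp: SL_def GL_def)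
  show "f \<Phi> \<in> mpolys 2" for \<Phi> by (rule M3_mpolys[OF f(1)])
  show "mcong q 2 (mpoly_subst (fgl_poly n 2 A) (f \<Phi>)) (f (A * \<Phi>))" if "A \<in> SL 2" "\<Phi> \<in> K" for A \<Phi>
  proof -
   have "A \<in> sl2" using SL_sl2 that(1) by blast
   then show ?thesis using mcong_sym[OF rho_mcong[of A "f \<Phi>"]] f(2)[OF _ that(2)] by simp
  qed
  show "\<exists>c. mcong q 2 (msingle k 1) (\<Sum>\<Phi>\<in>K. cst (c \<Phi>) * f \<Phi>)" if "k \<in> box q 2" for k
  proof -
   have "msingle k 1 \<in> M3" using that by (simp add: box_polys_def)
   then have "msingle k 1 \<in> W" using MW by blast
   then show ?thesis unfolding W_def spanned_def by blast
  qed
 qed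
 qed
 qed
qed

end

theorem theorem1p2:
  fixes p n d :: nat
  assumes p: "p = CARD('p::prime_card)"
    and n: "n \<ge> 1"
  shows
    "(n = 1 \<longrightarrow>
       isomorphic_modules (GL d :: 'p mod_ring mat set)
         (KBV n d) (KBV_act n d) (KHom n d) (KHom_act d)) \<and>
     (d = 2 \<and> p = 2 \<longrightarrow>
       isomorphic_modules (GL d :: 'p mod_ring mat set)
         (KBV n d) (KBV_act n d) (KHom n d) (KHom_act d)) \<and>
     (d = 2 \<and> p = 3 \<and> n \<in> {1, 2, 3} \<longrightarrow>
       isomorphic_modules (SL d :: 'p mod_ring mat set)
         (KBV n d) (KBV_act n d) (KHom n d) (KHom_act d))"
proof (intro conjI impI)
 show a: "isomorphic_modules (GL d :: 'p mod_ring mat set) (KBV n d) (KBV_act n d) (KHom n d) (KHom_act d)" if "n = 1"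
  unfolding that by (rule isomorphic_height_one)
 show "isomorphic_modules (GL d :: 'p mod_ring mat set) (KBV n d) (KBV_act n d) (KHom n d) (KHom_act d)" if h: "d = 2 & p = 2"
 \<comment> \<open>The argument with Frobenius twists needs \<open>n \<ge> 2\<close>; height one is
   covered by the case of arbitrary \<open>p\<close> and \<open>d\<close>.\<close>
 proof (cases "n = 1")
  case True
  then show ?thesis by (rule a)
 next
  case False
  then have n2: "n \<ge> 2" using n by simp
  have p2: "CARD('p) = 2" using h p by simp
  have "isomorphic_modules (GL 2 :: 'p mod_ring mat set) (KBV n 2) (KBV_act n 2) (KHom n 2) (KHom_act 2)"
   by (rule isomorphic_rank2_prime2[OF p2 n2 refl refl])
  then show ?thesis using h by simp
 qed
 show "isomorphic_modules (SL d :: 'p mod_ring mat set) (KBV n d) (KBV_act n d) (KHom n d) (KHom_act d)"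
  if h: "d = 2 & p = 3 & n \<in> {1, 2, 3}"
 proof (cases "n = 1")
  case True
  \<comment> \<open>For \<open>n = 1\<close> the isomorphism over \<open>GL\<close> is restricted to
    \<open>SL\<close>; the count of orbits is used for \<open>n = 2\<close> and \<open>n = 3\<close>
    only.\<close>
  have "(SL d :: 'p mod_ring mat set) \<subseteq> GL d" by (auto simp: SL_def)
  then show ?thesis by (rule isomorphic_modules_subset[OF a[OF True]])
 next
  case False
  then have n23: "n = 2 \<or> n = 3" using h by auto
  have p3: "CARD('p) = 3" using h p by simp
  interpret R: rank2_prime3 n "3 ^ (n - 1)" "3 ^ n" "TYPE('p)"
   by unfold_locales (use p3 n23 in auto)
  have "isomorphic_modules (SL 2 :: 'p mod_ring mat set) (KBV n 2) (KBV_act n 2) (KHom n 2) (KHom_act 2)"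
   by (rule R.isomorphic_SL[OF n23])
  then show ?thesis using h by simp
 qed
qed

end
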